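(* Assume $\|\mathrm{div}\,V\|_{L^N(\mathbb{T}^N)}\le\frac1\chi$. Then for every $P\in\mathbb{R}^N$: (i) $\lim_{k\to\infty}\overline H_k(P)=\overline H(P)$; (ii) the equation $H(x,Du+P)=\overline H(P)$ in $\mathbb{R}^N$ admits a bounded $\mathbb{Z}^N$-periodic upper semicontinuous viscosity subsolution and a bounded $\mathbb{Z}^N$-periodic lower semicontinuous viscosity supersolution.
   Context: $V:\mathbb{R}^N\to\mathbb{R}^N$ is $\mathbb{Z}^N$-periodic and Lipschitz continuous; $\mathbb{T}^N=\mathbb{R}^N/\mathbb{Z}^N$; $\chi$ is the isoperimetric constant of $\mathbb{T}^N$ (smallest constant with $|\Theta|^{1-1/N}\le\chi\,\mathcal{H}^{N-1}(\partial\Theta)$ for all $\Theta\subset\mathbb{T}^N$ with Lipschitz boundary; equal to the relative isoperimetric constant of $(0,1/2)^N$). $H(x,p)=|p|+p\cdot V(x)$; for $k\ge1$, $H_k(x,p)=\max\{H(x,p),-k\}+f_k(p)$ with $f_k(p)=\max\{|p|-k,0\}$. For $G\in\{H,H_k\}$, $\overline G(P)=\inf\{a\in\mathbb{R}\mid G(x,Du+P)=a$ admits an upper semicontinuous, bounded, $\mathbb{Z}^N$-periodic viscosity subsolution on $\mathbb{R}^N\}$; $\overline H_k$ and $\overline H$ are those of $H_k$ and $H$.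
   Formalization: The isoperimetric constant χ is defined with min(|Θ|, 1−|Θ|) in place of |Θ|, since no constant satisfies the inequality as written (Θ = T^N has empty boundary). *)

theory Defs
  imports "HOL-Analysis.Analysis"
begin

definition lattice_vec :: "('n::finite \<Rightarrow> int) \<Rightarrow> real ^ 'n" where
  "lattice_vec z = (\<chi> i. real_of_int (z i))"

definition zn_periodic :: "(real ^ 'n::finite \<Rightarrow> 'b) \<Rightarrow> bool" where
  "zn_periodic f \<longleftrightarrow> (\<forall>x z. f (x + lattice_vec z) = f x)"

definition zn_periodic_set :: "(real ^ 'n::finite) set \<Rightarrow> bool" where
  "zn_periodic_set E \<longleftrightarrow> (\<forall>x z. x + lattice_vec z \<in> E \<longleftrightarrow> x \<in> E)"

text \<open>Fundamental cell [0,1)^N, identified with the torus T^N.\<close>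
definition unit_cell :: "(real ^ 'n::finite) set" where
  "unit_cell = {x. \<forall>i. 0 \<le> x $ i \<and> x $ i < 1}"

text \<open>(s)-dimensional Hausdorff measure on R^N (normalized so that it agrees with
  s-dimensional surface measure), s a natural number.\<close>
definition hausdorff_normalization :: "nat \<Rightarrow> real" where
  "hausdorff_normalization s = pi powr (real s / 2) / Gamma (real s / 2 + 1)"

definition hausdorff_measure :: "nat \<Rightarrow> (real ^ 'n::finite) set \<Rightarrow> ennreal" where
  "hausdorff_measure s A =
     (SUP \<delta>\<in>{0<..}. INF C\<in>{C :: nat \<Rightarrow> (real ^ 'n) set.
          A \<subseteq> (\<Union>i. C i) \<and> (\<forall>i. bounded (C i) \<and> diameter (C i) \<le> \<delta>)}.
        (\<Sum>i. ennreal (if C i = {} then 0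
                        else hausdorff_normalization s * (diameter (C i) / 2) ^ s)))"

text \<open>A set has Lipschitz boundary: near each boundary point it is, in suitable
  rotated coordinates (the i-th coordinate being the vertical one), the strict
  subgraph of a Lipschitz function of the remaining N-1 coordinates.\<close>
definition lipschitz_boundary :: "(real ^ 'n::finite) set \<Rightarrow> bool" where
  "lipschitz_boundary E \<longleftrightarrow>
     (\<forall>x\<in>frontier E. \<exists>r>0. \<exists>(R :: real ^ 'n \<Rightarrow> real ^ 'n) (i :: 'n) (g :: real ^ 'n \<Rightarrow> real) (L :: real).
        orthogonal_transformation R \<and> L-lipschitz_on UNIV g \<and>
        (\<forall>y w. (\<forall>j. j \<noteq> i \<longrightarrow> y $ j = w $ j) \<longrightarrow> g y = g w) \<and>
        E \<inter> ball x r = {y \<in> ball x r. (R (y - x)) $ i < g (R (y - x))})"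

text \<open>Isoperimetric constant of the torus T^N: subsets of T^N are represented by
  Z^N-periodic subsets of R^N, their volume is the Lebesgue measure of the part in
  the unit cell, and their boundary in T^N is (frontier E) within the unit cell.
  The inequality is taken with min(|Theta|, |T^N - Theta|), as is necessary for
  it to make sense (Theta = T^N has empty boundary).\<close>
definition torus_isoperimetric_constant :: "'n::finite itself \<Rightarrow> real" where
  "torus_isoperimetric_constant _ =
     Inf {c. 0 \<le> c \<and>
       (\<forall>E :: (real ^ 'n) set. zn_periodic_set E \<and> lipschitz_boundary E \<longrightarrow>
          ennreal ((min (measure lborel (E \<inter> unit_cell))
                        (1 - measure lborel (E \<inter> unit_cell))) powr (1 - 1 / real CARD('n)))
          \<le> ennreal c * hausdorff_measure (CARD('n) - 1) (frontier E \<inter> unit_cell))}"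

text \<open>Pointwise divergence (defined a.e. for Lipschitz V by Rademacher's theorem,
  where it coincides with the distributional divergence).\<close>
definition divergence :: "(real ^ 'n::finite \<Rightarrow> real ^ 'n) \<Rightarrow> real ^ 'n \<Rightarrow> real" where
  "divergence V x = (\<Sum>i\<in>UNIV. frechet_derivative V (at x) (axis i 1) $ i)"

definition upper_semicont :: "(real ^ 'n::finite \<Rightarrow> real) \<Rightarrow> bool" where
  "upper_semicont u \<longleftrightarrow> (\<forall>x. \<forall>e>0. eventually (\<lambda>y. u y < u x + e) (at x))"

definition lower_semicont :: "(real ^ 'n::finite \<Rightarrow> real) \<Rightarrow> bool" where
  "lower_semicont u \<longleftrightarrow> (\<forall>x. \<forall>e>0. eventually (\<lambda>y. u x - e < u y) (at x))"

definition C1_test :: "(real ^ 'n::finite \<Rightarrow> real) \<Rightarrow> (real ^ 'n \<Rightarrow> real ^ 'n) \<Rightarrow> bool" where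
  "C1_test \<phi> D\<phi> \<longleftrightarrow> (\<forall>x. (\<phi> has_derivative (\<lambda>h. D\<phi> x \<bullet> h)) (at x)) \<and> continuous_on UNIV D\<phi>"

definition visc_subsol ::
  "(real ^ 'n::finite \<Rightarrow> real ^ 'n \<Rightarrow> real) \<Rightarrow> real ^ 'n \<Rightarrow> real \<Rightarrow> (real ^ 'n \<Rightarrow> real) \<Rightarrow> bool" where
  "visc_subsol G P a u \<longleftrightarrow>
     (\<forall>\<phi> D\<phi> x0. C1_test \<phi> D\<phi> \<and> (\<exists>r>0. \<forall>y\<in>ball x0 r. u y - \<phi> y \<le> u x0 - \<phi> x0)
        \<longrightarrow> G x0 (D\<phi> x0 + P) \<le> a)"

definition visc_supersol ::
  "(real ^ 'n::finite \<Rightarrow> real ^ 'n \<Rightarrow> real) \<Rightarrow> real ^ 'n \<Rightarrow> real \<Rightarrow> (real ^ 'n \<Rightarrow> real) \<Rightarrow> bool" where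
  "visc_supersol G P a u \<longleftrightarrow>
     (\<forall>\<phi> D\<phi> x0. C1_test \<phi> D\<phi> \<and> (\<exists>r>0. \<forall>y\<in>ball x0 r. u y - \<phi> y \<ge> u x0 - \<phi> x0)
        \<longrightarrow> G x0 (D\<phi> x0 + P) \<ge> a)"

definition eff_ham :: "(real ^ 'n::finite \<Rightarrow> real ^ 'n \<Rightarrow> real) \<Rightarrow> real ^ 'n \<Rightarrow> ereal" where
  "eff_ham G P = Inf {ereal a | a. \<exists>u. upper_semicont u \<and> bounded (range u) \<and>
                                      zn_periodic u \<and> visc_subsol G P a u}"

definition ham :: "(real ^ 'n::finite \<Rightarrow> real ^ 'n) \<Rightarrow> real ^ 'n \<Rightarrow> real ^ 'n \<Rightarrow> real" where
  "ham V x p = norm p + p \<bullet> V x"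

definition ham_k :: "real \<Rightarrow> (real ^ 'n::finite \<Rightarrow> real ^ 'n) \<Rightarrow> real ^ 'n \<Rightarrow> real ^ 'n \<Rightarrow> real" where
  "ham_k k V x p = max (ham V x p) (- k) + max (norm p - k) 0"

end

theory Submission
  imports Defs "HOL-Analysis.Analysis"
begin

text \<open>
  The Hamiltonian \<open>\<bar>p\<bar> + p \<bullet> V x\<close> is the support function of the velocity set \<open>V x + cball 0 1\<close>. If every
  point can be steered to every other one modulo \<open>\<int>\<^sup>N\<close>, then the control time is uniformly bounded and the
  ergodic problem is solvable: suprema of \<open>P \<bullet> (displacement) - \<lambda> \<cdot> (time)\<close> over trajectories are bounded and
  periodic and give the subsolution and, by a relaxed lower limit, the supersolution at the same level, while
  mollified subsolutions for slightly larger velocity sets are Lipschitz and hence subsolutions for \<open>H\<^sub>k\<close> with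
  large \<open>k\<close>. A doubling of variables shows that the two levels agree.

  If controllability fails, the closure \<open>A\<close> of some reachable set is a proper periodic trapping region, on
  whose boundary \<open>V\<close> points inwards with unit normal speed. Integrating \<open>div V\<close> against a Lipschitz cut-off
  of \<open>A\<close> bounds the volume of the shell of width \<open>s\<close> around \<open>A\<close> by \<open>s\<close> times \<open>F = - \<integral>\<^sub>A div V\<close>, up to \<open>o(s)\<close>.
  By the coarea formula for a polyhedral approximation of the distance function, some set with Lipschitz
  boundary between \<open>A\<close> and the shell has perimeter at most about \<open>F\<close>, so the isoperimetric inequality gives
  \<open>min m (1 - m) powr (1 - 1/N) \<le> \<chi> F\<close> with \<open>m = \<bar>A\<bar>\<close>. As \<open>div V\<close> has mean zero, Hoelder on \<open>A\<close> and on its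
  complement contradicts the bound on the \<open>L\<^sup>N\<close> norm of \<open>div V\<close>.
\<close>

section \<open>Rademacher's theorem\<close>

text \<open>The smallness condition is borderline: equality in the norm bound is allowed, so any
  constant lost on the way would ruin the final contradiction. Hence the normalised Hausdorff
  measure of a flat section is bounded by its Lebesgue measure with factor exactly 1, and the mesh
  of the polyhedral approximation and the width of the shell are both sent to 0. In the equality
  case the smaller of \<open>A\<close> and its complement absorbs the whole norm, and the other side
  cannot carry the flux that mean zero demands of it. Sublevel sets of the distance to
  \<open>A\<close> may have cusps, while the constant is defined by sets with Lipschitz boundary
  only. Polyhedral distances repair this: at all but countably many levels their sublevel sets are
  locally Lipschitz subgraphs. The constant is an infimum of reals, so a crude isoperimetric
  inequality is needed first, to show that the set of admissible constants is nonempty. Rademacher's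
  theorem links the pointwise \<open>divergence\<close> to limits of difference quotients, for which
  integration by parts is available. Velocity balls of radius slightly above 1 leave the room in
  which a subsolution can be mollified.\<close>

text \<open>A hole of relative size \<open>\<eta>\<close> at arbitrarily small scales keeps
  \<open>x\<close> from being a density point. The argument is quantitative: disjoint Vitali balls
  inside an open set slightly larger than the porous part each lose a fixed fraction
  \<open>c\<close>, so the measure of that part is at most \<open>1 - c\<close> times itself plus an
  arbitrarily small error.\<close>

lemma negligible_porous_points:
  fixes A :: "'a::euclidean_space set"
  assumes A: "closed A" and eta: "0 < \<eta>" "\<eta> \<le> 1"
  shows "negligible {x \<in> A. \<forall>d>0. \<exists>r y. 0 < r \<and> r < d \<and> dist x y < r \<and> ball y (\<eta> * r) \<inter> A = {}}"
proof -
  define W where "W m = {x. \<exists>r y. 0 < r \<and> r < 1 / real (Suc m) \<and> dist x y < r \<and> ball y (\<eta> * r) \<inter> A = {}}" for m :: nat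
  define P where "P = A \<inter> (\<Inter>m. W m)"
  have "open (W m)" for m
  proof -
    have eq: "W m = (\<Union>(r,y)\<in>{(r,y). 0 < r \<and> r < 1 / real (Suc m) \<and> ball y (\<eta> * r) \<inter> A = {}}. ball y r)"
      unfolding W_def by (auto simp: dist_commute; metis)
    show ?thesis unfolding eq by (intro open_UN) auto
  qed
  then have Pb: "P \<in> sets borel" using A unfolding P_def by (intro sets.Int) (auto intro!: sets.countable_INT')
  have sub: "{x \<in> A. \<forall>d>0. \<exists>r y. 0 < r \<and> r < d \<and> dist x y < r \<and> ball y (\<eta> * r) \<inter> A = {}} \<subseteq> P"
    unfolding P_def W_def by (auto simp del: of_nat_Suc)
  have "negligible (P \<inter> cball 0 R)" for R
  proof -
    define Q where "Q = P \<inter> cball 0 R"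
    have Qm: "Q \<in> lmeasurable" unfolding Q_def
      using Pb by (intro bounded_set_imp_lmeasurable) (auto simp: bounded_Int)
    \<comment> \<open>The fraction of \<open>cball x (2*r)\<close> filled by the hole; the doubled
      radius makes the hole fit inside.\<close>
    define c where "c = (\<eta>/2) ^ DIM('a)"
    have c: "0 < c" "c \<le> 1" using eta by (auto simp: c_def power_le_one)
    have key: "measure lebesgue Q \<le> (1 - c) * (measure lebesgue Q + e)" if e: "e > 0" for e
    proof -
      obtain U where U: "open U" "Q \<subseteq> U" "U - Q \<in> lmeasurable" "emeasure lebesgue (U - Q) < ennreal e"
        using sets_lebesgue_outer_open[of Q e] Qm e by auto
      have UQ: "U = Q \<union> (U - Q)" using U by auto
      have Um: "U \<in> lmeasurable" using UQ U(3) Qm by (metis fmeasurable.Un)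
      have mU: "measure lebesgue U \<le> measure lebesgue Q + e"
      proof -
        have "measure lebesgue U \<le> measure lebesgue Q + measure lebesgue (U - Q)"
          by (subst UQ) (intro measure_Un_le, use Qm U in auto)
        also have "measure lebesgue (U - Q) \<le> e"
          using U(3,4) e by (simp add: emeasure_eq_measure2 ennreal_less_iff)
        finally show ?thesis by simp
      qed
      define K where "K = {(x,r). x \<in> Q \<and> 0 < r \<and> cball x (2*r) \<subseteq> U \<and> (\<exists>y. dist x y < r \<and> ball y (\<eta> * r) \<inter> A = {})}"
      obtain C where C: "countable C" "C \<subseteq> K"
        "pairwise (\<lambda>i j. disjnt (cball (fst i) (2 * snd i)) (cball (fst j) (2 * snd j))) C"
        "negligible (Q - (\<Union>i\<in>C. cball (fst i) (2 * snd i)))"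
      proof (rule Vitali_covering_theorem_cballs[of K "\<lambda>i. 2 * snd i" Q fst])
        show "\<And>i. i \<in> K \<Longrightarrow> 0 < 2 * snd i" by (auto simp: K_def)
        fix x :: 'a and d :: real assume x: "x \<in> Q" and d: "0 < d"
        obtain e where e: "e > 0" "cball x e \<subseteq> U" using U(1,2) x by (meson open_contains_cball subsetD)
        obtain m where m: "1 / real (Suc m) < min (e/2) (d/2)"
          using e d nat_approx_posE[of "min (e/2) (d/2)"] by auto
        have "x \<in> W m" using x by (auto simp: Q_def P_def)
        then obtain r y where r: "0 < r" "r < 1 / real (Suc m)" "dist x y < r" "ball y (\<eta> * r) \<inter> A = {}"
          by (auto simp: W_def)
        then have r2: "r < e/2" "r < d/2" using m by linarith+
        have "cball x (2*r) \<subseteq> cball x e" using r2 by auto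
        then have "(x,r) \<in> K" using r e x by (auto simp: K_def)
        then show "\<exists>i. i \<in> K \<and> x \<in> cball (fst i) (2 * snd i) \<and> 2 * snd i < d"
          using r2 r by (intro exI[of _ "(x,r)"]) auto
      qed blast
      let ?B = "\<lambda>i. cball (fst i) (2 * snd i)"
      have disj: "disjoint_family_on ?B C"
        using C(3) by (auto simp: disjoint_family_on_def pairwise_def disjnt_def)
      have bd: "emeasure lebesgue (Q \<inter> ?B i) \<le> ennreal (1 - c) * emeasure lebesgue (?B i)" if i: "i \<in> C" for i
      proof -
        obtain x r where xr: "i = (x,r)" by force
        obtain y where y: "x \<in> Q" "0 < r" "dist x y < r" "ball y (\<eta> * r) \<inter> A = {}"
          using i C(2) by (auto simp: K_def xr)
        have sub: "ball y (\<eta> * r) \<subseteq> cball x (2*r)"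
        proof
          fix z assume "z \<in> ball y (\<eta> * r)"
          then have "dist y z < \<eta> * r" by simp
          also have "\<dots> \<le> r" using eta y by (simp add: mult_left_le_one_le)
          finally show "z \<in> cball x (2*r)" using dist_triangle[of x z y] y by simp
        qed
        have "Q \<inter> ?B i \<subseteq> cball x (2*r) - ball y (\<eta> * r)"
          using y by (auto simp: xr Q_def P_def)
        then have "emeasure lebesgue (Q \<inter> ?B i) \<le> emeasure lebesgue (cball x (2*r) - ball y (\<eta> * r))"
          by (intro emeasure_mono) auto
        also have "\<dots> = emeasure lebesgue (cball x (2*r)) - emeasure lebesgue (ball y (\<eta> * r))"
          using sub by (intro emeasure_Diff) (use emeasure_lborel_ball_finite[of y "\<eta> * r"] in auto)
        also have "\<dots> = ennreal (unit_ball_vol (DIM('a)) * (2*r) ^ DIM('a)) - ennreal (unit_ball_vol (DIM('a)) * (\<eta> * r) ^ DIM('a))"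
          using y eta by (simp add: emeasure_cball emeasure_ball)
        also have "\<dots> = ennreal (unit_ball_vol (DIM('a)) * (2*r) ^ DIM('a) - unit_ball_vol (DIM('a)) * (\<eta> * r) ^ DIM('a))"
          using y eta by (intro ennreal_minus) simp
        also have "unit_ball_vol (DIM('a)) * (2*r) ^ DIM('a) - unit_ball_vol (DIM('a)) * (\<eta> * r) ^ DIM('a)
            = (1 - c) * (unit_ball_vol (DIM('a)) * (2*r) ^ DIM('a))"
          by (simp add: c_def power_divide power_mult_distrib field_simps)
        also have "ennreal \<dots> = ennreal (1 - c) * emeasure lebesgue (?B i)"
          using y c by (simp add: ennreal_mult emeasure_cball xr)
        finally show ?thesis .
      qed
      have nul: "Q - (\<Union>i\<in>C. ?B i) \<in> null_sets lebesgue" using C(4) negligible_iff_null_sets by blast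
      have UNm: "(\<Union>i\<in>C. Q \<inter> ?B i) \<in> sets lebesgue"
        using C(1) Qm by (intro sets.countable_UN' ) auto
      have "emeasure lebesgue Q \<le> emeasure lebesgue ((\<Union>i\<in>C. Q \<inter> ?B i) \<union> (Q - (\<Union>i\<in>C. ?B i)))"
        using UNm nul by (intro emeasure_mono) auto
      also have "\<dots> = emeasure lebesgue (\<Union>i\<in>C. Q \<inter> ?B i)"
        using UNm nul by (rule emeasure_Un_null_set)
      also have "\<dots> = (\<integral>\<^sup>+i. emeasure lebesgue (Q \<inter> ?B i) \<partial>count_space C)"
        using C(1) Qm disj by (intro emeasure_UN_countable) (fastforce simp: disjoint_family_on_def simp del: mem_cball)+
      also have "\<dots> \<le> (\<integral>\<^sup>+i. ennreal (1 - c) * emeasure lebesgue (?B i) \<partial>count_space C)"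
        using bd by (intro nn_integral_mono) auto
      also have "\<dots> = ennreal (1 - c) * (\<integral>\<^sup>+i. emeasure lebesgue (?B i) \<partial>count_space C)"
        by (intro nn_integral_cmult) auto
      also have "(\<integral>\<^sup>+i. emeasure lebesgue (?B i) \<partial>count_space C) = emeasure lebesgue (\<Union>i\<in>C. ?B i)"
        using C(1) disj by (intro emeasure_UN_countable[symmetric]) auto
      also have "\<dots> \<le> emeasure lebesgue U"
      proof (intro emeasure_mono UN_least)
        fix i assume "i \<in> C"
        then have "i \<in> K" using C(2) by blast
        then show "?B i \<subseteq> U" by (auto simp: K_def simp del: mem_cball)
      qed (use Um in auto)
      also have "\<dots> = ennreal (measure lebesgue U)" using Um by (simp add: emeasure_eq_measure2)
      also have "\<dots> \<le> ennreal (measure lebesgue Q + e)" using mU by (intro ennreal_leI)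
      finally have "ennreal (measure lebesgue Q) \<le> ennreal ((1 - c) * (measure lebesgue Q + e))"
        using Qm c e by (simp add: emeasure_eq_measure2 ennreal_mult mult_left_mono)
      then show ?thesis using c e by (subst (asm) ennreal_le_iff) auto
    qed
    have "c * measure lebesgue Q \<le> e" if "e > 0" for e
    proof -
      have "(1 - c) * e \<le> e" using that c by simp
      moreover have "measure lebesgue Q \<le> (1 - c) * measure lebesgue Q + (1 - c) * e"
        using key[OF that] by (simp add: ring_distribs)
      ultimately show ?thesis by (simp add: algebra_simps)
    qed
    then have "c * measure lebesgue Q \<le> 0" by (rule field_le_epsilon) simp
    then have "measure lebesgue Q = 0" using c measure_nonneg[of lebesgue Q] by (simp add: mult_le_0_iff del: measure_nonneg)
    then show ?thesis using Qm unfolding Q_def[symmetric] by (simp add: negligible_iff_measure)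
  qed
  then have "negligible (\<Union>n::nat. P \<inter> cball 0 (real n))"
    by (intro negligible_countable_Union) auto
  moreover have "P \<subseteq> (\<Union>n::nat. P \<inter> cball 0 (real n))"
    using real_arch_simple by auto
  ultimately have "negligible P" by (rule negligible_subset)
  then show ?thesis using sub by (rule negligible_subset)
qed

section \<open>Lipschitz functions on the real line\<close>

text \<open>Vitali selects disjoint short intervals with one end point in \<open>E\<close> on which
  \<open>f\<close> has mean slope at most \<open>a\<close>; by monotonicity the image of each is the
  interval between the end values. The uncovered null set has a null image because \<open>f\<close>
  is Lipschitz.\<close>

lemma emeasure_image_small_slope:
  fixes f g :: "real \<Rightarrow> real"
  assumes mono: "strict_mono f" and gf: "\<And>x. g (f x) = x" and fg: "\<And>y. f (g y) = y"
    and lipf: "M-lipschitz_on UNIV f" and lipg: "M'-lipschitz_on UNIV g"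
    and E: "E \<in> sets borel" "bounded E" and a: "a > 0"
    and sl: "\<And>x d. x \<in> E \<Longrightarrow> d > 0 \<Longrightarrow> \<exists>h. h \<noteq> 0 \<and> \<bar>h\<bar> < d \<and> \<bar>f (x + h) - f x\<bar> \<le> a * \<bar>h\<bar>"
  shows "emeasure lborel (f ` E) \<le> ennreal a * emeasure lborel E"
proof -
  have contf: "continuous_on UNIV f" and contg: "continuous_on UNIV g"
    using lipf lipg by (auto intro: lipschitz_on_continuous_on)
  have img: "f ` T = g -` T" for T using gf fg by (auto intro: rev_image_eqI)
  have gm[measurable]: "g \<in> borel_measurable borel" using contg by (rule borel_measurable_continuous_onI)
  have fE: "f ` E \<in> sets borel" unfolding img using measurable_sets[OF gm E(1)] by simp
  have Efin: "emeasure lborel E < \<infinity>" using emeasure_bounded_finite[OF E(2)] by simp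
  have key: "emeasure lborel (f ` E) \<le> ennreal a * (emeasure lborel E + ennreal e)" if e: "e > 0" for e
  proof -
    obtain U where U: "open U" "E \<subseteq> U" "U - E \<in> lmeasurable" "emeasure lebesgue (U - E) < ennreal e"
      using sets_lebesgue_outer_open[of E e] E e by auto
    have UQ: "U = E \<union> (U - E)" using U by auto
    have mU: "emeasure lborel U \<le> emeasure lborel E + ennreal e"
    proof -
      have "emeasure lborel U \<le> emeasure lborel E + emeasure lborel (U - E)"
        by (subst UQ) (intro emeasure_subadditive, use U E in auto)
      also have "emeasure lborel (U - E) \<le> e"
        using U E by (simp add: less_imp_le)
      finally show ?thesis by (simp add: add_left_mono)
    qed
    \<comment> \<open>The interval between \<open>x\<close> and \<open>x + h\<close>, with
      \<open>h\<close> of either sign, is written as a ball about its midpoint.\<close>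
    define K where "K = {(x,h). x \<in> E \<and> h \<noteq> 0 \<and> cball (x + h/2) (\<bar>h\<bar>/2) \<subseteq> U \<and> \<bar>f (x + h) - f x\<bar> \<le> a * \<bar>h\<bar>}"
    let ?B = "\<lambda>i. cball (fst i + snd i / 2) (\<bar>snd i\<bar>/2)"
    obtain C where C: "countable C" "C \<subseteq> K" "pairwise (\<lambda>i j. disjnt (?B i) (?B j)) C" "negligible (E - (\<Union>i\<in>C. ?B i))"
    proof (rule Vitali_covering_theorem_cballs[of K "\<lambda>i. \<bar>snd i\<bar>/2" E "\<lambda>i. fst i + snd i / 2"])
      show "\<And>i. i \<in> K \<Longrightarrow> 0 < \<bar>snd i\<bar> / 2" by (auto simp: K_def)
      fix x d :: real assume x: "x \<in> E" and d: "0 < d"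
      obtain e where e: "e > 0" "cball x e \<subseteq> U" using U(1,2) x by (meson open_contains_cball subsetD)
      obtain h where h: "h \<noteq> 0" "\<bar>h\<bar> < min d e" "\<bar>f (x + h) - f x\<bar> \<le> a * \<bar>h\<bar>"
        using sl[OF x, of "min d e"] e d by auto
      have "cball (x + h/2) (\<bar>h\<bar>/2) \<subseteq> cball x e"
        using h unfolding subset_iff mem_cball dist_real_def by (intro allI impI) linarith
      then have "(x,h) \<in> K" using x h e by (auto simp: K_def)
      then show "\<exists>i. i \<in> K \<and> x \<in> ?B i \<and> \<bar>snd i\<bar> / 2 < d"
        using h by (intro exI[of _ "(x,h)"]) (auto simp: dist_real_def)
    qed blast
    have Bint: "?B i = {min (fst i) (fst i + snd i)..max (fst i) (fst i + snd i)}" for i :: "real \<times> real"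
      unfolding set_eq_iff mem_cball dist_real_def atLeastAtMost_iff by (intro allI) linarith
    have emB: "emeasure lborel (?B i) = ennreal \<bar>snd i\<bar>" for i :: "real \<times> real"
      unfolding Bint by (auto simp: min_def max_def)
    have bd: "emeasure lborel (f ` ?B i) \<le> ennreal a * emeasure lborel (?B i)" if "i \<in> C" for i
    proof -
      obtain x h where i: "i = (x,h)" by force
      have h: "\<bar>f (x + h) - f x\<bar> \<le> a * \<bar>h\<bar>" using that C(2) by (auto simp: K_def i)
      have "f ` ?B i \<subseteq> {min (f x) (f (x+h))..max (f x) (f (x+h))}"
        unfolding Bint i using strict_mono_less_eq[OF mono] by (auto simp: min_def max_def split: if_splits)
      then have "emeasure lborel (f ` ?B i) \<le> emeasure lborel {min (f x) (f (x+h))..max (f x) (f (x+h))}"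
        by (intro emeasure_mono) auto
      also have "\<dots> = ennreal \<bar>f (x + h) - f x\<bar>" by (auto simp: min_def max_def)
      also have "\<dots> \<le> ennreal (a * \<bar>h\<bar>)" using h by (intro ennreal_leI)
      also have "\<dots> = ennreal a * emeasure lborel (?B i)" unfolding emB i using a by (simp add: ennreal_mult)
      finally show ?thesis .
    qed
    have fB: "f ` ?B i \<in> sets borel" for i :: "real \<times> real"
      unfolding img using measurable_sets[OF gm, of "?B i"] by simp
    have disj: "disjoint_family_on ?B C"
      using C(3) by (auto simp: disjoint_family_on_def pairwise_def disjnt_def)
    have injf: "inj f" using gf by (metis injI)
    have "negligible (f ` (E - (\<Union>i\<in>C. ?B i)))"
      using C(4) lipf
      by (intro negligible_locally_Lipschitz_image[OF order_refl C(4)])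
         (auto simp: lipschitz_on_def dist_norm intro!: exI[of _ UNIV] exI[of _ M])
    then have nul: "f ` (E - (\<Union>i\<in>C. ?B i)) \<in> null_sets lebesgue" by (simp add: negligible_iff_null_sets)
    have "E - (\<Union>i\<in>C. ?B i) \<in> sets borel" using C(1) E by (intro sets.Diff sets.countable_UN') auto
    then have "f ` (E - (\<Union>i\<in>C. ?B i)) \<in> sets borel" unfolding img using measurable_sets[OF gm] by fastforce
    with nul have nul': "f ` (E - (\<Union>i\<in>C. ?B i)) \<in> null_sets lborel"
      by (simp add: null_sets_def)
    have UNm: "(\<Union>i\<in>C. f ` ?B i) \<in> sets borel" using C(1) fB by (intro sets.countable_UN') auto
    have "emeasure lborel (f ` E) \<le> emeasure lborel ((\<Union>i\<in>C. f ` ?B i) \<union> f ` (E - (\<Union>i\<in>C. ?B i)))"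
      using UNm nul' by (intro emeasure_mono sets.Un) (blast, auto dest: null_setsD2)
    also have "\<dots> = emeasure lborel (\<Union>i\<in>C. f ` ?B i)"
      using UNm nul' by (intro emeasure_Un_null_set) auto
    also have "\<dots> = (\<integral>\<^sup>+i. emeasure lborel (f ` ?B i) \<partial>count_space C)"
    proof (intro emeasure_UN_countable C(1))
      show "disjoint_family_on (\<lambda>i. f ` ?B i) C"
        using disj injf by (fastforce simp: disjoint_family_on_def inj_eq simp del: mem_cball)
    qed (use fB in auto)
    also have "\<dots> \<le> (\<integral>\<^sup>+i. ennreal a * emeasure lborel (?B i) \<partial>count_space C)"
      using bd by (intro nn_integral_mono) auto
    also have "\<dots> = ennreal a * (\<integral>\<^sup>+i. emeasure lborel (?B i) \<partial>count_space C)"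
      by (intro nn_integral_cmult) auto
    also have "(\<integral>\<^sup>+i. emeasure lborel (?B i) \<partial>count_space C) = emeasure lborel (\<Union>i\<in>C. ?B i)"
      using C(1) disj by (intro emeasure_UN_countable[symmetric]) auto
    also have "\<dots> \<le> emeasure lborel U"
    proof (intro emeasure_mono UN_least)
      fix i assume "i \<in> C"
      then have "i \<in> K" using C(2) by blast
      then show "?B i \<subseteq> U" by (auto simp: K_def simp del: mem_cball)
    qed (use U(1) in auto)
    also note mU
    finally show ?thesis by (simp add: mult_left_mono)
  qed
  show ?thesis
  proof (rule ennreal_le_epsilon)
    fix e :: real assume e: "e > 0"
    have "emeasure lborel (f ` E) \<le> ennreal a * (emeasure lborel E + ennreal (e/a))" using key[of "e/a"] a e by simp
    also have "\<dots> = ennreal a * emeasure lborel E + ennreal e"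
      using a e by (simp add: distrib_left ennreal_mult[symmetric])
    finally show "emeasure lborel (f ` E) \<le> ennreal a * emeasure lborel E + ennreal e" .
  qed
qed

lemma strict_mono_homeo_inverse:
  fixes F :: "real \<Rightarrow> real"
  assumes L: "0 < L" and lo: "\<And>x y. x \<le> y \<Longrightarrow> L * (y - x) \<le> F y - F x" and lip: "M-lipschitz_on UNIV F"
  obtains G where "\<And>x. G (F x) = x" "\<And>y. F (G y) = y" "(1/L)-lipschitz_on UNIV G"
proof -
  have cont: "continuous_on UNIV F" using lip by (rule lipschitz_on_continuous_on)
  have inj: "inj F"
  proof (rule injI)
    fix x y assume eq: "F x = F y"
    show "x = y" using lo[of x y] lo[of y x] eq L by (cases x y rule: linorder_cases) (auto simp: mult_le_0_iff)
  qed
  have surj: "surj F"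
    unfolding surj_def
  proof
    fix y
    define b where "b = \<bar>y - F 0\<bar> / L"
    have b: "b \<ge> 0" "L * b = \<bar>y - F 0\<bar>" using L by (auto simp: b_def)
    have "F (-b) \<le> y" "y \<le> F b" using lo[of 0 b] lo[of "-b" 0] b by auto
    then obtain x where "F x = y"
      using IVT'[of F "-b" y b] b cont by (meson continuous_on_subset subset_UNIV neg_le_0_iff_le order_trans)
    then show "\<exists>x. y = F x" by blast
  qed
  have G: "inv F (F x) = x" "F (inv F y) = y" for x y
    using inj surj by (auto simp: surj_f_inv_f)
  have "(1/L)-lipschitz_on UNIV (inv F)"
  proof (rule lipschitz_onI)
    fix u v
    have "L * \<bar>inv F u - inv F v\<bar> \<le> \<bar>u - v\<bar>"
      using lo[of "inv F u" "inv F v"] lo[of "inv F v" "inv F u"] G(2)[of u] G(2)[of v]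
      by (cases "inv F u \<le> inv F v") (auto simp: abs_if algebra_simps split: if_splits)
    then show "dist (inv F u) (inv F v) \<le> 1 / L * dist u v"
      using L by (simp add: dist_real_def field_simps)
  qed (use L in auto)
  then show thesis using that G by blast
qed

text \<open>Differentiability at 0 in disguise: only approximate slopes are asked for, and rational
  ones, so that the set of good points can be described by countable unions and
  intersections.\<close>

definition near_linear :: "(real \<Rightarrow> real) \<Rightarrow> bool" where
  "near_linear f \<longleftrightarrow> (\<forall>e>0. \<exists>q\<in>\<rat>. \<exists>d>0. \<forall>h. \<bar>h\<bar> < d \<longrightarrow> \<bar>f h - f 0 - q * h\<bar> \<le> e * \<bar>h\<bar>)"

text \<open>Dini derivate argument: where slopes below \<open>a\<close> and slopes above
  \<open>b\<close> both occur at arbitrarily small scales,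
  \<open>emeasure_image_small_slope\<close>, applied to an increasing function and to its inverse,
  bounds the measure by \<open>a / b\<close> times itself, hence by 0 for
  \<open>a < b\<close>.\<close>

lemma lipschitz_AE_near_linear:
  fixes f :: "real \<Rightarrow> real"
  assumes lipf: "L-lipschitz_on UNIV f"
  obtains N where "N \<in> null_sets lborel" "\<And>x. x \<notin> N \<Longrightarrow> near_linear (\<lambda>h. f (x + h))"
proof -
  define M where "M = max L 1"
  have M: "M > 0" "M-lipschitz_on UNIV f" using lipf by (auto simp: M_def intro: lipschitz_on_le)
  have fM: "\<bar>f x - f y\<bar> \<le> M * \<bar>x - y\<bar>" for x y
    using M(2) by (auto simp: lipschitz_on_def dist_real_def)
  \<comment> \<open>The linear term brings all slopes into \<open>[M, 3 * M]\<close>, so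
    \<open>F\<close> is increasing with a Lipschitz inverse \<open>G\<close>.\<close>
  define F where "F x = f x + 2 * M * x" for x
  have slF: "M * \<bar>h\<bar> \<le> \<bar>F (x+h) - F x\<bar>" "\<bar>F (x+h) - F x\<bar> \<le> 3 * M * \<bar>h\<bar>" "M \<le> (F (x+h) - F x)/h \<or> h = 0" "(F (x+h) - F x)/h \<le> 3 * M" for x h
  proof -
    have eq: "F (x+h) - F x = (f (x+h) - f x) + 2*M*h" by (simp add: F_def algebra_simps)
    have *: "\<bar>f (x+h) - f x\<bar> \<le> M * \<bar>h\<bar>" using fM[of "x+h" x] by simp
    have **: "M * h \<le> F (x+h) - F x" "F (x+h) - F x \<le> 3 * M * h" if "h \<ge> 0"
      using * that unfolding eq by (auto simp: abs_le_iff)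
    have ***: "M * h \<ge> F (x+h) - F x" "F (x+h) - F x \<ge> 3 * M * h" if "h < 0"
      using * that unfolding eq by (auto simp: abs_le_iff)
    show "M * \<bar>h\<bar> \<le> \<bar>F (x+h) - F x\<bar>" "\<bar>F (x+h) - F x\<bar> \<le> 3 * M * \<bar>h\<bar>"
      using ** *** by (cases "h \<ge> 0"; force simp: abs_if)+
    show "M \<le> (F (x+h) - F x)/h \<or> h = 0" "(F (x+h) - F x)/h \<le> 3 * M"
      using ** *** M by (cases "h > 0"; cases "h = 0"; force simp: field_simps)+
  qed
  have lipF: "(3*M)-lipschitz_on UNIV F"
  proof (rule lipschitz_onI)
    fix x y show "dist (F x) (F y) \<le> 3*M * dist x y"
      using slF(2)[of y "x - y"] by (simp add: dist_real_def)
  qed (use M in simp)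
  have lo: "M * (y - x) \<le> F y - F x" if "x \<le> y" for x y
    using slF(3)[of x "y - x"] that by (cases "y = x") (auto simp: field_simps)
  obtain G where G: "\<And>x. G (F x) = x" "\<And>y. F (G y) = y" "(1/M)-lipschitz_on UNIV G"
    using strict_mono_homeo_inverse[OF M(1) lo lipF] by blast
  have monoF: "strict_mono F"
  proof (rule strict_monoI)
    fix x y :: real assume "x < y"
    then show "F x < F y" using lo[of x y] mult_pos_pos[OF M(1), of "y - x"] by auto
  qed
  have monoG: "strict_mono G"
    using monoF G by (intro strict_monoI) (metis strict_mono_less)
  have contF: "continuous_on UNIV F" using lipF by (rule lipschitz_on_continuous_on)
  have contFx: "continuous_on UNIV (\<lambda>x. (F (x + h) - F x) / h)" if "h \<noteq> 0" for h
    using that by (intro continuous_intros continuous_on_compose2[OF contF]) auto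
  define lowslope where "lowslope a m = {x. \<exists>h. h \<noteq> 0 \<and> \<bar>h\<bar> < 1 / real (Suc m) \<and> (F (x + h) - F x) / h < a}" for a m
  define highslope where "highslope a m = {x. \<exists>h. h \<noteq> 0 \<and> \<bar>h\<bar> < 1 / real (Suc m) \<and> (F (x + h) - F x) / h > a}" for a m
  have op: "open (lowslope a m)" "open (highslope a m)" for a m
  proof -
    have "lowslope a m = (\<Union>h\<in>{h. h \<noteq> 0 \<and> \<bar>h\<bar> < 1 / real (Suc m)}. {x. (F (x + h) - F x) / h < a})"
      "highslope a m = (\<Union>h\<in>{h. h \<noteq> 0 \<and> \<bar>h\<bar> < 1 / real (Suc m)}. {x. a < (F (x + h) - F x) / h})"
      by (auto simp: lowslope_def highslope_def)
    then show "open (lowslope a m)" "open (highslope a m)"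
      by (auto intro!: open_UN open_Collect_less contFx continuous_on_const)
  qed
  define E where "E a b n = {-real n..real n} \<inter> (\<Inter>m. lowslope a m) \<inter> (\<Inter>m. highslope b m)" for a b :: real and n :: nat
  have Eb: "E a b n \<in> sets borel" "bounded (E a b n)" for a b n
    using op by (auto simp: E_def intro!: sets.Int sets.countable_INT' bounded_Int)
  have null: "E a b n \<in> null_sets lborel" if ab: "0 < a" "a < b" for a b n
  proof -
    have 1: "emeasure lborel (F ` E a b n) \<le> ennreal a * emeasure lborel (E a b n)"
    proof (rule emeasure_image_small_slope[OF monoF G(1,2) lipF G(3) Eb ab(1)])
      fix x d :: real assume x: "x \<in> E a b n" and d: "d > 0"
      obtain m where m: "1 / real (Suc m) < d" using nat_approx_posE[OF d] by auto
      have "x \<in> lowslope a m" using x by (auto simp: E_def)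
      then obtain h where h: "h \<noteq> 0" "\<bar>h\<bar> < 1 / real (Suc m)" "(F (x + h) - F x) / h < a" by (auto simp: lowslope_def)
      have "\<bar>F (x + h) - F x\<bar> = \<bar>(F (x + h) - F x) / h\<bar> * \<bar>h\<bar>" using h by (simp add: abs_divide)
      also have "\<dots> \<le> a * \<bar>h\<bar>" using h slF(3)[of x h] M by (intro mult_right_mono) auto
      finally show "\<exists>h. h \<noteq> 0 \<and> \<bar>h\<bar> < d \<and> \<bar>F (x + h) - F x\<bar> \<le> a * \<bar>h\<bar>" using h m by (intro exI[of _ h]) auto
    qed
    have img: "F ` T = G -` T" for T using G by (auto intro: rev_image_eqI)
    have Gm: "G \<in> borel_measurable borel"
      using G(3) by (intro borel_measurable_continuous_onI lipschitz_on_continuous_on)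
    have FE: "F ` E a b n \<in> sets borel" unfolding img using measurable_sets[OF Gm Eb(1)] by simp
    have bFE: "bounded (F ` E a b n)" 
    proof -
      obtain B where B: "\<And>x. x \<in> E a b n \<Longrightarrow> \<bar>x\<bar> \<le> B" using Eb(2)[of a b n] by (auto simp: bounded_iff)
      have "\<bar>F x\<bar> \<le> \<bar>F 0\<bar> + 3 * M * B" if "x \<in> E a b n" for x
        
      proof -
        have "\<bar>F x - F 0\<bar> \<le> 3 * M * \<bar>x\<bar>" using slF(2)[of 0 x] by simp
        moreover have "3 * M * \<bar>x\<bar> \<le> 3 * M * B" using B[OF that] M(1) by (intro mult_left_mono) auto
        ultimately show ?thesis by linarith
      qed
      then show ?thesis by (auto simp: bounded_iff)
    qed
    \<comment> \<open>Large slopes of \<open>F\<close> are small slopes of \<open>G\<close>, with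
      bound \<open>1 / b\<close>.\<close>
    have "emeasure lborel (G ` (F ` E a b n)) \<le> ennreal (1/b) * emeasure lborel (F ` E a b n)"
    proof (rule emeasure_image_small_slope[OF monoG G(2,1) G(3) lipF FE bFE])
      fix y d :: real assume y: "y \<in> F ` E a b n" and d: "d > 0"
      then obtain x where x: "y = F x" "x \<in> E a b n" by auto
      have "d / (3*M) > 0" using d M by simp
      then obtain m where m: "1 / real (Suc m) < d / (3*M)" using nat_approx_posE by blast
      have "x \<in> highslope b m" using x by (auto simp: E_def)
      then obtain h where h: "h \<noteq> 0" "\<bar>h\<bar> < 1 / real (Suc m)" "(F (x + h) - F x) / h > b" by (auto simp: highslope_def)
      define k where "k = F (x + h) - F x"
      have k: "k / h > b" using h by (simp add: k_def)
      have "k \<noteq> 0" using k ab by auto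
      moreover have "\<bar>k\<bar> < d"
      proof -
        have "\<bar>k\<bar> \<le> 3*M*\<bar>h\<bar>" using slF(2) by (simp add: k_def)
        also have "\<dots> < 3*M*(d/(3*M))" using h m M by (intro mult_strict_left_mono) auto
        finally show ?thesis using M by simp
      qed
      moreover have "\<bar>G (y + k) - G y\<bar> \<le> 1/b * \<bar>k\<bar>"
      proof -
        have "G (y + k) - G y = h" using G by (simp add: x k_def)
        moreover have "b * \<bar>h\<bar> \<le> \<bar>k / h\<bar> * \<bar>h\<bar>" using k ab by (intro mult_right_mono) linarith+
        ultimately show ?thesis using h ab by (simp add: field_simps)
      qed
      ultimately show "\<exists>k. k \<noteq> 0 \<and> \<bar>k\<bar> < d \<and> \<bar>G (y + k) - G y\<bar> \<le> 1/b * \<bar>k\<bar>" by blast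
    qed (use ab in auto)
    moreover have "G ` F ` E a b n = E a b n" using G by (force simp: image_image)
    ultimately have 2: "emeasure lborel (E a b n) \<le> ennreal (1/b) * emeasure lborel (F ` E a b n)" by simp
    have fin: "emeasure lborel (E a b n) < \<infinity>" using emeasure_bounded_finite[OF Eb(2)] by simp
    then obtain e where e: "emeasure lborel (E a b n) = ennreal e" "e \<ge> 0" by (cases "emeasure lborel (E a b n)") auto
    have "ennreal e \<le> ennreal (1/b) * (ennreal a * ennreal e)"
      using 2 mult_left_mono[OF 1, of "ennreal (1/b)"] e by (simp add: order_trans)
    then have "e \<le> (1/b) * (a * e)" using ab e by (simp add: ennreal_mult[symmetric])
    then have "e * (b - a) \<le> 0" using ab by (simp add: field_simps)
    then have "e = 0" using ab e by (simp add: mult_le_0_iff)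
    then show ?thesis using e Eb by (intro null_setsI) auto
  qed
  define N where "N = (\<Union>(a,b,n)\<in>{(a,b,n). a \<in> \<rat> \<and> b \<in> \<rat> \<and> 0 < a \<and> a < b}. E a b n)"
  have cnt: "countable {(a,b,n::nat). a \<in> \<rat> \<and> b \<in> \<rat> \<and> 0 < a \<and> a < (b::real)}"
    by (rule countable_subset[of _ "\<rat> \<times> \<rat> \<times> UNIV"]) (auto simp: countable_rat)
  have "N \<in> null_sets lborel"
    unfolding N_def using cnt null by (intro null_sets_UN') auto
  moreover have "near_linear (\<lambda>h. f (x + h))" if x: "x \<notin> N" for x
    unfolding near_linear_def
  proof (intro allI impI)
    fix e :: real assume e: "e > 0"
    obtain p where p: "1 / real (Suc p) < e / 2" using nat_approx_posE[of "e/2"] e by auto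
    \<comment> \<open>A grid of slopes with mesh \<open>1 / (p + 1)\<close>: \<open>ge j\<close>
      says that slopes at small scales stay above grid value \<open>j\<close>. At the last such
      \<open>j\<close> they also stay below grid value \<open>j + 2\<close>, since \<open>x\<close>
      is outside the null sets. Grid value \<open>j + 1\<close> is then within \<open>e / 2\<close>
      of them; the other half of \<open>e\<close> pays for the rational \<open>M'\<close> near
      \<open>2 * M\<close>.\<close>
    define ge where "ge j \<longleftrightarrow> (\<exists>m. \<forall>h. h \<noteq> 0 \<and> \<bar>h\<bar> < 1 / real (Suc m) \<longrightarrow> (F (x + h) - F x) / h \<ge> real j / real (Suc p))" for j :: nat
    have alt: "ge j \<or> (\<exists>m. \<forall>h. h \<noteq> 0 \<and> \<bar>h\<bar> < 1 / real (Suc m) \<longrightarrow> (F (x + h) - F x) / h \<le> real (Suc j) / real (Suc p))" if j: "j > 0" for j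
    proof (rule ccontr)
      assume neg: "\<not> ?thesis"
      obtain n where n: "\<bar>x\<bar> \<le> real n" using real_arch_simple by blast
      have "x \<in> E (real j / real (Suc p)) (real (Suc j) / real (Suc p)) n"
        using neg n unfolding E_def lowslope_def highslope_def ge_def by (auto simp: not_le simp del: of_nat_Suc)
      moreover have "real j / real (Suc p) \<in> \<rat>" "real (Suc j) / real (Suc p) \<in> \<rat>" by (intro Rats_divide Rats_of_nat)+
      moreover have "real j / real (Suc p) < real (Suc j) / real (Suc p)" by (intro divide_strict_right_mono) auto
      ultimately have "x \<in> N" using j unfolding N_def by (intro UN_I[of "(real j / real (Suc p), real (Suc j) / real (Suc p), n)"]) auto
      with that x show False by blast
    qed
    have ge0: "ge 0" unfolding ge_def
    proof (intro exI[of _ 0] allI impI)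
      fix h :: real assume "h \<noteq> 0 \<and> \<bar>h\<bar> < 1 / real (Suc 0)"
      then show "real 0 / real (Suc p) \<le> (F (x + h) - F x) / h" using slF(3)[of x h] M by auto
    qed
    obtain J where J: "3 * M * real (Suc p) < real J" using reals_Archimedean2 by blast
    have "\<not> ge J"
    proof
      assume "ge J"
      then obtain m where m: "\<And>h. h \<noteq> 0 \<and> \<bar>h\<bar> < 1 / real (Suc m) \<Longrightarrow> (F (x + h) - F x) / h \<ge> real J / real (Suc p)" by (auto simp: ge_def)
      define h where "h = 1 / real (Suc (Suc m))"
      have "(F (x + h) - F x) / h \<ge> real J / real (Suc p)" by (rule m) (auto simp: h_def field_simps)
      moreover have "real J / real (Suc p) > 3 * M" using J by (simp add: field_simps)
      ultimately show False using slF(4)[of x h] by linarith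
    qed
    then obtain j where j: "ge j" "\<not> ge (Suc j)"
      using ge0 by (metis nat_induct)
    obtain m1 where m1: "\<And>h. h \<noteq> 0 \<and> \<bar>h\<bar> < 1 / real (Suc m1) \<Longrightarrow> (F (x + h) - F x) / h \<ge> real j / real (Suc p)"
      using j(1) by (auto simp: ge_def)
    obtain m2 where m2: "\<And>h. h \<noteq> 0 \<and> \<bar>h\<bar> < 1 / real (Suc m2) \<Longrightarrow> (F (x + h) - F x) / h \<le> real (Suc (Suc j)) / real (Suc p)"
      using j(2) alt[of "Suc j"] by auto
    define K where "K = real_of_int \<lfloor>M\<rfloor>"
    obtain M' where M': "M' \<in> \<rat>" "\<bar>2 * M - M'\<bar> < e / 2"
    proof -
      obtain q where "q \<in> \<rat>" "2*M - e/2 < q" "q < 2*M"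
        using Rats_dense_in_real[of "2*M - e/2" "2*M"] e by auto
      then show thesis using that[of q] by auto
    qed
    define q where "q = real (Suc j) / real (Suc p) - M'"
    define d where "d = min (1 / real (Suc m1)) (1 / real (Suc m2))"
    show "\<exists>q\<in>\<rat>. \<exists>d>0. \<forall>h. \<bar>h\<bar> < d \<longrightarrow> \<bar>f (x + h) - f (x + 0) - q * h\<bar> \<le> e * \<bar>h\<bar>"
    proof (intro bexI[of _ q] exI[of _ d] conjI allI impI)
      show "q \<in> \<rat>" using M'(1) unfolding q_def by (intro Rats_diff Rats_divide Rats_of_nat)
      show "d > 0" by (simp add: d_def)
      fix h assume h: "\<bar>h\<bar> < d"
      show "\<bar>f (x + h) - f (x + 0) - q * h\<bar> \<le> e * \<bar>h\<bar>"
      proof (cases "h = 0")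
        case False
        define s where "s = (F (x + h) - F x) / h"
        have s: "real j / real (Suc p) \<le> s" "s \<le> real (Suc (Suc j)) / real (Suc p)"
          using m1[of h] m2[of h] h False by (auto simp: d_def s_def)
        have lin: "A = b + w \<Longrightarrow> b = a + w \<Longrightarrow> a \<le> s \<Longrightarrow> s \<le> A \<Longrightarrow> w < e/2 \<Longrightarrow> \<bar>s - b\<bar> \<le> e/2" for A b a w :: real
          by linarith
        have "real (Suc (Suc j)) / real (Suc p) = real (Suc j) / real (Suc p) + 1 / real (Suc p)"
          "real (Suc j) / real (Suc p) = real j / real (Suc p) + 1 / real (Suc p)"
          by (simp_all add: add_divide_distrib[symmetric] del: of_nat_Suc)
        then have "\<bar>s - real (Suc j) / real (Suc p)\<bar> \<le> e / 2"
          using s p by (rule_tac lin)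
        moreover have "f (x + h) - f (x + 0) - q * h = ((s - real (Suc j) / real (Suc p)) - (2 * M - M')) * h"
        proof -
          have "s * h = F (x + h) - F x" using False by (simp add: s_def)
          then show ?thesis by (simp add: F_def q_def algebra_simps del: of_nat_Suc)
        qed
        moreover have "\<bar>((s - real (Suc j) / real (Suc p)) - (2 * M - M')) * h\<bar> \<le> e * \<bar>h\<bar>"
          if "\<bar>s - real (Suc j) / real (Suc p)\<bar> \<le> e / 2"
          unfolding abs_mult using that M'(2) by (intro mult_right_mono) linarith+
        ultimately show ?thesis by simp
      qed simp
    qed
  qed
  ultimately show thesis using that by blast
qed

section \<open>From lines to full differentiability\<close>

text \<open>Approximate gradients for two tolerances differ by at most the sum of the tolerances, as
  a test in the direction of their difference shows; so they form a Cauchy sequence.\<close>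

lemma differentiable_if_almost_linear:
  fixes f :: "real^'n::finite \<Rightarrow> real"
  assumes *: "\<And>e. e > 0 \<Longrightarrow> \<exists>q. \<exists>d>0. \<forall>h. norm h < d \<longrightarrow> \<bar>f (x + h) - f x - q \<bullet> h\<bar> \<le> e * norm h"
  shows "f differentiable (at x)"
proof -
  have "\<forall>m. \<exists>q. \<exists>d>0. \<forall>h. norm h < d \<longrightarrow> \<bar>f (x + h) - f x - q \<bullet> h\<bar> \<le> (1 / real (Suc m)) * norm h"
    using * by (intro allI *) (simp del: of_nat_Suc)
  then obtain Q D where QD: "\<And>m. D m > 0" "\<And>m h. norm h < D m \<Longrightarrow> \<bar>f (x + h) - f x - Q m \<bullet> h\<bar> \<le> (1 / real (Suc m)) * norm h"
    by metis
  have close: "norm (Q m - Q n) \<le> 1 / real (Suc m) + 1 / real (Suc n)" for m n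
  proof (cases "Q m = Q n")
    case False
    define v where "v = Q m - Q n"
    define t where "t = min (D m) (D n) / (2 * norm v)"
    have v: "norm v > 0" using False by (simp add: v_def)
    have t: "t > 0" using v QD(1) by (simp add: t_def)
    have "norm (t *\<^sub>R v) = min (D m) (D n) / 2" using v QD(1)[of m] QD(1)[of n] by (simp add: t_def min_def)
    then have "norm (t *\<^sub>R v) < D m" "norm (t *\<^sub>R v) < D n" using QD(1)[of m] QD(1)[of n] by auto
    from QD(2)[OF this(1)] QD(2)[OF this(2)]
    have "\<bar>Q m \<bullet> (t *\<^sub>R v) - Q n \<bullet> (t *\<^sub>R v)\<bar> \<le> (1 / real (Suc m) + 1 / real (Suc n)) * norm (t *\<^sub>R v)"
      unfolding distrib_right by linarith
    moreover have "Q m \<bullet> (t *\<^sub>R v) - Q n \<bullet> (t *\<^sub>R v) = norm v * norm (t *\<^sub>R v)"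
    proof -
      have "Q m \<bullet> (t *\<^sub>R v) - Q n \<bullet> (t *\<^sub>R v) = v \<bullet> (t *\<^sub>R v)" by (simp only: v_def inner_diff_left)
      then show ?thesis using t by (simp add: dot_square_norm power2_eq_square)
    qed
    ultimately have "norm v * norm (t *\<^sub>R v) \<le> (1 / real (Suc m) + 1 / real (Suc n)) * norm (t *\<^sub>R v)" by simp
    then show ?thesis using v t by (simp add: v_def[symmetric] del: of_nat_Suc)
  qed (simp del: of_nat_Suc)
  have "Cauchy Q"
  proof (rule metric_CauchyI)
    fix e :: real assume e: "e > 0"
    obtain M where M: "1 / real (Suc M) < e / 2" using nat_approx_posE[of "e/2"] e by auto
    have "dist (Q m) (Q n) < e" if "m \<ge> M" "n \<ge> M" for m n
    proof -
      have "1 / real (Suc m) \<le> 1 / real (Suc M)" "1 / real (Suc n) \<le> 1 / real (Suc M)"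
        using that by (auto simp: frac_le)
      then show ?thesis using close[of m n] M by (simp add: dist_norm del: of_nat_Suc)
    qed
    then show "\<exists>M. \<forall>m\<ge>M. \<forall>n\<ge>M. dist (Q m) (Q n) < e" by blast
  qed
  then obtain q where q: "Q \<longlonglongrightarrow> q" using Cauchy_convergent convergent_def by blast
  have cq: "norm (Q m - q) \<le> 1 / real (Suc m)" for m
  proof (rule LIMSEQ_le)
    show "(\<lambda>n. norm (Q m - Q n)) \<longlonglongrightarrow> norm (Q m - q)" by (intro tendsto_intros q)
    show "(\<lambda>n. 1 / real (Suc m) + 1 / real (Suc n)) \<longlonglongrightarrow> 1 / real (Suc m)"
    proof -
      have "(\<lambda>n. 1 / real (Suc m) + 1 / real (Suc n)) \<longlonglongrightarrow> 1 / real (Suc m) + 0"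
        by (intro tendsto_intros LIMSEQ_Suc[OF lim_1_over_n])
      then show ?thesis by (simp only: add_0_right)
    qed
  qed (use close in auto)
  have "(f has_derivative (\<lambda>h. q \<bullet> h)) (at x)"
    unfolding has_derivative_at_alt
  proof (intro conjI allI impI bounded_linear_inner_right)
    fix e :: real assume e: "e > 0"
    obtain M where M: "1 / real (Suc M) < e / 2" using nat_approx_posE[of "e/2"] e by auto
    show "\<exists>d>0. \<forall>y. norm (y - x) < d \<longrightarrow> norm (f y - f x - q \<bullet> (y - x)) \<le> e * norm (y - x)"
    proof (intro exI[of _ "D M"] conjI allI impI QD(1))
      fix y assume y: "norm (y - x) < D M"
      have "\<bar>f y - f x - Q M \<bullet> (y - x)\<bar> \<le> 1 / real (Suc M) * norm (y - x)" using QD(2)[OF y] by simp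
      moreover have "\<bar>(Q M - q) \<bullet> (y - x)\<bar> \<le> 1 / real (Suc M) * norm (y - x)"
        using Cauchy_Schwarz_ineq2[of "Q M - q" "y - x"] cq[of M] by (meson mult_right_mono norm_ge_zero order_trans)
      ultimately have "\<bar>f y - f x - q \<bullet> (y - x)\<bar> \<le> 2 * (1 / real (Suc M)) * norm (y - x)"
        by (simp add: inner_diff_left del: of_nat_Suc)
      also have "\<dots> \<le> e * norm (y - x)" using M by (intro mult_right_mono) auto
      finally show "norm (f y - f x - q \<bullet> (y - x)) \<le> e * norm (y - x)" by simp
    qed
  qed
  then show ?thesis by (auto simp: differentiable_def)
qed

text \<open>Translating \<open>S\<close> by \<open>t *\<^sub>R v\<close> keeps its measure, so this
  measure is also its average over \<open>t\<close> in \<open>[0, 1]\<close>; Fubini turns the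
  average into line integrals along \<open>v\<close>, which vanish.\<close>

lemma lebesgue_null_if_null_on_lines:
  fixes S :: "(real^'n::finite) set"
  assumes S: "S \<in> sets borel" and null: "\<And>x. {t. x + t *\<^sub>R v \<in> S} \<in> null_sets lborel"
  shows "S \<in> null_sets lborel"
proof -
  have [measurable]: "(\<lambda>(t, x). x + t *\<^sub>R v) \<in> borel_measurable (borel \<Otimes>\<^sub>M borel)" 
    "(\<lambda>(x, t). x + t *\<^sub>R v) \<in> borel_measurable (borel \<Otimes>\<^sub>M borel)" by measurable
  note S[measurable]
  have tr: "(\<integral>\<^sup>+x. indicator S (x + t *\<^sub>R v) \<partial>lborel) = emeasure lborel S" for t :: real
  proof -
    have "(\<integral>\<^sup>+x. indicator S x \<partial>lborel) = (\<integral>\<^sup>+x. indicator S x \<partial>distr lborel borel ((+) (t *\<^sub>R v)))"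
      by (simp add: lborel_distr_plus)
    also have "\<dots> = (\<integral>\<^sup>+x. indicator S (t *\<^sub>R v + x) \<partial>lborel)"
      by (subst nn_integral_distr) auto
    finally show ?thesis using S by (simp add: add.commute)
  qed
  have "emeasure lborel S = (\<integral>\<^sup>+t. indicator {0..1::real} t * emeasure lborel S \<partial>lborel)"
    by (simp add: nn_integral_multc)
  also have "\<dots> = (\<integral>\<^sup>+t. (\<integral>\<^sup>+x. indicator {0..1} t * indicator S (x + t *\<^sub>R v) \<partial>lborel) \<partial>lborel)"
    by (simp add: nn_integral_cmult tr)
  also have "\<dots> = (\<integral>\<^sup>+x. (\<integral>\<^sup>+t. indicator {0..1::real} t * indicator S (x + t *\<^sub>R v) \<partial>lborel) \<partial>lborel)"
    by (intro lborel_pair.Fubini') measurable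
  also have "\<dots> = (\<integral>\<^sup>+(x::real^'n). 0 \<partial>lborel)"
  proof (intro nn_integral_cong)
    fix x :: "real^'n"
    have "AE t in lborel. t \<notin> {t. x + t *\<^sub>R v \<in> S}" using null by (rule AE_not_in)
    then have "(\<integral>\<^sup>+t. indicator {0..1::real} t * indicator S (x + t *\<^sub>R v) \<partial>lborel) = (\<integral>\<^sup>+(t::real). 0 \<partial>lborel)"
      by (intro nn_integral_cong_AE) (auto elim!: eventually_mono simp: indicator_def)
    then show "(\<integral>\<^sup>+t. indicator {0..1::real} t * indicator S (x + t *\<^sub>R v) \<partial>lborel) = 0" by simp
  qed
  finally show ?thesis using S by (intro null_setsI) auto
qed

text \<open>Only the quantifier over \<open>h\<close> remains uncountable; for a continuous function
  it yields an intersection of closed sets, so the good points form a Borel set.\<close>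

lemma Rats_countable_near_linear_iff:
  "near_linear f \<longleftrightarrow> (\<forall>m. \<exists>q\<in>\<rat>. \<exists>j. \<forall>h. \<bar>h\<bar> < 1 / real (Suc j) \<longrightarrow> \<bar>f h - f 0 - q * h\<bar> \<le> (1 / real (Suc m)) * \<bar>h\<bar>)"
  (is "_ = ?R")
proof
  assume L: "near_linear f"
  show ?R
  proof
    fix m
    obtain q d where q: "q \<in> \<rat>" "d > 0" "\<And>h. \<bar>h\<bar> < d \<Longrightarrow> \<bar>f h - f 0 - q * h\<bar> \<le> (1 / real (Suc m)) * \<bar>h\<bar>"
      using L unfolding near_linear_def by (elim allE[of _ "1 / real (Suc m)"]) auto
    obtain j where "1 / real (Suc j) < d" using nat_approx_posE[OF q(2)] by auto
    then show "\<exists>q\<in>\<rat>. \<exists>j. \<forall>h. \<bar>h\<bar> < 1 / real (Suc j) \<longrightarrow> \<bar>f h - f 0 - q * h\<bar> \<le> (1 / real (Suc m)) * \<bar>h\<bar>"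
      using q by (intro bexI[of _ q] exI[of _ j]) (auto simp del: of_nat_Suc)
  qed
next
  assume R: ?R
  show "near_linear f" unfolding near_linear_def
  proof (intro allI impI)
    fix e :: real assume "e > 0"
    then obtain m where m: "1 / real (Suc m) < e" using nat_approx_posE by auto
    obtain q j where q: "q \<in> \<rat>" "\<And>h. \<bar>h\<bar> < 1 / real (Suc j) \<Longrightarrow> \<bar>f h - f 0 - q * h\<bar> \<le> (1 / real (Suc m)) * \<bar>h\<bar>"
      using R by meson
    have "\<bar>f h - f 0 - q * h\<bar> \<le> e * \<bar>h\<bar>" if "\<bar>h\<bar> < 1 / real (Suc j)" for h
      using q(2)[OF that] mult_right_mono[of "1 / real (Suc m)" e "\<bar>h\<bar>"] m by linarith
    then show "\<exists>q\<in>\<rat>. \<exists>d>0. \<forall>h. \<bar>h\<bar> < d \<longrightarrow> \<bar>f h - f 0 - q * h\<bar> \<le> e * \<bar>h\<bar>"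
      using q(1) by (intro bexI[of _ q] exI[of _ "1 / real (Suc j)"]) auto
  qed
qed

lemma lipschitz_AE_partials:
  fixes f :: "real^'n::finite \<Rightarrow> real"
  assumes lip: "L-lipschitz_on UNIV f" and v: "norm v \<le> 1"
  shows "{x. \<not> near_linear (\<lambda>h. f (x + h *\<^sub>R v))} \<in> null_sets lborel"
proof -
  have cont: "continuous_on UNIV f" using lip by (rule lipschitz_on_continuous_on)
  define B where "B m q j = (\<Inter>h\<in>{h. \<bar>h\<bar> < 1 / real (Suc j)}. {x. \<bar>f (x + h *\<^sub>R v) - f x - q * h\<bar> \<le> (1 / real (Suc m)) * \<bar>h\<bar>})" for m j :: nat and q :: real
  have "closed (B m q j)" for m q j
    unfolding B_def by (intro closed_INT ballI closed_Collect_le continuous_intros continuous_on_compose2[OF cont]) auto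
  then have "B m q j \<in> sets borel" for m q j by (rule borel_closed)
  then have "(\<Union>j. B m q j) \<in> sets borel" for m q by (intro sets.countable_UN) auto
  then have "(\<Union>q\<in>\<rat>. \<Union>j. B m q j) \<in> sets borel" for m
    by (intro sets.countable_UN') (auto simp: countable_rat)
  then have "(\<Inter>m. \<Union>q\<in>\<rat>. \<Union>j. B m q j) \<in> sets borel" by (intro sets.countable_INT) auto
  also have "(\<Inter>m. \<Union>q\<in>\<rat>. \<Union>j. B m q j) = {x. near_linear (\<lambda>h. f (x + h *\<^sub>R v))}"
    unfolding Rats_countable_near_linear_iff B_def by auto
  finally have "- {x. near_linear (\<lambda>h. f (x + h *\<^sub>R v))} \<in> sets borel" by (rule borel_comp)
  then have S: "{x. \<not> near_linear (\<lambda>h. f (x + h *\<^sub>R v))} \<in> sets borel" by (simp add: Compl_eq)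
  show ?thesis
  proof (rule lebesgue_null_if_null_on_lines[OF S, of v])
    fix x
    have "L-lipschitz_on UNIV (\<lambda>t. f (x + t *\<^sub>R v))"
    proof (rule lipschitz_onI)
      fix s t :: real
      have "dist (f (x + s *\<^sub>R v)) (f (x + t *\<^sub>R v)) \<le> L * dist (x + s *\<^sub>R v) (x + t *\<^sub>R v)"
        using lip by (rule lipschitz_onD) auto
      also have "dist (x + s *\<^sub>R v) (x + t *\<^sub>R v) = dist s t * norm v"
        by (simp add: dist_norm scaleR_diff_left[symmetric])
      also have "L * \<dots> \<le> L * dist s t"
        using v lipschitz_on_nonneg[OF lip] by (intro mult_left_mono) (auto simp: mult_left_le)
      finally show "dist (f (x + s *\<^sub>R v)) (f (x + t *\<^sub>R v)) \<le> L * dist s t" .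
    qed (rule lipschitz_on_nonneg[OF lip])
    from lipschitz_AE_near_linear[OF this] obtain N where N: "N \<in> null_sets lborel"
      "\<And>t. t \<notin> N \<Longrightarrow> near_linear (\<lambda>h. f (x + (t + h) *\<^sub>R v))" by blast
    have "(\<lambda>t. x + t *\<^sub>R v) -` {x. \<not> near_linear (\<lambda>h. f (x + h *\<^sub>R v))} \<inter> space borel \<in> sets borel"
      by (rule measurable_sets[OF _ S]) measurable
    then have b: "{t. x + t *\<^sub>R v \<in> {x. \<not> near_linear (\<lambda>h. f (x + h *\<^sub>R v))}} \<in> sets borel"
      by (simp add: vimage_def)
    have sub: "{t. x + t *\<^sub>R v \<in> {x. \<not> near_linear (\<lambda>h. f (x + h *\<^sub>R v))}} \<subseteq> N"
      using N(2) by (auto simp: algebra_simps)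
    show "{t. x + t *\<^sub>R v \<in> {x. \<not> near_linear (\<lambda>h. f (x + h *\<^sub>R v))}} \<in> null_sets lborel"
      using null_sets_subset[OF N(1) _ sub] b by simp
  qed
qed

text \<open>Bad points are of two kinds: those without some partial derivative, and porous points of
  one of countably many closed sets \<open>A m j q\<close> on which the partial quotients are
  uniformly close to \<open>q\<close>. At any other point \<open>x\<close>, an increment
  \<open>h\<close> is split into axis steps; near each corner of the path there is a point of
  \<open>A m j q\<close>, where the axis step is almost linear, and the Lipschitz bound carries this
  over to the corner.\<close>

theorem rademacher_real:
  fixes f :: "real^'n::finite \<Rightarrow> real"
  assumes lip: "L-lipschitz_on UNIV f"
  shows "negligible {x. \<not> f differentiable (at x)}"
proof -
  have cont: "continuous_on UNIV f" using lip by (rule lipschitz_on_continuous_on)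
  have L: "L \<ge> 0" using lipschitz_on_nonneg[OF lip] .
  have fL: "\<bar>f x - f y\<bar> \<le> L * norm (x - y)" for x y
    using lip by (auto simp: lipschitz_on_def dist_norm)
  define A where "A m j q = {x. \<forall>i h. \<bar>h\<bar> < 1 / real (Suc j) \<longrightarrow>
     \<bar>f (x + h *\<^sub>R axis i 1) - f x - of_rat (q i) * h\<bar> \<le> (1 / real (Suc m)) * \<bar>h\<bar>}" for m j :: nat and q :: "'n \<Rightarrow> rat"
  have A: "closed (A m j q)" for m j q
  proof -
    have "A m j q = (\<Inter>i. \<Inter>h\<in>{h. \<bar>h\<bar> < 1 / real (Suc j)}.
      {x. \<bar>f (x + h *\<^sub>R axis i 1) - f x - of_rat (q i) * h\<bar> \<le> (1 / real (Suc m)) * \<bar>h\<bar>})"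
      by (auto simp: A_def)
    also have "closed \<dots>"
      by (intro closed_INT ballI closed_Collect_le continuous_intros continuous_on_compose2[OF cont]) auto
    finally show ?thesis .
  qed
  define N1 where "N1 = (\<Union>i::'n. {x. \<not> near_linear (\<lambda>h. f (x + h *\<^sub>R axis i 1))})"
  define Por where "Por p B = {x \<in> B. \<forall>d>0. \<exists>r y. 0 < r \<and> r < d \<and> dist x y < r \<and> ball y ((1 / real (Suc p)) * r) \<inter> B = {}}" for p :: nat and B :: "(real^'n) set"
  define N2 where "N2 = (\<Union>(p,m,j,q). Por p (A m j q))"
  have "negligible N1"
    unfolding N1_def using lipschitz_AE_partials[OF lip]
    by (intro negligible_Union finite_imageI) (auto simp: negligible_iff_null_sets null_sets_completionI)
  moreover have "negligible N2"
  proof -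
    have "negligible (Por p (A m j q))" for p m j q
      unfolding Por_def by (rule negligible_porous_points[OF A]) auto
    then show ?thesis unfolding N2_def
      by (intro negligible_countable_Union) auto
  qed
  ultimately have "negligible (N1 \<union> N2)" by (rule negligible_Un)
  moreover have "f differentiable (at x)" if x: "x \<notin> N1 \<union> N2" for x
  proof (rule differentiable_if_almost_linear)
    fix e :: real assume e: "e > 0"
    let ?n = "real CARD('n)"
    have n: "?n > 0" by simp
    \<comment> \<open>Each of the \<open>?n\<close> axis steps will cost \<open>2 * e' * r\<close>
      with \<open>r = 2 * norm h\<close>, in total \<open>e * norm h\<close>.\<close>
    define e' where "e' = e / (4 * ?n)"
    have e': "e' > 0" using e n by (simp add: e'_def)
    obtain m where m: "1 / real (Suc m) < e'" using nat_approx_posE[OF e'] by auto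
    define L1 where "L1 = 2 * L + 1"
    have L1: "L1 > 0" "2 * L \<le> L1" using L by (auto simp: L1_def)
    have "e' / L1 > 0" using e' L1 by simp
    then obtain p where p: "1 / real (Suc p) < e' / L1" using nat_approx_posE by blast
    have "\<forall>i. \<exists>q\<in>\<rat>. \<exists>j. \<forall>h. \<bar>h\<bar> < 1 / real (Suc j) \<longrightarrow> \<bar>f (x + h *\<^sub>R axis i 1) - f x - q * h\<bar> \<le> (1 / real (Suc m)) * \<bar>h\<bar>"
      using x unfolding N1_def Rats_countable_near_linear_iff by auto
    then obtain q J where qJ: "\<And>i. q i \<in> \<rat>" "\<And>i h. \<bar>h\<bar> < 1 / real (Suc (J i)) \<Longrightarrow> \<bar>f (x + h *\<^sub>R axis i 1) - f x - q i * h\<bar> \<le> (1 / real (Suc m)) * \<bar>h\<bar>"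
      by metis
    have "\<forall>i. \<exists>r. q i = of_rat r" using qJ(1) by (auto simp: Rats_def)
    then obtain q' where q': "\<And>i. q i = of_rat (q' i)" by metis
    define j where "j = Max (range J)"
    have jJ: "J i \<le> j" for i by (simp add: j_def)
    have xA: "x \<in> A m j q'"
      unfolding A_def
    proof (intro CollectI allI impI)
      fix i h assume h: "\<bar>h\<bar> < 1 / real (Suc j)"
      have "1 / real (Suc j) \<le> 1 / real (Suc (J i))" using jJ[of i] by (intro divide_left_mono) auto
      then show "\<bar>f (x + h *\<^sub>R axis i 1) - f x - of_rat (q' i) * h\<bar> \<le> (1 / real (Suc m)) * \<bar>h\<bar>"
        using qJ(2)[of h i] h q' by auto
    qed
    have "x \<notin> Por p (A m j q')" using x unfolding N2_def by fast
    then obtain d where d: "d > 0" "\<And>r y. 0 < r \<Longrightarrow> r < d \<Longrightarrow> dist x y < r \<Longrightarrow> ball y ((1 / real (Suc p)) * r) \<inter> A m j q' \<noteq> {}"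
      using xA unfolding Por_def by blast
    define Q :: "real^'n" where "Q = (\<chi> i. of_rat (q' i))"
    define D where "D = min (d / 2) (1 / real (Suc j))"
    show "\<exists>q. \<exists>d>0. \<forall>h. norm h < d \<longrightarrow> \<bar>f (x + h) - f x - q \<bullet> h\<bar> \<le> e * norm h"
    proof (intro exI[of _ Q] exI[of _ D] conjI allI impI)
      show "D > 0" using d by (simp add: D_def)
      fix h :: "real^'n" assume h: "norm h < D"
      show "\<bar>f (x + h) - f x - Q \<bullet> h\<bar> \<le> e * norm h"
      proof (cases "h = 0")
        case False
        define r where "r = 2 * norm h"
        have r: "0 < r" "r < d" "norm h < r" using False h by (auto simp: r_def D_def)
        \<comment> \<open>Corner of the axis-parallel path from \<open>x\<close> to
          \<open>x + h\<close> after the steps in \<open>S\<close>.\<close>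
        define pt where "pt S = x + (\<Sum>i\<in>S. h $ i *\<^sub>R axis i 1)" for S
        have ptn: "norm (pt S - x) \<le> norm h" for S
        proof -
          have "pt S - x = (\<chi> i. if i \<in> S then h $ i else 0)"
            by (auto simp: pt_def vec_eq_iff axis_def if_distrib[of "\<lambda>t. _ * t"] sum.delta cong: if_cong)
          then show ?thesis by (auto simp: norm_vec_def intro!: L2_set_mono)
        qed
        have "\<bar>f (pt S) - f x - (\<Sum>i\<in>S. of_rat (q' i) * h $ i)\<bar> \<le> real (card S) * (2 * e' * r)" if "finite S" for S
          using that
        proof induction
          case (insert i S)
          have "dist x (pt S) < r" using ptn[of S] r by (simp add: dist_norm norm_minus_commute)
          \<comment> \<open>Since \<open>x\<close> is not porous, the hole around the corner of size
            \<open>r / (p + 1)\<close> must contain a point of the set.\<close>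
          from d(2)[OF r(1,2) this] obtain z where z: "z \<in> A m j q'" "dist (pt S) z < 1 / real (Suc p) * r" by auto
          have hi: "\<bar>h $ i\<bar> \<le> norm h" by (rule component_le_norm_cart)
          then have "\<bar>h $ i\<bar> < 1 / real (Suc j)" using h by (simp add: D_def)
          then have 1: "\<bar>f (z + h $ i *\<^sub>R axis i 1) - f z - of_rat (q' i) * h $ i\<bar> \<le> 1 / real (Suc m) * \<bar>h $ i\<bar>"
            using z(1) unfolding A_def by auto
          also have "\<dots> \<le> e' * r" using m hi r e' by (intro mult_mono) auto
          finally have 1: "\<bar>f (z + h $ i *\<^sub>R axis i 1) - f z - of_rat (q' i) * h $ i\<bar> \<le> e' * r" .
          have dz: "norm (pt S - z) \<le> e' / L1 * r"
            using z(2) p r mult_strict_right_mono[OF p r(1)] by (simp add: dist_norm)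
          have 2: "L * norm (pt S - z) \<le> e' * r / 2"
          proof -
            have "L * norm (pt S - z) \<le> (L1/2) * (e' / L1 * r)" using L1 L dz e' r by (intro mult_mono) auto
            then show ?thesis using L1 by simp
          qed
          have 3: "\<bar>f (pt S) - f z\<bar> \<le> e' * r / 2" using fL[of "pt S" z] 2 by linarith
          have pti: "pt (insert i S) = pt S + h $ i *\<^sub>R axis i 1" using insert by (simp add: pt_def algebra_simps)
          have 4: "\<bar>f (pt (insert i S)) - f (z + h $ i *\<^sub>R axis i 1)\<bar> \<le> e' * r / 2"
            using fL[of "pt (insert i S)" "z + h $ i *\<^sub>R axis i 1"] 2 by (simp add: pti)
          have "\<bar>f (pt (insert i S)) - f (pt S) - of_rat (q' i) * h $ i\<bar> \<le> 2 * e' * r"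
            using 1 3 4 by linarith
          then show ?case using insert by (simp add: algebra_simps)
        qed (simp add: pt_def)
        from this[of UNIV] have "\<bar>f (pt UNIV) - f x - Q \<bullet> h\<bar> \<le> ?n * (2 * e' * r)"
          by (simp add: Q_def inner_vec_def)
        also have "\<dots> = e * norm h" using n by (simp add: e'_def r_def)
        also have "pt UNIV = x + h"
          by (auto simp: pt_def vec_eq_iff axis_def if_distrib[of "\<lambda>t. _ * t"] sum.delta cong: if_cong)
        finally show ?thesis .
      qed simp
    qed
  qed
  ultimately show ?thesis by (elim negligible_subset) auto
qed

theorem rademacher:
  fixes f :: "real^'n::finite \<Rightarrow> real^'m::finite"
  assumes lip: "L-lipschitz_on UNIV f"
  shows "negligible {x. \<not> f differentiable (at x)}"
proof -
  have comp: "L-lipschitz_on UNIV (\<lambda>x. f x $ i)" for i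
  proof (rule lipschitz_onI)
    fix x y
    have "dist (f x $ i) (f y $ i) \<le> dist (f x) (f y)" by (rule dist_vec_nth_le)
    also have "\<dots> \<le> L * dist x y" using lip by (rule lipschitz_onD) auto
    finally show "dist (f x $ i) (f y $ i) \<le> L * dist x y" .
  qed (rule lipschitz_on_nonneg[OF lip])
  have "{x. \<not> f differentiable (at x)} \<subseteq> (\<Union>i. {x. \<not> (\<lambda>x. f x $ i) differentiable (at x)})"
  proof (intro subsetI, rule ccontr)
    fix x assume "x \<in> {x. \<not> f differentiable at x}" and "x \<notin> (\<Union>i. {x. \<not> (\<lambda>x. f x $ i) differentiable (at x)})"
    then have nd: "\<not> f differentiable at x" and "\<forall>i. (\<lambda>x. f x $ i) differentiable at x" by auto
    then have "\<forall>i. \<exists>D. ((\<lambda>x. f x $ i) has_derivative D) (at x)" by (simp add: differentiable_def)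
    then obtain D where D: "\<And>i. ((\<lambda>x. f x $ i) has_derivative D i) (at x)" unfolding choice_iff by blast
    have "(f has_derivative (\<lambda>h. \<chi> i. D i h)) (at x)"
      by (subst has_derivative_componentwise_within) (auto simp: Basis_vec_def inner_axis intro!: D)
    with nd show False by (auto simp: differentiable_def)
  qed
  moreover have "negligible (\<Union>i. {x. \<not> (\<lambda>x. f x $ i) differentiable (at x)})"
    using rademacher_real[OF comp] by (intro negligible_Union) auto
  ultimately show ?thesis by (rule negligible_subset[rotated])
qed

section \<open>Trajectories and controllability\<close>

lemma lattice_vec_add: "lattice_vec (\<lambda>i. z i + w i) = lattice_vec z + lattice_vec w"
  by (simp add: lattice_vec_def vec_eq_iff)

lemma lattice_vec_minus: "lattice_vec (\<lambda>i. - z i) = - lattice_vec z"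
  by (simp add: lattice_vec_def vec_eq_iff)

lemma lattice_vec_diff: "lattice_vec (\<lambda>i. z i - w i) = lattice_vec z - lattice_vec w"
  by (simp add: lattice_vec_def vec_eq_iff)

lemma lattice_vec_0 [simp]: "lattice_vec (\<lambda>i. 0) = 0"
  by (simp add: lattice_vec_def vec_eq_iff)

lemma zn_periodicD: "zn_periodic f \<Longrightarrow> f (x + lattice_vec z) = f x"
  by (simp add: zn_periodic_def)

lemma ex_lattice_translate_in_unit_cell: "\<exists>z. x + lattice_vec z \<in> unit_cell"
proof (intro exI[of _ "\<lambda>i. - \<lfloor>x $ i\<rfloor>"])
  show "x + lattice_vec (\<lambda>i. - \<lfloor>x $ i\<rfloor>) \<in> unit_cell"
    unfolding unit_cell_def lattice_vec_def by (auto intro: floor_less_iff) linarith+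
qed

lemma unit_cell_subset_cbox: "unit_cell \<subseteq> cbox 0 (1 :: real ^ 'n::finite)"
  by (auto simp: unit_cell_def mem_box_cart less_imp_le)

section \<open>Polygonal trajectories\<close>

text \<open>Constant velocity with a strict bound on the whole closed segment: by compactness
  admissibility survives small changes of the data, and trajectories can be glued without solving a
  differential equation.\<close>

definition adm :: "(real^'n::finite \<Rightarrow> real^'n) \<Rightarrow> real \<Rightarrow> real^'n \<Rightarrow> real^'n \<Rightarrow> real \<Rightarrow> bool" where
  "adm V r x q t \<longleftrightarrow> t > 0 \<and> (\<forall>s\<in>{0..t}. norm (q - V (x + s *\<^sub>R q)) < r)"

text \<open>Polygonal trajectories of the differential inclusion \<open>x' \<in> V x + ball 0 r\<close>.\<close>
inductive reach :: "(real^'n::finite \<Rightarrow> real^'n) \<Rightarrow> real \<Rightarrow> real^'n \<Rightarrow> real^'n \<Rightarrow> real \<Rightarrow> bool" for V r x where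
  reach_one: "adm V r x q t \<Longrightarrow> reach V r x (x + t *\<^sub>R q) t"
| reach_step: "reach V r x y T \<Longrightarrow> adm V r y q t \<Longrightarrow> reach V r x (y + t *\<^sub>R q) (T + t)"

lemma reach_pos: "reach V r x y T \<Longrightarrow> T > 0"
  by (induction rule: reach.induct) (auto simp: adm_def)

lemma reach_trans: "reach V r y z S \<Longrightarrow> reach V r x y T \<Longrightarrow> reach V r x z (T + S)"
proof (induction rule: reach.induct)
  case (reach_step z S q t)
  then show ?case using reach.reach_step[of V r x z "T + S" q t] by (simp add: add.assoc)
qed (rule reach.reach_step)

lemma adm_mono: "adm V r x q t \<Longrightarrow> r \<le> r' \<Longrightarrow> adm V r' x q t"
  by (fastforce simp: adm_def)

lemma reach_mono: "reach V r x y T \<Longrightarrow> r \<le> r' \<Longrightarrow> reach V r' x y T"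
  by (induction rule: reach.induct) (auto intro: reach.intros adm_mono)

lemma adm_sub:
  assumes "adm V r x q t" "0 \<le> a" "a < b" "b \<le> t"
  shows "adm V r (x + a *\<^sub>R q) q (b - a)"
proof -
  have *: "x + a *\<^sub>R q + s *\<^sub>R q = x + (a + s) *\<^sub>R q" for s by (simp add: scaleR_left_distrib)
  show ?thesis using assms unfolding adm_def * by auto
qed

lemma reach_split:
  assumes "reach V r x y T" "0 < s" "s < T"
  shows "\<exists>m. reach V r x m s \<and> reach V r m y (T - s)"
  using assms
proof (induction arbitrary: s rule: reach.induct)
  case (reach_one q t)
  have "reach V r x (x + s *\<^sub>R q) s"
    using adm_sub[OF reach_one(1), of 0 s] reach_one by (intro reach.reach_one) auto
  moreover have "reach V r (x + s *\<^sub>R q) (x + s *\<^sub>R q + (t - s) *\<^sub>R q) (t - s)"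
    using adm_sub[OF reach_one(1), of s t] reach_one by (intro reach.reach_one) auto
  ultimately show ?case by (intro exI[of _ "x + s *\<^sub>R q"]) (simp add: algebra_simps)
next
  case (reach_step y T q t)
  consider "s < T" | "s = T" | "s > T" by linarith
  then show ?case
  proof cases
    case 1
    then obtain m where m: "reach V r x m s" "reach V r m y (T - s)" using reach_step by blast
    then show ?thesis using reach.reach_step[OF m(2) reach_step(2)] by (intro exI[of _ m]) (simp add: algebra_simps)
  next
    case 2
    then show ?thesis using reach_step reach.reach_one by (intro exI[of _ y]) auto
  next
    case 3
    have a: "adm V r y q (s - T)" using adm_sub[OF reach_step(2), of 0 "s - T"] reach_step 3 by auto
    have "reach V r x (y + (s - T) *\<^sub>R q) s"
      using reach.reach_step[OF reach_step(1) a] by simp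
    moreover have "reach V r (y + (s - T) *\<^sub>R q) (y + (s - T) *\<^sub>R q + (t - (s - T)) *\<^sub>R q) (t - (s - T))"
      using adm_sub[OF reach_step(2), of "s - T" t] reach_step 3 by (intro reach.reach_one) auto
    ultimately show ?thesis by (intro exI[of _ "y + (s - T) *\<^sub>R q"]) (simp add: algebra_simps)
  qed
qed

text \<open>Time reversal exchanges the end points and turns \<open>V\<close> into
  \<open>- V\<close>, so facts about end points become facts about starting points.\<close>

lemma adm_reverse: "adm V r x q t \<Longrightarrow> adm (\<lambda>x. - V x) r (x + t *\<^sub>R q) (- q) t"
  unfolding adm_def
proof (intro conjI ballI, simp)
  fix s assume a: "0 < t \<and> (\<forall>s\<in>{0..t}. norm (q - V (x + s *\<^sub>R q)) < r)" and s: "s \<in> {0..t}"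
  have "norm (q - V (x + (t - s) *\<^sub>R q)) < r" using a s by auto
  moreover have "x + t *\<^sub>R q + s *\<^sub>R - q = x + (t - s) *\<^sub>R q" by (simp add: algebra_simps)
  ultimately show "norm (- q - - V (x + t *\<^sub>R q + s *\<^sub>R - q)) < r"
    by (simp only:) (metis minus_diff_minus norm_minus_cancel)
qed

lemma reach_reverse: "reach V r x y T \<Longrightarrow> reach (\<lambda>x. - V x) r y x T"
proof (induction rule: reach.induct)
  case (reach_one q t)
  then show ?case using reach.reach_one[OF adm_reverse[OF reach_one]] by simp
next
  case (reach_step y T q t)
  have "reach (\<lambda>x. - V x) r (y + t *\<^sub>R q) y t"
    using reach.reach_one[OF adm_reverse[OF reach_step(2)]] by simp
  from reach_trans[OF reach_step.IH this] show ?case by (simp add: add.commute)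
qed

section \<open>Periodic Lipschitz vector fields and uniform controllability\<close>

locale flow =
  fixes V :: "real^'n::finite \<Rightarrow> real^'n" and L :: real
  assumes per: "zn_periodic V" and lip: "L-lipschitz_on UNIV V"
begin

lemma L_nonneg: "L \<ge> 0" using lipschitz_on_nonneg[OF lip] .

lemma V_lip: "norm (V x - V y) \<le> L * norm (x - y)"
  using lipschitz_onD[OF lip, of x y] by (simp add: dist_norm)

lemma V_cont: "continuous_on S V"
  using lipschitz_on_continuous_on[OF lip] continuous_on_subset by blast

lemma V_bounded: "\<exists>B\<ge>0. \<forall>x. norm (V x) \<le> B"
proof -
  have "compact (V ` cbox 0 1)" by (intro compact_continuous_image V_cont compact_cbox)
  then have "bounded (V ` cbox 0 1)" by (rule compact_imp_bounded)
  then obtain B where B: "\<forall>x\<in>cbox 0 1. norm (V x) \<le> B" by (auto simp: bounded_iff)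
  have "norm (V x) \<le> B" for x
  proof -
    obtain z where "x + lattice_vec z \<in> unit_cell" using ex_lattice_translate_in_unit_cell by blast
    then show ?thesis using B[rule_format, of "x + lattice_vec z"] unit_cell_subset_cbox zn_periodicD[OF per, of x z] by auto
  qed
  moreover from this[of 0] have "B \<ge> 0" using norm_ge_zero order_trans by blast
  ultimately show ?thesis by blast
qed

definition B where "B = (SOME B. B \<ge> 0 \<and> (\<forall>x. norm (V x) \<le> B))"

lemma B_nonneg: "B \<ge> 0" and V_le_B: "norm (V x) \<le> B"
  using someI_ex[OF V_bounded] by (auto simp: B_def)

lemma adm_lattice: "adm V r x q t \<Longrightarrow> adm V r (x + lattice_vec z) q t"
  using zn_periodicD[OF per, of "x + s *\<^sub>R q" z for s] by (auto simp: adm_def algebra_simps)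

lemma reach_lattice: "reach V r x y T \<Longrightarrow> reach V r (x + lattice_vec z) (y + lattice_vec z) T"
proof (induction rule: reach.induct)
  case (reach_one q t)
  from reach.reach_one[OF adm_lattice[OF this, of z]] show ?case by (simp add: algebra_simps)
next
  case (reach_step y T q t)
  from reach.reach_step[OF reach_step.IH adm_lattice[OF reach_step(2), of z]] show ?case by (simp add: algebra_simps)
qed

lemma adm_speed: "adm V r x q t \<Longrightarrow> norm q \<le> B + r"
proof -
  assume "adm V r x q t"
  then have "norm (q - V x) < r" by (auto simp: adm_def dest!: bspec[of _ _ 0])
  then show ?thesis using norm_triangle_ineq[of "q - V x" "V x"] V_le_B[of x] by simp
qed

lemma reach_speed: "reach V r x y T \<Longrightarrow> norm (y - x) \<le> (B + r) * T"
proof (induction rule: reach.induct)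
  case (reach_one q t)
  then show ?case using adm_speed[OF reach_one] mult_right_mono[of "norm q" "B + r" t] by (auto simp: adm_def mult.commute)
next
  case (reach_step y T q t)
  have "norm (t *\<^sub>R q) \<le> (B + r) * t"
    using adm_speed[OF reach_step(2)] reach_step(2) mult_right_mono[of "norm q" "B + r" t] by (auto simp: adm_def mult.commute)
  then show ?case using reach_step.IH norm_triangle_ineq[of "y - x" "t *\<^sub>R q"] by (simp add: algebra_simps)
qed

text \<open>Moving the end point by \<open>d\<close> changes the velocity by \<open>d / t\<close>
  and every intermediate position by at most \<open>d\<close>, hence \<open>V\<close> by at most
  \<open>L * d\<close>. The margin \<open>r - M\<close>, positive by compactness, absorbs
  \<open>(1/t + L) * d\<close>.\<close>

lemma adm_open:
  assumes "adm V r x q t"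
  shows "\<exists>e>0. \<forall>y\<in>ball (x + t *\<^sub>R q) e. adm V r x ((1/t) *\<^sub>R (y - x)) t"
proof -
  have t: "t > 0" using assms by (simp add: adm_def)
  have "continuous_on {0..t} (\<lambda>s. norm (q - V (x + s *\<^sub>R q)))"
    by (intro continuous_intros continuous_on_compose2[OF V_cont[of UNIV]]) auto
  then obtain s0 where s0: "s0 \<in> {0..t}" "\<And>s. s \<in> {0..t} \<Longrightarrow> norm (q - V (x + s *\<^sub>R q)) \<le> norm (q - V (x + s0 *\<^sub>R q))"
    using continuous_attains_sup[of "{0..t}" "\<lambda>s. norm (q - V (x + s *\<^sub>R q))"] t by (auto simp: image_iff)
  define M where "M = norm (q - V (x + s0 *\<^sub>R q))"
  have M: "M < r" using assms s0(1) by (auto simp: M_def adm_def)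
  define e where "e = (r - M) / (1/t + L)"
  have den: "1/t + L > 0" using t L_nonneg by (simp add: add_pos_nonneg)
  have e: "e > 0" using M den by (simp add: e_def)
  have "adm V r x ((1/t) *\<^sub>R (y - x)) t" if y: "y \<in> ball (x + t *\<^sub>R q) e" for y
    unfolding adm_def
  proof (intro conjI ballI t)
    fix s assume s: "s \<in> {0..t}"
    define q' where "q' = (1/t) *\<^sub>R (y - x)"
    have qq: "q' - q = (1/t) *\<^sub>R (y - (x + t *\<^sub>R q))" using t by (simp add: q'_def algebra_simps)
    have dy: "norm (y - (x + t *\<^sub>R q)) < e" using y by (simp add: dist_norm norm_minus_commute)
    have n1: "norm (q' - q) = (1/t) * norm (y - (x + t *\<^sub>R q))" using t by (simp add: qq)
    have "norm (V (x + s *\<^sub>R q') - V (x + s *\<^sub>R q)) \<le> L * (s * norm (q' - q))"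
      using V_lip[of "x + s *\<^sub>R q'" "x + s *\<^sub>R q"] s by (simp add: scaleR_diff_right[symmetric])
    also have "\<dots> \<le> L * (t * norm (q' - q))"
      using s L_nonneg by (intro mult_left_mono mult_right_mono) auto
    also have "\<dots> = L * norm (y - (x + t *\<^sub>R q))" using t by (simp add: n1)
    finally have n2: "norm (V (x + s *\<^sub>R q') - V (x + s *\<^sub>R q)) \<le> L * norm (y - (x + t *\<^sub>R q))" .
    have eq: "q' - V (x + s *\<^sub>R q') = (q - V (x + s *\<^sub>R q)) + (q' - q) - (V (x + s *\<^sub>R q') - V (x + s *\<^sub>R q))" by simp
    have "norm (q' - V (x + s *\<^sub>R q')) \<le> norm (q - V (x + s *\<^sub>R q)) + norm (q' - q) + norm (V (x + s *\<^sub>R q') - V (x + s *\<^sub>R q))"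
      unfolding eq using norm_triangle_ineq4[of "(q - V (x + s *\<^sub>R q)) + (q' - q)" "V (x + s *\<^sub>R q') - V (x + s *\<^sub>R q)"]
        norm_triangle_ineq[of "q - V (x + s *\<^sub>R q)" "q' - q"] by linarith
    also have "\<dots> \<le> M + (1/t + L) * norm (y - (x + t *\<^sub>R q))"
      using n1 n2 s0(2)[OF s] by (simp add: M_def algebra_simps)
    also have "\<dots> < M + (1/t + L) * e" using dy den by (intro add_strict_left_mono mult_strict_left_mono)
    also have "\<dots> = r" using den by (simp add: e_def)
    finally show "norm ((1/t) *\<^sub>R (y - x) - V (x + s *\<^sub>R (1/t) *\<^sub>R (y - x))) < r" by (simp add: q'_def)
  qed
  then show ?thesis using e by blast
qed

lemma reach_end_open: "reach V r x y T \<Longrightarrow> \<exists>e>0. \<forall>y'\<in>ball y e. reach V r x y' T"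
proof (induction rule: reach.cases)
  case (reach_one q t)
  then obtain e where e: "e > 0" "\<And>y'. y' \<in> ball (x + t *\<^sub>R q) e \<Longrightarrow> adm V r x ((1/t) *\<^sub>R (y' - x)) t"
    using adm_open by blast
  have "reach V r x y' t" if "y' \<in> ball (x + t *\<^sub>R q) e" for y'
    using reach.reach_one[OF e(2)[OF that]] reach_one by (simp add: adm_def)
  then show ?case using e(1) reach_one by blast
next
  case (reach_step y0 T0 q t)
  then obtain e where e: "e > 0" "\<And>y'. y' \<in> ball (y0 + t *\<^sub>R q) e \<Longrightarrow> adm V r y0 ((1/t) *\<^sub>R (y' - y0)) t"
    using adm_open by blast
  have "reach V r x y' (T0 + t)" if "y' \<in> ball (y0 + t *\<^sub>R q) e" for y'
    using reach.reach_step[OF _ e(2)[OF that]] reach_step by (simp add: adm_def)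
  then show ?case using e(1) reach_step by blast
qed

lemma flow_neg: "flow (\<lambda>x. - V x) L"
proof
  show "zn_periodic (\<lambda>x. - V x)" using per by (simp add: zn_periodic_def)
  show "L-lipschitz_on UNIV (\<lambda>x. - V x)" using lip by (rule lipschitz_on_minus)
qed

lemma reach_start_open:
  assumes "reach V r x y T" shows "\<exists>e>0. \<forall>x'\<in>ball x e. reach V r x' y T"
proof -
  interpret N: flow "\<lambda>x. - V x" L by (rule flow_neg)
  from N.reach_end_open[OF reach_reverse[OF assms]]
  obtain e where e: "e > 0" "\<And>x'. x' \<in> ball x e \<Longrightarrow> reach (\<lambda>x. - V x) r y x' T" by blast
  have "reach V r x' y T" if "x' \<in> ball x e" for x' using reach_reverse[OF e(2)[OF that]] by simp
  then show ?thesis using e(1) by blast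
qed

text \<open>The segment starts at \<open>x - s *\<^sub>R q\<close> and passes through
  \<open>x\<close> at time \<open>s\<close>: one statement serves for leaving \<open>x\<close>
  (\<open>s = 0\<close>) and for arriving there (\<open>s = t\<close>).\<close>

lemma adm_small:
  assumes q: "norm (q - V x) < r"
  obtains t0 where "t0 > 0" "\<And>t s. 0 < t \<Longrightarrow> t \<le> t0 \<Longrightarrow> 0 \<le> s \<Longrightarrow> s \<le> t \<Longrightarrow> adm V r (x - s *\<^sub>R q) q t"
proof -
  define d where "d = r - norm (q - V x)"
  define t0 where "t0 = d / (2 * (L * norm q + 1))"
  have den: "L * norm q + 1 > 0" using L_nonneg by (simp add: add_nonneg_pos)
  have t0: "t0 > 0" using q den by (simp add: t0_def d_def)
  show thesis
  proof (rule that[OF t0])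
    fix t s assume t: "0 < t" "t \<le> t0" "0 \<le> s" "s \<le> t"
    show "adm V r (x - s *\<^sub>R q) q t" unfolding adm_def
    proof (intro conjI ballI t)
      fix a assume a: "a \<in> {0..t}"
      have "norm (V (x - s *\<^sub>R q + a *\<^sub>R q) - V x) \<le> L * norm ((a - s) *\<^sub>R q)"
        using V_lip[of "x - s *\<^sub>R q + a *\<^sub>R q" x] by (simp add: algebra_simps)
      also have "\<dots> = \<bar>a - s\<bar> * (L * norm q)" by simp
      also have "\<dots> \<le> t0 * (L * norm q + 1)" using t a L_nonneg by (intro mult_mono) auto
      also have "\<dots> = d / 2" unfolding t0_def times_divide_eq_left using den by (intro nonzero_divide_eq_eq[THEN iffD2]) auto
      also have "\<dots> < d" using q by (simp add: d_def)
      finally have "norm (V (x - s *\<^sub>R q + a *\<^sub>R q) - V x) < d" .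
      moreover have "q - V (x - s *\<^sub>R q + a *\<^sub>R q) = (q - V x) - (V (x - s *\<^sub>R q + a *\<^sub>R q) - V x)" by simp
      ultimately show "norm (q - V (x - s *\<^sub>R q + a *\<^sub>R q)) < r"
        unfolding d_def by (metis (no_types) norm_triangle_ineq4 order_le_less_trans less_diff_eq add.commute)
    qed
  qed
qed

definition controllable :: bool where
  "controllable \<longleftrightarrow> (\<forall>x y. \<exists>T z. reach V 1 x (y + lattice_vec z) T)"

lemma increasing_open_cover_unit_cell:
  fixes A :: "nat \<Rightarrow> (real^'n) set"
  assumes A: "\<And>n. open (A n)" "\<And>n. A n \<subseteq> A (Suc n)" "(\<Union>n. A n) = UNIV"
  shows "\<exists>n. unit_cell \<subseteq> A n"
proof -
  have m: "A i \<subseteq> A j" if "i \<le> j" for i j using lift_Suc_mono_le[of A, OF A(2) that] .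
  have "cbox 0 1 \<subseteq> \<Union>(range A)" using A(3) by simp
  then obtain C where C: "finite C" "cbox (0::real^'n) 1 \<subseteq> (\<Union>n\<in>C. A n)"
    using compact_cbox[of "0::real^'n" 1] A(1) by (metis compactE_image[of "cbox 0 1" UNIV A] UNIV_I subset_UNIV)
  have "(\<Union>n\<in>C. A n) \<subseteq> A (Max (insert 0 C))"
    using m C(1) by (intro UN_least m) auto
  then show ?thesis using C(2) unit_cell_subset_cbox by blast
qed

text \<open>All routes pass through the origin modulo the lattice. The points that reach it, or are
  reached from it, within time \<open>n\<close> form increasing open sets that exhaust space, so
  compactness of the unit cube bounds both times; a lattice translation glues the two
  halves.\<close>

lemma uniformly_controllable:
  assumes controllable
  obtains T0 where "T0 > 0" "\<And>x y. \<exists>T z. T \<le> T0 \<and> reach V 1 x (y + lattice_vec z) T"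
proof -
  define A where "A n = {x. \<exists>T z. T \<le> real n \<and> reach V 1 x (lattice_vec z) T}" for n
  define A' where "A' n = {y. \<exists>T z. T \<le> real n \<and> reach V 1 (lattice_vec z) y T}" for n
  have "\<exists>n. unit_cell \<subseteq> A n"
  proof (rule increasing_open_cover_unit_cell)
    show "open (A n)" for n unfolding open_contains_ball
    proof
      fix x assume "x \<in> A n"
      then obtain T z where T: "T \<le> real n" "reach V 1 x (lattice_vec z) T" by (auto simp: A_def)
      from reach_start_open[OF T(2)] obtain e where "e > 0" "\<And>x'. x' \<in> ball x e \<Longrightarrow> reach V 1 x' (lattice_vec z) T" by blast
      then show "\<exists>e>0. ball x e \<subseteq> A n" using T(1) unfolding A_def by blast
    qed
    show "A n \<subseteq> A (Suc n)" for n
    proof -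
      have "real n \<le> real (Suc n)" by simp
      then show ?thesis unfolding A_def by (blast intro: order_trans)
    qed
    have "x \<in> (\<Union>n. A n)" for x
    proof -
      obtain T z where "reach V 1 x (0 + lattice_vec z) T" using assms unfolding controllable_def by blast
      moreover obtain n where "T \<le> real n" using real_arch_simple by blast
      ultimately show ?thesis by (auto simp: A_def)
    qed
    then show "(\<Union>n. A n) = UNIV" by blast
  qed
  then obtain n1 where n1: "unit_cell \<subseteq> A n1" by blast
  have "\<exists>n. unit_cell \<subseteq> A' n"
  proof (rule increasing_open_cover_unit_cell)
    show "open (A' n)" for n unfolding open_contains_ball
    proof
      fix x assume "x \<in> A' n"
      then obtain T z where T: "T \<le> real n" "reach V 1 (lattice_vec z) x T" by (auto simp: A'_def)
      from reach_end_open[OF T(2)] obtain e where "e > 0" "\<And>x'. x' \<in> ball x e \<Longrightarrow> reach V 1 (lattice_vec z) x' T" by blast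
      then show "\<exists>e>0. ball x e \<subseteq> A' n" using T(1) unfolding A'_def by blast
    qed
    show "A' n \<subseteq> A' (Suc n)" for n
    proof -
      have "real n \<le> real (Suc n)" by simp
      then show ?thesis unfolding A'_def by (blast intro: order_trans)
    qed
    have "y \<in> (\<Union>n. A' n)" for y
    proof -
      obtain T z where "reach V 1 0 (y + lattice_vec z) T" using assms unfolding controllable_def by blast
      from reach_lattice[OF this, of "\<lambda>i. - z i"] have "reach V 1 (lattice_vec (\<lambda>i. - z i)) y T"
        by (simp add: lattice_vec_minus)
      moreover obtain n where "T \<le> real n" using real_arch_simple by blast
      ultimately show ?thesis by (auto simp: A'_def)
    qed
    then show "(\<Union>n. A' n) = UNIV" by blast
  qed
  then obtain n2 where n2: "unit_cell \<subseteq> A' n2" by blast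
  show thesis
  proof (rule that[of "real n1 + real n2 + 1"])
    fix x y :: "real^'n"
    obtain z1 where z1: "x + lattice_vec z1 \<in> unit_cell" using ex_lattice_translate_in_unit_cell by blast
    obtain z2 where z2: "y + lattice_vec z2 \<in> unit_cell" using ex_lattice_translate_in_unit_cell by blast
    obtain T1 w1 where 1: "T1 \<le> real n1" "reach V 1 (x + lattice_vec z1) (lattice_vec w1) T1"
      using z1 n1 by (auto simp: A_def)
    obtain T2 w2 where 2: "T2 \<le> real n2" "reach V 1 (lattice_vec w2) (y + lattice_vec z2) T2"
      using z2 n2 by (auto simp: A'_def)
    have "reach V 1 x (lattice_vec (\<lambda>i. w1 i - z1 i)) T1"
      using reach_lattice[OF 1(2), of "\<lambda>i. - z1 i"]
      by (simp add: lattice_vec_minus lattice_vec_diff)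
    moreover have "reach V 1 (lattice_vec (\<lambda>i. w1 i - z1 i)) (y + lattice_vec (\<lambda>i. z2 i + (w1 i - z1 i - w2 i))) T2"
      using reach_lattice[OF 2(2), of "\<lambda>i. w1 i - z1 i - w2 i"]
      by (simp add: lattice_vec_add[symmetric] add.assoc)
    ultimately have "reach V 1 x (y + lattice_vec (\<lambda>i. z2 i + (w1 i - z1 i - w2 i))) (T1 + T2)"
      using reach_trans by blast
    moreover have "T1 + T2 \<le> real n1 + real n2 + 1" using 1 2 by simp
    ultimately show "\<exists>T z. T \<le> real n1 + real n2 + 1 \<and> reach V 1 x (y + lattice_vec z) T" by blast
  qed simp
qed

end

section \<open>Viscosity solutions\<close>

lemma C1_test_line:
  assumes "C1_test \<phi> D"
  shows "((\<lambda>t. \<phi> (x + t *\<^sub>R q)) has_real_derivative D (x + t *\<^sub>R q) \<bullet> q) (at t)"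
proof -
  have "(\<phi> has_derivative (\<lambda>h. D (x + t *\<^sub>R q) \<bullet> h)) (at (x + t *\<^sub>R q))"
    using assms by (simp add: C1_test_def)
  moreover have "((\<lambda>t. x + t *\<^sub>R q) has_derivative (\<lambda>h. h *\<^sub>R q)) (at t)"
    by (auto intro!: derivative_eq_intros)
  ultimately have "((\<lambda>t. \<phi> (x + t *\<^sub>R q)) has_derivative (\<lambda>h. D (x + t *\<^sub>R q) \<bullet> (h *\<^sub>R q))) (at t)"
    by (rule has_derivative_compose[rotated])
  then show ?thesis by (simp add: has_field_derivative_def mult.commute[of _ "_ \<bullet> _"] mult_commute_abs)
qed

lemma local_increment_bound:
  assumes C1: "C1_test \<phi> D" and t0: "t0 > 0" and le: "\<And>t. 0 < t \<Longrightarrow> t < t0 \<Longrightarrow> \<phi> x - \<phi> (x - t *\<^sub>R q) \<le> c * t"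
  shows "D x \<bullet> q \<le> c"
proof (rule ccontr)
  assume neg: "\<not> ?thesis"
  define g where "g t = \<phi> x - \<phi> (x + t *\<^sub>R (- q)) - c * t" for t
  have "(g has_real_derivative (0 - D (x + 0 *\<^sub>R (- q)) \<bullet> (- q) - c * 1)) (at 0)"
    unfolding g_def by (intro DERIV_diff DERIV_const C1_test_line[OF C1] DERIV_cmult DERIV_ident)
  moreover have "0 < 0 - D (x + 0 *\<^sub>R (- q)) \<bullet> (- q) - c * 1" using neg by simp
  ultimately obtain d where d: "d > 0" "\<And>h. 0 < h \<Longrightarrow> h < d \<Longrightarrow> g 0 < g (0 + h)"
    using DERIV_pos_inc_right by blast
  define t where "t = min t0 d / 2"
  have t: "0 < t" "t < t0" "t < d" using t0 d by (auto simp: t_def)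
  have "g 0 < g t" using d(2)[of t] t by simp
  then show False using le[of t] t by (simp add: g_def)
qed

text \<open>Integrated form of the subsolution property: \<open>u x + P \<bullet> x\<close> grows at
  most at rate \<open>a\<close> along admissible segments. It makes sense without regularity of
  \<open>u\<close> and passes to infima and averages.\<close>

definition ctrl_sub :: "(real^'n::finite \<Rightarrow> real^'n) \<Rightarrow> real \<Rightarrow> real^'n \<Rightarrow> real \<Rightarrow> (real^'n \<Rightarrow> real) \<Rightarrow> bool" where
  "ctrl_sub V r P a u \<longleftrightarrow> (\<forall>x q t. adm V r x q t \<longrightarrow> u (x + t *\<^sub>R q) + t * (P \<bullet> q) \<le> u x + a * t)"

context flow begin

text \<open>If the test function touches \<open>u\<close> from above at \<open>x0\<close>, a short
  segment arriving at \<open>x0\<close> with velocity \<open>q\<close> gives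
  \<open>(D x0 + P) \<bullet> q \<le> a\<close>; the supremum over
  \<open>norm (q - V x0) < 1\<close> is the Hamiltonian.\<close>

lemma ctrl_sub_imp_visc_subsol:
  assumes u: "ctrl_sub V 1 P a u"
  shows "visc_subsol (ham V) P a u"
  unfolding visc_subsol_def
proof (intro allI impI, elim conjE exE)
  fix \<phi> D x0 r
  assume C1: "C1_test \<phi> D" and r: "r > 0" and touch: "\<forall>y\<in>ball x0 r. u y - \<phi> y \<le> u x0 - \<phi> x0"
  let ?p = "D x0 + P"
  have key: "?p \<bullet> q \<le> a" if q: "norm (q - V x0) < 1" for q
  proof -
    obtain t0 where t0: "t0 > 0" "\<And>t s. 0 < t \<Longrightarrow> t \<le> t0 \<Longrightarrow> 0 \<le> s \<Longrightarrow> s \<le> t \<Longrightarrow> adm V 1 (x0 - s *\<^sub>R q) q t"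
      using adm_small[OF q] by blast
    define t1 where "t1 = min t0 (r / (norm q + 1))"
    have n: "norm q + 1 > 0" by (simp add: add_nonneg_pos)
    have t1: "t1 > 0" using t0 r n by (simp add: t1_def)
    have "D x0 \<bullet> q \<le> a - P \<bullet> q"
    proof (rule local_increment_bound[OF C1 t1])
      fix t assume t: "0 < t" "t < t1"
      have "adm V 1 (x0 - t *\<^sub>R q) q t" using t0(2)[of t t] t by (auto simp: t1_def)
      then have 1: "u (x0 - t *\<^sub>R q + t *\<^sub>R q) + t * (P \<bullet> q) \<le> u (x0 - t *\<^sub>R q) + a * t"
        using u unfolding ctrl_sub_def by blast
      have "t * norm q < r"
      proof -
        have "t * (norm q + 1) < r" using t n by (simp add: t1_def pos_less_divide_eq)
        then show ?thesis using t by (simp add: distrib_left)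
      qed
      then have "x0 - t *\<^sub>R q \<in> ball x0 r" using t by (simp add: dist_norm)
      then have "u (x0 - t *\<^sub>R q) - \<phi> (x0 - t *\<^sub>R q) \<le> u x0 - \<phi> x0" using touch by blast
      then show "\<phi> x0 - \<phi> (x0 - t *\<^sub>R q) \<le> (a - P \<bullet> q) * t" using 1 by (simp add: algebra_simps)
    qed
    then show ?thesis by (simp add: inner_add_left)
  qed
  show "ham V x0 ?p \<le> a"
  proof (cases "?p = 0")
    case True
    then show ?thesis using key[of "V x0"] by (simp add: ham_def)
  next
    case False
    \<comment> \<open>The maximising velocity lies on the boundary of the open velocity ball, so it
      is approached from inside with \<open>s < 1\<close>.\<close>
    have "s * norm ?p + ?p \<bullet> V x0 \<le> a" if s: "0 \<le> s" "s < 1" for s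
    proof -
      have "?p \<bullet> (V x0 + (s / norm ?p) *\<^sub>R ?p) \<le> a"
        using False s by (intro key) simp
      also have "?p \<bullet> (V x0 + (s / norm ?p) *\<^sub>R ?p) = s * norm ?p + ?p \<bullet> V x0"
        using False by (simp add: inner_add_right dot_square_norm power2_eq_square)
      finally show ?thesis .
    qed
    then have "s * norm ?p \<le> a - ?p \<bullet> V x0" if "0 < s" "s < 1" for s
      using \<open>\<And>s. 0 \<le> s \<Longrightarrow> s < 1 \<Longrightarrow> s * norm ?p + ?p \<bullet> V x0 \<le> a\<close>[of s] that by linarith
    then have "norm ?p \<le> a - ?p \<bullet> V x0" by (rule field_le_mult_one_interval)
    then show ?thesis by (simp add: ham_def)
  qed
qed

end

lemma visc_subsol_mono: "visc_subsol G P a u \<Longrightarrow> (\<And>x p. G' x p \<le> G x p) \<Longrightarrow> a \<le> b \<Longrightarrow> visc_subsol G' P b u"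
  unfolding visc_subsol_def by (blast intro: order_trans)

lemma ham_le_ham_k: "ham V x p \<le> ham_k k V x p"
  by (simp add: ham_k_def)

text \<open>A local Lipschitz bound \<open>K\<close> limits every test gradient, so
  \<open>norm (D x0 + P) \<le> k\<close> and the penalty in \<open>ham_k\<close> vanishes, while
  \<open>- k \<le> a\<close> makes the truncation from below harmless.\<close>

lemma lipschitz_subsol_ham_k:
  assumes u: "visc_subsol (ham V) P a u"
    and lip: "\<And>x y. norm (x - y) \<le> 1 \<Longrightarrow> \<bar>u x - u y\<bar> \<le> K * norm (x - y)"
    and k: "k \<ge> K + norm P" "k \<ge> - a"
  shows "visc_subsol (ham_k k V) P a u"
  unfolding visc_subsol_def
proof (intro allI impI, elim conjE exE)
  fix \<phi> D x0 r
  assume C1: "C1_test \<phi> D" and r: "r > 0" and touch: "\<forall>y\<in>ball x0 r. u y - \<phi> y \<le> u x0 - \<phi> x0"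
  have H: "ham V x0 (D x0 + P) \<le> a" using u C1 r touch unfolding visc_subsol_def by blast
  define n where "n = norm (D x0)"
  have "n \<le> K"
  proof (cases "n = 0")
    case True
    \<comment> \<open>Two points at distance 1 reveal that \<open>K\<close> is nonnegative.\<close>
    have "\<bar>u (axis undefined 1) - u 0\<bar> \<le> K * norm (axis undefined 1 - 0 :: real^'a)"
      by (rule lip) (simp add: norm_axis_1)
    then show ?thesis using True by (simp add: norm_axis_1)
  next
    case False
    then have n: "n > 0" by (simp add: n_def)
    define t0 where "t0 = min r 1 / n"
    have "D x0 \<bullet> D x0 \<le> K * n"
    proof (rule local_increment_bound[OF C1, of t0])
      show "t0 > 0" using n r by (simp add: t0_def)
      fix t assume t: "0 < t" "t < t0"
      then have tn: "t * n < min r 1" using n by (simp add: t0_def pos_less_divide_eq)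
      then have "x0 - t *\<^sub>R D x0 \<in> ball x0 r" using t by (simp add: dist_norm n_def)
      then have 1: "u (x0 - t *\<^sub>R D x0) - \<phi> (x0 - t *\<^sub>R D x0) \<le> u x0 - \<phi> x0" using touch by blast
      have "\<bar>u x0 - u (x0 - t *\<^sub>R D x0)\<bar> \<le> K * norm (x0 - (x0 - t *\<^sub>R D x0))"
        using tn t by (intro lip) (simp add: n_def)
      then show "\<phi> x0 - \<phi> (x0 - t *\<^sub>R D x0) \<le> K * n * t" using 1 t by (simp add: n_def mult_ac)
    qed
    then show ?thesis using n by (simp add: n_def dot_square_norm power2_eq_square)
  qed
  then have "norm (D x0 + P) \<le> k" using norm_triangle_ineq[of "D x0" P] k by (simp add: n_def)
  then show "ham_k k V x0 (D x0 + P) \<le> a" using H k by (simp add: ham_k_def)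
qed

section \<open>Semicontinuity, comparison and mollification\<close>

lemma upper_semicont_iff: "upper_semicont u \<longleftrightarrow> (\<forall>x. \<forall>e>0. \<exists>d>0. \<forall>y. dist y x < d \<longrightarrow> u y < u x + e)"
  unfolding upper_semicont_def eventually_at
  by (intro all_cong1 imp_cong[OF refl] ex_cong1 conj_cong[OF refl])
     (metis UNIV_I less_add_same_cancel1)

lemma lower_semicont_iff: "lower_semicont u \<longleftrightarrow> upper_semicont (\<lambda>x. - u x)"
proof -
  have "(u x - e < u y) = (- u y < - u x + e)" for x y e by auto
  then show ?thesis by (simp add: lower_semicont_def upper_semicont_def)
qed

lemma upper_semicont_borel:
  assumes "upper_semicont u" shows "u \<in> borel_measurable borel"
proof (rule borel_measurableI_less)
  fix a
  have "open {x. u x < a}"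
    unfolding open_contains_ball
  proof
    fix x assume "x \<in> {x. u x < a}"
    then have "a - u x > 0" by simp
    then obtain d where "d > 0" "\<And>y. dist y x < d \<Longrightarrow> u y < u x + (a - u x)"
      using assms unfolding upper_semicont_iff by blast
    then show "\<exists>e>0. ball x e \<subseteq> {x. u x < a}" by (intro exI[of _ d]) (auto simp: dist_commute)
  qed
  then show "{x \<in> space borel. u x < a} \<in> sets borel" by simp
qed

lemma upper_semicont_seq:
  assumes "upper_semicont u" "x \<longlonglongrightarrow> l" "e > 0"
  shows "eventually (\<lambda>n. u (x n) < u l + e) sequentially"
proof -
  obtain d where d: "d > 0" "\<And>y. dist y l < d \<Longrightarrow> u y < u l + e"
    using assms unfolding upper_semicont_iff by blast
  show ?thesis by (rule eventually_mono[OF tendstoD[OF assms(2) d(1)]]) (rule d(2))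
qed

lemma abs_integral_le:
  fixes f g :: "'a \<Rightarrow> real"
  assumes "integrable M f" "integrable M g" "\<And>x. \<bar>f x\<bar> \<le> g x"
  shows "\<bar>\<integral>x. f x \<partial>M\<bar> \<le> (\<integral>x. g x \<partial>M)"
proof -
  have "norm (\<integral>x. f x \<partial>M) \<le> (\<integral>x. norm (f x) \<partial>M)" by (rule integral_norm_bound)
  also have "\<dots> \<le> (\<integral>x. g x \<partial>M)" using assms by (intro integral_mono) auto
  finally show ?thesis by simp
qed

text \<open>Here \<open>v\<close> will be minus the supersolution, so that both functions are upper
  semicontinuous.\<close>

definition doubled :: "(real^'n::finite \<Rightarrow> real) \<Rightarrow> (real^'n \<Rightarrow> real) \<Rightarrow> real \<Rightarrow> real^'n \<Rightarrow> real^'n \<Rightarrow> real" where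
  "doubled u v \<alpha> x y = u x + v y - \<alpha> * (norm (x - y))\<^sup>2"

text \<open>Space is not compact: a maximising pair is translated by a lattice vector until its
  first point lies in the unit cube, and the quadratic penalty keeps the second one at bounded
  distance. A limit pair is a maximiser by upper semicontinuity.\<close>

lemma doubled_attains_sup:
  fixes u v :: "real^'n::finite \<Rightarrow> real"
  assumes u: "upper_semicont u" "bounded (range u)" "zn_periodic u"
    and v: "upper_semicont v" "bounded (range v)" "zn_periodic v" and al: "\<alpha> > 0"
  shows "\<exists>x y. \<forall>x' y'. doubled u v \<alpha> x' y' \<le> doubled u v \<alpha> x y"
proof -
  obtain Mu where "\<forall>y\<in>range u. norm y \<le> Mu" using u(2) unfolding bounded_iff by blast
  then have Mu: "\<bar>u x\<bar> \<le> Mu" for x by simp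
  obtain Mv where "\<forall>y\<in>range v. norm y \<le> Mv" using v(2) unfolding bounded_iff by blast
  then have Mv: "\<bar>v x\<bar> \<le> Mv" for x by simp
  define S where "S = {doubled u v \<alpha> x y | x y. True}"
  have ub: "s \<le> Mu + Mv" if sS: "s \<in> S" for s
  proof -
    obtain x y where s: "s = doubled u v \<alpha> x y" using sS unfolding S_def by blast
    have "\<alpha> * (norm (x - y))\<^sup>2 \<ge> 0" using al by simp
    then show ?thesis using Mu[of x] Mv[of y] by (simp add: s doubled_def)
  qed
  have bdd: "bdd_above S" using ub by (auto simp: bdd_above_def)
  have ne: "S \<noteq> {}" by (auto simp: S_def)
  define s where "s = Sup S"
  have "\<exists>x y. doubled u v \<alpha> x y > s - 1 / real (Suc n) \<and> x \<in> cbox 0 1" for n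
  proof -
    have "s - 1 / real (Suc n) < Sup S" by (simp add: s_def)
    then obtain x y where xy: "s - 1 / real (Suc n) < doubled u v \<alpha> x y"
      using less_cSup_iff[OF ne bdd] by (auto simp: S_def)
    obtain z where z: "x + lattice_vec z \<in> unit_cell" using ex_lattice_translate_in_unit_cell by blast
    have "doubled u v \<alpha> (x + lattice_vec z) (y + lattice_vec z) = doubled u v \<alpha> x y"
      using u(3) v(3) by (simp add: doubled_def zn_periodicD)
    moreover have "x + lattice_vec z \<in> cbox 0 1" using z unit_cell_subset_cbox by blast
    ultimately show ?thesis using xy by (intro exI[of _ "x + lattice_vec z"] exI[of _ "y + lattice_vec z"]) simp
  qed
  then obtain X Y where XY: "\<And>n. doubled u v \<alpha> (X n) (Y n) > s - 1 / real (Suc n)" "\<And>n. X n \<in> cbox 0 1"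
    by metis
  have d00: "doubled u v \<alpha> 0 0 \<le> s" unfolding s_def using bdd by (intro cSup_upper) (auto simp: S_def)
  have "(norm (X n - Y n))\<^sup>2 \<le> (2 * Mu + 2 * Mv + 1) / \<alpha>" for n
  proof -
    have "1 / real (Suc n) \<le> 1" by simp
    then have "doubled u v \<alpha> (X n) (Y n) \<ge> doubled u v \<alpha> 0 0 - 1" using XY(1)[of n] d00 by linarith
    then have "\<alpha> * (norm (X n - Y n))\<^sup>2 \<le> 2 * Mu + 2 * Mv + 1"
    proof -
      have "doubled u v \<alpha> 0 0 = u 0 + v 0" by (simp add: doubled_def)
      moreover have "doubled u v \<alpha> (X n) (Y n) = u (X n) + v (Y n) - \<alpha> * (norm (X n - Y n))\<^sup>2" by (simp add: doubled_def)
      ultimately show ?thesis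
        using Mu[of "X n"] Mu[of 0] Mv[of "Y n"] Mv[of 0] \<open>doubled u v \<alpha> (X n) (Y n) \<ge> doubled u v \<alpha> 0 0 - 1\<close> by linarith
    qed
    then show ?thesis using al by (simp add: pos_le_divide_eq mult.commute)
  qed
  then have bd: "norm (X n - Y n) \<le> sqrt ((2 * Mu + 2 * Mv + 1) / \<alpha>)" for n by (rule real_le_rsqrt)
  have bX: "bounded (range X)" using XY(2) by (intro bounded_subset[OF bounded_cbox[of 0 1]]) blast
  then obtain K where "\<forall>x\<in>range X. norm x \<le> K" unfolding bounded_iff by blast
  then have K: "norm (X n) \<le> K" for n by blast
  have "norm (Y n) \<le> K + sqrt ((2 * Mu + 2 * Mv + 1) / \<alpha>)" for n
    using bd[of n] K[of n] norm_triangle_ineq2[of "Y n" "X n"] by (simp add: norm_minus_commute)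
  then have bY: "bounded (range Y)" unfolding bounded_iff by blast
  have "range (\<lambda>n. (X n, Y n)) \<subseteq> range X \<times> range Y" by blast
  then have "bounded (range (\<lambda>n. (X n, Y n)))"
    using bounded_subset[OF bounded_Times[OF bX bY]] by blast
  then obtain l r where r: "strict_mono r" "((\<lambda>n. (X n, Y n)) \<circ> r) \<longlonglongrightarrow> l"
    using bounded_imp_convergent_subsequence by blast
  obtain x y where l: "l = (x, y)" by force
  have Xl: "(\<lambda>n. X (r n)) \<longlonglongrightarrow> x" and Yl: "(\<lambda>n. Y (r n)) \<longlonglongrightarrow> y"
    using tendsto_fst[OF r(2)] tendsto_snd[OF r(2)] by (simp_all add: l o_def)
  have nl: "(\<lambda>n. \<alpha> * (norm (X (r n) - Y (r n)))\<^sup>2) \<longlonglongrightarrow> \<alpha> * (norm (x - y))\<^sup>2"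
    by (intro tendsto_intros Xl Yl)
  have "s \<le> doubled u v \<alpha> x y + e" if e: "e > 0" for e
  proof -
    have e4: "e/4 > 0" using e by simp
    obtain m where m: "1 / real (Suc m) < e/4" using nat_approx_posE[OF e4] by auto
    have ev3: "\<forall>\<^sub>F n in sequentially. \<alpha> * (norm (x - y))\<^sup>2 - e/4 < \<alpha> * (norm (X (r n) - Y (r n)))\<^sup>2"
      by (rule order_tendstoD(1)[OF nl]) (use e in simp)
    have "eventually (\<lambda>n. s \<le> doubled u v \<alpha> x y + e) sequentially"
      using upper_semicont_seq[OF u(1) Xl e4] upper_semicont_seq[OF v(1) Yl e4] ev3
        eventually_ge_at_top[of m]
    proof eventually_elim
      case (elim n)
      have "1 / real (Suc (r n)) \<le> 1 / real (Suc m)"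
        using elim(4) seq_suble[OF r(1), of n] by (intro divide_left_mono) auto
      then show ?case using elim XY(1)[of "r n"] m e unfolding doubled_def by linarith
    qed
    then show ?thesis by simp
  qed
  then have "s \<le> doubled u v \<alpha> x y" by (rule field_le_epsilon)
  moreover have "doubled u v \<alpha> x' y' \<le> s" for x' y'
    unfolding s_def using bdd by (intro cSup_upper) (auto simp: S_def)
  ultimately show ?thesis by (blast intro: order_trans)
qed

lemma C1_test_sq: "C1_test (\<lambda>x. \<alpha> * (norm (x - y))\<^sup>2) (\<lambda>x. (2 * \<alpha>) *\<^sub>R (x - y))"
proof -
  have "((\<lambda>x. \<alpha> * ((x - y) \<bullet> (x - y))) has_derivative (\<lambda>h. \<alpha> * ((x - y) \<bullet> h + h \<bullet> (x - y)))) (at x)" for x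
    by (intro has_derivative_mult_right has_derivative_inner) (auto intro!: derivative_eq_intros)
  then have "((\<lambda>x. \<alpha> * (norm (x - y))\<^sup>2) has_derivative (\<lambda>h. ((2 * \<alpha>) *\<^sub>R (x - y)) \<bullet> h)) (at x)" for x
    unfolding power2_norm_eq_inner[symmetric] by (rule has_derivative_eq_rhs) (simp add: fun_eq_iff inner_commute)
  then show ?thesis unfolding C1_test_def by (intro conjI allI continuous_intros)
qed

lemma C1_test_neg: "C1_test \<phi> D \<Longrightarrow> C1_test (\<lambda>x. - \<phi> x) (\<lambda>x. - D x)"
  unfolding C1_test_def
  by (auto intro!: continuous_intros intro: has_derivative_eq_rhs[OF has_derivative_minus] simp: fun_eq_iff)

context flow begin

text \<open>Doubling of variables with penalties \<open>2 ^ n\<close>. The penalty at the maximiser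
  must vanish although \<open>u\<close> and \<open>v\<close> are only semicontinuous; this follows
  by comparing consecutive maxima, which decrease to a limit. Since \<open>ham\<close> varies in
  \<open>x\<close> by at most \<open>L * norm p * norm (x - y)\<close>, and the test gradient is
  proportional to \<open>x - y\<close> times the parameter, the error is of the order of the penalty
  plus \<open>norm P\<close> times the distance. The equation has no term in \<open>u\<close>
  itself, so what gets compared are the levels.\<close>

theorem comparison:
  assumes u: "upper_semicont u" "bounded (range u)" "zn_periodic u" "visc_subsol (ham V) P a u"
    and v: "lower_semicont v" "bounded (range v)" "zn_periodic v" "visc_supersol (ham V) P c v"
  shows "c \<le> a"
proof -
  define w where "w x = - v x" for x
  have w: "upper_semicont w" "bounded (range w)" "zn_periodic w"
    using v(1-3) unfolding w_def by (auto simp: lower_semicont_iff zn_periodic_def bounded_iff)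
  define \<alpha> where "\<alpha> n = (2::real) ^ n" for n :: nat
  have al: "\<alpha> n \<ge> 1" for n by (simp add: \<alpha>_def)
  have "\<forall>n. \<exists>x y. \<forall>x' y'. doubled u w (\<alpha> n) x' y' \<le> doubled u w (\<alpha> n) x y"
    using doubled_attains_sup[OF u(1-3) w] al by (meson less_le_trans zero_less_one)
  then obtain X Y where XY: "\<And>n x' y'. doubled u w (\<alpha> n) x' y' \<le> doubled u w (\<alpha> n) (X n) (Y n)" by metis
  define M where "M n = doubled u w (\<alpha> n) (X n) (Y n)" for n
  \<comment> \<open>The maximiser for \<open>Suc n\<close> competes in the problem for
    \<open>n\<close>; since the parameter doubles, its gain there is exactly
    \<open>\<alpha> n\<close> times the squared distance.\<close>
  have dd: "\<alpha> n * (norm (X (Suc n) - Y (Suc n)))\<^sup>2 \<le> M n - M (Suc n)" for n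
  proof -
    have "doubled u w (\<alpha> n) (X (Suc n)) (Y (Suc n)) = M (Suc n) + \<alpha> n * (norm (X (Suc n) - Y (Suc n)))\<^sup>2"
      by (simp add: M_def doubled_def \<alpha>_def)
    then show ?thesis using XY[of n "X (Suc n)" "Y (Suc n)"] by (simp add: M_def)
  qed
  have "decseq M"
  proof (rule decseq_SucI)
    fix n have "\<alpha> n * (norm (X (Suc n) - Y (Suc n)))\<^sup>2 \<ge> 0" by (simp add: \<alpha>_def)
    then show "M (Suc n) \<le> M n" using dd[of n] by linarith
  qed
  moreover have "M n \<ge> u 0 + w 0" for n using XY[of n 0 0] by (simp add: M_def doubled_def)
  ultimately obtain l where l: "M \<longlonglongrightarrow> l" using decseq_convergent[of M] by blast
  have "(\<lambda>n. M n - M (Suc n)) \<longlonglongrightarrow> l - l" by (intro tendsto_diff l LIMSEQ_Suc)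
  then have lim: "(\<lambda>n. M n - M (Suc n)) \<longlonglongrightarrow> 0" by simp
  define d where "d n = norm (X (Suc n) - Y (Suc n))" for n
  \<comment> \<open>The 4 combines the 2 from the gradient of the square with the 2 from
    \<open>\<alpha> (Suc n) = 2 * \<alpha> n\<close>.\<close>
  have step: "c - a \<le> L * (4 * (M n - M (Suc n)) + norm P * d n)" for n
  proof -
    define x y \<beta> where "x = X (Suc n)" and "y = Y (Suc n)" and "\<beta> = \<alpha> (Suc n)"
    define p where "p = (2 * \<beta>) *\<^sub>R (x - y)"
    have max: "doubled u w \<beta> x' y' \<le> doubled u w \<beta> x y" for x' y' using XY[of "Suc n"] by (simp add: x_def y_def \<beta>_def)
    have be: "\<beta> > 0" using al[of "Suc n"] by (simp add: \<beta>_def)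
    have "\<forall>x'\<in>ball x 1. u x' - \<beta> * (norm (x' - y))\<^sup>2 \<le> u x - \<beta> * (norm (x - y))\<^sup>2"
      using max[of _ y] by (simp add: doubled_def)
    then have 1: "ham V x (p + P) \<le> a"
      using u(4)[unfolded visc_subsol_def, rule_format, of "\<lambda>x. \<beta> * (norm (x - y))\<^sup>2" "\<lambda>x. (2 * \<beta>) *\<^sub>R (x - y)" x] C1_test_sq[of \<beta> y]
      unfolding p_def by (metis zero_less_one)
    have "\<forall>y'\<in>ball y 1. v y - (- (\<beta> * (norm (y - x))\<^sup>2)) \<le> v y' - (- (\<beta> * (norm (y' - x))\<^sup>2))"
    proof
      fix y' show "v y - (- (\<beta> * (norm (y - x))\<^sup>2)) \<le> v y' - (- (\<beta> * (norm (y' - x))\<^sup>2))"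
        using max[of x y'] norm_minus_commute[of x y] norm_minus_commute[of x y'] by (simp add: doubled_def w_def)
    qed
    then have 2: "c \<le> ham V y (- ((2 * \<beta>) *\<^sub>R (y - x)) + P)"
      using v(4)[unfolded visc_supersol_def, rule_format, of "\<lambda>y. - (\<beta> * (norm (y - x))\<^sup>2)" "\<lambda>y. - ((2 * \<beta>) *\<^sub>R (y - x))" y]
        C1_test_neg[OF C1_test_sq[of \<beta> x]] by (metis zero_less_one)
    have "- ((2 * \<beta>) *\<^sub>R (y - x)) = p" by (simp add: p_def algebra_simps)
    with 1 2 have "c - a \<le> ham V y (p + P) - ham V x (p + P)" by simp
    also have "\<dots> = (p + P) \<bullet> (V y - V x)" by (simp add: ham_def inner_diff_right)
    also have "\<dots> \<le> norm (p + P) * norm (V y - V x)" by (rule norm_cauchy_schwarz)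
    also have "\<dots> \<le> (norm p + norm P) * (L * d n)"
      using V_lip[of y x] norm_triangle_ineq[of p P] by (intro mult_mono) (auto simp: d_def x_def y_def norm_minus_commute)
    also have "norm p = 2 * \<beta> * d n" using be by (simp add: p_def d_def x_def y_def)
    also have "(2 * \<beta> * d n + norm P) * (L * d n) = L * (4 * (\<alpha> n * (d n)\<^sup>2) + norm P * d n)"
      by (simp add: \<beta>_def \<alpha>_def power2_eq_square algebra_simps)
    also have "\<dots> \<le> L * (4 * (M n - M (Suc n)) + norm P * d n)"
      using dd[of n] L_nonneg by (intro mult_left_mono) (auto simp: d_def)
    finally show ?thesis .
  qed
  have d_lim: "d \<longlonglongrightarrow> 0"
  proof -
    have "(\<lambda>n. (d n)\<^sup>2) \<longlonglongrightarrow> 0"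
    proof (rule tendsto_sandwich[OF _ _ tendsto_const lim])
      have "(d n)\<^sup>2 \<le> \<alpha> n * (d n)\<^sup>2" for n using mult_right_mono[OF al[of n], of "(d n)\<^sup>2"] by simp
      then show "\<forall>\<^sub>F n in sequentially. (d n)\<^sup>2 \<le> M n - M (Suc n)" using dd unfolding d_def by (meson always_eventually order_trans)
    qed auto
    then have "(\<lambda>n. sqrt ((d n)\<^sup>2)) \<longlonglongrightarrow> sqrt 0" by (rule tendsto_real_sqrt)
    moreover have "sqrt ((d n)\<^sup>2) = d n" for n by (simp add: d_def)
    ultimately show ?thesis by simp
  qed
  have "(\<lambda>n. L * (4 * (M n - M (Suc n)) + norm P * d n)) \<longlonglongrightarrow> L * (4 * 0 + norm P * 0)"
    by (intro tendsto_intros lim d_lim)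
  then have "c - a \<le> L * (4 * 0 + norm P * 0)" using step by (intro LIMSEQ_le_const) auto
  then show ?thesis by simp
qed

text \<open>A segment of radius 1 from \<open>x\<close>, moved to start at \<open>x + z\<close> with
  \<open>norm z < \<epsilon>\<close>, is admissible for radius
  \<open>1 + L * \<epsilon> \<le> r\<close>; so the inequality for \<open>u\<close> holds on all
  these translates and survives averaging. The kernel is Lipschitz, hence so is \<open>U\<close> at
  unit distances, although \<open>u\<close> is only bounded and measurable.\<close>

lemma mollified_ctrl_sub:
  assumes u: "u \<in> borel_measurable borel" "\<And>x. \<bar>u x\<bar> \<le> M" "zn_periodic u" "ctrl_sub V r P a u" and r: "r > 1"
  obtains U K where "\<And>x y. norm (x - y) \<le> 1 \<Longrightarrow> \<bar>U x - U y\<bar> \<le> K * norm (x - y)" "\<And>x. \<bar>U x\<bar> \<le> M" "zn_periodic U" "ctrl_sub V 1 P a U"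
proof -
  define \<epsilon> where "\<epsilon> = (r - 1) / (L + 1)"
  have eps: "\<epsilon> > 0" "L * \<epsilon> \<le> r - 1" using r L_nonneg by (auto simp: \<epsilon>_def field_simps)
  define \<rho> where "\<rho> z = max 0 (\<epsilon> - norm z)" for z :: "real^'n"
  have rho_cont: "continuous_on UNIV \<rho>" unfolding \<rho>_def by (intro continuous_intros)
  have [measurable]: "\<rho> \<in> borel_measurable borel" using rho_cont by (rule borel_measurable_continuous_onI)
  note u(1)[measurable]
  have M: "M \<ge> 0" using u(2)[of 0] by simp
  have rho: "0 \<le> \<rho> z" "\<rho> z \<le> \<epsilon>" "norm z \<ge> \<epsilon> \<Longrightarrow> \<rho> z = 0" for z using eps by (auto simp: \<rho>_def)
  have rho_lip: "\<bar>\<rho> y - \<rho> z\<bar> \<le> norm (y - z)" for y z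
    using norm_triangle_ineq3[of y z] by (auto simp: \<rho>_def max_def)
  have int_bd: "integrable lborel f" if f: "f \<in> borel_measurable borel" "\<And>z. norm z \<ge> R \<Longrightarrow> f z = 0" "\<And>z. \<bar>f z\<bar> \<le> C" for f :: "real^'n \<Rightarrow> real" and R C
  proof (rule Bochner_Integration.integrable_bound[of _ "\<lambda>z. C * indicat_real (cball 0 R) z"])
    have C: "C \<ge> 0" using f(3)[of 0] by simp
    show "integrable lborel (\<lambda>z. C * indicat_real (cball 0 R) z :: real)"
      by (intro integrable_mult_right integrable_real_indicator) (use emeasure_lborel_cball_finite in \<open>auto simp: less_top[symmetric]\<close>)
    show "AE z in lborel. norm (f z) \<le> norm (C * indicat_real (cball 0 R) z)"
      using f(2,3) C by (intro AE_I2) (auto simp: indicator_def)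
  qed (use f in auto)
  have int_rho: "integrable lborel \<rho>" by (rule int_bd[of _ \<epsilon> \<epsilon>]) (auto simp: rho)
  define Z where "Z = (\<integral>z. \<rho> z \<partial>lborel)"
  have Z: "Z > 0"
  proof -
    have "(\<epsilon>/2) * measure lborel (ball (0::real^'n) (\<epsilon>/2)) = (\<integral>z. (\<epsilon>/2) * indicator (ball 0 (\<epsilon>/2)) (z::real^'n) \<partial>lborel)"
      by simp
    also have "\<dots> \<le> Z" unfolding Z_def
    proof (rule integral_mono[OF _ int_rho])
      show "integrable lborel (\<lambda>z. \<epsilon> / 2 * indicat_real (ball 0 (\<epsilon> / 2)) (z::real^'n))"
        by (intro integrable_mult_right integrable_real_indicator) (use emeasure_lborel_ball_finite in \<open>auto simp: less_top[symmetric]\<close>)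
    qed (use eps in \<open>auto simp: indicator_def \<rho>_def\<close>)
    finally show ?thesis using eps content_ball_pos[of "\<epsilon>/2" "0::real^'n"]
      by (smt (verit) half_gt_zero mult_pos_pos)
  qed
  define U where "U x = (1/Z) * (\<integral>z. \<rho> z * u (x + z) \<partial>lborel)" for x
  have int_U: "integrable lborel (\<lambda>z. \<rho> z * u (x + z))" for x
  proof (rule int_bd[of _ \<epsilon> "\<epsilon> * M"])
    show "\<bar>\<rho> z * u (x + z)\<bar> \<le> \<epsilon> * M" for z
      unfolding abs_mult using rho[of z] u(2)[of "x + z"] eps by (intro mult_mono) auto
  qed (auto simp: rho)
  \<comment> \<open>Moves the dependence on \<open>x\<close> from \<open>u\<close> to the kernel,
    whose Lipschitz constant is 1.\<close>
  have shift: "(\<integral>z. \<rho> z * u (x + z) \<partial>lborel) = (\<integral>z. \<rho> (z - x) * u z \<partial>lborel)" for x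
  proof -
    have "(\<integral>z. \<rho> (z - x) * u z \<partial>lborel) = (\<integral>z. \<rho> (z - x) * u z \<partial>distr lborel borel ((+) x))"
      by (simp add: lborel_distr_plus)
    also have "\<dots> = (\<integral>z. \<rho> z * u (x + z) \<partial>lborel)" by (subst integral_distr) auto
    finally show ?thesis by simp
  qed
  have int_sh: "integrable lborel (\<lambda>z. \<rho> (z - x) * u z)" for x
  proof (rule int_bd[of _ "\<epsilon> + norm x" "\<epsilon> * M"])
    show "\<bar>\<rho> (z - x) * u z\<bar> \<le> \<epsilon> * M" for z
      unfolding abs_mult using rho[of "z - x"] u(2)[of z] eps by (intro mult_mono) auto
    show "\<rho> (z - x) * u z = 0" if "norm z \<ge> \<epsilon> + norm x" for z
      using that norm_triangle_ineq2[of z x] by (simp add: rho)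
  qed auto
  \<comment> \<open>For \<open>norm (x - y) \<le> 1\<close> the difference of the two shifted
    kernels is supported in a ball of radius \<open>\<epsilon> + 1\<close>.\<close>
  define K where "K = (1/Z) * (M * measure lborel (cball (0::real^'n) (\<epsilon> + 1)))"
  have lipU: "\<bar>U x - U y\<bar> \<le> K * norm (x - y)" if xy: "norm (x - y) \<le> 1" for x y
  proof -
    have "\<bar>(\<integral>z. \<rho> (z - x) * u z \<partial>lborel) - (\<integral>z. \<rho> (z - y) * u z \<partial>lborel)\<bar> = \<bar>\<integral>z. \<rho> (z - x) * u z - \<rho> (z - y) * u z \<partial>lborel\<bar>"
      using int_sh by simp
    also have "\<dots> \<le> (\<integral>z. norm (x - y) * M * indicator (cball x (\<epsilon> + 1)) z \<partial>lborel)"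
    proof (rule abs_integral_le)
      show "integrable lborel (\<lambda>z. \<rho> (z - x) * u z - \<rho> (z - y) * u z)" using int_sh by simp
      show "integrable lborel (\<lambda>z. norm (x - y) * M * indicat_real (cball x (\<epsilon> + 1)) z)"
        by (intro integrable_mult_right integrable_real_indicator) (use emeasure_lborel_cball_finite in \<open>auto simp: less_top[symmetric]\<close>)
      fix z
      show "\<bar>\<rho> (z - x) * u z - \<rho> (z - y) * u z\<bar> \<le> norm (x - y) * M * indicat_real (cball x (\<epsilon> + 1)) z"
      proof (cases "z \<in> cball x (\<epsilon> + 1)")
        case True
        have "\<bar>\<rho> (z - x) - \<rho> (z - y)\<bar> \<le> norm (x - y)" using rho_lip[of "z - x" "z - y"] by (simp add: norm_minus_commute)
        then have "\<bar>\<rho> (z - x) - \<rho> (z - y)\<bar> * \<bar>u z\<bar> \<le> norm (x - y) * M" using u(2)[of z] M by (intro mult_mono) auto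
        then show ?thesis using True by (simp add: left_diff_distrib[symmetric] abs_mult)
      next
        case False
        then have "norm (z - x) > \<epsilon> + 1" by (simp add: dist_norm norm_minus_commute)
        moreover have "norm (z - x) \<le> norm (z - y) + norm (x - y)"
          using norm_triangle_ineq[of "z - y" "y - x"] by (simp add: norm_minus_commute)
        ultimately have "\<rho> (z - x) = 0" "\<rho> (z - y) = 0" using xy by (auto intro!: rho(3))
        then show ?thesis using False by simp
      qed
    qed
    also have "\<dots> = norm (x - y) * M * measure lborel (cball (0::real^'n) (\<epsilon> + 1))"
      using content_cball[of "\<epsilon> + 1" x] content_cball[of "\<epsilon> + 1" "0::real^'n"] eps by simp
    finally have "(1/Z) * \<bar>(\<integral>z. \<rho> (z - x) * u z \<partial>lborel) - (\<integral>z. \<rho> (z - y) * u z \<partial>lborel)\<bar>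
        \<le> (1/Z) * (norm (x - y) * M * measure lborel (cball (0::real^'n) (\<epsilon> + 1)))"
      using Z by (intro mult_left_mono) auto
    moreover have "\<bar>U x - U y\<bar> = (1/Z) * \<bar>(\<integral>z. \<rho> (z - x) * u z \<partial>lborel) - (\<integral>z. \<rho> (z - y) * u z \<partial>lborel)\<bar>"
      using Z by (simp add: U_def shift right_diff_distrib[symmetric] abs_mult diff_divide_distrib[symmetric])
    ultimately show ?thesis by (simp add: K_def mult_ac)
  qed
  have bdU: "\<bar>U x\<bar> \<le> M" for x
  proof -
    have "\<bar>\<integral>z. \<rho> z * u (x + z) \<partial>lborel\<bar> \<le> (\<integral>z. M * \<rho> z \<partial>lborel)"
    proof (rule abs_integral_le[OF int_U])
      show "integrable lborel (\<lambda>z. M * \<rho> z)" using int_rho by simp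
      show "\<bar>\<rho> z * u (x + z)\<bar> \<le> M * \<rho> z" for z
        using mult_left_mono[OF u(2)[of "x + z"] rho(1)[of z]] rho(1)[of z] by (simp add: abs_mult mult.commute)
    qed
    also have "\<dots> = M * Z" by (simp add: Z_def)
    finally show ?thesis using Z by (simp add: U_def abs_mult divide_le_eq)
  qed
  have perU: "zn_periodic U"
  proof -
    have "u (x + lattice_vec w + z) = u (x + z)" for x w z
      using zn_periodicD[OF u(3), of "x + z" w] by (simp add: algebra_simps)
    then show ?thesis by (simp add: zn_periodic_def U_def)
  qed
  have "ctrl_sub V 1 P a U"
    unfolding ctrl_sub_def
  proof (intro allI impI)
    fix x q t assume adm: "adm V 1 x q t"
    have pt: "\<rho> z * u (x + t *\<^sub>R q + z) \<le> \<rho> z * u (x + z) + (a * t - t * (P \<bullet> q)) * \<rho> z" for z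
    proof (cases "norm z < \<epsilon>")
      case True
      have "adm V r (x + z) q t" unfolding adm_def
      proof (intro conjI ballI)
        show "t > 0" using adm by (simp add: adm_def)
        fix s assume "s \<in> {0..t}"
        then have 1: "norm (q - V (x + s *\<^sub>R q)) < 1" using adm by (simp add: adm_def)
        have "norm (V (x + s *\<^sub>R q) - V (x + z + s *\<^sub>R q)) \<le> L * norm z"
          using V_lip[of "x + s *\<^sub>R q" "x + z + s *\<^sub>R q"] by simp
        also have "\<dots> \<le> L * \<epsilon>" using True L_nonneg by (intro mult_left_mono) auto
        also note eps(2)
        finally show "norm (q - V (x + z + s *\<^sub>R q)) < r"
          using 1 norm_triangle_ineq[of "q - V (x + s *\<^sub>R q)" "V (x + s *\<^sub>R q) - V (x + z + s *\<^sub>R q)"] by simp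
      qed
      then have "u (x + z + t *\<^sub>R q) + t * (P \<bullet> q) \<le> u (x + z) + a * t" using u(4) unfolding ctrl_sub_def by blast
      then have "u (x + t *\<^sub>R q + z) \<le> u (x + z) + (a * t - t * (P \<bullet> q))" by (simp add: algebra_simps)
      then have "\<rho> z * u (x + t *\<^sub>R q + z) \<le> \<rho> z * (u (x + z) + (a * t - t * (P \<bullet> q)))" using rho(1) by (rule mult_left_mono)
      then show ?thesis by (simp add: algebra_simps)
    qed (simp add: rho)
    have "(\<integral>z. \<rho> z * u (x + t *\<^sub>R q + z) \<partial>lborel) \<le> (\<integral>z. \<rho> z * u (x + z) + (a * t - t * (P \<bullet> q)) * \<rho> z \<partial>lborel)"
      using int_U[of "x + t *\<^sub>R q"] int_U[of x] int_rho pt by (intro integral_mono) auto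
    also have "\<dots> = (\<integral>z. \<rho> z * u (x + z) \<partial>lborel) + (a * t - t * (P \<bullet> q)) * Z"
      using int_U[of x] int_rho by (simp add: Z_def)
    finally have "(1/Z) * (\<integral>z. \<rho> z * u (x + t *\<^sub>R q + z) \<partial>lborel) \<le> (1/Z) * ((\<integral>z. \<rho> z * u (x + z) \<partial>lborel) + (a * t - t * (P \<bullet> q)) * Z)"
      using Z by (intro mult_left_mono) auto
    also have "\<dots> = U x + (a * t - t * (P \<bullet> q))" using Z by (simp add: U_def distrib_left)
    finally show "U (x + t *\<^sub>R q) + t * (P \<bullet> q) \<le> U x + a * t" by (simp add: U_def)
  qed
  with lipU bdU perU show thesis by (rule that)
qed

end

section \<open>The ergodic problem for controllable flows\<close>

locale ctrl_flow = flow V L for V :: "real^'n::finite \<Rightarrow> real^'n" and L +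
  fixes P :: "real^'n"
  assumes ctrl: controllable
begin

definition T0 where "T0 = (SOME T0. T0 > 0 \<and> (\<forall>x y. \<exists>T z. T \<le> T0 \<and> reach V 1 x (y + lattice_vec z) T))"

lemma ex_reach1: "\<exists>T z. T \<le> T0 \<and> reach V 1 x (y + lattice_vec z) T"
proof -
  have "\<exists>T0. T0 > 0 \<and> (\<forall>x y. \<exists>T z. T \<le> T0 \<and> reach V 1 x (y + lattice_vec z) T)"
    using uniformly_controllable[OF ctrl] by metis
  from someI_ex[OF this] show "\<exists>T z. T \<le> T0 \<and> reach V 1 x (y + lattice_vec z) T"
    unfolding T0_def[symmetric] by auto
qed

lemma obtain_reach:
  assumes "1 \<le> r" obtains T z where "T \<le> T0" "T > 0" "reach V r x (y + lattice_vec z) T"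
  using ex_reach1[of x y] reach_mono[OF _ assms] reach_pos by blast

text \<open>Bounds the rate of \<open>P \<bullet> x\<close> along trajectories of every radius up to
  2; all radii that occur below are of this kind.\<close>

definition C where "C = norm P * (B + 2)"

lemma C_nonneg: "C \<ge> 0" using B_nonneg by (simp add: C_def)

lemma disp_bound:
  assumes "reach V r x y T" "r \<le> 2" shows "\<bar>P \<bullet> (y - x)\<bar> \<le> C * T"
proof -
  have "\<bar>P \<bullet> (y - x)\<bar> \<le> norm P * norm (y - x)" by (rule Cauchy_Schwarz_ineq2)
  also have "\<dots> \<le> norm P * ((B + r) * T)" using reach_speed[OF assms(1)] by (intro mult_left_mono) auto
  also have "\<dots> \<le> norm P * ((B + 2) * T)" using assms reach_pos[OF assms(1)] by (intro mult_left_mono mult_right_mono) auto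
  finally show ?thesis by (simp add: C_def mult.assoc)
qed

text \<open>\<open>crit r\<close> is the best long-time average of \<open>P \<bullet> x'\<close> along the inclusion of radius \<open>r\<close>; its limit
  as \<open>r\<close> decreases to \<open>1\<close> is the effective Hamiltonian.\<close>
definition maxdisp where "maxdisp r S = Sup {P \<bullet> (y - x) | x y. reach V r x y S}"
definition crit where "crit r = Inf {maxdisp r S / S | S. S > 0}"

lemma long_loop:
  assumes r: "1 \<le> r" and loop: "reach V r x (x + lattice_vec z) T"
  shows "reach V r x (x + real (Suc n) *\<^sub>R lattice_vec z) (real (Suc n) * T)"
proof (induction n)
  case (Suc n)
  have lv: "lattice_vec (\<lambda>i. int (Suc n) * z i) = real (Suc n) *\<^sub>R lattice_vec z"
    by (simp add: lattice_vec_def vec_eq_iff)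
  have step: "reach V r (x + real (Suc n) *\<^sub>R lattice_vec z) (x + lattice_vec z + real (Suc n) *\<^sub>R lattice_vec z) T"
    using reach_lattice[OF loop, of "\<lambda>i. int (Suc n) * z i"] unfolding lv .
  have 1: "x + real (Suc (Suc n)) *\<^sub>R lattice_vec z = x + lattice_vec z + real (Suc n) *\<^sub>R lattice_vec z"
    using scaleR_left_distrib[of 1 "real (Suc n)" "lattice_vec z"] by (simp add: add.assoc)
  have 2: "real (Suc (Suc n)) * T = real (Suc n) * T + T" by (simp add: distrib_right)
  show ?case unfolding 1 2 using reach_trans[OF step Suc] .
qed (use loop in simp)

text \<open>Makes the supremum in \<open>maxdisp\<close> one over a nonempty set: a loop at
  \<open>y\<close> is repeated until it lasts longer than \<open>S\<close>, and its final piece of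
  duration exactly \<open>S\<close> is kept and translated back.\<close>

lemma ex_reach_duration:
  assumes r: "1 \<le> r" and S: "S > 0"
  shows "\<exists>x. reach V r x y S"
proof -
  obtain T z where T: "T > 0" "reach V r y (y + lattice_vec z) T" using obtain_reach[OF r] by blast
  obtain n where n: "S / T < real (Suc n)" using reals_Archimedean2[of "S/T"] less_trans[OF _ lessI[THEN of_nat_less_iff[THEN iffD2]]] by blast
  define U where "U = real (Suc n) * T"
  have U: "S < U" using n T by (simp add: U_def pos_divide_less_eq)
  have R: "reach V r y (y + real (Suc n) *\<^sub>R lattice_vec z) U" using long_loop[OF r T(2), of n] by (simp only: U_def)
  obtain m where "reach V r m (y + real (Suc n) *\<^sub>R lattice_vec z) (U - (U - S))"
    using reach_split[OF R, of "U - S"] U S by auto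
  then have m: "reach V r m (y + real (Suc n) *\<^sub>R lattice_vec z) S" by simp
  have lv: "lattice_vec (\<lambda>i. - (int (Suc n) * z i)) = - (real (Suc n) *\<^sub>R lattice_vec z)"
    by (simp add: lattice_vec_def vec_eq_iff)
  have "reach V r (m + lattice_vec (\<lambda>i. - (int (Suc n) * z i))) y S"
    using reach_lattice[OF m, of "\<lambda>i. - (int (Suc n) * z i)"] unfolding lv by simp
  then show ?thesis by blast
qed

lemma maxdisp_props:
  assumes r: "1 \<le> r" "r \<le> 2" and S: "S > 0"
  shows maxdisp_ub: "reach V r x y S \<Longrightarrow> P \<bullet> (y - x) \<le> maxdisp r S"
    and maxdisp_abs: "\<bar>maxdisp r S\<bar> \<le> C * S"
    and maxdisp_attained: "e > 0 \<Longrightarrow> \<exists>x y. reach V r x y S \<and> maxdisp r S - e < P \<bullet> (y - x)"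
proof -
  let ?A = "{P \<bullet> (y - x) | x y. reach V r x y S}"
  obtain x0 where x0: "reach V r x0 0 S" using ex_reach_duration[OF r(1) S] by blast
  then have ne: "?A \<noteq> {}" by blast
  have bd: "\<bar>a\<bar> \<le> C * S" if a: "a \<in> ?A" for a using a disp_bound[OF _ r(2)] by blast
  have bdd: "bdd_above ?A" unfolding bdd_above_def using bd by (meson abs_le_D1)
  show "reach V r x y S \<Longrightarrow> P \<bullet> (y - x) \<le> maxdisp r S"
    unfolding maxdisp_def by (intro cSup_upper bdd) blast
  have "maxdisp r S \<le> C * S" unfolding maxdisp_def using bd by (intro cSup_least ne) (meson abs_le_D1)
  moreover have "- (C * S) \<le> P \<bullet> (0 - x0)" using disp_bound[OF x0 r(2)] by linarith
  moreover have "P \<bullet> (0 - x0) \<le> maxdisp r S" unfolding maxdisp_def using x0 by (intro cSup_upper bdd) blast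
  ultimately show "\<bar>maxdisp r S\<bar> \<le> C * S" by linarith
  show "\<exists>x y. reach V r x y S \<and> maxdisp r S - e < P \<bullet> (y - x)" if e: "e > 0"
  proof -
    have "maxdisp r S - e < Sup ?A" using e by (simp add: maxdisp_def)
    then obtain a where "a \<in> ?A" "maxdisp r S - e < a" using less_cSup_iff[OF ne bdd] by blast
    then show ?thesis by blast
  qed
qed

lemma crit_props:
  assumes r: "1 \<le> r" "r \<le> 2"
  shows crit_le: "S > 0 \<Longrightarrow> crit r \<le> maxdisp r S / S"
    and crit_abs: "\<bar>crit r\<bar> \<le> C"
    and crit_greatest: "(\<And>S. S > 0 \<Longrightarrow> c \<le> maxdisp r S / S) \<Longrightarrow> c \<le> crit r"
proof -
  let ?A = "{maxdisp r S / S | S. S > 0}"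
  have bd: "\<bar>maxdisp r S / S\<bar> \<le> C" if S: "S > 0" for S
    using maxdisp_abs[OF r S] S by (simp add: abs_divide pos_divide_le_eq)
  have bdd: "bdd_below ?A" unfolding bdd_below_def
  proof (intro exI[of _ "-C"] ballI)
    fix a assume "a \<in> ?A"
    then obtain S where "a = maxdisp r S / S" "S > 0" by blast
    with bd[of S] show "- C \<le> a" by linarith
  qed
  have ne: "?A \<noteq> {}" using zero_less_one by blast
  show le: "crit r \<le> maxdisp r S / S" if S: "S > 0" for S
    unfolding crit_def using S by (intro cInf_lower bdd) blast
  show g: "c \<le> crit r" if c: "\<And>S. S > 0 \<Longrightarrow> c \<le> maxdisp r S / S" for c
    unfolding crit_def using c by (intro cInf_greatest ne) blast
  have "- C \<le> crit r"
  proof (rule g)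
    fix S :: real assume "S > 0"
    from bd[OF this] show "- C \<le> maxdisp r S / S" by linarith
  qed
  moreover have "crit r \<le> C" using le[of 1] bd[of 1] by auto
  ultimately show "\<bar>crit r\<bar> \<le> C" by linarith
qed

lemma crit_mono:
  assumes r: "1 \<le> r" "r \<le> r'" "r' \<le> 2" shows "crit r \<le> crit r'"
proof (rule crit_greatest)
  fix S :: real assume S: "S > 0"
  have "maxdisp r S \<le> maxdisp r' S + e" if e: "e > 0" for e
  proof -
    obtain x y where "reach V r x y S" "maxdisp r S - e < P \<bullet> (y - x)" using maxdisp_attained[of r S e] r S e by auto
    moreover from this have "P \<bullet> (y - x) \<le> maxdisp r' S" using r S reach_mono by (intro maxdisp_ub) auto
    ultimately show ?thesis by simp
  qed
  then have "maxdisp r S \<le> maxdisp r' S" by (rule field_le_epsilon)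
  then have "maxdisp r S / S \<le> maxdisp r' S / S" using S by (simp add: divide_right_mono)
  then show "crit r \<le> maxdisp r' S / S" using crit_le[of r S] r S by linarith
qed (use r in auto)

text \<open>Subadditivity in the form used for loops: pieces of duration \<open>S\<close> are cut
  off one by one, each with displacement at most \<open>maxdisp r S\<close>.\<close>

lemma disp_chop:
  assumes r: "1 \<le> r" "r \<le> 2" and S: "S > 0" and R: "reach V r x y U" "real m * S < U"
  shows "\<exists>w. reach V r w y (U - real m * S) \<and> P \<bullet> (w - x) \<le> real m * maxdisp r S"
  using R(2)
proof (induction m)
  case 0
  then show ?case using R(1) by (intro exI[of _ x]) simp
next
  case (Suc m)
  have "real m * S < U" using Suc.prems S by (simp add: algebra_simps)
  with Suc.IH obtain w where w: "reach V r w y (U - real m * S)" "P \<bullet> (w - x) \<le> real m * maxdisp r S" by blast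
  have "S < U - real m * S" using Suc.prems by (simp add: algebra_simps)
  from reach_split[OF w(1) S this] obtain k where k: "reach V r w k S" "reach V r k y (U - real m * S - S)" by blast
  have "P \<bullet> (k - w) \<le> maxdisp r S" using maxdisp_ub[OF r S k(1)] .
  moreover have "P \<bullet> (k - x) = P \<bullet> (k - w) + P \<bullet> (w - x)" by (simp add: inner_diff_right)
  ultimately have "P \<bullet> (k - x) \<le> real (Suc m) * maxdisp r S" using w(2) by (simp add: algebra_simps)
  then show ?case using k(2) by (intro exI[of _ k]) (simp add: algebra_simps)
qed

text \<open>Repeating the loop multiplies its gain over the rate \<open>maxdisp r S / S\<close> by
  the number of rounds, while chopping into pieces of duration \<open>S\<close> leaves an error
  independent of that number. So there is no gain, for any \<open>S\<close>, and \<open>crit\<close>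
  is the infimum of these rates.\<close>

lemma loop_le_crit:
  assumes r: "1 \<le> r" "r \<le> 2" and loop: "reach V r x (x + lattice_vec z) T"
  shows "P \<bullet> lattice_vec z \<le> crit r * T"
proof -
  have T: "T > 0" using reach_pos[OF loop] .
  have "P \<bullet> lattice_vec z / T \<le> crit r"
  proof (rule crit_greatest[OF r])
    fix S :: real assume S: "S > 0"
    define D where "D = P \<bullet> lattice_vec z - T * (maxdisp r S / S)"
    have le: "real (Suc n) * D \<le> \<bar>maxdisp r S\<bar> + C * S" for n
    proof -
      define U where "U = real (Suc n) * T"
      have U: "U > 0" using T by (simp add: U_def)
      have R: "reach V r x (x + real (Suc n) *\<^sub>R lattice_vec z) U" using long_loop[OF r(1) loop, of n] by (simp only: U_def)
      \<comment> \<open>Largest number of full pieces with a remainder in \<open>(0, S]\<close>: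
        trajectories have positive duration, so nothing may remain of length 0.\<close>
      define m where "m = nat (\<lceil>U / S\<rceil> - 1)"
      have c1: "\<lceil>U / S\<rceil> \<ge> 1" using U S by (simp add: one_le_ceiling)
      have m: "real m < U / S" "U / S \<le> real m + 1"
      proof -
        have "real m = real_of_int \<lceil>U / S\<rceil> - 1" using c1 by (simp add: m_def)
        then show "real m < U / S" "U / S \<le> real m + 1" using ceiling_correct[of "U/S"] by linarith+
      qed
      have mS: "real m * S < U" "U \<le> (real m + 1) * S" using m S by (simp_all add: pos_less_divide_eq pos_divide_le_eq)
      obtain w where w: "reach V r w (x + real (Suc n) *\<^sub>R lattice_vec z) (U - real m * S)" "P \<bullet> (w - x) \<le> real m * maxdisp r S"
        using disp_chop[OF r S R mS(1)] by blast
      have 1: "P \<bullet> (x + real (Suc n) *\<^sub>R lattice_vec z - w) \<le> C * (U - real m * S)"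
        using disp_bound[OF w(1) r(2)] by simp
      have 2: "C * (U - real m * S) \<le> C * S" using mS C_nonneg by (intro mult_left_mono) (auto simp: algebra_simps)
      have 3: "real m * maxdisp r S \<le> (U / S) * maxdisp r S + \<bar>maxdisp r S\<bar>"
      proof -
        have "\<bar>(real m - U / S) * maxdisp r S\<bar> \<le> 1 * \<bar>maxdisp r S\<bar>"
          unfolding abs_mult using m by (intro mult_right_mono) auto
        then show ?thesis by (simp add: left_diff_distrib)
      qed
      have "real (Suc n) * (P \<bullet> lattice_vec z) = P \<bullet> (x + real (Suc n) *\<^sub>R lattice_vec z - w) + P \<bullet> (w - x)"
        by (simp add: inner_diff_right inner_add_right)
      also have "\<dots> \<le> C * S + ((U / S) * maxdisp r S + \<bar>maxdisp r S\<bar>)" using 1 2 3 w(2) by linarith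
      finally have "real (Suc n) * (P \<bullet> lattice_vec z) - real (Suc n) * (T * (maxdisp r S / S)) \<le> C * S + \<bar>maxdisp r S\<bar>"
        by (simp add: U_def mult_ac del: of_nat_Suc)
      then show ?thesis by (simp add: D_def right_diff_distrib del: of_nat_Suc)
    qed
    have "D \<le> 0"
    proof (rule ccontr)
      assume "\<not> D \<le> 0"
      then obtain n where "\<bar>maxdisp r S\<bar> + C * S < real n * D" using reals_Archimedean3[of D] by auto
      then have "\<bar>maxdisp r S\<bar> + C * S < real (Suc n) * D" using \<open>\<not> D \<le> 0\<close> by (simp add: algebra_simps)
      with le[of n] show False by linarith
    qed
    then show "P \<bullet> lattice_vec z / T \<le> maxdisp r S / S" using T by (simp add: D_def pos_divide_le_eq mult.commute)
  qed
  then show ?thesis using T by (simp add: pos_divide_le_eq)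
qed

text \<open>Any trajectory closes to a loop modulo the lattice within extra time \<open>T0\<close>;
  the closing piece costs at most \<open>C * T0\<close> in displacement and as much in
  \<open>crit r\<close> times its duration.\<close>

lemma disp_le_crit:
  assumes r: "1 \<le> r" "r \<le> 2" and R: "reach V r x y T"
  shows "P \<bullet> (y - x) \<le> crit r * T + 2 * C * T0"
proof -
  obtain S z where S: "S \<le> T0" "S > 0" "reach V r y (x + lattice_vec z) S" using obtain_reach[OF r(1)] by blast
  have 1: "P \<bullet> lattice_vec z \<le> crit r * (T + S)" using loop_le_crit[OF r reach_trans[OF S(3) R]] .
  have 2: "\<bar>P \<bullet> (x + lattice_vec z - y)\<bar> \<le> C * S" using disp_bound[OF S(3) r(2)] .
  have 3: "C * S \<le> C * T0" using S C_nonneg by (intro mult_left_mono) auto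
  have 4: "crit r * S \<le> C * S" using crit_abs[OF r] S by (intro mult_right_mono) auto
  have "P \<bullet> (y - x) = P \<bullet> lattice_vec z - P \<bullet> (x + lattice_vec z - y)" by (simp add: inner_diff_right inner_add_right)
  then show ?thesis using 1 2 3 4 by (simp add: distrib_left)
qed

text \<open>Near-optimal trajectories exist because \<open>crit r * S \<le> maxdisp r S\<close>;
  steering their end to \<open>x\<close> modulo the lattice costs at most \<open>2 * C * T0\<close>,
  and the 1 is the slack in the supremum.\<close>

lemma ex_good_long_path:
  assumes r: "1 \<le> r" "r \<le> 2" and S: "S > 0"
  shows "\<exists>y T. T \<ge> S \<and> reach V r y x T \<and> crit r * T - P \<bullet> (x - y) \<le> 2 * C * T0 + 1"
proof -
  obtain a b where ab: "reach V r a b S" "maxdisp r S - 1 < P \<bullet> (b - a)" using maxdisp_attained[OF r S zero_less_one] by blast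
  have m: "crit r * S \<le> maxdisp r S" using crit_le[OF r S] S by (simp add: pos_le_divide_eq)
  obtain U z where U: "U \<le> T0" "U > 0" "reach V r b (x + lattice_vec z) U" using obtain_reach[OF r(1)] by blast
  have R: "reach V r (a - lattice_vec z) x (S + U)"
    using reach_lattice[OF reach_trans[OF U(3) ab(1)], of "\<lambda>i. - z i"] by (simp add: lattice_vec_minus)
  have 2: "\<bar>P \<bullet> (x + lattice_vec z - b)\<bar> \<le> C * U" using disp_bound[OF U(3) r(2)] .
  have 3: "C * U \<le> C * T0" using U C_nonneg by (intro mult_left_mono) auto
  have 4: "crit r * U \<le> C * U" using crit_abs[OF r] U by (intro mult_right_mono) auto
  have "P \<bullet> (x - (a - lattice_vec z)) = P \<bullet> (x + lattice_vec z - b) + P \<bullet> (b - a)" by (simp add: inner_diff_right inner_add_right)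
  then have "crit r * (S + U) - P \<bullet> (x - (a - lattice_vec z)) \<le> 2 * C * T0 + 1"
    using 2 3 4 m ab(2) by (simp add: distrib_left)
  then show ?thesis using R U by (intro exI[of _ "a - lattice_vec z"] exI[of _ "S + U"]) auto
qed

text \<open>Value function: the infimum of \<open>crit r * T\<close> minus the displacement along
  \<open>P\<close>, over trajectories from lattice points to \<open>x\<close>. It is bounded below
  by \<open>disp_le_crit\<close> and above by one trajectory of duration at most \<open>T0\<close>;
  appending a segment gives \<open>ctrl_sub\<close>. Upper semicontinuity holds because the end of a
  trajectory can be moved with its duration fixed.\<close>

lemma ex_crit_subsol:
  assumes r: "1 \<le> r" "r \<le> 2"
  shows "\<exists>u. upper_semicont u \<and> bounded (range u) \<and> zn_periodic u \<and> ctrl_sub V r P (crit r) u"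
proof -
  define A where "A x = {crit r * T - P \<bullet> (x - lattice_vec z) | T z. reach V r (lattice_vec z) x T}" for x
  define u where "u x = Inf (A x)" for x
  have lo: "a \<ge> - (2 * C * T0)" if a: "a \<in> A x" for a x
    using a disp_le_crit[OF r] unfolding A_def by fastforce
  have bdd: "bdd_below (A x)" for x using lo unfolding bdd_below_def by blast
  have up: "\<exists>a\<in>A x. a \<le> 2 * C * T0" for x
  proof -
    obtain S z where S: "S \<le> T0" "S > 0" "reach V r 0 (x + lattice_vec z) S" using obtain_reach[OF r(1)] by blast
    have R: "reach V r (lattice_vec (\<lambda>i. - z i)) x S" using reach_lattice[OF S(3), of "\<lambda>i. - z i"] by (simp add: lattice_vec_minus)
    have 2: "\<bar>P \<bullet> (x - lattice_vec (\<lambda>i. - z i))\<bar> \<le> C * S" using disp_bound[OF R r(2)] .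
    have 3: "C * S \<le> C * T0" using S C_nonneg by (intro mult_left_mono) auto
    have 4: "crit r * S \<le> C * S" using crit_abs[OF r] S by (intro mult_right_mono) auto
    have "crit r * S - P \<bullet> (x - lattice_vec (\<lambda>i. - z i)) \<in> A x" using R unfolding A_def by blast
    moreover have "crit r * S - P \<bullet> (x - lattice_vec (\<lambda>i. - z i)) \<le> 2 * C * T0" using 2 3 4 by linarith
    ultimately show ?thesis by blast
  qed
  have ne: "A x \<noteq> {}" for x using up by blast
  have u_le: "u x \<le> a" if "a \<in> A x" for a x unfolding u_def using that by (intro cInf_lower bdd)
  have u_at: "\<exists>a\<in>A x. a < u x + e" if e: "e > 0" for x e
  proof -
    have "Inf (A x) < u x + e" using e by (simp add: u_def)
    then show ?thesis using cInf_less_iff[OF ne bdd] by blast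
  qed
  have "upper_semicont u" unfolding upper_semicont_iff
  proof (intro allI impI)
    fix x and e :: real assume e: "e > 0"
    obtain T z where Tz: "reach V r (lattice_vec z) x T" "crit r * T - P \<bullet> (x - lattice_vec z) < u x + e/2"
      using u_at[of "e/2" x] e unfolding A_def by auto
    obtain d where d: "d > 0" "\<And>y. y \<in> ball x d \<Longrightarrow> reach V r (lattice_vec z) y T" using reach_end_open[OF Tz(1)] by blast
    define d' where "d' = min d (e / (2 * (norm P + 1)))"
    have nP: "norm P + 1 > 0" by (simp add: add_nonneg_pos)
    have "d' > 0" using d e nP by (simp add: d'_def)
    moreover have "u y < u x + e" if y: "dist y x < d'" for y
    proof -
      have "reach V r (lattice_vec z) y T" using d(2)[of y] y by (simp add: d'_def dist_commute)
      then have 1: "u y \<le> crit r * T - P \<bullet> (y - lattice_vec z)" by (intro u_le) (auto simp: A_def)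
      have "\<bar>P \<bullet> (x - y)\<bar> \<le> norm P * norm (x - y)" by (rule Cauchy_Schwarz_ineq2)
      also have "\<dots> \<le> (norm P + 1) * d'" using y by (intro mult_mono) (auto simp: dist_norm norm_minus_commute)
      also have "\<dots> \<le> (norm P + 1) * (e / (2 * (norm P + 1)))" using nP by (intro mult_left_mono) (auto simp: d'_def)
      also have "\<dots> = e / 2" using nP by (simp add: field_simps)
      finally have "P \<bullet> (x - y) \<le> e / 2" by simp
      then show ?thesis using 1 Tz(2) by (simp add: inner_diff_right)
    qed
    ultimately show "\<exists>d>0. \<forall>y. dist y x < d \<longrightarrow> u y < u x + e" by blast
  qed
  moreover have "bounded (range u)"
  proof -
    have "u x \<le> 2 * C * T0" "u x \<ge> - (2 * C * T0)" for x
    proof -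
      obtain a where "a \<in> A x" "a \<le> 2 * C * T0" using up by blast
      then show "u x \<le> 2 * C * T0" using u_le by (meson order_trans)
      show "u x \<ge> - (2 * C * T0)" unfolding u_def using lo by (intro cInf_greatest ne)
    qed
    then have "\<forall>y\<in>range u. norm y \<le> 2 * C * T0" by (auto simp: abs_le_iff minus_le_iff)
    then show ?thesis unfolding bounded_iff by blast
  qed
  moreover have "zn_periodic u"
  proof -
    have sub: "A x \<subseteq> A (x + lattice_vec w)" for x w
    proof
      fix a assume "a \<in> A x"
      then obtain T z where a: "a = crit r * T - P \<bullet> (x - lattice_vec z)" "reach V r (lattice_vec z) x T" by (auto simp: A_def)
      have "reach V r (lattice_vec (\<lambda>i. z i + w i)) (x + lattice_vec w) T"
        using reach_lattice[OF a(2), of w] by (simp add: lattice_vec_add)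
      moreover have "a = crit r * T - P \<bullet> (x + lattice_vec w - lattice_vec (\<lambda>i. z i + w i))"
        by (simp add: a(1) lattice_vec_add)
      ultimately show "a \<in> A (x + lattice_vec w)" unfolding A_def by blast
    qed
    have "A (x + lattice_vec w) = A x" for x w
      using sub[of x w] sub[of "x + lattice_vec w" "\<lambda>i. - w i"] by (simp add: lattice_vec_minus)
    then show ?thesis by (simp add: zn_periodic_def u_def)
  qed
  moreover have "ctrl_sub V r P (crit r) u" unfolding ctrl_sub_def
  proof (intro allI impI)
    fix x q t assume adm: "adm V r x q t"
    have "u (x + t *\<^sub>R q) + t * (P \<bullet> q) \<le> (u x + crit r * t) + e" if e: "e > 0" for e
    proof -
      obtain T z where Tz: "reach V r (lattice_vec z) x T" "crit r * T - P \<bullet> (x - lattice_vec z) < u x + e"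
        using u_at[OF e, of x] unfolding A_def by auto
      have "crit r * (T + t) - P \<bullet> (x + t *\<^sub>R q - lattice_vec z) \<in> A (x + t *\<^sub>R q)"
        using reach.reach_step[OF Tz(1) adm] unfolding A_def by blast
      from u_le[OF this] Tz(2) show ?thesis by (simp add: inner_diff_right inner_add_right distrib_left)
    qed
    then show "u (x + t *\<^sub>R q) + t * (P \<bullet> q) \<le> u x + crit r * t" by (rule field_le_epsilon)
  qed
  ultimately show ?thesis by blast
qed

end

section \<open>The limiting supersolution\<close>

text \<open>Mean value theorem on each segment. The distance condition refers to the end point
  \<open>y\<close>: going backwards at speed at most \<open>B + r\<close> then keeps the whole
  trajectory in the ball.\<close>

lemma (in flow) reach_test_increment:
  assumes C1: "C1_test \<phi> D" and r: "r \<ge> 0"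
    and le: "\<And>x q. x \<in> cball x0 \<rho> \<Longrightarrow> norm (q - V x) < r \<Longrightarrow> (D x + P) \<bullet> q \<le> \<kappa>"
    and R: "reach V r x y T" and d: "dist y x0 + (B + r) * T \<le> \<rho>"
  shows "\<phi> y + P \<bullet> y - (\<phi> x + P \<bullet> x) \<le> \<kappa> * T"
proof -
  have seg: "\<phi> (x + t *\<^sub>R q) + P \<bullet> (x + t *\<^sub>R q) - (\<phi> x + P \<bullet> x) \<le> \<kappa> * t"
    if adm: "adm V r x q t" and ds: "dist (x + t *\<^sub>R q) x0 + (B + r) * t \<le> \<rho>" for x q t
  proof -
    have t: "t > 0" using adm by (simp add: adm_def)
    define h where "h s = \<phi> (x + s *\<^sub>R q) + (P \<bullet> x + (P \<bullet> q) * s)" for s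
    have "(h has_real_derivative (D (x + s *\<^sub>R q) \<bullet> q + (0 + (P \<bullet> q) * 1))) (at s)" for s
      unfolding h_def by (intro DERIV_add C1_test_line[OF C1] DERIV_const DERIV_cmult DERIV_ident)
    then have "\<exists>z>0. z < t \<and> h t - h 0 = (t - 0) * (D (x + z *\<^sub>R q) \<bullet> q + (0 + (P \<bullet> q) * 1))"
      using t by (intro MVT2) auto
    then obtain z where z: "0 < z" "z < t" "h t - h 0 = t * ((D (x + z *\<^sub>R q) + P) \<bullet> q)" by (auto simp: inner_add_left)
    have "x + z *\<^sub>R q \<in> cball x0 \<rho>"
    proof -
      have "dist (x + z *\<^sub>R q) (x + t *\<^sub>R q) = (t - z) * norm q"
        using z by (simp add: dist_norm scaleR_diff_left[symmetric])
      also have "\<dots> \<le> t * (B + r)" using z adm_speed[OF adm] by (intro mult_mono) auto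
      finally show ?thesis using ds dist_triangle[of x0 "x + z *\<^sub>R q" "x + t *\<^sub>R q"] by (simp add: dist_commute mult.commute)
    qed
    moreover have "norm (q - V (x + z *\<^sub>R q)) < r" using adm z by (simp add: adm_def)
    ultimately have "(D (x + z *\<^sub>R q) + P) \<bullet> q \<le> \<kappa>" by (rule le)
    then have "h t - h 0 \<le> \<kappa> * t" unfolding z(3) using t by (simp add: mult.commute)
    then show ?thesis by (simp add: h_def inner_add_right mult.commute)
  qed
  from R d show ?thesis
  proof (induction rule: reach.induct)
    case (reach_one q t)
    then show ?case by (rule seg)
  next
    case (reach_step y T q t)
    have T: "T > 0" "t > 0" using reach_pos[OF reach_step(1)] reach_step(2) by (auto simp: adm_def)
    have "norm (t *\<^sub>R q) \<le> (B + r) * t" using adm_speed[OF reach_step(2)] T mult_right_mono[of "norm q" "B + r" t] by (simp add: mult.commute)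
    then have "dist y x0 \<le> dist (y + t *\<^sub>R q) x0 + (B + r) * t"
      using dist_triangle[of y x0 "y + t *\<^sub>R q"] by (simp add: dist_norm)
    then have "\<phi> y + P \<bullet> y - (\<phi> x + P \<bullet> x) \<le> \<kappa> * T" using reach_step by (intro reach_step.IH) (simp add: distrib_left)
    moreover have "(B + r) * T \<ge> 0" using T B_nonneg r by simp
    then have "\<phi> (y + t *\<^sub>R q) + P \<bullet> (y + t *\<^sub>R q) - (\<phi> y + P \<bullet> y) \<le> \<kappa> * t"
      using reach_step.prems by (intro seg reach_step(2)) (simp add: distrib_left)
    ultimately show ?case by (simp add: distrib_left)
  qed
qed

context ctrl_flow begin

definition rad where "rad n = 1 + 1 / real (Suc n)"
definition lam where "lam n = crit (rad n)"
definition clim where "clim = lim lam"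

lemma rad: "1 \<le> rad n" "1 < rad n" "rad n \<le> 2" by (auto simp: rad_def)

lemma lam_lim: "lam \<longlonglongrightarrow> clim" and lam_ge: "clim \<le> lam n"
proof -
  have "decseq lam"
  proof (rule decseq_SucI)
    fix n
    have "1 / real (Suc (Suc n)) \<le> 1 / real (Suc n)" by (intro divide_left_mono) auto
    then have "rad (Suc n) \<le> rad n" by (simp only: rad_def)
    then show "lam (Suc n) \<le> lam n" unfolding lam_def using rad by (intro crit_mono) auto
  qed
  moreover have "- C \<le> lam n" for n using crit_abs[OF rad(1) rad(3), of n] by (simp add: lam_def)
  ultimately obtain l where l: "lam \<longlonglongrightarrow> l" "\<And>n. l \<le> lam n" using decseq_convergent[of lam "-C"] by blast
  then have "clim = l" unfolding clim_def by (intro limI)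
  with l show "lam \<longlonglongrightarrow> clim" "clim \<le> lam n" by auto
qed

text \<open>Half-relaxed lower limit of costs as the radius tends to 1 and the duration to infinity.
  Long durations allow the final piece of a near-optimal trajectory to be removed without leaving
  the family, which is the dynamic programming step behind the supersolution property. Radii above 1
  are kept until the limit, so that the level is \<open>clim\<close>, the limit of the levels
  \<open>lam n\<close> of the mollified subsolutions.\<close>

lemma ex_limit_supersol:
  "\<exists>v. lower_semicont v \<and> bounded (range v) \<and> zn_periodic v \<and> visc_supersol (ham V) P clim v"
proof -
  \<comment> \<open>Costs of trajectories with radius index and duration at least \<open>m\<close>
    that end within \<open>1 / (m + 1)\<close> of \<open>x\<close>. The sets shrink as
    \<open>m\<close> grows, so \<open>v\<close> is the increasing limit of their infima.\<close>
  define A where "A m x = {lam n * T - P \<bullet> (y - y0) | n T y y0. n \<ge> m \<and> T \<ge> real m \<and> reach V (rad n) y0 y T \<and> dist y x < 1 / real (Suc m)}" for m x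
  define I where "I m x = Inf (A m x)" for m x
  define v where "v x = (SUP m. I m x)" for x
  have lo: "- (2 * C * T0) \<le> a" if a: "a \<in> A m x" for a m x
  proof -
    obtain n T y y0 where *: "a = lam n * T - P \<bullet> (y - y0)" "reach V (rad n) y0 y T" using a unfolding A_def by blast
    then show ?thesis using disp_le_crit[OF rad(1) rad(3) *(2)] by (simp add: lam_def)
  qed
  have up: "\<exists>a\<in>A m x. a \<le> 2 * C * T0 + 1" for m x
  proof -
    obtain y T where y: "T \<ge> real (Suc m)" "reach V (rad m) y x T" "crit (rad m) * T - P \<bullet> (x - y) \<le> 2 * C * T0 + 1"
      using ex_good_long_path[OF rad(1) rad(3), of "real (Suc m)" m x] by auto
    have "lam m * T - P \<bullet> (x - y) \<in> A m x" unfolding A_def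
      using y by (intro CollectI exI[of _ m] exI[of _ T] exI[of _ x] exI[of _ y]) auto
    then show ?thesis using y(3) by (auto simp: lam_def)
  qed
  have ne: "A m x \<noteq> {}" for m x using up by blast
  have bdd: "bdd_below (A m x)" for m x using lo unfolding bdd_below_def by blast
  have I_le: "I m x \<le> a" if "a \<in> A m x" for a m x unfolding I_def using that by (intro cInf_lower bdd)
  have I_bd: "- (2 * C * T0) \<le> I m x" "I m x \<le> 2 * C * T0 + 1" for m x
  proof -
    show "- (2 * C * T0) \<le> I m x" unfolding I_def using lo by (intro cInf_greatest ne)
    obtain a where "a \<in> A m x" "a \<le> 2 * C * T0 + 1" using up by blast
    then show "I m x \<le> 2 * C * T0 + 1" using I_le by (meson order_trans)
  qed
  have bddI: "bdd_above (range (\<lambda>m. I m x))" for x using I_bd(2) unfolding bdd_above_def by blast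
  have I_v: "I m x \<le> v x" for m x unfolding v_def by (intro cSUP_upper bddI) simp
  have v_le: "v x \<le> a" if "\<And>m. I m x \<le> a" for x a unfolding v_def using that by (intro cSUP_least) auto
  have v_at: "\<exists>m. v x - e < I m x" if e: "e > 0" for x e
  proof (rule ccontr)
    assume "\<not> ?thesis"
    then have "v x \<le> v x - e" by (intro v_le) (simp add: not_less)
    then show False using e by simp
  qed
  have "lower_semicont v" unfolding lower_semicont_iff upper_semicont_iff
  proof (intro allI impI)
    fix x and e :: real assume e: "e > 0"
    obtain m where m: "v x - e < I m x" using v_at[OF e] by blast
    \<comment> \<open>Twice \<open>1 / (k + 1)\<close> is \<open>1 / (m + 1)\<close>, as the
      triangle inequality requires.\<close>
    define k where "k = Suc (2 * m)"
    have dk: "1 / real (Suc k) + 1 / real (Suc k) = 1 / real (Suc m)" by (simp add: k_def field_simps)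
    have "A k y \<subseteq> A m x" if y: "dist y x < 1 / real (Suc k)" for y
    proof
      fix a assume "a \<in> A k y"
      then obtain n T z y0 where *: "a = lam n * T - P \<bullet> (z - y0)" "n \<ge> k" "T \<ge> real k" "reach V (rad n) y0 z T" "dist z y < 1 / real (Suc k)"
        unfolding A_def by blast
      have "dist z x < 1 / real (Suc m)" using *(5) y dist_triangle[of z x y] dk by linarith
      moreover have "n \<ge> m" "T \<ge> real m" using * by (auto simp: k_def)
      ultimately show "a \<in> A m x" unfolding A_def using * by blast
    qed
    then have "I m x \<le> I k y" if "dist y x < 1 / real (Suc k)" for y
      unfolding I_def using that by (intro cInf_superset_mono ne bdd)
    then have "- v y < - v x + e" if "dist y x < 1 / real (Suc k)" for y using that m I_v[of k y] by fastforce
    then show "\<exists>d>0. \<forall>y. dist y x < d \<longrightarrow> - v y < - v x + e" by (intro exI[of _ "1 / real (Suc k)"]) auto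
  qed
  moreover have "bounded (range v)"
  proof -
    have "\<bar>v x\<bar> \<le> 2 * C * T0 + 1" for x
    proof -
      have "- (2 * C * T0) \<le> v x" using I_bd(1)[of 0 x] I_v[of 0 x] by linarith
      moreover have "v x \<le> 2 * C * T0 + 1" using I_bd(2) by (rule v_le)
      ultimately show ?thesis by linarith
    qed
    then have "\<forall>y\<in>range v. norm y \<le> 2 * C * T0 + 1" by auto
    then show ?thesis unfolding bounded_iff by blast
  qed
  moreover have "zn_periodic v"
  proof -
    have sub: "A m x \<subseteq> A m (x + lattice_vec w)" for m x w
    proof
      fix a assume "a \<in> A m x"
      then obtain n T z y0 where *: "a = lam n * T - P \<bullet> (z - y0)" "n \<ge> m" "T \<ge> real m" "reach V (rad n) y0 z T" "dist z x < 1 / real (Suc m)"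
        unfolding A_def by blast
      have "reach V (rad n) (y0 + lattice_vec w) (z + lattice_vec w) T" using reach_lattice[OF *(4)] .
      moreover have "a = lam n * T - P \<bullet> (z + lattice_vec w - (y0 + lattice_vec w))" by (simp add: *(1))
      moreover have "dist (z + lattice_vec w) (x + lattice_vec w) < 1 / real (Suc m)" using *(5) by (simp add: dist_norm)
      ultimately show "a \<in> A m (x + lattice_vec w)" unfolding A_def using *(2,3) by blast
    qed
    have "A m (x + lattice_vec w) = A m x" for m x w
      using sub[of m x w] sub[of m "x + lattice_vec w" "\<lambda>i. - w i"] by (simp add: lattice_vec_minus)
    then show ?thesis by (simp add: zn_periodic_def v_def I_def)
  qed
  moreover have "visc_supersol (ham V) P clim v" unfolding visc_supersol_def
  proof (intro allI impI, elim conjE exE, rule ccontr)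
    fix \<phi> D x0 \<rho>
    assume C1: "C1_test \<phi> D" and rho: "\<rho> > 0" and touch: "\<forall>y\<in>ball x0 \<rho>. v x0 - \<phi> x0 \<le> v y - \<phi> y"
      and neg: "\<not> clim \<le> ham V x0 (D x0 + P)"
    have contD: "continuous_on UNIV D" and contphi: "continuous_on UNIV \<phi>"
      using C1 by (auto simp: C1_test_def intro!: has_derivative_continuous_on intro: has_derivative_at_withinI)
    \<comment> \<open>The deficit at \<open>x0\<close> is four times \<open>\<eta>\<close>: one part
      is spent on continuity in \<open>x\<close>, one on the excess of the radius over 1, and two
      remain.\<close>
    define \<eta> where "\<eta> = (clim - ham V x0 (D x0 + P)) / 4"
    have eta: "\<eta> > 0" using neg by (simp add: \<eta>_def)
    have "continuous_on UNIV (\<lambda>x. ham V x (D x + P))" unfolding ham_def by (intro continuous_intros contD V_cont)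
    then have i1: "isCont (\<lambda>x. ham V x (D x + P)) x0" by (simp add: continuous_on_eq_continuous_at)
    have "continuous_on UNIV (\<lambda>x. norm (D x + P))" by (intro continuous_intros contD)
    then have i2: "isCont (\<lambda>x. norm (D x + P)) x0" by (simp add: continuous_on_eq_continuous_at)
    obtain d1 where d1: "d1 > 0" "\<And>x. dist x x0 < d1 \<Longrightarrow> dist (ham V x (D x + P)) (ham V x0 (D x0 + P)) < \<eta>"
      using i1 eta unfolding continuous_at_eps_delta by blast
    obtain d2 where d2: "d2 > 0" "\<And>x. dist x x0 < d2 \<Longrightarrow> dist (norm (D x + P)) (norm (D x0 + P)) < 1"
      using i2 zero_less_one unfolding continuous_at_eps_delta by blast
    define K where "K = norm (D x0 + P) + 1"
    define \<rho>1 where "\<rho>1 = min \<rho> (min d1 d2) / 2"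
    have rho1: "\<rho>1 > 0" "\<rho>1 < \<rho>" "\<rho>1 < d1" "\<rho>1 < d2" using rho d1 d2 by (auto simp: \<rho>1_def)
    have "\<eta> / K > 0" using eta by (simp add: K_def add_nonneg_pos)
    then obtain n0 where n0: "1 / real (Suc n0) < \<eta> / K" using nat_approx_posE by blast
    have K: "K > 0" by (simp add: K_def add_nonneg_pos)
    have key: "(D x + P) \<bullet> q \<le> clim - 2 * \<eta>" if n: "n \<ge> n0" and x: "x \<in> cball x0 \<rho>1" and q: "norm (q - V x) < rad n" for n x q
    proof -
      have dx: "dist x x0 < d1" "dist x x0 < d2" using x rho1 by (auto simp: dist_commute)
      have 1: "ham V x (D x + P) \<le> clim - 3 * \<eta>" 
      proof -
        have gen: "x = h + 4 * ((x - h) / 4)" for x h :: real by (simp add: field_simps)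
        have "clim = ham V x0 (D x0 + P) + 4 * \<eta>" unfolding \<eta>_def by (rule gen)
        then show ?thesis using d1(2)[OF dx(1)] unfolding dist_real_def by linarith
      qed
      have 2: "norm (D x + P) \<le> K" using d2(2)[OF dx(2)] by (auto simp: K_def dist_real_def)
      have "(D x + P) \<bullet> (q - V x) \<le> norm (D x + P) * norm (q - V x)" by (rule norm_cauchy_schwarz)
      also have "\<dots> \<le> norm (D x + P) * rad n" using q by (intro mult_left_mono) auto
      also have "\<dots> = norm (D x + P) + norm (D x + P) * (1 / real (Suc n))" by (simp add: rad_def distrib_left del: of_nat_Suc)
      also have "norm (D x + P) * (1 / real (Suc n)) \<le> K * (1 / real (Suc n0))"
        using n 2 K by (intro mult_mono divide_left_mono) auto
      also have "K * (1 / real (Suc n0)) \<le> K * (\<eta> / K)" using n0 K by (intro mult_left_mono) auto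
      also have "\<dots> = \<eta>" using K by simp
      finally have "(D x + P) \<bullet> (q - V x) \<le> norm (D x + P) + \<eta>" by simp
      then show ?thesis using 1 by (simp add: ham_def inner_diff_right)
    qed
    \<comment> \<open>A time in which no trajectory of radius at most 2 moves farther than
      \<open>\<rho>1 / 4\<close>.\<close>
    define \<tau> where "\<tau> = \<rho>1 / (4 * (B + 2))"
    have B2: "B + 2 > 0" using B_nonneg by simp
    have tau: "\<tau> > 0" "(B + 2) * \<tau> = \<rho>1 / 4"
    proof -
      show "\<tau> > 0" using rho1 B2 by (simp add: \<tau>_def)
      have "(B + 2) * \<tau> = ((B + 2) * \<rho>1) / ((B + 2) * 4)" by (simp only: \<tau>_def times_divide_eq_right mult.commute[of 4])
      also have "\<dots> = \<rho>1 / 4" using B2 by (intro mult_divide_mult_cancel_left) simp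
      finally show "(B + 2) * \<tau> = \<rho>1 / 4" .
    qed
    have "\<exists>n T y y0. n \<ge> m \<and> T \<ge> real m \<and> reach V (rad n) y0 y T \<and> dist y x0 < 1 / real (Suc m) \<and>
       lam n * T - P \<bullet> (y - y0) < v x0 + 1 / real (Suc m)" for m
    proof -
      have "Inf (A m x0) < v x0 + 1 / real (Suc m)" using I_v[of m x0] unfolding I_def by (rule le_less_trans) simp
      then obtain a where "a \<in> A m x0" "a < v x0 + 1 / real (Suc m)" using cInf_less_iff[OF ne bdd] by blast
      then show ?thesis unfolding A_def by blast
    qed
    then obtain N T X Y where pick: "\<And>m. N m \<ge> m" "\<And>m. T m \<ge> real m" "\<And>m. reach V (rad (N m)) (Y m) (X m) (T m)"
      "\<And>m. dist (X m) x0 < 1 / real (Suc m)" "\<And>m. lam (N m) * T m - P \<bullet> (X m - Y m) < v x0 + 1 / real (Suc m)"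
      by metis
    have "\<rho>1 / 2 > 0" using rho1 by simp
    then obtain n1 where n1: "1 / real (Suc n1) < \<rho>1 / 2" using nat_approx_posE by blast
    obtain n2 where n2: "\<tau> < real n2" using reals_Archimedean2 by blast
    define m0 where "m0 = max n0 (max n1 n2)"
    \<comment> \<open>The final piece of duration \<open>\<tau>\<close> is removed. On it
      \<open>\<phi>\<close> plus \<open>P \<bullet> x\<close> grows by at most
      \<open>(clim - 2 * \<eta>) * \<tau>\<close>, while its duration was charged at least
      \<open>clim * \<tau>\<close>; relative to \<open>\<phi>\<close>, the shortened trajectory is
      cheaper by \<open>2 * \<eta> * \<tau>\<close>.\<close>
    have step: "\<exists>w. dist w x0 \<le> \<rho>1 * 3 / 4 \<and> reach V (rad (N m)) (Y m) w (T m - \<tau>) \<and>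
       lam (N m) * (T m - \<tau>) - P \<bullet> (w - Y m) \<le> v x0 + 1 / real (Suc m) - \<phi> (X m) + \<phi> w - 2 * \<eta> * \<tau>" if m: "m \<ge> m0" for m
    proof -
      have Tm: "\<tau> < T m" using pick(2)[of m] n2 m by (simp add: m0_def)
      obtain w where w: "reach V (rad (N m)) (Y m) w (T m - \<tau>)" "reach V (rad (N m)) w (X m) \<tau>"
        using reach_split[OF pick(3)[of m], of "T m - \<tau>"] Tm tau by auto
      have "1 / real (Suc m) \<le> 1 / real (Suc n1)" using m by (intro divide_left_mono) (auto simp: m0_def)
      then have dX: "dist (X m) x0 \<le> \<rho>1 / 2" using pick(4)[of m] n1 by linarith
      have sp: "(B + rad (N m)) * \<tau> \<le> \<rho>1 / 4" 
      proof -
        have "(B + rad (N m)) * \<tau> \<le> (B + 2) * \<tau>" using rad(3)[of "N m"] tau(1) by (intro mult_right_mono) auto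
        then show ?thesis unfolding tau(2) .
      qed
      have "dist w (X m) \<le> \<rho>1 / 4" using reach_speed[OF w(2)] sp by (simp add: dist_norm norm_minus_commute)
      then have dw: "dist w x0 \<le> \<rho>1 * 3 / 4" using dX dist_triangle[of w x0 "X m"] by simp
      have inc: "\<phi> (X m) + P \<bullet> X m - (\<phi> w + P \<bullet> w) \<le> (clim - 2 * \<eta>) * \<tau>"
      proof (rule reach_test_increment[OF C1 _ key w(2)])
        show "rad (N m) \<ge> 0" using rad(1)[of "N m"] by linarith
        show "N m \<ge> n0" using pick(1)[of m] m by (simp add: m0_def)
        show "dist (X m) x0 + (B + rad (N m)) * \<tau> \<le> \<rho>1" using dX sp rho1 by linarith
      qed
      have "clim * \<tau> \<le> lam (N m) * \<tau>" using lam_ge tau by (intro mult_right_mono) auto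
      then have "lam (N m) * (T m - \<tau>) - P \<bullet> (w - Y m) \<le> v x0 + 1 / real (Suc m) - \<phi> (X m) + \<phi> w - 2 * \<eta> * \<tau>"
        using inc pick(5)[of m] by (simp add: inner_diff_right left_diff_distrib right_diff_distrib del: of_nat_Suc)
      with w(1) dw show ?thesis by blast
    qed
    define XX YY TT NN where "XX j = X (j + m0)" and "YY j = Y (j + m0)" and "TT j = T (j + m0)" and "NN j = N (j + m0)" for j
    have "\<exists>w. dist w x0 \<le> \<rho>1 * 3 / 4 \<and> reach V (rad (NN j)) (YY j) w (TT j - \<tau>) \<and>
       lam (NN j) * (TT j - \<tau>) - P \<bullet> (w - YY j) \<le> v x0 + 1 / real (Suc (j + m0)) - \<phi> (XX j) + \<phi> w - 2 * \<eta> * \<tau>" for j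
      using step[of "j + m0"] by (simp add: XX_def YY_def TT_def NN_def)
    then obtain W where W: "\<And>j. dist (W j) x0 \<le> \<rho>1 * 3 / 4" "\<And>j. reach V (rad (NN j)) (YY j) (W j) (TT j - \<tau>)"
       "\<And>j. lam (NN j) * (TT j - \<tau>) - P \<bullet> (W j - YY j) \<le> v x0 + 1 / real (Suc (j + m0)) - \<phi> (XX j) + \<phi> (W j) - 2 * \<eta> * \<tau>"
      by metis
    have Wc: "\<forall>j. W j \<in> cball x0 (\<rho>1 * 3 / 4)" using W(1) by (simp add: dist_commute)
    obtain w s where ws: "w \<in> cball x0 (\<rho>1 * 3 / 4)" "strict_mono s" "(W \<circ> s) \<longlonglongrightarrow> w"
      using compact_cball[of x0 "\<rho>1 * 3 / 4"] Wc unfolding compact_def by metis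
    have Wl: "(\<lambda>j. W (s j)) \<longlonglongrightarrow> w" using ws(3) by (simp add: o_def)
    have XXl: "XX \<longlonglongrightarrow> x0"
    proof (rule metric_LIMSEQ_I)
      fix e :: real assume "e > 0"
      then obtain k where k: "1 / real (Suc k) < e" using nat_approx_posE by blast
      have "dist (XX j) x0 < e" if "j \<ge> k" for j
      proof -
        have "1 / real (Suc (j + m0)) \<le> 1 / real (Suc k)" using that by (intro divide_left_mono) auto
        then show ?thesis using pick(4)[of "j + m0"] k unfolding XX_def by linarith
      qed
      then show "\<exists>no. \<forall>n\<ge>no. dist (XX n) x0 < e" by blast
    qed
    have pl: "(\<lambda>j. \<phi> (f j)) \<longlonglongrightarrow> \<phi> l" if "f \<longlonglongrightarrow> l" for f l
      using continuous_on_tendsto_compose[OF contphi that] by simp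
    have X2: "(\<lambda>j. XX (s j)) \<longlonglongrightarrow> x0" using LIMSEQ_subseq_LIMSEQ[OF XXl ws(2)] by (simp add: o_def)
    have "(\<lambda>j. 1 / real (Suc (j + m0))) \<longlonglongrightarrow> 0"
      using LIMSEQ_ignore_initial_segment[OF LIMSEQ_Suc[OF lim_1_over_n], of m0] by simp
    from LIMSEQ_subseq_LIMSEQ[OF this ws(2)] have z: "(\<lambda>j. 1 / real (Suc (s j + m0))) \<longlonglongrightarrow> 0" by (simp only: o_def)
    have lim: "(\<lambda>j. v x0 + 1 / real (Suc (s j + m0)) - \<phi> (XX (s j)) + \<phi> (W (s j)) - 2 * \<eta> * \<tau>) \<longlonglongrightarrow> v x0 + 0 - \<phi> x0 + \<phi> w - 2 * \<eta> * \<tau>"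
      by (intro tendsto_intros z pl X2 Wl)
    \<comment> \<open>For fixed \<open>k\<close> the shortened trajectories eventually belong to
      \<open>A k w\<close>; this is where durations tending to infinity enter.\<close>
    have "I k w \<le> v x0 + 0 - \<phi> x0 + \<phi> w - 2 * \<eta> * \<tau>" for k
    proof (rule tendsto_lowerbound[OF lim _ sequentially_bot])
      obtain j1 where j1: "real k + \<tau> < real j1" using reals_Archimedean2 by blast
      have "1 / real (Suc k) > 0" by simp
      from eventually_ge_at_top[of "max k j1"] tendstoD[OF Wl this]
      show "\<forall>\<^sub>F j in sequentially. I k w \<le> v x0 + 1 / real (Suc (s j + m0)) - \<phi> (XX (s j)) + \<phi> (W (s j)) - 2 * \<eta> * \<tau>"
      proof eventually_elim
        case (elim j)
        have sj: "s j \<ge> max k j1" using seq_suble[OF ws(2), of j] elim(1) by linarith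
        have "NN (s j) \<ge> k" using pick(1)[of "s j + m0"] sj by (simp add: NN_def)
        moreover have "TT (s j) - \<tau> \<ge> real k" using pick(2)[of "s j + m0"] sj j1 by (simp add: TT_def)
        ultimately have "lam (NN (s j)) * (TT (s j) - \<tau>) - P \<bullet> (W (s j) - YY (s j)) \<in> A k w"
          unfolding A_def using W(2)[of "s j"] elim(2) by blast
        from I_le[OF this] W(3)[of "s j"] show ?case by linarith
      qed
    qed
    then have vw: "v w \<le> v x0 + 0 - \<phi> x0 + \<phi> w - 2 * \<eta> * \<tau>" by (rule v_le)
    have "w \<in> ball x0 \<rho>" using ws(1) rho1 by auto
    then have "v x0 - \<phi> x0 \<le> v w - \<phi> w" using touch by blast
    moreover have "\<eta> * \<tau> > 0" using eta tau by simp
    ultimately show False using vw by simp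
  qed
  ultimately show ?thesis by blast
qed

theorem ergodic_problem:
  "((\<lambda>k::nat. eff_ham (ham_k (real k) V) P) \<longlonglongrightarrow> eff_ham (ham V) P) \<and>
   (\<exists>c. eff_ham (ham V) P = ereal c \<and>
     (\<exists>u. upper_semicont u \<and> bounded (range u) \<and> zn_periodic u \<and> visc_subsol (ham V) P c u) \<and>
     (\<exists>v. lower_semicont v \<and> bounded (range v) \<and> zn_periodic v \<and> visc_supersol (ham V) P c v))"
proof -
  let ?S = "\<lambda>G. {ereal a | a. \<exists>u. upper_semicont u \<and> bounded (range u) \<and> zn_periodic u \<and> visc_subsol G P a u}"
  obtain v where v: "lower_semicont v" "bounded (range v)" "zn_periodic v" "visc_supersol (ham V) P clim v"
    using ex_limit_supersol by blast
  obtain u where u: "upper_semicont u" "bounded (range u)" "zn_periodic u" "ctrl_sub V 1 P (crit 1) u"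
    using ex_crit_subsol[of 1] by auto
  \<comment> \<open>An inequality between the two levels is enough: the subsolution at
    \<open>crit 1\<close> is also one at \<open>clim\<close>, and comparison with \<open>v\<close>
    forbids any level below \<open>clim\<close>.\<close>
  have "crit 1 \<le> lam n" for n unfolding lam_def using rad by (intro crit_mono) auto
  then have c1: "crit 1 \<le> clim" by (intro LIMSEQ_le_const[OF lam_lim]) auto
  have usub: "visc_subsol (ham V) P clim u"
    using visc_subsol_mono[OF ctrl_sub_imp_visc_subsol[OF u(4)] order_refl c1] .
  have lower: "ereal clim \<le> eff_ham (ham V) P"
    unfolding eff_ham_def
  proof (rule Inf_greatest)
    fix e assume "e \<in> ?S (ham V)"
    then obtain a w where w: "e = ereal a" "upper_semicont w" "bounded (range w)" "zn_periodic w" "visc_subsol (ham V) P a w" by blast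
    then show "ereal clim \<le> e" using comparison[OF w(2-5) v] by simp
  qed
  have "eff_ham (ham V) P \<le> ereal clim"
    unfolding eff_ham_def using u(1-3) usub by (intro Inf_lower) blast
  with lower have eq: "eff_ham (ham V) P = ereal clim" by (rule antisym[rotated])
  have lowk: "ereal clim \<le> eff_ham (ham_k k V) P" for k
  proof -
    have "eff_ham (ham V) P \<le> eff_ham (ham_k k V) P" unfolding eff_ham_def
    proof (rule Inf_superset_mono, rule subsetI)
      fix e assume "e \<in> ?S (ham_k k V)"
      then obtain a w where w: "e = ereal a" "upper_semicont w" "bounded (range w)" "zn_periodic w" "visc_subsol (ham_k k V) P a w" by blast
      have "visc_subsol (ham V) P a w" using visc_subsol_mono[OF w(5) ham_le_ham_k order_refl] .
      with w show "e \<in> ?S (ham V)" by blast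
    qed
    then show ?thesis by (simp add: eq)
  qed
  \<comment> \<open>The mollified subsolution at level \<open>lam n\<close> is Lipschitz, so for
    large \<open>k\<close> it does not notice the truncation and competes in the infimum for
    \<open>ham_k\<close>.\<close>
  have upk: "\<forall>\<^sub>F k in sequentially. eff_ham (ham_k (real k) V) P \<le> ereal (lam n)" for n
  proof -
    obtain w where w: "upper_semicont w" "bounded (range w)" "zn_periodic w" "ctrl_sub V (rad n) P (lam n) w"
      using ex_crit_subsol[OF rad(1) rad(3), of n] by (auto simp: lam_def)
    obtain M where "\<forall>y\<in>range w. norm y \<le> M" using w(2) unfolding bounded_iff by blast
    then have M: "\<bar>w x\<bar> \<le> M" for x by simp
    obtain U K where U: "\<And>x y. norm (x - y) \<le> 1 \<Longrightarrow> \<bar>U x - U y\<bar> \<le> K * norm (x - y)" "\<And>x. \<bar>U x\<bar> \<le> M" "zn_periodic U" "ctrl_sub V 1 P (lam n) U"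
      using mollified_ctrl_sub[OF upper_semicont_borel[OF w(1)] M w(3,4) rad(2)] by blast
    have Usub: "visc_subsol (ham V) P (lam n) U" using ctrl_sub_imp_visc_subsol[OF U(4)] .
    have bU: "bounded (range U)" unfolding bounded_iff using U(2) by auto
    have usc: "upper_semicont U" unfolding upper_semicont_iff
    proof (intro allI impI)
      fix x and e :: real assume e: "e > 0"
      define d where "d = min 1 (e / (\<bar>K\<bar> + 1))"
      have "d > 0" using e by (simp add: d_def)
      moreover have "U y < U x + e" if y: "dist y x < d" for y
      proof -
        have "\<bar>U y - U x\<bar> \<le> K * norm (y - x)" using y by (intro U(1)) (simp add: d_def dist_norm)
        also have "\<dots> \<le> \<bar>K\<bar> * norm (y - x)" by (intro mult_right_mono) auto
        also have "\<dots> \<le> (\<bar>K\<bar> + 1) * norm (y - x)" by (intro mult_right_mono) auto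
        also have "\<dots> < (\<bar>K\<bar> + 1) * (e / (\<bar>K\<bar> + 1))" using y by (intro mult_strict_left_mono) (auto simp: d_def dist_norm)
        also have "\<dots> = e" by simp
        finally show ?thesis by linarith
      qed
      ultimately show "\<exists>d>0. \<forall>y. dist y x < d \<longrightarrow> U y < U x + e" by blast
    qed
    have "eff_ham (ham_k (real k) V) P \<le> ereal (lam n)" if k: "real k \<ge> max (K + norm P) (- lam n)" for k
    proof -
      have "visc_subsol (ham_k (real k) V) P (lam n) U" using k by (intro lipschitz_subsol_ham_k[OF Usub U(1)]) auto
      then show ?thesis unfolding eff_ham_def using usc bU U(3) by (intro Inf_lower) blast
    qed
    moreover obtain k0 where "real k0 \<ge> max (K + norm P) (- lam n)" using real_arch_simple by blast
    then have "real k \<ge> max (K + norm P) (- lam n)" if "k \<ge> k0" for k using of_nat_mono[OF that, where 'a=real] by linarith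
    ultimately show ?thesis unfolding eventually_sequentially by blast
  qed
  have "(\<lambda>k::nat. eff_ham (ham_k (real k) V) P) \<longlonglongrightarrow> ereal clim"
  proof (rule order_tendstoI)
    fix a assume "a < ereal clim"
    then show "\<forall>\<^sub>F k in sequentially. a < eff_ham (ham_k (real k) V) P" using lowk by (intro always_eventually allI) (rule less_le_trans)
  next
    fix a assume a: "ereal clim < a"
    have "(\<lambda>n. ereal (lam n)) \<longlonglongrightarrow> ereal clim" using lam_lim by simp
    from order_tendstoD(2)[OF this a] obtain n where n: "ereal (lam n) < a" unfolding eventually_sequentially by blast
    show "\<forall>\<^sub>F k in sequentially. eff_ham (ham_k (real k) V) P < a"
      by (rule eventually_mono[OF upk[of n]]) (rule le_less_trans[OF _ n])
  qed
  then show ?thesis unfolding eq using u(1-3) usub v by blast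
qed

end

section \<open>The isoperimetric inequality on the torus\<close>

lemma sets_unit_cell [measurable]: "unit_cell \<in> sets (borel :: (real^'n::finite) measure)"
proof -
  have "unit_cell = (\<Inter>i. {x :: real^'n. 0 \<le> x $ i} \<inter> {x. x $ i < 1})" by (auto simp: unit_cell_def)
  also have "\<dots> \<in> sets borel"
    by (intro sets.countable_INT'' sets.Int borel_closed borel_open closed_Collect_le open_Collect_less continuous_intros)
      (auto intro!: borel_closed borel_open closed_Collect_le open_Collect_less continuous_intros)
  finally show ?thesis .
qed

lemma emeasure_unit_cell: "emeasure lborel (unit_cell :: (real^'n::finite) set) = 1"
proof (rule antisym)
  have one: "\<And>b::real^'n. b \<in> Basis \<Longrightarrow> 1 \<bullet> b = (1::real)" by (auto simp: Basis_vec_def inner_axis)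
  have "emeasure lborel (unit_cell :: (real^'n) set) \<le> emeasure lborel (cbox 0 (1::real^'n))"
    using unit_cell_subset_cbox by (intro emeasure_mono) auto
  also have "\<dots> = 1" by (subst emeasure_lborel_cbox) (auto simp: one)
  finally show "emeasure lborel (unit_cell :: (real^'n) set) \<le> 1" .
  have "1 = emeasure lborel (box 0 (1::real^'n))" by (subst emeasure_lborel_box) (auto simp: one)
  also have "\<dots> \<le> emeasure lborel (unit_cell :: (real^'n) set)"
    by (intro emeasure_mono) (auto simp: unit_cell_def mem_box_cart less_imp_le)
  finally show "1 \<le> emeasure lborel (unit_cell :: (real^'n) set)" .
qed

lemma emeasure_lborel_translate:
  fixes A :: "'a::euclidean_space set"
  assumes "A \<in> sets borel" shows "emeasure lborel {x. x + v \<in> A} = emeasure lborel A"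
proof -
  have "emeasure lborel A = emeasure (distr lborel borel ((+) v)) A" by (simp add: lborel_distr_plus)
  also have "\<dots> = emeasure lborel ((+) v -` A \<inter> space lborel)" using assms by (intro emeasure_distr) auto
  also have "(+) v -` A \<inter> space lborel = {x. x + v \<in> A}" by (auto simp: add.commute)
  finally show ?thesis by simp
qed

lemma sets_translate:
  fixes A :: "'a::euclidean_space set"
  assumes "A \<in> sets borel" shows "{x. x + v \<in> A} \<in> sets borel"
proof -
  have "(\<lambda>x. x + v) -` A \<inter> space borel \<in> sets borel" by (rule measurable_sets[OF _ assms]) simp
  then show ?thesis by (simp add: vimage_def)
qed

lemma unit_cell_translate_unique:
  assumes "x - lattice_vec z \<in> unit_cell" "x - lattice_vec w \<in> unit_cell" shows "z = w"
proof
  fix i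
  have "0 \<le> x $ i - real_of_int (z i)" "x $ i - real_of_int (z i) < 1" "0 \<le> x $ i - real_of_int (w i)" "x $ i - real_of_int (w i) < 1"
    using assms by (auto simp: unit_cell_def lattice_vec_def)
  then show "z i = w i" by linarith
qed

lemma emeasure_lattice_decompose:
  fixes D :: "(real^'n::finite) set"
  assumes D: "D \<in> sets borel"
  shows "emeasure lborel D = (\<integral>\<^sup>+z. emeasure lborel ({x. x + lattice_vec z \<in> D} \<inter> unit_cell) \<partial>count_space UNIV)"
proof -
  define Dz where "Dz z = {x. x + lattice_vec (\<lambda>i. - z i) \<in> unit_cell} \<inter> D" for z :: "'n \<Rightarrow> int"
  have Dzm: "Dz z \<in> sets lborel" for z unfolding Dz_def using D by (auto intro!: sets_translate sets_unit_cell)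
  have "D = (\<Union>z. Dz z)"
  proof (intro equalityI subsetI)
    fix x assume "x \<in> D"
    obtain z where "x + lattice_vec z \<in> unit_cell" using ex_lattice_translate_in_unit_cell by blast
    then have "x \<in> Dz (\<lambda>i. - z i)" using \<open>x \<in> D\<close> by (simp add: Dz_def)
    then show "x \<in> (\<Union>z. Dz z)" by blast
  qed (auto simp: Dz_def)
  then have "emeasure lborel D = emeasure lborel (\<Union>z. Dz z)" by simp
  also have "\<dots> = (\<integral>\<^sup>+z. emeasure lborel (Dz z) \<partial>count_space UNIV)"
  proof (intro emeasure_UN_countable Dzm)
    show "disjoint_family_on Dz UNIV"
    proof (unfold disjoint_family_on_def, intro ballI impI)
      fix z w :: "'n \<Rightarrow> int" assume "z \<noteq> w"
      then show "Dz z \<inter> Dz w = {}" using unit_cell_translate_unique[of _ z w] by (auto simp: Dz_def lattice_vec_minus)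
    qed
  qed auto
  also have "\<dots> = (\<integral>\<^sup>+z. emeasure lborel ({x. x + lattice_vec z \<in> D} \<inter> unit_cell) \<partial>count_space UNIV)"
  proof (intro nn_integral_cong)
    fix z :: "'n \<Rightarrow> int"
    have "emeasure lborel (Dz z) = emeasure lborel {x. x + lattice_vec z \<in> Dz z}"
      using Dzm[of z] by (intro emeasure_lborel_translate[symmetric]) simp
    also have "{x. x + lattice_vec z \<in> Dz z} = {x. x + lattice_vec z \<in> D} \<inter> unit_cell"
      by (auto simp: Dz_def lattice_vec_minus)
    finally show "emeasure lborel (Dz z) = emeasure lborel ({x. x + lattice_vec z \<in> D} \<inter> unit_cell)" .
  qed
  finally show ?thesis .
qed

lemma zn_periodic_setD: "zn_periodic_set E \<Longrightarrow> x + lattice_vec z \<in> E \<longleftrightarrow> x \<in> E"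
  by (simp add: zn_periodic_set_def)

text \<open>\<open>D\<close> meets every lattice class at most once, so its pieces in the different
  cells remain disjoint after translation into the unit cell.\<close>

lemma emeasure_le_periodic:
  fixes D A :: "(real^'n::finite) set"
  assumes D: "D \<in> sets borel" and A: "A \<in> sets borel" "zn_periodic_set A" and sub: "D \<subseteq> A"
    and inj: "\<And>x z. x \<in> D \<Longrightarrow> x + lattice_vec z \<in> D \<Longrightarrow> z = (\<lambda>i. 0)"
  shows "emeasure lborel D \<le> emeasure lborel (A \<inter> unit_cell)"
proof -
  let ?F = "\<lambda>z. {x. x + lattice_vec z \<in> D} \<inter> unit_cell"
  have Fm: "?F z \<in> sets lborel" for z using D by (auto intro!: sets_translate sets_unit_cell)
  have "emeasure lborel D = (\<integral>\<^sup>+z. emeasure lborel (?F z) \<partial>count_space UNIV)" by (rule emeasure_lattice_decompose[OF D])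
  also have "\<dots> = emeasure lborel (\<Union>z. ?F z)"
  proof (intro emeasure_UN_countable[symmetric] Fm)
    show "disjoint_family_on ?F UNIV"
    proof (unfold disjoint_family_on_def, intro ballI impI)
      fix z w :: "'n \<Rightarrow> int" assume ne: "z \<noteq> w"
      show "?F z \<inter> ?F w = {}"
      proof (rule ccontr)
        assume "?F z \<inter> ?F w \<noteq> {}"
        then obtain x where x: "x + lattice_vec z \<in> D" "x + lattice_vec w \<in> D" by auto
        have "x + lattice_vec z + lattice_vec (\<lambda>i. w i - z i) \<in> D" using x(2) by (simp add: lattice_vec_diff)
        from inj[OF x(1) this] have "\<And>i. w i - z i = 0" by (simp add: fun_eq_iff)
        then have "z = w" by (intro ext) simp
        with ne show False ..
      qed
    qed
  qed auto
  also have "\<dots> \<le> emeasure lborel (A \<inter> unit_cell)"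
  proof (rule emeasure_mono)
    show "(\<Union>z. ?F z) \<subseteq> A \<inter> unit_cell" using sub zn_periodic_setD[OF A(2)] by blast
    show "A \<inter> unit_cell \<in> sets lborel" using A(1) by (auto intro: sets_unit_cell)
  qed
  finally show ?thesis .
qed

lemma emeasure_periodic_translate_le:
  fixes A :: "(real^'n::finite) set"
  assumes A: "A \<in> sets borel" "zn_periodic_set A"
  shows "emeasure lborel ({x. x + v \<in> A} \<inter> unit_cell) \<le> emeasure lborel (A \<inter> unit_cell)"
proof -
  let ?D = "{x. x + (- v) \<in> {x. x + v \<in> A} \<inter> unit_cell}"
  have m: "{x. x + v \<in> A} \<inter> unit_cell \<in> sets borel" using A(1) by (auto intro!: sets_translate sets_unit_cell)
  have "emeasure lborel ({x. x + v \<in> A} \<inter> unit_cell) = emeasure lborel ?D"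
    by (rule emeasure_lborel_translate[OF m, symmetric])
  also have "\<dots> \<le> emeasure lborel (A \<inter> unit_cell)"
  proof (rule emeasure_le_periodic[OF _ A])
    show "?D \<in> sets borel" using m by (rule sets_translate)
    show "?D \<subseteq> A" by auto
    fix x z assume "x \<in> ?D" "x + lattice_vec z \<in> ?D"
    then have "(x - v) - lattice_vec (\<lambda>i. 0) \<in> unit_cell" "(x - v) - lattice_vec (\<lambda>i. - z i) \<in> unit_cell"
      by (auto simp: lattice_vec_minus algebra_simps)
    from unit_cell_translate_unique[OF this] have "\<And>i. 0 = - z i" by (simp add: fun_eq_iff)
    then show "z = (\<lambda>i. 0)" by (intro ext) simp
  qed
  finally show ?thesis .
qed

text \<open>Projection to the torus does not increase measure: the pieces of \<open>Q\<close>,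
  translated into the unit cell, cover the hull, possibly with overlaps.\<close>

lemma emeasure_periodic_hull_le:
  fixes Q :: "(real^'n::finite) set"
  assumes "Q \<in> sets borel"
  shows "emeasure lborel ({x. \<exists>z. x + lattice_vec z \<in> Q} \<inter> unit_cell) \<le> emeasure lborel Q"
proof -
  let ?F = "\<lambda>z. {x. x + lattice_vec z \<in> Q} \<inter> unit_cell"
  have Fm: "?F z \<in> sets lborel" for z using assms by (auto intro!: sets_translate sets_unit_cell)
  have eq: "{x. \<exists>z. x + lattice_vec z \<in> Q} \<inter> unit_cell = (\<Union>z. ?F z)" by auto
  have "emeasure lborel (\<Union>z. ?F z) \<le> (\<integral>\<^sup>+z. emeasure lborel (?F z) \<partial>count_space UNIV)"
  proof -
    let ?e = "from_nat :: nat \<Rightarrow> ('n \<Rightarrow> int)"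
    have "inj (to_nat :: ('n \<Rightarrow> int) \<Rightarrow> nat)" by simp
    define G where "G n = (if n \<in> range (to_nat :: ('n \<Rightarrow> int) \<Rightarrow> nat) then ?F (?e n) else {})" for n
    have "(\<Union>z. ?F z) = (\<Union>n. G n)"
    proof (intro equalityI subsetI)
      fix x assume "x \<in> (\<Union>z. ?F z)"
      then obtain z where "x \<in> ?F z" by blast
      then have "x \<in> G (to_nat z)" by (simp add: G_def)
      then show "x \<in> (\<Union>n. G n)" by blast
    qed (auto simp: G_def split: if_splits)
    then have "emeasure lborel (\<Union>z. ?F z) = emeasure lborel (\<Union>n. G n)" by simp
    also have "\<dots> \<le> (\<Sum>n. emeasure lborel (G n))" using Fm by (intro emeasure_subadditive_countably) (auto simp: G_def)
    also have "\<dots> = (\<integral>\<^sup>+n. emeasure lborel (G n) \<partial>count_space UNIV)" by (rule nn_integral_count_space_nat[symmetric])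
    also have "\<dots> = (\<integral>\<^sup>+n. emeasure lborel (G n) * indicator (range (to_nat :: ('n \<Rightarrow> int) \<Rightarrow> nat)) n \<partial>count_space UNIV)"
      by (intro nn_integral_cong) (auto simp: G_def indicator_def)
    also have "\<dots> = (\<integral>\<^sup>+n. emeasure lborel (G n) \<partial>count_space (range (to_nat :: ('n \<Rightarrow> int) \<Rightarrow> nat)))"
      by (simp add: nn_integral_count_space_indicator)
    also have "\<dots> = (\<integral>\<^sup>+z. emeasure lborel (G (to_nat z)) \<partial>count_space (UNIV :: ('n \<Rightarrow> int) set))"
      by (rule nn_integral_bij_count_space[symmetric]) (simp add: bij_betw_def)
    also have "\<dots> = (\<integral>\<^sup>+z. emeasure lborel (?F z) \<partial>count_space UNIV)"
      by (intro nn_integral_cong) (simp add: G_def)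
    finally show ?thesis .
  qed
  then show ?thesis unfolding eq using emeasure_lattice_decompose[OF assms] by simp
qed

lemma zn_periodic_set_frontier:
  assumes "zn_periodic_set E" shows "zn_periodic_set (frontier E)"
proof -
  have eq: "(+) (lattice_vec z) ` E = E" for z
  proof (intro equalityI subsetI)
    fix x assume "x \<in> E"
    then have "x + lattice_vec (\<lambda>i. - z i) \<in> E" using zn_periodic_setD[OF assms] by blast
    then show "x \<in> (+) (lattice_vec z) ` E" by (intro image_eqI[of _ _ "x + lattice_vec (\<lambda>i. - z i)"]) (auto simp: lattice_vec_minus)
  qed (use zn_periodic_setD[OF assms] in \<open>auto simp: add.commute\<close>)
  have fr: "(+) (lattice_vec z) ` frontier E = frontier E" for z
    using frontier_translation[of "lattice_vec z" E] unfolding eq by simp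
  have "x \<in> frontier E \<longleftrightarrow> x + lattice_vec z \<in> frontier E" for x z
    using inj_image_mem_iff[of "(+) (lattice_vec z)" x "frontier E"] unfolding fr by (simp add: add.commute)
  then show ?thesis by (simp add: zn_periodic_set_def)
qed

section \<open>Exit sets and a crude isoperimetric inequality\<close>

text \<open>Hausdorff sum of a cover in codimension 1, with diameters in place of radii and without
  the normalising constant.\<close>

definition dsum :: "(nat \<Rightarrow> (real^'n::finite) set) \<Rightarrow> ennreal" where
  "dsum C = (\<Sum>j. ennreal (if C j = {} then 0 else diameter (C j) ^ (CARD('n) - 1)))"

text \<open>A point that leaves \<open>F\<close> under the shift crosses the frontier on its way, at
  a point that lies in some \<open>C j\<close> modulo the lattice. So, modulo the lattice, it lies
  in a cube of half side \<open>diameter (C j)\<close> about a point of \<open>C j\<close>, extended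
  backwards by \<open>t\<close> along the axis. Only one side of this box feels \<open>t\<close>;
  the others produce the power of the diameter.\<close>

lemma axis_exit_measure:
  fixes F :: "(real^'n::finite) set"
  assumes F: "F \<in> sets borel" "zn_periodic_set F"
    and C: "frontier F \<inter> unit_cell \<subseteq> (\<Union>j. C j)" "\<And>j. bounded (C j)" "\<And>j. diameter (C j) \<le> \<delta>"
    and t: "0 \<le> t" "t \<le> r"
  shows "emeasure lborel ({y \<in> F. y + t *\<^sub>R axis i 1 \<notin> F} \<inter> unit_cell) \<le> ennreal ((r + 2 * \<delta>) * 2 ^ (CARD('n) - 1)) * dsum C"
proof -
  let ?N = "CARD('n)"
  define d where "d j = diameter (C j)" for j
  have d: "0 \<le> d j" "d j \<le> \<delta>" for j using C(2,3) diameter_ge_0 by (auto simp: d_def)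
  define p where "p j = (SOME x. x \<in> C j)" for j
  have p: "p j \<in> C j" if "C j \<noteq> {}" for j unfolding p_def using that by (simp add: some_in_eq)
  define Q where "Q j = (if C j = {} then {} else cbox (\<chi> k. p j $ k - d j - (if k = i then t else 0)) (\<chi> k. p j $ k + d j))" for j
  have Qm: "Q j \<in> sets borel" for j by (simp add: Q_def)
  have Qv: "emeasure lborel (Q j) \<le> ennreal ((r + 2 * \<delta>) * 2 ^ (?N - 1)) * ennreal (if C j = {} then 0 else d j ^ (?N - 1))" for j
  proof (cases "C j = {}")
    case False
    have ne: "Q j \<noteq> {}" using False d(1)[of j] t by (auto simp: Q_def interval_ne_empty_cart)
    have "measure lborel (Q j) = (\<Prod>k\<in>UNIV. 2 * d j + (if k = i then t else 0))"
    proof -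
      let ?a = "(\<chi> k. p j $ k - d j - (if k = i then t else 0)) :: real^'n" and ?b = "(\<chi> k. p j $ k + d j) :: real^'n"
      have Q: "Q j = cbox ?a ?b" using False by (simp add: Q_def)
      have "measure lborel (Q j) = (\<Prod>k\<in>UNIV. ?b $ k - ?a $ k)" using ne unfolding Q by (rule content_cbox_cart)
      also have "\<dots> = (\<Prod>k\<in>UNIV. 2 * d j + (if k = i then t else 0))" by (rule prod.cong) auto
      finally show ?thesis .
    qed
    also have "\<dots> = (2 * d j + t) * (\<Prod>k\<in>UNIV - {i}. 2 * d j + (if k = i then t else 0))"
      by (subst prod.remove[of _ i]) auto
    also have "(\<Prod>k\<in>UNIV - {i}. 2 * d j + (if k = i then t else 0)) = (\<Prod>k\<in>UNIV - {i}. 2 * d j)"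
      by (rule prod.cong) auto
    also have "\<dots> = (2 * d j) ^ (?N - 1)" by (simp add: card_Diff_singleton)
    also have "(2 * d j + t) * (2 * d j) ^ (?N - 1) \<le> (r + 2 * \<delta>) * (2 * d j) ^ (?N - 1)"
      using d[of j] t by (intro mult_right_mono) auto
    finally have le: "measure lborel (Q j) \<le> (r + 2 * \<delta>) * 2 ^ (?N - 1) * d j ^ (?N - 1)"
      by (simp add: power_mult_distrib mult.assoc)
    have "emeasure lborel (Q j) = ennreal (measure lborel (Q j))"
      using False by (intro emeasure_eq_ennreal_measure) (simp add: Q_def emeasure_lborel_cbox_eq)
    also have "\<dots> \<le> ennreal ((r + 2 * \<delta>) * 2 ^ (?N - 1) * d j ^ (?N - 1))" using le by (rule ennreal_leI)
    also have "\<dots> = ennreal ((r + 2 * \<delta>) * 2 ^ (?N - 1)) * ennreal (d j ^ (?N - 1))"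
      using d[of j] t by (intro ennreal_mult) auto
    finally show ?thesis using False by simp
  qed (simp add: Q_def)
  let ?H = "\<lambda>j. {x. \<exists>z. x + lattice_vec z \<in> Q j} \<inter> unit_cell"
  have Hm: "?H j \<in> sets lborel" for j
  proof -
    have "?H j = (\<Union>z. {x. x + lattice_vec z \<in> Q j}) \<inter> unit_cell" by auto
    also have "\<dots> \<in> sets borel" using Qm by (intro sets.Int sets.countable_UN' sets_unit_cell) (auto intro!: sets_translate)
    finally show ?thesis by simp
  qed
  have sub: "{y \<in> F. y + t *\<^sub>R axis i 1 \<notin> F} \<inter> unit_cell \<subseteq> (\<Union>j. ?H j)"
  proof
    fix y assume y: "y \<in> {y \<in> F. y + t *\<^sub>R axis i 1 \<notin> F} \<inter> unit_cell"
    have "closed_segment y (y + t *\<^sub>R axis i 1) \<inter> frontier F \<noteq> {}"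
      using y by (intro connected_Int_frontier connected_segment) auto
    then obtain b where b: "b \<in> closed_segment y (y + t *\<^sub>R axis i 1)" "b \<in> frontier F" by blast
    then obtain u where u: "0 \<le> u" "u \<le> 1" "b = (1 - u) *\<^sub>R y + u *\<^sub>R (y + t *\<^sub>R axis i 1)" unfolding in_segment by blast
    define s where "s = u * t"
    have s: "0 \<le> s" "s \<le> t" "b = y + s *\<^sub>R axis i 1" using u t mult_right_mono[of u 1 t] by (auto simp: s_def algebra_simps)
    obtain z where z: "b + lattice_vec z \<in> unit_cell" using ex_lattice_translate_in_unit_cell by blast
    then have "b + lattice_vec z \<in> frontier F \<inter> unit_cell" using zn_periodic_setD[OF zn_periodic_set_frontier[OF F(2)]] b(2) by simp
    then obtain j where j: "b + lattice_vec z \<in> C j" using C(1) by blast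
    then have ne: "C j \<noteq> {}" by blast
    have "\<bar>(b + lattice_vec z) $ k - p j $ k\<bar> \<le> d j" for k
    proof -
      have "\<bar>(b + lattice_vec z - p j) $ k\<bar> \<le> norm (b + lattice_vec z - p j)" by (rule component_le_norm_cart)
      also have "\<dots> \<le> d j" using diameter_bounded_bound[OF C(2) j p[OF ne]] by (simp add: d_def dist_norm)
      finally show ?thesis by simp
    qed
    then have "y + lattice_vec z \<in> Q j"
    proof -
      assume *: "\<And>k. \<bar>(b + lattice_vec z) $ k - p j $ k\<bar> \<le> d j"
      have "p j $ k - d j - (if k = i then t else 0) \<le> (y + lattice_vec z) $ k \<and> (y + lattice_vec z) $ k \<le> p j $ k + d j" for k
      proof -
        have "(y + lattice_vec z) $ k = (b + lattice_vec z) $ k - (if k = i then s else 0)" by (simp add: s(3) axis_def)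
        then show ?thesis using *[of k] s(1,2) 
          by (cases "k = i") (simp_all only: if_True if_False refl abs_le_iff, auto)
      qed
      then show ?thesis using ne by (simp add: Q_def mem_box_cart)
    qed
    then show "y \<in> (\<Union>j. ?H j)" using y by blast
  qed
  have "emeasure lborel ({y \<in> F. y + t *\<^sub>R axis i 1 \<notin> F} \<inter> unit_cell) \<le> emeasure lborel (\<Union>j. ?H j)"
    using Hm by (intro emeasure_mono sub sets.countable_UN) blast
  also have "\<dots> \<le> (\<Sum>j. emeasure lborel (?H j))" using Hm by (intro emeasure_subadditive_countably) blast
  also have "\<dots> \<le> (\<Sum>j. ennreal ((r + 2 * \<delta>) * 2 ^ (?N - 1)) * ennreal (if C j = {} then 0 else d j ^ (?N - 1)))"
    by (intro suminf_le order_trans[OF emeasure_periodic_hull_le[OF Qm] Qv]) auto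
  also have "\<dots> = ennreal ((r + 2 * \<delta>) * 2 ^ (?N - 1)) * dsum C"
    unfolding dsum_def d_def by (rule ennreal_suminf_cmult)
  finally show ?thesis .
qed

text \<open>The shift is made one axis at a time. A point that leaves \<open>F\<close> does so at
  one of these steps, and the points leaving at a given step form a translate of an axis exit set,
  which by periodicity obeys the same bound.\<close>

lemma translate_exit_measure:
  fixes F :: "(real^'n::finite) set"
  assumes F: "F \<in> sets borel" "zn_periodic_set F"
    and K: "\<And>i. emeasure lborel ({y \<in> F. y + w $ i *\<^sub>R axis i 1 \<notin> F} \<inter> unit_cell) \<le> K"
  shows "emeasure lborel ({y \<in> F. y + w \<notin> F} \<inter> unit_cell) \<le> of_nat CARD('n) * K"
proof -
  let ?p = "\<lambda>S. \<Sum>i\<in>S. w $ i *\<^sub>R axis i 1 :: real^'n"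
  have m: "{y \<in> F. y + v \<notin> F} \<in> sets borel" for v
  proof -
    have "{y \<in> F. y + v \<notin> F} = F - {y. y + v \<in> F}" by auto
    then show ?thesis using F(1) sets_translate[OF F(1)] by (metis sets.Diff)
  qed
  have "emeasure lborel ({y \<in> F. y + ?p S \<notin> F} \<inter> unit_cell) \<le> of_nat (card S) * K" if "finite S" for S
    using that
  proof induction
    case (insert i S)
    let ?D = "{y \<in> F. y + w $ i *\<^sub>R axis i 1 \<notin> F}"
    have pD: "zn_periodic_set ?D"
      unfolding zn_periodic_set_def
    proof (intro allI)
      fix x z
      have "x + lattice_vec z + w $ i *\<^sub>R axis i 1 = x + w $ i *\<^sub>R axis i 1 + lattice_vec z" by simp
      then show "(x + lattice_vec z \<in> ?D) = (x \<in> ?D)" using zn_periodic_setD[OF F(2)] by (simp only: mem_Collect_eq)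
    qed
    have "{y \<in> F. y + ?p (insert i S) \<notin> F} \<inter> unit_cell
       \<subseteq> ({y \<in> F. y + ?p S \<notin> F} \<inter> unit_cell) \<union> ({y. y + ?p S \<in> ?D} \<inter> unit_cell)"
      using insert.hyps by (auto simp: algebra_simps)
    then have "emeasure lborel ({y \<in> F. y + ?p (insert i S) \<notin> F} \<inter> unit_cell)
       \<le> emeasure lborel (({y \<in> F. y + ?p S \<notin> F} \<inter> unit_cell) \<union> ({y. y + ?p S \<in> ?D} \<inter> unit_cell))"
      using m sets_translate[OF m] by (intro emeasure_mono) (auto intro!: sets.Un sets.Int sets_unit_cell)
    also have "\<dots> \<le> emeasure lborel ({y \<in> F. y + ?p S \<notin> F} \<inter> unit_cell) + emeasure lborel ({y. y + ?p S \<in> ?D} \<inter> unit_cell)"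
      using m sets_translate[OF m] by (intro emeasure_subadditive) (auto intro!: sets.Int sets_unit_cell)
    also have "\<dots> \<le> of_nat (card S) * K + K"
      by (intro add_mono insert.IH order_trans[OF emeasure_periodic_translate_le[OF m pD] K])
    also have "\<dots> = of_nat (card (insert i S)) * K" using insert.hyps by (simp add: distrib_right add.commute)
    finally show ?case .
  qed simp
  from this[of UNIV] have "emeasure lborel ({y \<in> F. y + ?p UNIV \<notin> F} \<inter> unit_cell) \<le> of_nat CARD('n) * K" by simp
  moreover have "?p UNIV = w" by (auto simp: vec_eq_iff axis_def if_distrib[of "\<lambda>t. _ * t"] sum.delta cong: if_cong)
  ultimately show ?thesis by simp
qed

text \<open>Double counting over shifts \<open>w\<close> in a cube of volume \<open>2 * m\<close>.
  For each \<open>x\<close> the shifts that land in \<open>F\<close> have volume at most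
  \<open>m\<close>, because an open cube of side at most 1 meets no lattice class twice; so shifts
  of volume at least \<open>m\<close> leave \<open>F\<close>. Integrating over \<open>x\<close> in
  \<open>F\<close> gives \<open>m * m \<le> 2 * m * K\<close>.\<close>

lemma exit_averaging:
  fixes F :: "(real^'n::finite) set"
  assumes F: "F \<in> sets borel" "zn_periodic_set F" and r: "0 < r" "r \<le> 1"
    and m: "emeasure lborel (F \<inter> unit_cell) = ennreal m" "m \<ge> 0" and rm: "r ^ CARD('n) = 2 * m"
    and K: "\<And>w. (\<And>i. 0 \<le> w $ i \<and> w $ i \<le> r) \<Longrightarrow> emeasure lborel ({y \<in> F. y + w \<notin> F} \<inter> unit_cell) \<le> K"
  shows "ennreal (m / 2) \<le> K"
proof -
  define W where "W = box 0 ((\<chi> i. r) :: real^'n)"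
  have W: "emeasure lborel W = ennreal (2 * m)"
  proof -
    have rb: "\<And>b :: real^'n. b \<in> Basis \<Longrightarrow> (\<chi> i. r) \<bullet> b = r" by (auto simp: Basis_vec_def inner_axis)
    have "emeasure lborel W = ennreal (\<Prod>b\<in>(Basis :: (real^'n) set). ((\<chi> i. r) - 0) \<bullet> b)"
      unfolding W_def using r by (intro emeasure_lborel_box) (auto simp: rb)
    also have "(\<Prod>b\<in>(Basis :: (real^'n) set). ((\<chi> i. r) - 0) \<bullet> b) = (\<Prod>b\<in>(Basis :: (real^'n) set). r)"
      by (rule prod.cong) (auto simp: rb)
    also have "\<dots> = r ^ CARD('n)" by simp
    finally show ?thesis by (simp add: rm)
  qed
  have Wm[measurable]: "W \<in> sets borel" by (simp add: W_def)
  note F(1)[measurable] sets_unit_cell[measurable]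
  have mpos: "m > 0" using rm r by (metis zero_less_mult_pos zero_less_numeral zero_less_power)
  have in1: "ennreal m \<le> (\<integral>\<^sup>+w. indicator W w * indicator (- F) (x + w) \<partial>lborel)" for x
  proof -
    have S1: "{w. w + x \<in> F} \<in> sets borel" by (rule sets_translate[OF F(1)])
    have Dm: "F \<inter> {y. y + (- x) \<in> W} \<in> sets borel" using F(1) sets_translate[OF Wm] by (intro sets.Int)
    have eq: "W \<inter> {w. w + x \<in> F} = {w. w + x \<in> F \<inter> {y. y + (- x) \<in> W}}" by auto
    have "emeasure lborel (W \<inter> {w. w + x \<in> F}) = emeasure lborel (F \<inter> {y. y + (- x) \<in> W})"
      unfolding eq by (rule emeasure_lborel_translate[OF Dm])
    also have "\<dots> \<le> emeasure lborel (F \<inter> unit_cell)"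
    proof (rule emeasure_le_periodic[OF Dm F])
      fix y z assume "y \<in> F \<inter> {y. y + (- x) \<in> W}" "y + lattice_vec z \<in> F \<inter> {y. y + (- x) \<in> W}"
      then have b: "0 < y $ i - x $ i" "y $ i - x $ i < r" "0 < y $ i + real_of_int (z i) - x $ i" "y $ i + real_of_int (z i) - x $ i < r" for i
        by (auto simp: W_def mem_box_cart lattice_vec_def)
      show "z = (\<lambda>i. 0)"
      proof
        fix i
        have "real_of_int (z i) < 1" "real_of_int (z i) > - 1" using b[of i] r by linarith+
        then show "z i = 0" by linarith
      qed
    qed auto
    finally have le: "emeasure lborel (W \<inter> {w. w + x \<in> F}) \<le> ennreal m" by (simp add: m)
    have "ennreal (2 * m) = emeasure lborel ((W \<inter> {w. w + x \<in> F}) \<union> (W - {w. w + x \<in> F}))"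
      using W by (simp add: Int_Diff_Un)
    also have "\<dots> = emeasure lborel (W \<inter> {w. w + x \<in> F}) + emeasure lborel (W - {w. w + x \<in> F})"
      using Wm S1 by (intro plus_emeasure[symmetric]) auto
    also have "\<dots> \<le> ennreal m + emeasure lborel (W - {w. w + x \<in> F})" by (intro add_right_mono le)
    finally have "ennreal m + ennreal m \<le> ennreal m + emeasure lborel (W - {w. w + x \<in> F})"
      using m by (simp add: ennreal_plus[symmetric])
    then have "ennreal m \<le> emeasure lborel (W - {w. w + x \<in> F})" by (subst (asm) ennreal_add_left_cancel_le) auto
    also have "\<dots> = (\<integral>\<^sup>+w. indicator (W - {w. w + x \<in> F}) w \<partial>lborel)" using Wm S1 by (intro nn_integral_indicator[symmetric]) auto
    also have "\<dots> = (\<integral>\<^sup>+w. indicator W w * indicator (- F) (x + w) \<partial>lborel)"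
      by (intro nn_integral_cong) (auto simp: indicator_def add.commute)
    finally show ?thesis .
  qed
  have [measurable]: "(\<lambda>(x, w). x + w) \<in> borel_measurable (borel \<Otimes>\<^sub>M (borel :: (real^'n) measure))"
    "(\<lambda>(w, x). x + w) \<in> borel_measurable (borel \<Otimes>\<^sub>M (borel :: (real^'n) measure))" by measurable
  have "ennreal m * ennreal m = (\<integral>\<^sup>+x. indicator (F \<inter> unit_cell) x * ennreal m \<partial>lborel)"
    using F(1) m by (simp add: nn_integral_multc)
  also have "\<dots> \<le> (\<integral>\<^sup>+x. indicator (F \<inter> unit_cell) x * (\<integral>\<^sup>+w. indicator W w * indicator (- F) (x + w) \<partial>lborel) \<partial>lborel)"
    by (intro nn_integral_mono mult_left_mono in1) auto
  also have "\<dots> = (\<integral>\<^sup>+x. (\<integral>\<^sup>+w. indicator (F \<inter> unit_cell) x * (indicator W w * indicator (- F) (x + w)) \<partial>lborel) \<partial>lborel)"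
    by (intro nn_integral_cong nn_integral_cmult[symmetric]) measurable
  also have "\<dots> = (\<integral>\<^sup>+w. (\<integral>\<^sup>+x. indicator (F \<inter> unit_cell) x * (indicator W w * indicator (- F) (x + w)) \<partial>lborel) \<partial>lborel)"
    by (intro lborel_pair.Fubini') measurable
  also have "\<dots> \<le> (\<integral>\<^sup>+w. indicator W w * K \<partial>lborel)"
  proof (rule nn_integral_mono)
    fix w :: "real^'n"
    show "(\<integral>\<^sup>+x. indicator (F \<inter> unit_cell) x * (indicator W w * indicator (- F) (x + w)) \<partial>lborel) \<le> indicator W w * K"
    proof (cases "w \<in> W")
      case True
      have "{y \<in> F. y + w \<notin> F} = F - {y. y + w \<in> F}" by auto
      then have Sm: "{y \<in> F. y + w \<notin> F} \<inter> unit_cell \<in> sets lborel" using F(1) sets_translate[OF F(1)] by (auto intro!: sets.Int sets_unit_cell)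
      have "(\<integral>\<^sup>+x. indicator (F \<inter> unit_cell) x * (indicator W w * indicator (- F) (x + w)) \<partial>lborel)
          = (\<integral>\<^sup>+x. indicator ({y \<in> F. y + w \<notin> F} \<inter> unit_cell) x \<partial>lborel)"
        using True by (intro nn_integral_cong) (auto simp: indicator_def)
      also have "\<dots> = emeasure lborel ({y \<in> F. y + w \<notin> F} \<inter> unit_cell)" using Sm by (rule nn_integral_indicator)
      also have "\<dots> \<le> K" using True by (intro K) (auto simp: W_def mem_box_cart less_imp_le)
      finally show ?thesis using True by simp
    qed simp
  qed
  also have "\<dots> = ennreal (2 * m) * K" using W by (simp add: nn_integral_multc)
  finally have "ennreal m * ennreal m \<le> ennreal (2 * m) * K" .
  then show ?thesis
  proof (cases K)
    case (real k)
    then have "m * m \<le> 2 * m * k" using \<open>ennreal m * ennreal m \<le> ennreal (2 * m) * K\<close> m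
      by (simp add: ennreal_mult[symmetric])
    then have "m / 2 \<le> k" using mpos by simp
    then show ?thesis using real by (simp add: ennreal_leI)
  qed simp
qed

text \<open>The bound \<open>m \<le> 1/2\<close> makes the side \<open>r\<close> of the averaging
  cube at most 1. With cover diameters at most \<open>q\<close> the exit bound has the factor
  \<open>r + 2 * q \<le> 4 * q\<close>, and passing from \<open>m / 2\<close> to
  \<open>m / q\<close> multiplies by \<open>2 / q\<close>; together this gives the 8.\<close>

lemma isoperimetric_cover_half:
  fixes F :: "(real^'n::finite) set"
  assumes F: "F \<in> sets borel" "zn_periodic_set F"
    and m: "measure lborel (F \<inter> unit_cell) = m" "0 < m" "m \<le> 1/2"
    and C: "frontier F \<inter> unit_cell \<subseteq> (\<Union>j. C j)" "\<And>j. bounded (C j)" "\<And>j. diameter (C j) \<le> m powr (1 / real CARD('n))"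
  shows "ennreal (m powr (1 - 1 / real CARD('n))) \<le> ennreal (8 * real CARD('n) * 2 ^ (CARD('n) - 1)) * dsum C"
proof -
  let ?N = "CARD('n)"
  define q where "q = m powr (1 / real ?N)"
  define r where "r = (2 * m) powr (1 / real ?N)"
  have q: "q > 0" using m by (simp add: q_def)
  have r: "0 < r" "r \<le> 1" using m powr_mono2[of "1 / real ?N" "2 * m" 1] by (auto simp: r_def)
  have rN: "r ^ ?N = 2 * m" using m r by (simp add: r_def powr_realpow[symmetric] powr_powr)
  have qN: "q ^ ?N = m" using m q by (simp add: q_def powr_realpow[symmetric] powr_powr)
  have rq: "r \<le> 2 * q"
  proof (rule power_le_imp_le_base[of r "?N - 1"])
    have "r ^ ?N \<le> 2 ^ ?N * m" unfolding rN using m self_le_power[of "2::real" ?N] by (intro mult_right_mono) auto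
    then show "r ^ Suc (?N - 1) \<le> (2 * q) ^ Suc (?N - 1)" using qN by (simp add: power_mult_distrib)
  qed (use q in simp)
  have em: "emeasure lborel (F \<inter> unit_cell) = ennreal m"
  proof -
    have "emeasure lborel (F \<inter> unit_cell) \<le> emeasure lborel (unit_cell :: (real^'n) set)" by (intro emeasure_mono) (auto intro: sets_unit_cell)
    then have "emeasure lborel (F \<inter> unit_cell) \<noteq> top" using emeasure_unit_cell by (metis ennreal_one_neq_top top.extremum_uniqueI)
    then show ?thesis using m(1) by (simp add: emeasure_eq_ennreal_measure)
  qed
  define K where "K = of_nat ?N * (ennreal ((r + 2 * q) * 2 ^ (?N - 1)) * dsum C)"
  have "ennreal (m / 2) \<le> K"
  proof (rule exit_averaging[OF F r em _ rN])
    show "m \<ge> 0" using m by simp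
    fix w :: "real^'n" assume w: "\<And>i. 0 \<le> w $ i \<and> w $ i \<le> r"
    show "emeasure lborel ({y \<in> F. y + w \<notin> F} \<inter> unit_cell) \<le> K"
      unfolding K_def using w C by (intro translate_exit_measure[OF F] axis_exit_measure[OF F]) (auto simp: q_def)
  qed
  also have "K \<le> ennreal (real ?N * (4 * q) * 2 ^ (?N - 1)) * dsum C"
  proof -
    have "K = ennreal (real ?N * ((r + 2 * q) * 2 ^ (?N - 1))) * dsum C"
      unfolding K_def using r q by (simp add: ennreal_mult ennreal_of_nat_eq_real_of_nat mult.assoc)
    also have "\<dots> \<le> ennreal (real ?N * (4 * q) * 2 ^ (?N - 1)) * dsum C"
      unfolding mult.assoc[of "real ?N"] using rq by (intro mult_right_mono ennreal_leI mult_left_mono) auto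
    finally show ?thesis .
  qed
  finally have le: "ennreal (m / 2) \<le> ennreal (real ?N * (4 * q) * 2 ^ (?N - 1)) * dsum C" .
  have "ennreal (m powr (1 - 1 / real ?N)) = ennreal (2 / q) * ennreal (m / 2)"
  proof -
    have "m powr (1 - 1 / real ?N) = m / q" using m by (simp add: q_def powr_diff)
    then show ?thesis using q m by (simp add: ennreal_mult[symmetric])
  qed
  also have "\<dots> \<le> ennreal (2 / q) * (ennreal (real ?N * (4 * q) * 2 ^ (?N - 1)) * dsum C)" by (intro mult_left_mono le) auto
  also have "\<dots> = ennreal (8 * real ?N * 2 ^ (?N - 1)) * dsum C"
    using q by (simp add: mult.assoc[symmetric] ennreal_mult[symmetric])
  finally show ?thesis .
qed

lemma hausdorff_normalization_pos: "hausdorff_normalization s > 0"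
  unfolding hausdorff_normalization_def by (intro divide_pos_pos Gamma_real_pos) (auto simp: add_nonneg_pos)

text \<open>The Hausdorff measure is a supremum over scales, so covers at a single scale suffice for
  a lower bound; the factor converts \<open>dsum\<close> to normalised radii.\<close>

lemma hausdorff_measure_ge:
  fixes A :: "(real^'n::finite) set"
  assumes d: "\<delta> > 0" and le: "\<And>C. A \<subseteq> (\<Union>i. C i) \<Longrightarrow> (\<And>i. bounded (C i)) \<Longrightarrow> (\<And>i. diameter (C i) \<le> \<delta>) \<Longrightarrow> x \<le> dsum C"
  shows "ennreal (hausdorff_normalization (CARD('n) - 1) / 2 ^ (CARD('n) - 1)) * x \<le> hausdorff_measure (CARD('n) - 1) A"
  unfolding hausdorff_measure_def
proof (rule SUP_upper2[of \<delta>])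
  let ?s = "CARD('n) - 1"
  let ?w = "hausdorff_normalization ?s"
  show "ennreal (?w / 2 ^ ?s) * x \<le> (INF C\<in>{C. A \<subseteq> (\<Union>i. C i) \<and> (\<forall>i. bounded (C i) \<and> diameter (C i) \<le> \<delta>)}.
      (\<Sum>i. ennreal (if C i = {} then 0 else ?w * (diameter (C i) / 2) ^ ?s)))"
  proof (rule INF_greatest)
    fix C :: "nat \<Rightarrow> (real^'n) set" assume "C \<in> {C. A \<subseteq> (\<Union>i. C i) \<and> (\<forall>i. bounded (C i) \<and> diameter (C i) \<le> \<delta>)}"
    then have C: "A \<subseteq> (\<Union>i. C i)" "\<And>i. bounded (C i)" "\<And>i. diameter (C i) \<le> \<delta>" by auto
    have "ennreal (?w / 2 ^ ?s) * x \<le> ennreal (?w / 2 ^ ?s) * dsum C" using le[OF C] by (intro mult_left_mono) auto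
    also have "\<dots> = (\<Sum>i. ennreal (?w / 2 ^ ?s) * ennreal (if C i = {} then 0 else diameter (C i) ^ ?s))"
      unfolding dsum_def by (rule ennreal_suminf_cmult[symmetric])
    also have "\<dots> = (\<Sum>i. ennreal (if C i = {} then 0 else ?w * (diameter (C i) / 2) ^ ?s))"
    proof (rule suminf_cong)
      fix i
      have "?w \<ge> 0" "diameter (C i) \<ge> 0" using hausdorff_normalization_pos[of ?s] diameter_ge_0[OF C(2)] by (auto simp: less_imp_le)
      then show "ennreal (?w / 2 ^ ?s) * ennreal (if C i = {} then 0 else diameter (C i) ^ ?s) = ennreal (if C i = {} then 0 else ?w * (diameter (C i) / 2) ^ ?s)"
        by (simp add: ennreal_mult[symmetric] power_divide)
    qed
    finally show "ennreal (?w / 2 ^ ?s) * x \<le> (\<Sum>i. ennreal (if C i = {} then 0 else ?w * (diameter (C i) / 2) ^ ?s))" .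
  qed
qed (use d in simp)

text \<open>Supplies an admissible constant for the set whose infimum is
  \<open>torus_isoperimetric_constant\<close>, so that this infimum is taken over a nonempty set.
  Coverings of the frontier see no regularity, so all periodic sets are treated alike; sets filling
  more than half of the torus are replaced by their complement.\<close>

lemma torus_isoperimetric_inequality:
  "\<exists>c\<ge>0. \<forall>E :: (real^'n::finite) set. zn_periodic_set E \<longrightarrow>
     ennreal ((min (measure lborel (E \<inter> unit_cell)) (1 - measure lborel (E \<inter> unit_cell))) powr (1 - 1 / real CARD('n)))
      \<le> ennreal c * hausdorff_measure (CARD('n) - 1) (frontier E \<inter> unit_cell)"
proof -
  let ?N = "CARD('n)"
  let ?w = "hausdorff_normalization (?N - 1) / 2 ^ (?N - 1)"
  define k where "k = 8 * real ?N * 2 ^ (?N - 1)"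
  have w: "?w > 0" using hausdorff_normalization_pos[of "?N - 1"] by simp
  have k: "k > 0" by (simp add: k_def)
  have half: "ennreal (measure lborel (F \<inter> unit_cell) powr (1 - 1 / real ?N)) \<le> ennreal (k / ?w) * hausdorff_measure (?N - 1) (frontier F \<inter> unit_cell)"
    if F: "F \<in> sets borel" "zn_periodic_set F" "measure lborel (F \<inter> unit_cell) \<le> 1/2" for F :: "(real^'n) set"
  proof (cases "measure lborel (F \<inter> unit_cell) = 0")
    case False
    define m where "m = measure lborel (F \<inter> unit_cell)"
    have m: "0 < m" "m \<le> 1/2" using False F(3) by (auto simp: m_def zero_less_measure_iff)
    let ?x = "ennreal (m powr (1 - 1 / real ?N) / k)"
    have "ennreal ?w * ?x \<le> hausdorff_measure (?N - 1) (frontier F \<inter> unit_cell)"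
    proof (rule hausdorff_measure_ge[of "m powr (1 / real ?N)"])
      fix C :: "nat \<Rightarrow> (real^'n) set"
      assume C: "frontier F \<inter> unit_cell \<subseteq> (\<Union>i. C i)" "\<And>i. bounded (C i)" "\<And>i. diameter (C i) \<le> m powr (1 / real ?N)"
      have "ennreal (m powr (1 - 1 / real ?N)) \<le> ennreal k * dsum C"
        unfolding k_def by (rule isoperimetric_cover_half[OF F(1,2) m_def[symmetric] m C])
      then have "ennreal (1/k) * ennreal (m powr (1 - 1 / real ?N)) \<le> ennreal (1/k) * (ennreal k * dsum C)" by (intro mult_left_mono) auto
      also have "\<dots> = dsum C" using k by (simp add: mult.assoc[symmetric] ennreal_mult[symmetric])
      finally show "?x \<le> dsum C" using k by (simp add: ennreal_mult[symmetric])
    qed (use m in simp)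
    then have "ennreal (k / ?w) * (ennreal ?w * ?x) \<le> ennreal (k / ?w) * hausdorff_measure (?N - 1) (frontier F \<inter> unit_cell)"
      by (intro mult_left_mono) auto
    moreover have "ennreal (k / ?w) * (ennreal ?w * ?x) = ennreal (m powr (1 - 1 / real ?N))"
    proof -
      have gen: "ennreal (k / a) * (ennreal a * ennreal (y / k)) = ennreal y" if "a > 0" "y \<ge> 0" for a y
        using k that by (simp add: ennreal_mult[symmetric])
      show ?thesis using w by (intro gen) auto
    qed
    ultimately show ?thesis unfolding m_def by simp
  qed simp
  show ?thesis
  proof (intro exI[of _ "k / ?w"] conjI allI impI)
    show "0 \<le> k / ?w" by (rule less_imp_le[OF divide_pos_pos[OF k w]])
    fix E :: "(real^'n) set" assume E: "zn_periodic_set E"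
    let ?a = "measure lborel (E \<inter> unit_cell)"
    show "ennreal ((min ?a (1 - ?a)) powr (1 - 1 / real ?N)) \<le> ennreal (k / ?w) * hausdorff_measure (?N - 1) (frontier E \<inter> unit_cell)"
    proof (cases "E \<inter> unit_cell \<in> sets borel")
      case False
      \<comment> \<open>Non-measurable sets have \<open>measure\<close> 0 by convention, which makes
        the left side 0.\<close>
      then have "?a = 0" by (intro measure_notin_sets) simp
      then show ?thesis by simp
    next
      case True
      have Em: "E \<in> sets borel"
      proof -
        have "E = (\<Union>z. {x. x + lattice_vec z \<in> E \<inter> unit_cell})"
          using ex_lattice_translate_in_unit_cell zn_periodic_setD[OF E] by auto
        also have "\<dots> \<in> sets borel" using sets_translate[OF True] by (intro sets.countable_UN') auto
        finally show ?thesis .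
      qed
      have Ecm: "measure lborel (- E \<inter> unit_cell) = 1 - ?a"
      proof -
        have "- E \<inter> unit_cell = unit_cell - E \<inter> unit_cell" by auto
        moreover have "measure lborel (unit_cell - E \<inter> unit_cell) = measure lborel (unit_cell :: (real^'n) set) - ?a"
          using Em emeasure_unit_cell[where 'n='n] by (intro measure_Diff) (auto intro: sets_unit_cell)
        moreover have "measure lborel (unit_cell :: (real^'n) set) = 1"
          using emeasure_unit_cell[where 'n='n] by (simp add: measure_def)
        ultimately show ?thesis by simp
      qed
      show ?thesis
      proof (cases "?a \<le> 1/2")
        case True
        then have "min ?a (1 - ?a) = ?a" by simp
        then show ?thesis using half[OF Em E True] by simp
      next
        case False
        have "zn_periodic_set (- E)" using E by (simp add: zn_periodic_set_def)
        from half[OF borel_comp[OF Em] this] False have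
          "ennreal ((1 - ?a) powr (1 - 1 / real ?N)) \<le> ennreal (k / ?w) * hausdorff_measure (?N - 1) (frontier (- E) \<inter> unit_cell)"
          unfolding Ecm by simp
        moreover have "min ?a (1 - ?a) = 1 - ?a" using False by simp
        ultimately show ?thesis by (simp add: frontier_complement)
      qed
    qed
  qed
qed

section \<open>Hausdorff measure of hyperplane sections and coarea\<close>

definition cst :: "nat \<Rightarrow> (real^'n::finite) set \<Rightarrow> ennreal" where
  "cst s C = ennreal (if C = {} then 0 else hausdorff_normalization s * (diameter C / 2) ^ s)"

text \<open>The Hausdorff premeasure of dimension \<open>s\<close> at scale \<open>\<delta>\<close>.
  Upper bounds are proved for it and passed to the supremum over \<open>\<delta>\<close> at the
  end.\<close>

definition hcont :: "nat \<Rightarrow> real \<Rightarrow> (real^'n::finite) set \<Rightarrow> ennreal" where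
  "hcont s \<delta> A = (INF C\<in>{C :: nat \<Rightarrow> (real^'n) set. A \<subseteq> (\<Union>i. C i) \<and> (\<forall>i. bounded (C i) \<and> diameter (C i) \<le> \<delta>)}. \<Sum>i. cst s (C i))"

lemma hausdorff_measure_hcont: "hausdorff_measure s A = (SUP \<delta>\<in>{0<..}. hcont s \<delta> A)"
  by (simp add: hausdorff_measure_def hcont_def cst_def)

text \<open>Lets covers be indexed by any countable type instead of \<open>nat\<close>; numbers that
  encode no index contribute 0.\<close>

lemma suminf_eq_nn_integral_countable:
  fixes F :: "'i::countable \<Rightarrow> ennreal"
  shows "(\<Sum>n. if n \<in> range (to_nat :: 'i \<Rightarrow> nat) then F (from_nat n) else 0) = (\<integral>\<^sup>+i. F i \<partial>count_space UNIV)"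
proof -
  let ?G = "\<lambda>n. if n \<in> range (to_nat :: 'i \<Rightarrow> nat) then F (from_nat n) else 0"
  have "(\<Sum>n. ?G n) = (\<integral>\<^sup>+n. ?G n \<partial>count_space UNIV)" by (rule nn_integral_count_space_nat[symmetric])
  also have "\<dots> = (\<integral>\<^sup>+n. ?G n * indicator (range (to_nat :: 'i \<Rightarrow> nat)) n \<partial>count_space UNIV)"
    by (intro nn_integral_cong) (auto simp: indicator_def)
  also have "\<dots> = (\<integral>\<^sup>+n. ?G n \<partial>count_space (range (to_nat :: 'i \<Rightarrow> nat)))"
    by (simp add: nn_integral_count_space_indicator)
  also have "\<dots> = (\<integral>\<^sup>+i. ?G (to_nat i) \<partial>count_space (UNIV :: 'i set))"
    by (rule nn_integral_bij_count_space[symmetric]) (simp add: bij_betw_def)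
  also have "\<dots> = (\<integral>\<^sup>+i. F i \<partial>count_space UNIV)" by (intro nn_integral_cong) simp
  finally show ?thesis .
qed

lemma hcont_le_cover_UNIV:
  fixes C :: "'i::countable \<Rightarrow> (real^'n::finite) set"
  assumes "A \<subseteq> (\<Union>i. C i)" "\<And>i. bounded (C i)" "\<And>i. diameter (C i) \<le> \<delta>" "\<delta> \<ge> 0"
  shows "hcont s \<delta> A \<le> (\<integral>\<^sup>+i. cst s (C i) \<partial>count_space UNIV)"
proof -
  define D where "D n = (if n \<in> range (to_nat :: 'i \<Rightarrow> nat) then C (from_nat n) else {})" for n
  have "A \<subseteq> (\<Union>n. D n)"
  proof
    fix x assume "x \<in> A"
    then obtain i where "x \<in> C i" using assms(1) by blast
    then have "x \<in> D (to_nat i)" by (simp add: D_def)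
    then show "x \<in> (\<Union>n. D n)" by blast
  qed
  moreover have "bounded (D n)" "diameter (D n) \<le> \<delta>" for n using assms by (auto simp: D_def)
  ultimately have "hcont s \<delta> A \<le> (\<Sum>n. cst s (D n))" unfolding hcont_def by (intro INF_lower) auto
  also have "\<dots> = (\<Sum>n. if n \<in> range (to_nat :: 'i \<Rightarrow> nat) then cst s (C (from_nat n)) else 0)"
    by (rule suminf_cong) (simp add: D_def cst_def)
  also have "\<dots> = (\<integral>\<^sup>+i. cst s (C i) \<partial>count_space UNIV)"
    by (rule suminf_eq_nn_integral_countable[of "\<lambda>i. cst s (C i)"])
  finally show ?thesis .
qed

lemma hcont_mono: "A \<subseteq> B \<Longrightarrow> hcont s \<delta> A \<le> hcont s \<delta> B"
  unfolding hcont_def by (rule INF_superset_mono) auto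

lemma hcont_le_cst:
  assumes "bounded A" "diameter A \<le> \<delta>" "\<delta> \<ge> 0" shows "hcont s \<delta> A \<le> cst s A"
proof -
  have "hcont s \<delta> A \<le> (\<integral>\<^sup>+i. cst s A \<partial>count_space (UNIV :: unit set))"
    using assms by (intro hcont_le_cover_UNIV) auto
  then show ?thesis by (simp add: nn_integral_count_space_finite UNIV_unit)
qed

lemma hcont_empty: "\<delta> \<ge> 0 \<Longrightarrow> hcont s \<delta> {} = 0"
  using hcont_le_cst[of "{}" \<delta> s] by (simp add: cst_def)

text \<open>Countable subadditivity by near-optimal covers with geometrically decreasing errors. An
  infinite summand is treated apart, because adding an error to it gives no strict
  inequality.\<close>

lemma hcont_UN_UNIV:
  fixes A :: "'i::countable \<Rightarrow> (real^'n::finite) set"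
  assumes d: "\<delta> \<ge> 0"
  shows "hcont s \<delta> (\<Union>i. A i) \<le> (\<integral>\<^sup>+i. hcont s \<delta> (A i) \<partial>count_space UNIV)"
proof (cases "\<exists>i. hcont s \<delta> (A i) = top")
  case True
  then obtain i where "hcont s \<delta> (A i) = top" by blast
  moreover have "hcont s \<delta> (A i) \<le> (\<integral>\<^sup>+i. hcont s \<delta> (A i) \<partial>count_space UNIV)"
    by (rule nn_integral_ge_point) simp
  ultimately show ?thesis by (simp add: top_unique)
next
  case False
  show ?thesis
  proof (rule ennreal_le_epsilon)
    fix e :: real assume e: "e > 0"
    have "\<exists>C. A i \<subseteq> (\<Union>n. C n) \<and> (\<forall>n. bounded (C n) \<and> diameter (C n) \<le> \<delta>) \<and>
        (\<Sum>n. cst s (C n)) \<le> hcont s \<delta> (A i) + ennreal (e * (1/2) ^ Suc (to_nat i))" for i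
    proof -
      have "e * (1/2) ^ Suc (to_nat i) > 0" using e by simp
      moreover have "x < x + ennreal b" if "x \<noteq> top" "b > 0" for x b
        using that by (cases x) (auto simp: ennreal_plus[symmetric] ennreal_less_iff simp del: ennreal_plus)
      ultimately have "hcont s \<delta> (A i) < hcont s \<delta> (A i) + ennreal (e * (1/2) ^ Suc (to_nat i))"
        using False by blast
      then obtain C where "C \<in> {C :: nat \<Rightarrow> (real^'n) set. A i \<subseteq> (\<Union>i. C i) \<and> (\<forall>i. bounded (C i) \<and> diameter (C i) \<le> \<delta>)}"
        "(\<Sum>i. cst s (C i)) < hcont s \<delta> (A i) + ennreal (e * (1/2) ^ Suc (to_nat i))"
        unfolding hcont_def[of s \<delta> "A i"] INF_less_iff by blast
      then show ?thesis by (intro exI[of _ C]) auto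
    qed
    then obtain C where C: "\<And>i. A i \<subseteq> (\<Union>n. C i n)" "\<And>i n. bounded (C i n)" "\<And>i n. diameter (C i n) \<le> \<delta>"
      "\<And>i. (\<Sum>n. cst s (C i n)) \<le> hcont s \<delta> (A i) + ennreal (e * (1/2) ^ Suc (to_nat i))"
      by metis
    have "hcont s \<delta> (\<Union>i. A i) \<le> (\<integral>\<^sup>+p. cst s (case p of (i, n) \<Rightarrow> C i n) \<partial>count_space UNIV)"
    proof (rule hcont_le_cover_UNIV[OF _ _ _ d])
      show "(\<Union>i. A i) \<subseteq> (\<Union>p. case p of (i, n) \<Rightarrow> C i n)"
      proof
        fix x assume "x \<in> (\<Union>i. A i)"
        then obtain i n where "x \<in> C i n" using C(1) by blast
        then show "x \<in> (\<Union>p. case p of (i, n) \<Rightarrow> C i n)" by (intro UN_I[of "(i, n)"]) auto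
      qed
    qed (use C in \<open>auto split: prod.splits\<close>)
    also have "\<dots> = (\<integral>\<^sup>+i. (\<integral>\<^sup>+n. cst s (C i n) \<partial>count_space UNIV) \<partial>count_space UNIV)"
      using nn_integral_fst_count_space[of "\<lambda>p. cst s (case p of (i, n) \<Rightarrow> C i n)"] by simp
    also have "\<dots> = (\<integral>\<^sup>+i. (\<Sum>n. cst s (C i n)) \<partial>count_space UNIV)" by (simp add: nn_integral_count_space_nat)
    also have "\<dots> \<le> (\<integral>\<^sup>+i. hcont s \<delta> (A i) + ennreal (e * (1/2) ^ Suc (to_nat i)) \<partial>count_space UNIV)"
      by (intro nn_integral_mono C(4))
    also have "\<dots> = (\<integral>\<^sup>+i. hcont s \<delta> (A i) \<partial>count_space UNIV) + (\<integral>\<^sup>+(i::'i). ennreal (e * (1/2) ^ Suc (to_nat i)) \<partial>count_space UNIV)"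
      by (intro nn_integral_add) auto
    also have "(\<integral>\<^sup>+(i::'i). ennreal (e * (1/2) ^ Suc (to_nat i)) \<partial>count_space UNIV) \<le> ennreal e"
    proof -
      have "(\<integral>\<^sup>+(i::'i). ennreal (e * (1/2) ^ Suc (to_nat i)) \<partial>count_space UNIV)
          = (\<Sum>n. if n \<in> range (to_nat :: 'i \<Rightarrow> nat) then ennreal (e * (1/2) ^ Suc (to_nat (from_nat n :: 'i))) else 0)"
        by (rule suminf_eq_nn_integral_countable[symmetric])
      also have "\<dots> \<le> (\<Sum>n. ennreal (e * (1/2) ^ Suc n))"
        by (intro suminf_le) auto
      also have "\<dots> = ennreal (\<Sum>n. e * (1/2) ^ Suc n)"
        using e by (intro suminf_ennreal2 summable_mult power_half_series[THEN sums_summable]) auto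
      also have "(\<Sum>n. e * (1/2) ^ Suc n) = e"
        using sums_mult[OF power_half_series, of e] sums_unique by force
      finally show ?thesis .
    qed
    finally show "hcont s \<delta> (\<Union>i. A i) \<le> (\<integral>\<^sup>+i. hcont s \<delta> (A i) \<partial>count_space UNIV) + ennreal e"
      by (simp add: add_left_mono)
  qed
qed

lemma hcont_UN:
  fixes A :: "'i::countable \<Rightarrow> (real^'n::finite) set"
  assumes d: "\<delta> \<ge> 0"
  shows "hcont s \<delta> (\<Union>i\<in>I. A i) \<le> (\<integral>\<^sup>+i. hcont s \<delta> (A i) \<partial>count_space I)"
proof -
  have "hcont s \<delta> (\<Union>i\<in>I. A i) = hcont s \<delta> (\<Union>i. if i \<in> I then A i else {})"
    by (rule arg_cong[where f="hcont s \<delta>"]) (auto split: if_splits)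
  also have "\<dots> \<le> (\<integral>\<^sup>+i. hcont s \<delta> (if i \<in> I then A i else {}) \<partial>count_space UNIV)" by (rule hcont_UN_UNIV[OF d])
  also have "\<dots> = (\<integral>\<^sup>+i. hcont s \<delta> (A i) * indicator I i \<partial>count_space UNIV)"
    by (intro nn_integral_cong) (auto simp: hcont_empty[OF d])
  also have "\<dots> = (\<integral>\<^sup>+i. hcont s \<delta> (A i) \<partial>count_space I)" by (simp add: nn_integral_count_space_indicator)
  finally show ?thesis .
qed

lemma hcont_Un: "\<delta> \<ge> 0 \<Longrightarrow> hcont s \<delta> (A \<union> B) \<le> hcont s \<delta> A + hcont s \<delta> B"
proof -
  assume d: "\<delta> \<ge> 0"
  have "A \<union> B = (\<Union>b. if b then A else B)" by (auto split: if_splits)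
  then have "hcont s \<delta> (A \<union> B) \<le> (\<integral>\<^sup>+b. hcont s \<delta> (if b then A else B) \<partial>count_space UNIV)"
    using hcont_UN_UNIV[OF d, of s "\<lambda>b. if b then A else B"] by simp
  also have "\<dots> = hcont s \<delta> A + hcont s \<delta> B" by (simp add: nn_integral_count_space_finite UNIV_bool add.commute)
  finally show ?thesis .
qed

lemma hcont_isometry:
  fixes A :: "(real^'n::finite) set" and f :: "real^'n \<Rightarrow> real^'n"
  assumes f: "\<And>x y. dist (f x) (f y) \<le> dist x y"
  shows "hcont s \<delta> (f ` A) \<le> hcont s \<delta> A"
  unfolding hcont_def[of s \<delta> A]
proof (rule INF_greatest)
  fix C :: "nat \<Rightarrow> (real^'n) set" assume "C \<in> {C. A \<subseteq> (\<Union>i. C i) \<and> (\<forall>i. bounded (C i) \<and> diameter (C i) \<le> \<delta>)}"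
  then have C: "A \<subseteq> (\<Union>i. C i)" "\<And>i. bounded (C i)" "\<And>i. diameter (C i) \<le> \<delta>" by auto
  have dle: "diameter (f ` C i) \<le> diameter (C i)" for i
  proof (rule diameter_le)
    show "f ` C i \<noteq> {} \<or> 0 \<le> diameter (C i)" using diameter_ge_0[OF C(2)] by blast
    fix x y assume "x \<in> f ` C i" "y \<in> f ` C i"
    then obtain a b where ab: "x = f a" "y = f b" "a \<in> C i" "b \<in> C i" by blast
    have "dist x y \<le> dist a b" unfolding ab(1,2) by (rule f)
    also have "\<dots> \<le> diameter (C i)" by (rule diameter_bounded_bound[OF C(2) ab(3,4)])
    finally show "norm (x - y) \<le> diameter (C i)" by (simp add: dist_norm)
  qed
  have bdd: "bounded (f ` C i)" for i
  proof (cases "C i = {}")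
    case False
    then obtain a where a: "a \<in> C i" by blast
    have "f ` C i \<subseteq> cball (f a) (diameter (C i))"
    proof
      fix y assume "y \<in> f ` C i"
      then obtain b where b: "y = f b" "b \<in> C i" by blast
      show "y \<in> cball (f a) (diameter (C i))"
        using order_trans[OF f diameter_bounded_bound[OF C(2) a b(2)]] b(1) by simp
    qed
    then show ?thesis by (rule bounded_subset[OF bounded_cball])
  qed simp
  have "hcont s \<delta> (f ` A) \<le> (\<Sum>i. cst s (f ` C i))"
    unfolding hcont_def
  proof (rule INF_lower, intro CollectI conjI allI)
    show "f ` A \<subseteq> (\<Union>i. f ` C i)" using C(1) by blast
    show "bounded (f ` C i)" "diameter (f ` C i) \<le> \<delta>" for i using bdd order_trans[OF dle C(3)] by auto
  qed
  also have "\<dots> \<le> (\<Sum>i. cst s (C i))"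
  proof (rule suminf_le)
    fix i
    have "hausdorff_normalization s * (diameter (f ` C i) / 2) ^ s \<le> hausdorff_normalization s * (diameter (C i) / 2) ^ s"
      using dle[of i] hausdorff_normalization_pos[of s] diameter_ge_0[OF bdd, of i]
      by (intro mult_left_mono power_mono divide_right_mono) auto
    then show "cst s (f ` C i) \<le> cst s (C i)" by (simp add: cst_def ennreal_leI)
  qed auto
  finally show "hcont s \<delta> (f ` A) \<le> (\<Sum>i. cst s (C i))" .
qed

section \<open>The exact premeasure bound for cubes in a hyperplane\<close>

text \<open>Volume in dimension \<open>N - 1\<close> is read off from cylinders of height 1 in the
  full space. Fubini splits off the axis, and \<open>hausdorff_normalization (N - 1)\<close> turns
  out to be the volume of the unit ball in the remaining coordinates.\<close>

lemma emeasure_ball_cylinder: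
  fixes i :: "'n::finite"
  assumes r: "r > 0"
  shows "emeasure lborel {x :: real^'n. 0 \<le> x $ i \<and> x $ i \<le> 1 \<and> (\<Sum>j\<in>UNIV-{i}. (x $ j)\<^sup>2) \<le> r\<^sup>2}
    = ennreal (hausdorff_normalization (CARD('n) - 1) * r ^ (CARD('n) - 1))"
proof -
  interpret product_sigma_finite "\<lambda>_. lborel" by standard
  let ?B = "Basis :: (real^'n) set"
  define e where "e = (axis i 1 :: real^'n)"
  define A where "A = ?B - {e}"
  have eB: "e \<in> ?B" by (auto simp: e_def Basis_vec_def)
  have B: "?B = insert e A" "e \<notin> A" "finite A" using eB by (auto simp: A_def)
  have Aeq: "A = (\<lambda>j. axis j 1) ` (UNIV - {i})" by (auto simp: A_def e_def Basis_vec_def axis_eq_axis)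
  have inj: "inj_on (\<lambda>j. axis j 1 :: real^'n) (UNIV - {i})" by (auto simp: inj_on_def axis_eq_axis)
  have cA: "card A = CARD('n) - 1" unfolding Aeq using card_image[OF inj] by (simp add: card_Diff_singleton)
  let ?S = "{x :: real^'n. 0 \<le> x $ i \<and> x $ i \<le> 1 \<and> (\<Sum>j\<in>UNIV-{i}. (x $ j)\<^sup>2) \<le> r\<^sup>2}"
  have Sm: "?S \<in> sets borel"
    by (intro borel_closed closed_Collect_conj closed_Collect_le continuous_intros)
  have sumA: "(\<Sum>j\<in>UNIV-{i}. (\<phi> (axis j 1))\<^sup>2) = (\<Sum>b\<in>A. (\<phi> b)\<^sup>2)" for \<phi> :: "real^'n \<Rightarrow> real"
    unfolding Aeq by (subst sum.reindex[OF inj]) simp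
  have comp: "(\<Sum>b\<in>?B. f b *\<^sub>R b) $ j = f (axis j 1)" for f :: "real^'n \<Rightarrow> real" and j
  proof -
    have "(\<Sum>b\<in>?B. f b *\<^sub>R b) $ j = (\<Sum>b\<in>?B. f b *\<^sub>R b) \<bullet> axis j 1" by (simp add: inner_axis)
    also have "\<dots> = f (axis j 1)" by (rule inner_sum_left_Basis) (auto simp: Basis_vec_def)
    finally show ?thesis .
  qed
  define g where "g f = (\<Sum>b\<in>?B. f b *\<^sub>R b)" for f :: "real^'n \<Rightarrow> real"
  define T where "T = {f :: real^'n \<Rightarrow> real. 0 \<le> f e \<and> f e \<le> 1 \<and> (\<Sum>b\<in>A. (f b)\<^sup>2) \<le> r\<^sup>2}"
  let ?M = "Pi\<^sub>M ?B (\<lambda>_. lborel) :: (real^'n \<Rightarrow> real) measure"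
  have mm: "g \<in> measurable ?M borel" unfolding g_def by measurable
  have gT: "g -` ?S = T" by (auto simp: T_def g_def comp sumA e_def simp del: sum_component)
  have Tm0: "T \<inter> space ?M \<in> sets ?M" using measurable_sets[OF mm Sm] unfolding gT .
  have "emeasure lborel ?S = emeasure (distr ?M borel g) ?S"
    unfolding g_def by (subst lborel_eq) simp
  also have "\<dots> = emeasure ?M (T \<inter> space ?M)"
    using Sm mm unfolding gT[symmetric] by (intro emeasure_distr) auto
  also have "\<dots> = (\<integral>\<^sup>+f. indicator (T \<inter> space ?M) f \<partial>?M)" using Tm0 by (rule nn_integral_indicator[symmetric])
  also have "\<dots> = (\<integral>\<^sup>+f. indicator T f \<partial>Pi\<^sub>M (insert e A) (\<lambda>_. lborel))"
    unfolding B(1)[symmetric] by (intro nn_integral_cong) (simp add: indicator_def)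
  also have "\<dots> = (\<integral>\<^sup>+y. (\<integral>\<^sup>+f. indicator T (f(e := y)) \<partial>Pi\<^sub>M A (\<lambda>_. lborel)) \<partial>lborel)"
  proof (rule product_nn_integral_insert_rev[OF B(3,2)])
    have "(indicator (T \<inter> space ?M) :: _ \<Rightarrow> ennreal) \<in> borel_measurable ?M" using Tm0 by (rule borel_measurable_indicator)
    then have "(indicator T :: _ \<Rightarrow> ennreal) \<in> borel_measurable ?M"
      by (subst (asm) measurable_cong[of ?M _ "indicator T"]) (auto simp: indicator_def)
    then show "(indicator T :: _ \<Rightarrow> ennreal) \<in> borel_measurable (Pi\<^sub>M (insert e A) (\<lambda>_. lborel))"
      unfolding B(1)[symmetric] .
  qed
  also have "\<dots> = (\<integral>\<^sup>+(y::real). indicator {0..1} y * emeasure (Pi\<^sub>M A (\<lambda>_. lborel)) ({f. sqrt (\<Sum>b\<in>A. (f b)\<^sup>2) \<le> r} \<inter> space (Pi\<^sub>M A (\<lambda>_. lborel))) \<partial>lborel)"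
  proof (rule nn_integral_cong)
    fix y :: real
    have Tm: "{f. sqrt (\<Sum>b\<in>A. (f b)\<^sup>2) \<le> r} \<inter> space (Pi\<^sub>M A (\<lambda>_. lborel)) \<in> sets (Pi\<^sub>M A (\<lambda>_. lborel))"
    proof -
      have "(\<lambda>f. sqrt (\<Sum>b\<in>A. (f b)\<^sup>2)) \<in> borel_measurable (Pi\<^sub>M A (\<lambda>_. lborel))" by measurable
      then have "{f \<in> space (Pi\<^sub>M A (\<lambda>_. lborel)). sqrt (\<Sum>b\<in>A. (f b)\<^sup>2) \<le> r} \<in> sets (Pi\<^sub>M A (\<lambda>_. lborel))" by measurable
      moreover have "{f \<in> space (Pi\<^sub>M A (\<lambda>_. lborel)). sqrt (\<Sum>b\<in>A. (f b)\<^sup>2) \<le> r} = {f. sqrt (\<Sum>b\<in>A. (f b)\<^sup>2) \<le> r} \<inter> space (Pi\<^sub>M A (\<lambda>_. lborel))" by blast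
      ultimately show ?thesis by simp
    qed
    have s1: "(\<Sum>b\<in>A. ((f(e := y)) b)\<^sup>2) = (\<Sum>b\<in>A. (f b)\<^sup>2)" for f :: "real^'n \<Rightarrow> real"
      using B(2) by (intro sum.cong) auto
    have s2: "sqrt t \<le> r \<longleftrightarrow> t \<le> r\<^sup>2" if "t \<ge> 0" for t
      using r real_sqrt_le_iff[of t "r\<^sup>2"] by simp
    have "(\<integral>\<^sup>+f. indicator T (f(e := y)) \<partial>Pi\<^sub>M A (\<lambda>_. lborel))
      = (\<integral>\<^sup>+f. indicator {0..1} y * indicator ({f. sqrt (\<Sum>b\<in>A. (f b)\<^sup>2) \<le> r} \<inter> space (Pi\<^sub>M A (\<lambda>_. lborel))) f \<partial>Pi\<^sub>M A (\<lambda>_. lborel))"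
      unfolding indicator_def T_def mem_Collect_eq s1 by (intro nn_integral_cong) (simp add: s2 sum_nonneg)
    also have "\<dots> = indicator {0..1} y * emeasure (Pi\<^sub>M A (\<lambda>_. lborel)) ({f. sqrt (\<Sum>b\<in>A. (f b)\<^sup>2) \<le> r} \<inter> space (Pi\<^sub>M A (\<lambda>_. lborel)))"
      using Tm by (subst nn_integral_cmult) auto
    finally show "(\<integral>\<^sup>+f. indicator T (f(e := y)) \<partial>Pi\<^sub>M A (\<lambda>_. lborel)) = indicator {0..1} y * emeasure (Pi\<^sub>M A (\<lambda>_. lborel)) ({f. sqrt (\<Sum>b\<in>A. (f b)\<^sup>2) \<le> r} \<inter> space (Pi\<^sub>M A (\<lambda>_. lborel)))" .
  qed
  also have "\<dots> = ennreal (unit_ball_vol (real (card A)) * r ^ card A)"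
    unfolding emeasure_cball_aux[OF B(3) r] by (simp add: nn_integral_multc)
  finally show ?thesis by (simp add: cA hausdorff_normalization_def unit_ball_vol_def)
qed

text \<open>A cube in the hyperplane \<open>x $ i = 0\<close>, half open so that grids of subcubes
  tile it.\<close>

definition hcube :: "'n::finite \<Rightarrow> real \<Rightarrow> (real^'n) set" where
  "hcube i l = {x. x $ i = 0 \<and> (\<forall>j. j \<noteq> i \<longrightarrow> - l / 2 \<le> x $ j \<and> x $ j < l / 2)}"

lemma norm_le_card_mult:
  fixes x :: "real^'n::finite"
  assumes "\<And>j. \<bar>x $ j\<bar> \<le> c" shows "norm x \<le> real CARD('n) * c"
proof -
  have "norm x \<le> (\<Sum>j\<in>UNIV. \<bar>x $ j\<bar>)" by (rule norm_le_l1_cart)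
  also have "\<dots> \<le> (\<Sum>j\<in>(UNIV::'n set). c)" by (intro sum_mono assms)
  finally show ?thesis by simp
qed

lemma hcube_diff_norm:
  fixes x y :: "real^'n::finite"
  assumes "x \<in> hcube i l" "y \<in> hcube i l" "l \<ge> 0"
  shows "norm (x - y) \<le> real CARD('n) * l"
proof (rule norm_le_card_mult)
  fix j
  show "\<bar>(x - y) $ j\<bar> \<le> l"
  proof (cases "j = i")
    case False
    then have "- l / 2 \<le> x $ j" "x $ j < l / 2" "- l / 2 \<le> y $ j" "y $ j < l / 2" using assms by (auto simp: hcube_def)
    then show ?thesis by simp
  qed (use assms in \<open>simp add: hcube_def\<close>)
qed

text \<open>A crude finite constant, from covering the cube by itself; it gives the recursion in
  \<open>hcont_hcube\<close> a starting point.\<close>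

lemma hcont_hcube_rough:
  fixes i :: "'n::finite"
  assumes l: "l \<ge> 0" "real CARD('n) * l \<le> \<delta>"
  shows "hcont s \<delta> (hcube i l) \<le> ennreal (hausdorff_normalization s * (real CARD('n) / 2) ^ s * l ^ s)"
proof -
  have bdd: "bounded (hcube i l)"
  proof -
    have "norm x \<le> real CARD('n) * l" if "x \<in> hcube i l" for x :: "real^'n"
    proof (rule norm_le_card_mult)
      fix j show "\<bar>x $ j\<bar> \<le> l"
      proof (cases "j = i")
        case False
        then have "- l / 2 \<le> x $ j" "x $ j < l / 2" using that by (auto simp: hcube_def)
        then show ?thesis using l by linarith
      qed (use that l in \<open>simp add: hcube_def\<close>)
    qed
    then show ?thesis unfolding bounded_iff by blast
  qed
  have d: "diameter (hcube i l) \<le> real CARD('n) * l"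
    using hcube_diff_norm[of _ i l] l by (intro diameter_le) auto
  have "0 \<le> real CARD('n) * l" using l by simp
  then have "\<delta> \<ge> 0" using l(2) by linarith
  then have "hcont s \<delta> (hcube i l) \<le> cst s (hcube i l)" using bdd d l by (intro hcont_le_cst) auto
  also have "\<dots> \<le> ennreal (hausdorff_normalization s * (real CARD('n) / 2) ^ s * l ^ s)"
  proof -
    have "hausdorff_normalization s * (diameter (hcube i l) / 2) ^ s \<le> hausdorff_normalization s * (real CARD('n) * l / 2) ^ s"
      using d hausdorff_normalization_pos[of s] diameter_ge_0[OF bdd] by (intro mult_left_mono power_mono) auto
    also have "\<dots> = hausdorff_normalization s * (real CARD('n) / 2) ^ s * l ^ s"
      by (simp add: power_mult_distrib power_divide)
    finally have "hausdorff_normalization s * (diameter (hcube i l) / 2) ^ s \<le> hausdorff_normalization s * (real CARD('n) / 2) ^ s * l ^ s" .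
    moreover have "0 \<le> hausdorff_normalization s * (real CARD('n) / 2) ^ s * l ^ s" using hausdorff_normalization_pos[of s] l by simp
    ultimately show ?thesis by (simp add: cst_def ennreal_leI)
  qed
  finally show ?thesis .
qed

lemma hcont_translate: "hcont s \<delta> ((+) v ` A) \<le> hcont s \<delta> A"
  by (rule hcont_isometry) simp

text \<open>Cover the cube by its inscribed ball and by the cells of a fine grid that are not contained in
  that ball; the number of those cells is controlled by the volume of the ball.\<close>

lemma hcont_hcube_recursion:
  fixes i :: "'n::finite"
  defines "s \<equiv> CARD('n) - 1"
  assumes l: "0 < l" "real CARD('n) * l \<le> \<delta>" and M: "2 * CARD('n) < M"
    and g: "g \<ge> 0" "hcont s \<delta> (hcube i (l / real M)) \<le> ennreal (g * (l / real M) ^ s)"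
  shows "hcont s \<delta> (hcube i l) \<le> ennreal ((hausdorff_normalization s * (1/2) ^ s
      + g * (1 - hausdorff_normalization s * (1/2 - real CARD('n) / real M) ^ s)) * l ^ s)"
proof -
  let ?N = "CARD('n)"
  let ?w = "hausdorff_normalization s"
  have w: "?w > 0" by (rule hausdorff_normalization_pos)
  have "0 \<le> real ?N * l" using l by simp
  then have d: "\<delta> \<ge> 0" using l(2) by linarith
  have M0: "real M > 0" using M by simp
  define h where "h = l / real M"
  have h: "h > 0" "real M * h = l" using l M0 by (auto simp: h_def)
  define KK where "KK = PiE (UNIV - {i}) (\<lambda>_. {..<M})"
  have KKf: "finite KK" unfolding KK_def by (intro finite_PiE) auto
  have KKc: "card KK = M ^ s" unfolding KK_def by (subst card_PiE) (auto simp: s_def card_Diff_singleton)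
  define v where "v k = (\<chi> j. if j = i then 0 else - l / 2 + (real (k j) + 1/2) * h)" for k :: "'n \<Rightarrow> nat"
  define Sub where "Sub k = (+) (v k) ` hcube i h" for k
  have Sub_iff: "x \<in> Sub k \<longleftrightarrow> x $ i = 0 \<and> (\<forall>j. j \<noteq> i \<longrightarrow> - l / 2 + real (k j) * h \<le> x $ j \<and> x $ j < - l / 2 + (real (k j) + 1) * h)" for x k
  proof -
    have "x \<in> Sub k \<longleftrightarrow> x - v k \<in> hcube i h"
      unfolding Sub_def by (auto intro!: image_eqI[of _ _ "x - v k"])
    also have "\<dots> \<longleftrightarrow> x $ i = 0 \<and> (\<forall>j. j \<noteq> i \<longrightarrow> - l / 2 + real (k j) * h \<le> x $ j \<and> x $ j < - l / 2 + (real (k j) + 1) * h)"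
      by (auto simp: hcube_def v_def algebra_simps)
    finally show ?thesis .
  qed
  define kk where "kk x = restrict (\<lambda>j. nat \<lfloor>(x $ j + l / 2) / h\<rfloor>) (UNIV - {i})" for x :: "real^'n"
  have kk: "kk x \<in> KK" "\<And>j. j \<noteq> i \<Longrightarrow> - l / 2 + real (kk x j) * h \<le> x $ j \<and> x $ j < - l / 2 + (real (kk x j) + 1) * h"
    if x: "\<And>j. j \<noteq> i \<Longrightarrow> - l / 2 \<le> x $ j \<and> x $ j < l / 2" for x :: "real^'n"
  proof -
    have *: "(x $ j + l / 2) / h < real M" "0 \<le> (x $ j + l / 2) / h" if j: "j \<noteq> i" for j
      using x[OF j] h by (auto simp: pos_divide_less_eq)
    have **: "real (kk x j) \<le> (x $ j + l / 2) / h" "(x $ j + l / 2) / h < real (kk x j) + 1" if j: "j \<noteq> i" for j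
    proof -
      have "real (kk x j) = real_of_int \<lfloor>(x $ j + l / 2) / h\<rfloor>" using *(2)[OF j] j by (simp add: kk_def)
      then show "real (kk x j) \<le> (x $ j + l / 2) / h" "(x $ j + l / 2) / h < real (kk x j) + 1" by linarith+
    qed
    have "kk x j < M" if j: "j \<noteq> i" for j
    proof -
      have "real (kk x j) < real M" using *[OF j] **[OF j] by linarith
      then show ?thesis by simp
    qed
    then show "kk x \<in> KK" by (auto simp: KK_def kk_def PiE_iff)
    fix j assume j: "j \<noteq> i"
    show "- l / 2 + real (kk x j) * h \<le> x $ j \<and> x $ j < - l / 2 + (real (kk x j) + 1) * h"
      using **[OF j] h by (simp add: pos_le_divide_eq pos_divide_less_eq)
  qed
  define Good where "Good = {k \<in> KK. Sub k \<subseteq> cball 0 (l/2)}"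
  define Bad where "Bad = KK - Good"
  have fin: "finite Good" "finite Bad" "Good \<subseteq> KK" using KKf by (auto simp: Good_def Bad_def)
  have cB: "real (card Bad) = real M ^ s - real (card Good)"
    using card_Diff_subset[OF fin(1,3)] card_mono[OF KKf fin(3)] by (simp add: Bad_def KKc of_nat_diff)
  \<comment> \<open>Grid cells have diameter at most \<open>?N * h\<close>, so every cell meeting
    the ball of radius \<open>\<rho>\<close> lies in that of radius \<open>l / 2\<close>; the volume
    of the smaller ball bounds the number of good cells from below.\<close>
  define \<rho> where "\<rho> = l / 2 - real ?N * h"
  have rho: "\<rho> > 0" "\<rho> = l * (1/2 - real ?N / real M)"
  proof -
    show eq: "\<rho> = l * (1/2 - real ?N / real M)" by (simp add: \<rho>_def h_def right_diff_distrib)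
    have "real ?N / real M < 1/2" using M M0 by (simp add: pos_divide_less_eq)
    then show "\<rho> > 0" unfolding eq using l by simp
  qed
  have goodcount: "?w * \<rho> ^ s \<le> real (card Good) * h ^ s"
  proof -
    let ?Cyl = "{x :: real^'n. 0 \<le> x $ i \<and> x $ i \<le> 1 \<and> (\<Sum>j\<in>UNIV-{i}. (x $ j)\<^sup>2) \<le> \<rho>\<^sup>2}"
    define Bx where "Bx k = cbox (\<chi> j. if j = i then 0 else - l / 2 + real (k j) * h) ((\<chi> j. if j = i then 1 else - l / 2 + (real (k j) + 1) * h) :: real^'n)" for k
    have Bv: "emeasure lborel (Bx k) = ennreal (h ^ s)" for k
    proof -
      have ne: "Bx k \<noteq> {}" unfolding Bx_def interval_ne_empty_cart using h by auto
      have "measure lborel (Bx k) = (\<Prod>j\<in>UNIV. if j = i then 1 else h)"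
      proof -
        let ?a = "(\<chi> j. if j = i then 0 else - l / 2 + real (k j) * h) :: real^'n" and ?b = "(\<chi> j. if j = i then 1 else - l / 2 + (real (k j) + 1) * h) :: real^'n"
        have "measure lborel (Bx k) = (\<Prod>j\<in>UNIV. ?b $ j - ?a $ j)" using ne unfolding Bx_def by (rule content_cbox_cart)
        also have "\<dots> = (\<Prod>j\<in>UNIV. if j = i then 1 else h)" by (rule prod.cong) (auto simp: algebra_simps)
        finally show ?thesis .
      qed
      also have "\<dots> = 1 * (\<Prod>j\<in>UNIV-{i}. if j = i then 1 else h)" by (subst prod.remove[of _ i]) auto
      also have "(\<Prod>j\<in>UNIV-{i}. if j = i then 1 else h) = (\<Prod>j\<in>UNIV-{i}. h)" by (rule prod.cong) auto
      also have "\<dots> = h ^ s" by (simp add: s_def card_Diff_singleton)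
      finally have "measure lborel (Bx k) = h ^ s" by simp
      then show ?thesis using emeasure_eq_ennreal_measure[of lborel "Bx k"] by (simp add: Bx_def emeasure_lborel_cbox_eq)
    qed
    have "?Cyl \<subseteq> (\<Union>k\<in>Good. Bx k)"
    proof
      fix x assume x: "x \<in> ?Cyl"
      define x' where "x' = (\<chi> j. if j = i then 0 else x $ j)"
      have nx': "norm x' \<le> \<rho>"
      proof -
        have "(norm x')\<^sup>2 = (\<Sum>j\<in>UNIV. (x' $ j)\<^sup>2)" by (simp add: norm_vec_def L2_set_def sum_nonneg)
        also have "\<dots> = (x' $ i)\<^sup>2 + (\<Sum>j\<in>UNIV-{i}. (x' $ j)\<^sup>2)" by (subst sum.remove[of _ i]) auto
        also have "\<dots> = (\<Sum>j\<in>UNIV-{i}. (x $ j)\<^sup>2)" by (auto simp: x'_def intro!: sum.cong)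
        also have "\<dots> \<le> \<rho>\<^sup>2" using x by simp
        finally show ?thesis using rho by (simp add: power2_le_iff_abs_le)
      qed
      have rl: "\<rho> < l / 2" using h by (simp add: \<rho>_def)
      have xj: "- l / 2 \<le> x $ j \<and> x $ j < l / 2" if "j \<noteq> i" for j
        using component_le_norm_cart[of x' j] nx' rl that by (auto simp: x'_def abs_le_iff)
      have k1: "kk x \<in> KK" by (rule kk(1)) (rule xj)
      have k2: "- l / 2 + real (kk x j) * h \<le> x $ j \<and> x $ j < - l / 2 + (real (kk x j) + 1) * h" if "j \<noteq> i" for j
        by (rule kk(2)[OF xj that])
      have "Sub (kk x) \<subseteq> cball 0 (l/2)"
      proof
        fix y assume y: "y \<in> Sub (kk x)"
        have "norm (y - x') \<le> real ?N * h"
        proof (rule norm_le_card_mult)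
          fix j
          show "\<bar>(y - x') $ j\<bar> \<le> h"
          proof (cases "j = i")
            case False
            then have "- l / 2 + real (kk x j) * h \<le> y $ j \<and> y $ j < - l / 2 + (real (kk x j) + 1) * h" using y Sub_iff by blast
            then show ?thesis using k2[OF False] False by (simp add: x'_def distrib_right abs_le_iff)
          qed (use y Sub_iff h in \<open>auto simp: x'_def\<close>)
        qed
        then have "norm y \<le> l / 2" using nx' norm_triangle_ineq[of "y - x'" x'] by (simp add: \<rho>_def)
        then show "y \<in> cball 0 (l/2)" by simp
      qed
      then have "kk x \<in> Good" using k1 by (simp add: Good_def)
      moreover have "x \<in> Bx (kk x)" unfolding Bx_def mem_box_cart using k2 x by (auto simp: less_imp_le)
      ultimately show "x \<in> (\<Union>k\<in>Good. Bx k)" by blast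
    qed
    then have "emeasure lborel ?Cyl \<le> emeasure lborel (\<Union>k\<in>Good. Bx k)"
      using fin(1) by (intro emeasure_mono) (auto simp: Bx_def)
    also have "\<dots> \<le> (\<Sum>k\<in>Good. emeasure lborel (Bx k))"
      using fin(1) by (intro emeasure_subadditive_finite) (auto simp: Bx_def)
    also have "\<dots> = ennreal (real (card Good) * h ^ s)"
      using h by (simp add: Bv ennreal_mult ennreal_of_nat_eq_real_of_nat)
    finally have "ennreal (?w * \<rho> ^ s) \<le> ennreal (real (card Good) * h ^ s)"
      unfolding emeasure_ball_cylinder[OF rho(1)] s_def .
    then show ?thesis using h by (subst (asm) ennreal_le_iff) auto
  qed
  have bad: "real (card Bad) * h ^ s \<le> l ^ s - ?w * \<rho> ^ s"
  proof -
    have "real (card Bad) * h ^ s = (real M * h) ^ s - real (card Good) * h ^ s"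
      by (simp add: cB left_diff_distrib power_mult_distrib)
    then show ?thesis using goodcount h by simp
  qed
  let ?D = "hcube i l \<inter> cball 0 (l/2)"
  have sub: "hcube i l \<subseteq> ?D \<union> (\<Union>k\<in>Bad. Sub k)"
  proof
    fix x assume x: "x \<in> hcube i l"
    then have xj: "- l / 2 \<le> x $ j \<and> x $ j < l / 2" if "j \<noteq> i" for j using that by (auto simp: hcube_def)
    have k1: "kk x \<in> KK" by (rule kk(1)) (rule xj)
    have k2: "- l / 2 + real (kk x j) * h \<le> x $ j \<and> x $ j < - l / 2 + (real (kk x j) + 1) * h" if "j \<noteq> i" for j
      by (rule kk(2)[OF xj that])
    have xs: "x \<in> Sub (kk x)" using k2 x by (auto simp: Sub_iff hcube_def)
    show "x \<in> ?D \<union> (\<Union>k\<in>Bad. Sub k)"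
    proof (cases "kk x \<in> Good")
      case True
      then show ?thesis using xs x by (auto simp: Good_def)
    next
      case False
      then show ?thesis using xs k1 by (auto simp: Bad_def)
    qed
  qed
  have hD: "hcont s \<delta> ?D \<le> ennreal (?w * (l / 2) ^ s)"
  proof -
    have bdd: "bounded ?D" by (intro bounded_Int) simp
    have dl: "diameter ?D \<le> l"
    proof (rule diameter_le)
      fix x y :: "real^'n" assume "x \<in> ?D" "y \<in> ?D"
      then show "norm (x - y) \<le> l" using norm_triangle_ineq4[of x y] by simp
    qed (use l in simp)
    have "l \<le> real ?N * l" using l by (simp add: Suc_le_eq)
    then have "diameter ?D \<le> \<delta>" using dl l by linarith
    then have "hcont s \<delta> ?D \<le> cst s ?D" using bdd d by (intro hcont_le_cst) auto
    also have "\<dots> \<le> ennreal (?w * (l / 2) ^ s)"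
    proof -
      have "?w * (diameter ?D / 2) ^ s \<le> ?w * (l / 2) ^ s"
        using dl w diameter_ge_0[OF bdd] by (intro mult_left_mono power_mono) auto
      then show ?thesis using w l by (simp add: cst_def ennreal_leI)
    qed
    finally show ?thesis .
  qed
  have hB: "hcont s \<delta> (\<Union>k\<in>Bad. Sub k) \<le> ennreal (g * (l ^ s - ?w * \<rho> ^ s))"
  proof -
    have "hcont s \<delta> (\<Union>k\<in>Bad. Sub k) \<le> (\<integral>\<^sup>+k. hcont s \<delta> (Sub k) \<partial>count_space Bad)" by (rule hcont_UN[OF d])
    also have "\<dots> \<le> (\<integral>\<^sup>+k. ennreal (g * h ^ s) \<partial>count_space Bad)"
      unfolding Sub_def h_def by (intro nn_integral_mono order_trans[OF hcont_translate g(2)])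
    also have "\<dots> = ennreal (g * (real (card Bad) * h ^ s))"
      using fin(2) g(1) h by (simp add: nn_integral_count_space_finite ennreal_mult[symmetric] ennreal_of_nat_eq_real_of_nat mult_ac)
    also have "\<dots> \<le> ennreal (g * (l ^ s - ?w * \<rho> ^ s))" using bad g(1) by (intro ennreal_leI mult_left_mono)
    finally show ?thesis .
  qed
  have nn: "0 \<le> l ^ s - ?w * \<rho> ^ s" 
  proof -
    have "0 \<le> real (card Bad) * h ^ s" using h by simp
    then show ?thesis using bad by linarith
  qed
  have "hcont s \<delta> (hcube i l) \<le> hcont s \<delta> ?D + hcont s \<delta> (\<Union>k\<in>Bad. Sub k)"
    using hcont_mono[OF sub] hcont_Un[OF d] order_trans by blast
  also have "\<dots> \<le> ennreal (?w * (l / 2) ^ s) + ennreal (g * (l ^ s - ?w * \<rho> ^ s))" by (intro add_mono hD hB)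
  also have "\<dots> = ennreal (?w * (l / 2) ^ s + g * (l ^ s - ?w * \<rho> ^ s))" using w l g nn by (intro ennreal_plus[symmetric]) auto
  also have "?w * (l / 2) ^ s + g * (l ^ s - ?w * \<rho> ^ s) = (?w * (1/2) ^ s + g * (1 - ?w * (1/2 - real ?N / real M) ^ s)) * l ^ s"
  proof -
    have "\<rho> ^ s = l ^ s * (1/2 - real ?N / real M) ^ s" unfolding rho(2) by (rule power_mult_distrib)
    moreover have "(l / 2) ^ s = l ^ s * (1/2) ^ s" using power_mult_distrib[of l "1/2" s] by simp
    ultimately show ?thesis by (simp add: algebra_simps)
  qed
  finally show ?thesis .
qed

text \<open>The sharp constant 1. Let \<open>g\<close> be the best constant for all cubes of side at
  most \<open>l\<close>, finite by the rough bound. As \<open>M\<close> tends to infinity the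
  recursion becomes \<open>g \<le> q + (1 - q) * g\<close>, up to truncation at 0, where
  \<open>q > 0\<close> is the share of the cube filled by its inscribed ball; hence
  \<open>g \<le> 1\<close>.\<close>

lemma hcont_hcube:
  fixes i :: "'n::finite"
  assumes l: "0 < l" "real CARD('n) * l \<le> \<delta>"
  shows "hcont (CARD('n) - 1) \<delta> (hcube i l) \<le> ennreal (l ^ (CARD('n) - 1))"
proof -
  let ?N = "CARD('n)"
  define s where "s = ?N - 1"
  let ?w = "hausdorff_normalization s"
  have w: "?w > 0" by (rule hausdorff_normalization_pos)
  \<comment> \<open>All sides \<open>t \<le> l\<close> are included because the recursion passes
    from \<open>t\<close> to \<open>t / M\<close>.\<close>
  define G where "G = {g. g \<ge> 0 \<and> (\<forall>t. 0 < t \<longrightarrow> t \<le> l \<longrightarrow> hcont s \<delta> (hcube i t) \<le> ennreal (g * t ^ s))}"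
  have td: "real ?N * t \<le> \<delta>" if "t \<le> l" for t using that l(2) by (meson mult_left_mono of_nat_0_le_iff order_trans)
  have ne: "G \<noteq> {}"
  proof -
    have "?w * (real ?N / 2) ^ s \<in> G" unfolding G_def
      using w hcont_hcube_rough[OF _ td, of _ s i] by (auto simp: less_imp_le)
    then show ?thesis by blast
  qed
  have bdd: "bdd_below G" by (auto simp: G_def bdd_below_def)
  define g where "g = Inf G"
  have g0: "g \<ge> 0" unfolding g_def using ne by (intro cInf_greatest) (auto simp: G_def)
  have gb: "hcont s \<delta> (hcube i t) \<le> ennreal (g * t ^ s)" if t: "0 < t" "t \<le> l" for t
  proof (rule ennreal_le_epsilon)
    fix e :: real assume e: "e > 0"
    have ts: "t ^ s > 0" using t by simp
    obtain g' where g': "g' \<in> G" "g' < g + e / t ^ s" using cInf_lessD[OF ne, of "g + e / t ^ s"] e ts by (auto simp: g_def)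
    have "hcont s \<delta> (hcube i t) \<le> ennreal (g' * t ^ s)" using g'(1) t by (auto simp: G_def)
    also have "\<dots> \<le> ennreal ((g + e / t ^ s) * t ^ s)" using g' ts by (intro ennreal_leI mult_right_mono) auto
    also have "(g + e / t ^ s) * t ^ s = g * t ^ s + e" using t by (simp add: distrib_right)
    also have "ennreal (g * t ^ s + e) = ennreal (g * t ^ s) + ennreal e" using g0 ts e by (intro ennreal_plus) auto
    finally show "hcont s \<delta> (hcube i t) \<le> ennreal (g * t ^ s) + ennreal e" .
  qed
  have rec: "g \<le> max 0 (?w * (1/2) ^ s + g * (1 - ?w * (1/2 - real ?N / real M) ^ s))" if M: "2 * ?N < M" for M
  proof -
    define g2 where "g2 = max 0 (?w * (1/2) ^ s + g * (1 - ?w * (1/2 - real ?N / real M) ^ s))"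
    have "hcont s \<delta> (hcube i t) \<le> ennreal (g2 * t ^ s)" if t: "0 < t" "t \<le> l" for t
    proof -
      have M1: "real M \<ge> 1" using M by simp
      have tM: "0 < t / real M" "t / real M \<le> l"
      proof -
        have "l * 1 \<le> l * real M" using M1 l by (intro mult_left_mono) auto
        then have "t \<le> l * real M" using t by linarith
        then show "0 < t / real M" "t / real M \<le> l" using t M1 by (auto simp: pos_divide_le_eq)
      qed
      have "hcont s \<delta> (hcube i t) \<le> ennreal ((?w * (1/2) ^ s + g * (1 - ?w * (1/2 - real ?N / real M) ^ s)) * t ^ s)"
        using hcont_hcube_recursion[of t \<delta> M g i] t td[OF t(2)] M g0 gb[OF tM] unfolding s_def by blast
      also have "\<dots> \<le> ennreal (g2 * t ^ s)"
        unfolding g2_def using t by (intro ennreal_leI mult_right_mono) auto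
      finally show ?thesis .
    qed
    then have "g2 \<in> G" unfolding G_def by (simp add: g2_def)
    then have "g \<le> g2" unfolding g_def by (rule cInf_lower[OF _ bdd])
    then show ?thesis by (simp only: g2_def)
  qed
  have "(\<lambda>M. max 0 (?w * (1/2) ^ s + g * (1 - ?w * (1/2 - real ?N / real M) ^ s))) \<longlonglongrightarrow> max 0 (?w * (1/2) ^ s + g * (1 - ?w * (1/2 - 0) ^ s))"
    by (intro tendsto_intros lim_const_over_n)
  then have "g \<le> max 0 (?w * (1/2) ^ s + g * (1 - ?w * (1/2 - 0) ^ s))"
    by (rule LIMSEQ_le_const) (use rec in \<open>auto intro!: exI[of _ "Suc (2 * ?N)"]\<close>)
  then have "g \<le> 1"
  proof -
    define q where "q = ?w * (1/2) ^ s"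
    have q: "q > 0" using w by (simp add: q_def)
    have "g \<le> max 0 (q + g * (1 - q))" using \<open>g \<le> max 0 _\<close> by (simp add: q_def)
    then have "g \<le> 0 \<or> q * g \<le> q * 1" by (auto simp: max_def algebra_simps split: if_splits)
    then show "g \<le> 1" using q by auto
  qed
  then have "ennreal (g * l ^ s) \<le> ennreal (l ^ s)" using l by (intro ennreal_leI) (simp add: mult_left_le_one_le g0)
  then show ?thesis using order_trans[OF gb[OF l(1) order_refl]] unfolding s_def by blast
qed

text \<open>The section of \<open>A\<close> by the hyperplane \<open>n \<bullet> x = s\<close>, thickened to a cylinder of unit height:
  its Lebesgue measure is the \<open>(N-1)\<close>-dimensional measure of the section.\<close>
definition seccyl :: "real^'n::finite \<Rightarrow> real \<Rightarrow> (real^'n) set \<Rightarrow> (real^'n) set" where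
  "seccyl n s A = {x. 0 \<le> n \<bullet> x \<and> n \<bullet> x < 1 \<and> x + (s - n \<bullet> x) *\<^sub>R n \<in> A}"

lemma sets_seccyl_pair:
  fixes A :: "(real^'n::finite) set"
  assumes A: "A \<in> sets borel"
  shows "{p. snd p \<in> seccyl n (fst p) A} \<in> sets (borel \<Otimes>\<^sub>M (borel :: (real^'n) measure))"
proof -
  note A[measurable]
  have "(\<lambda>p :: real \<times> (real^'n). snd p + (fst p - n \<bullet> snd p) *\<^sub>R n) \<in> borel_measurable (borel \<Otimes>\<^sub>M borel)" by measurable
  from measurable_sets[OF this A]
  have 1: "(\<lambda>p :: real \<times> (real^'n). snd p + (fst p - n \<bullet> snd p) *\<^sub>R n) -` A \<in> sets (borel \<Otimes>\<^sub>M borel)" by (simp add: space_pair_measure)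
  have "{p \<in> space (borel \<Otimes>\<^sub>M (borel :: (real^'n) measure)). 0 \<le> n \<bullet> snd p \<and> n \<bullet> snd p < 1} \<in> sets ((borel :: real measure) \<Otimes>\<^sub>M (borel :: (real^'n) measure))"
    by measurable
  then have 2: "{p :: real \<times> (real^'n). 0 \<le> n \<bullet> snd p \<and> n \<bullet> snd p < 1} \<in> sets (borel \<Otimes>\<^sub>M borel)" by (simp add: space_pair_measure)
  have "{p. snd p \<in> seccyl n (fst p) A} = {p. 0 \<le> n \<bullet> snd p \<and> n \<bullet> snd p < 1} \<inter> ((\<lambda>p :: real \<times> (real^'n). snd p + (fst p - n \<bullet> snd p) *\<^sub>R n) -` A)"
    by (auto simp: seccyl_def)
  then show ?thesis using sets.Int[OF 2 1] by simp
qed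

lemma sets_seccyl: "A \<in> sets borel \<Longrightarrow> seccyl n s A \<in> sets borel"
  using sets_Pair1[OF sets_seccyl_pair[of A n], of s] by simp

lemma seccyl_measurable:
  fixes A :: "(real^'n::finite) set"
  assumes A: "A \<in> sets borel"
  shows "(\<lambda>s. emeasure lborel (seccyl n s A)) \<in> borel_measurable borel"
proof -
  have "{p. snd p \<in> seccyl n (fst p) A} \<in> sets (borel \<Otimes>\<^sub>M lborel)" using sets_seccyl_pair[OF A]
  proof -
    have "sets ((borel :: real measure) \<Otimes>\<^sub>M (lborel :: (real^'n) measure)) = sets (borel \<Otimes>\<^sub>M borel)" by (rule sets_pair_measure_cong) auto
    then show ?thesis using sets_seccyl_pair[OF A] by blast
  qed
  from lborel.measurable_emeasure_Pair[OF this] show ?thesis by simp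
qed

text \<open>Fubini: with \<open>s = n \<bullet> x + t\<close> and \<open>x\<close> moved by
  \<open>t *\<^sub>R n\<close>, each point \<open>y\<close> of \<open>A\<close> is counted for those
  \<open>t\<close> with \<open>0 \<le> n \<bullet> y - t < 1\<close>, a set of length 1.\<close>

lemma nn_integral_seccyl:
  fixes A :: "(real^'n::finite) set"
  assumes A: "A \<in> sets borel" and n: "norm n = 1"
  shows "(\<integral>\<^sup>+s. emeasure lborel (seccyl n s A) \<partial>lborel) = emeasure lborel A"
proof -
  note A[measurable]
  have nn: "n \<bullet> n = 1" using n by (simp add: dot_square_norm)
  let ?i = "\<lambda>x. indicator {0..<1} (n \<bullet> x) :: ennreal"
  have [measurable]: "(\<lambda>(s, x). x + (s - n \<bullet> x) *\<^sub>R n) \<in> borel_measurable (borel \<Otimes>\<^sub>M borel)"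
    "(\<lambda>(x, s). x + (s - n \<bullet> x) *\<^sub>R n) \<in> borel_measurable (borel \<Otimes>\<^sub>M borel)"
    "(\<lambda>(x, t). x + t *\<^sub>R n) \<in> borel_measurable (borel \<Otimes>\<^sub>M borel)" "(\<lambda>(t, x). x + t *\<^sub>R n) \<in> borel_measurable (borel \<Otimes>\<^sub>M borel)"
    "(\<lambda>(t, x). x - t *\<^sub>R n) \<in> borel_measurable (borel \<Otimes>\<^sub>M borel)" "(\<lambda>(x, t). x - t *\<^sub>R n) \<in> borel_measurable (borel \<Otimes>\<^sub>M borel)" by measurable
  have "(\<integral>\<^sup>+s. emeasure lborel (seccyl n s A) \<partial>lborel) = (\<integral>\<^sup>+s. (\<integral>\<^sup>+x. ?i x * indicator A (x + (s - n \<bullet> x) *\<^sub>R n) \<partial>lborel) \<partial>lborel)"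
    using sets_seccyl[OF A] by (intro nn_integral_cong) (auto simp: nn_integral_indicator[symmetric] seccyl_def indicator_def intro!: nn_integral_cong)
  also have "\<dots> = (\<integral>\<^sup>+x. (\<integral>\<^sup>+s. ?i x * indicator A (x + (s - n \<bullet> x) *\<^sub>R n) \<partial>lborel) \<partial>lborel)"
    by (intro lborel_pair.Fubini') measurable
  also have "\<dots> = (\<integral>\<^sup>+x. (\<integral>\<^sup>+t. ?i x * indicator A (x + t *\<^sub>R n) \<partial>lborel) \<partial>lborel)"
  proof (rule nn_integral_cong)
    fix x
    have "(\<integral>\<^sup>+s. ?i x * indicator A (x + (s - n \<bullet> x) *\<^sub>R n) \<partial>lborel)
      = (\<integral>\<^sup>+s. ?i x * indicator A (x + (s - n \<bullet> x) *\<^sub>R n) \<partial>distr lborel borel ((+) (n \<bullet> x)))" by (simp add: lborel_distr_plus)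
    also have "\<dots> = (\<integral>\<^sup>+t. ?i x * indicator A (x + t *\<^sub>R n) \<partial>lborel)" by (subst nn_integral_distr) auto
    finally show "(\<integral>\<^sup>+s. ?i x * indicator A (x + (s - n \<bullet> x) *\<^sub>R n) \<partial>lborel) = (\<integral>\<^sup>+t. ?i x * indicator A (x + t *\<^sub>R n) \<partial>lborel)" .
  qed
  also have "\<dots> = (\<integral>\<^sup>+t. (\<integral>\<^sup>+x. ?i x * indicator A (x + t *\<^sub>R n) \<partial>lborel) \<partial>lborel)"
    by (intro lborel_pair.Fubini'[symmetric]) measurable
  also have "\<dots> = (\<integral>\<^sup>+t. (\<integral>\<^sup>+y. indicator {0..<1} (n \<bullet> y - t) * indicator A y \<partial>lborel) \<partial>lborel)"
  proof (rule nn_integral_cong)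
    fix t :: real
    have "(\<integral>\<^sup>+y. indicator {0..<1} (n \<bullet> y - t) * indicator A y \<partial>lborel)
      = (\<integral>\<^sup>+y. indicator {0..<1} (n \<bullet> y - t) * indicator A y \<partial>distr lborel borel ((+) (t *\<^sub>R n)))" by (simp add: lborel_distr_plus)
    also have "\<dots> = (\<integral>\<^sup>+x. ?i x * indicator A (x + t *\<^sub>R n) \<partial>lborel)"
      by (subst nn_integral_distr) (auto simp: inner_add_right nn add.commute)
    finally show "(\<integral>\<^sup>+x. ?i x * indicator A (x + t *\<^sub>R n) \<partial>lborel) = (\<integral>\<^sup>+y. indicator {0..<1} (n \<bullet> y - t) * indicator A y \<partial>lborel)" by simp
  qed
  also have "\<dots> = (\<integral>\<^sup>+y. (\<integral>\<^sup>+t. indicator {0..<1} (n \<bullet> y - t) * indicator A y \<partial>lborel) \<partial>lborel)"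
    by (intro lborel_pair.Fubini') measurable
  also have "\<dots> = (\<integral>\<^sup>+y. indicator A y \<partial>lborel)"
  proof (rule nn_integral_cong)
    fix y
    have "(\<integral>\<^sup>+t. indicator {0..<1} (n \<bullet> y - t) * indicator A y \<partial>lborel) = (\<integral>\<^sup>+t. indicator {n \<bullet> y - 1<..n \<bullet> y} t * indicator A y \<partial>lborel)"
      by (intro nn_integral_cong) (auto simp: indicator_def)
    also have "\<dots> = indicator A y" by (subst nn_integral_multc) auto
    finally show "(\<integral>\<^sup>+t. indicator {0..<1} (n \<bullet> y - t) * indicator A y \<partial>lborel) = indicator A y" .
  qed
  finally show ?thesis using A by simp
qed

section \<open>Hyperplane sections\<close>

text \<open>The base of the open cylinder is decomposed into the largest dyadic cubes that fit into
  it and are small against \<open>\<delta>\<close>. For each of them the premeasure is at most the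
  volume by \<open>hcont_hcube\<close>, and height 1 turns this volume into Lebesgue measure of the
  cylinder.\<close>

lemma hcont_open_cylinder:
  fixes U :: "(real^'n::finite) set" and i :: 'n
  assumes U: "open U" and cyl: "\<And>x t. x \<in> U \<Longrightarrow> x + t *\<^sub>R axis i 1 \<in> U" and d: "\<delta> > 0"
  shows "hcont (CARD('n) - 1) \<delta> (U \<inter> {x. x $ i = 0}) \<le> emeasure lborel (U \<inter> {x. 0 \<le> x $ i \<and> x $ i < 1})"
proof -
  let ?N = "CARD('n)"
  obtain n0 where n0: "real ?N * (1/2) ^ n0 \<le> \<delta>"
  proof -
    obtain n where "(1/2::real) ^ n < \<delta> / real ?N" using real_arch_pow_inv[of "\<delta> / real ?N" "1/2"] d by auto
    then show thesis using that[of n] by (simp add: pos_less_divide_eq mult.commute)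
  qed
  \<comment> \<open>Dyadic index at level \<open>m\<close>; entry \<open>i\<close> is set to 0, so
    that cells are full cylinders along axis \<open>i\<close>.\<close>
  define kx where "kx m x = (\<lambda>j. if j = i then 0 else \<lfloor>2 ^ m * x $ j\<rfloor>)" for m :: nat and x :: "real^'n"
  define cell where "cell m k = {x. kx m x = k}" for m and k :: "'n \<Rightarrow> int"
  have nest: "kx m y = kx m x" if "kx m' y = kx m' x" "m \<le> m'" for m m' x y
  proof -
    have fl: "\<lfloor>2 ^ m * (r::real)\<rfloor> = \<lfloor>2 ^ m' * r\<rfloor> div 2 ^ (m' - m)" for r
    proof -
      have "(2::real) ^ m' = 2 ^ m * 2 ^ (m' - m)" using that(2) by (simp add: power_add[symmetric])
      then have "2 ^ m * r = (2 ^ m' * r) / real_of_int (2 ^ (m' - m))" by simp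
      then show ?thesis by (simp only: floor_divide_real_eq_div[OF zero_le_power[OF zero_le_numeral]])
    qed
    show ?thesis
    proof
      fix j show "kx m y j = kx m x j" using fun_cong[OF that(1), of j] by (auto simp: kx_def fl)
    qed
  qed
  have ex: "\<exists>m\<ge>n0. cell m (kx m x) \<subseteq> U" if x: "x \<in> U" for x
  proof -
    obtain e where e: "e > 0" "ball x e \<subseteq> U" using U x open_contains_ball by blast
    obtain m where m: "(1/2::real) ^ m < e / real ?N" using real_arch_pow_inv[of "e / real ?N" "1/2"] e by auto
    define m' where "m' = max m n0"
    have "(1/2::real) ^ m' \<le> (1/2) ^ m" by (intro power_decreasing) (auto simp: m'_def)
    then have "real ?N * (1/2) ^ m' \<le> real ?N * (1/2) ^ m" by (intro mult_left_mono) auto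
    moreover have "real ?N * (1/2) ^ m < e" using m by (simp add: pos_less_divide_eq mult.commute)
    ultimately have m': "real ?N * (1/2) ^ m' < e" by linarith
    have "cell m' (kx m' x) \<subseteq> U"
    proof
      fix y assume "y \<in> cell m' (kx m' x)"
      then have k: "kx m' y = kx m' x" by (simp add: cell_def)
      \<comment> \<open>The point is moved along the axis to the height of \<open>x\<close>, where
        it is close to \<open>x\<close>; invariance of \<open>U\<close> then moves it back.\<close>
      define c where "c = x $ i - y $ i"
      define y' where "y' = y + c *\<^sub>R axis i 1"
      have "norm (y' - x) \<le> real ?N * (1/2) ^ m'"
      proof (rule norm_le_card_mult)
        fix j
        show "\<bar>(y' - x) $ j\<bar> \<le> (1/2) ^ m'"
        proof (cases "j = i")
          case False
          then have fe: "\<lfloor>2 ^ m' * y $ j\<rfloor> = \<lfloor>2 ^ m' * x $ j\<rfloor>" using fun_cong[OF k, of j] by (simp add: kx_def)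
          have "\<bar>2 ^ m' * y $ j - 2 ^ m' * x $ j\<bar> \<le> 1"
            using floor_correct[of "2 ^ m' * y $ j"] floor_correct[of "2 ^ m' * x $ j"] unfolding fe by linarith
          then have "2 ^ m' * \<bar>y $ j - x $ j\<bar> \<le> 1" by (simp add: right_diff_distrib[symmetric] abs_mult)
          then have "\<bar>y $ j - x $ j\<bar> \<le> (1/2) ^ m'" by (simp add: power_one_over pos_le_divide_eq mult.commute)
          then show ?thesis using False by (simp add: y'_def axis_def)
        qed (simp add: y'_def axis_def c_def)
      qed
      then have "y' \<in> U" using m' e(2) by (auto simp: dist_norm norm_minus_commute)
      from cyl[OF this, of "- c"] show "y \<in> U" by (simp add: y'_def)
    qed
    then show ?thesis by (intro exI[of _ m']) (auto simp: m'_def)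
  qed
  \<comment> \<open>The coarsest admissible level. Dyadic cells are nested, so two cells chosen in
    this way are equal or disjoint.\<close>
  define nx where "nx x = (LEAST m. n0 \<le> m \<and> cell m (kx m x) \<subseteq> U)" for x
  have nx: "n0 \<le> nx x" "cell (nx x) (kx (nx x) x) \<subseteq> U" if "x \<in> U" for x
    using LeastI_ex[OF ex[OF that]] by (auto simp: nx_def)
  define Sel where "Sel = (\<lambda>x. (nx x, kx (nx x) x)) ` U"
  let ?c = "\<lambda>p :: nat \<times> ('n \<Rightarrow> int). case p of (m, k) \<Rightarrow> cell m k"
  have eqn: "nx y = nx x" if x: "x \<in> U" and y: "y \<in> cell (nx x) (kx (nx x) x)" for x y
  proof -
    have k: "kx (nx x) y = kx (nx x) x" using y by (simp add: cell_def)
    have same: "kx m y = kx m x" if "m \<le> nx x" for m using nest[OF k that] .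
    show ?thesis
    proof (rule antisym)
      show "nx y \<le> nx x" unfolding nx_def[of y] using nx[OF x] k by (intro Least_le) auto
      have yU: "y \<in> U" using y nx(2)[OF x] by blast
      show "nx x \<le> nx y"
      proof (rule ccontr)
        assume "\<not> nx x \<le> nx y"
        then have lt: "nx y < nx x" by simp
        have "n0 \<le> nx y \<and> cell (nx y) (kx (nx y) x) \<subseteq> U" using nx[OF yU] same[of "nx y"] lt by simp
        then have "nx x \<le> nx y" unfolding nx_def[of x] by (rule Least_le)
        with lt show False by simp
      qed
    qed
  qed
  have disj: "disjoint_family_on (\<lambda>p. ?c p \<inter> {x. 0 \<le> x $ i \<and> x $ i < 1}) Sel"
    unfolding disjoint_family_on_def
  proof (intro ballI impI)
    fix p p' assume "p \<in> Sel" "p' \<in> Sel" and ne: "p \<noteq> p'"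
    then obtain x x' where x: "p = (nx x, kx (nx x) x)" "x \<in> U" and x': "p' = (nx x', kx (nx x') x')" "x' \<in> U" by (auto simp: Sel_def)
    have False if y: "y \<in> ?c p" "y \<in> ?c p'" for y
    proof -
      have y1: "y \<in> cell (nx x) (kx (nx x) x)" and y2: "y \<in> cell (nx x') (kx (nx x') x')" using y x x' by auto
      have "nx x = nx x'" using eqn[OF x(2) y1] eqn[OF x'(2) y2] by simp
      moreover from this have "kx (nx x) x = kx (nx x') x'" using y1 y2 by (simp add: cell_def)
      ultimately show False using ne x x' by simp
    qed
    then show "(?c p \<inter> {x. 0 \<le> x $ i \<and> x $ i < 1}) \<inter> (?c p' \<inter> {x. 0 \<le> x $ i \<and> x $ i < 1}) = {}" by blast
  qed
  have cell_iff: "x \<in> cell m k \<longleftrightarrow> k i = 0 \<and> (\<forall>j. j \<noteq> i \<longrightarrow> real_of_int (k j) \<le> 2 ^ m * x $ j \<and> 2 ^ m * x $ j < real_of_int (k j) + 1)" for x m k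
    unfolding cell_def kx_def mem_Collect_eq fun_eq_iff by (auto simp: floor_eq_iff split: if_splits)
  have cm: "?c p \<inter> {x. 0 \<le> x $ i \<and> x $ i < 1} \<in> sets lborel" for p
  proof -
    obtain m k where p: "p = (m, k)" by force
    have "cell m k \<inter> {x. 0 \<le> x $ i \<and> x $ i < 1} = (if k i = 0 then (\<Inter>j\<in>UNIV-{i}. {x. real_of_int (k j) \<le> 2 ^ m * x $ j} \<inter> {x. 2 ^ m * x $ j < real_of_int (k j) + 1}) \<inter> {x. 0 \<le> x $ i} \<inter> {x. x $ i < 1} else {})"
      by (auto simp: cell_iff)
    also have "\<dots> \<in> sets borel"
    proof (cases "UNIV - {i} = {}")
      case True
      show ?thesis unfolding True by (auto intro!: sets.Int borel_closed borel_open closed_Collect_le open_Collect_less continuous_intros)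
    next
      case False
      then show ?thesis
        by (auto intro!: sets.Int sets.finite_INT borel_closed borel_open closed_Collect_le open_Collect_less continuous_intros)
    qed
    finally show ?thesis by (simp add: p)
  qed
  have one: "hcont (?N - 1) \<delta> (?c p \<inter> {x. x $ i = 0}) \<le> emeasure lborel (?c p \<inter> {x. 0 \<le> x $ i \<and> x $ i < 1})" if p: "p \<in> Sel" for p
  proof -
    obtain x where x: "p = (nx x, kx (nx x) x)" "x \<in> U" using p by (auto simp: Sel_def)
    define m where "m = nx x"
    define k where "k = kx m x"
    have pk: "p = (m, k)" "k i = 0" by (simp_all add: x m_def k_def kx_def)
    define l where "l = (1/2::real) ^ m"
    have l: "l > 0" "2 ^ m * l = 1" by (simp_all add: l_def power_one_over)
    have "(1/2::real) ^ m \<le> (1/2) ^ n0" using nx(1)[OF x(2)] by (intro power_decreasing) (auto simp: m_def)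
    then have "real ?N * l \<le> real ?N * (1/2) ^ n0" unfolding l_def by (intro mult_left_mono) auto
    then have lN: "real ?N * l \<le> \<delta>" using n0 by linarith
    define v where "v = (\<chi> j. if j = i then 0 else (real_of_int (k j) + 1/2) * l)"
    have sub: "cell m k \<inter> {x. x $ i = 0} \<subseteq> (+) v ` hcube i l"
    proof
      fix y assume y: "y \<in> cell m k \<inter> {x. x $ i = 0}"
      have "y - v \<in> hcube i l" unfolding hcube_def
      proof (intro CollectI conjI allI impI)
        fix j assume j: "j \<noteq> i"
        have b: "real_of_int (k j) \<le> 2 ^ m * y $ j" "2 ^ m * y $ j < real_of_int (k j) + 1" using y j by (auto simp: cell_iff)
        have e: "l * (2 ^ m * y $ j) = y $ j" using l(2) by (simp add: mult.assoc[symmetric] mult.commute[of l])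
        have "l * real_of_int (k j) \<le> y $ j" using mult_left_mono[OF b(1), of l] l(1) e by simp
        then show "- l / 2 \<le> (y - v) $ j" using j by (simp add: v_def algebra_simps)
        have "y $ j < l * (real_of_int (k j) + 1)" using mult_strict_left_mono[OF b(2) l(1)] e by simp
        then show "(y - v) $ j < l / 2" using j by (simp add: v_def algebra_simps)
      qed (use y in \<open>simp add: v_def\<close>)
      then show "y \<in> (+) v ` hcube i l" by (intro image_eqI[of _ _ "y - v"]) auto
    qed
    have "hcont (?N - 1) \<delta> (cell m k \<inter> {x. x $ i = 0}) \<le> ennreal (l ^ (?N - 1))"
      by (rule order_trans[OF hcont_mono[OF sub] order_trans[OF hcont_translate hcont_hcube[OF l(1) lN]]])
    also have "\<dots> \<le> emeasure lborel (cell m k \<inter> {x. 0 \<le> x $ i \<and> x $ i < 1})"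
    proof -
      define a where "a = ((\<chi> j. if j = i then 0 else real_of_int (k j) * l) :: real^'n)"
      define b where "b = ((\<chi> j. if j = i then 1 else (real_of_int (k j) + 1) * l) :: real^'n)"
      have ab: "a $ j \<le> b $ j" for j using l by (auto simp: a_def b_def algebra_simps)
      have sub: "box a b \<subseteq> cell m k \<inter> {x. 0 \<le> x $ i \<and> x $ i < 1}"
      proof
        fix y assume "y \<in> box a b"
        then have y: "a $ j < y $ j" "y $ j < b $ j" for j by (auto simp: mem_box_cart)
        have "real_of_int (k j) \<le> 2 ^ m * y $ j \<and> 2 ^ m * y $ j < real_of_int (k j) + 1" if j: "j \<noteq> i" for j
        proof -
          have e: "2 ^ m * (c * l) = c" for c using l(2) by (metis mult.commute mult.left_commute mult_1_right)
          have "2 ^ m * (real_of_int (k j) * l) < 2 ^ m * y $ j" using y(1)[of j] j by (intro mult_strict_left_mono) (auto simp: a_def)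
          moreover have "2 ^ m * y $ j < 2 ^ m * ((real_of_int (k j) + 1) * l)" using y(2)[of j] j by (intro mult_strict_left_mono) (auto simp: b_def)
          ultimately show ?thesis unfolding e by simp
        qed
        moreover have "0 \<le> y $ i" "y $ i < 1" using y[of i] by (auto simp: a_def b_def)
        ultimately show "y \<in> cell m k \<inter> {x. 0 \<le> x $ i \<and> x $ i < 1}" using pk(2) by (auto simp: cell_iff)
      qed
      have "measure lborel (box a b) = measure lborel (cbox a b)" by (simp add: measure_def emeasure_lborel_box_eq emeasure_lborel_cbox_eq)
      also have "\<dots> = (\<Prod>j\<in>UNIV. b $ j - a $ j)" using ab by (intro content_cbox_cart) (auto simp: interval_ne_empty_cart)
      also have "\<dots> = (b $ i - a $ i) * (\<Prod>j\<in>UNIV-{i}. b $ j - a $ j)" by (subst prod.remove[of _ i]) auto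
      also have "(\<Prod>j\<in>UNIV-{i}. b $ j - a $ j) = (\<Prod>j\<in>UNIV-{i}. l)" by (rule prod.cong) (auto simp: a_def b_def algebra_simps)
      also have "(b $ i - a $ i) * (\<Prod>j\<in>UNIV-{i}. l) = l ^ (?N - 1)" by (simp add: a_def b_def card_Diff_singleton)
      finally have "emeasure lborel (box a b) = ennreal (l ^ (?N - 1))"
        by (metis emeasure_eq_ennreal_measure emeasure_lborel_box_finite less_top infinity_ennreal_def)
      moreover have "cell m k \<inter> {x. 0 \<le> x $ i \<and> x $ i < 1} \<in> sets lborel" using cm[of "(m, k)"] by (simp only: prod.case)
      ultimately show ?thesis using emeasure_mono[OF sub, where M=lborel] by simp
    qed
    finally show ?thesis by (simp add: pk(1))
  qed
  have cov: "U \<inter> {x. x $ i = 0} \<subseteq> (\<Union>p\<in>Sel. ?c p \<inter> {x. x $ i = 0})"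
  proof
    fix x assume "x \<in> U \<inter> {x. x $ i = 0}"
    then show "x \<in> (\<Union>p\<in>Sel. ?c p \<inter> {x. x $ i = 0})"
      by (intro UN_I[of "(nx x, kx (nx x) x)"]) (auto simp: Sel_def cell_def)
  qed
  have "hcont (?N - 1) \<delta> (U \<inter> {x. x $ i = 0}) \<le> hcont (?N - 1) \<delta> (\<Union>p\<in>Sel. ?c p \<inter> {x. x $ i = 0})" by (rule hcont_mono[OF cov])
  also have "\<dots> \<le> (\<integral>\<^sup>+p. hcont (?N - 1) \<delta> (?c p \<inter> {x. x $ i = 0}) \<partial>count_space Sel)" using d by (intro hcont_UN) simp
  also have "\<dots> \<le> (\<integral>\<^sup>+p. emeasure lborel (?c p \<inter> {x. 0 \<le> x $ i \<and> x $ i < 1}) \<partial>count_space Sel)"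
    using one by (intro nn_integral_mono) auto
  also have "\<dots> = emeasure lborel (\<Union>p\<in>Sel. ?c p \<inter> {x. 0 \<le> x $ i \<and> x $ i < 1})"
    using cm disj by (intro emeasure_UN_countable[symmetric]) auto
  also have "\<dots> \<le> emeasure lborel (U \<inter> {x. 0 \<le> x $ i \<and> x $ i < 1})"
  proof (rule emeasure_mono)
    show "(\<Union>p\<in>Sel. ?c p \<inter> {x. 0 \<le> x $ i \<and> x $ i < 1}) \<subseteq> U \<inter> {x. 0 \<le> x $ i \<and> x $ i < 1}"
      using nx(2) by (auto simp: Sel_def)
    have "closed {x :: real^'n. 0 \<le> x $ i}" by (intro closed_Collect_le continuous_intros)
    moreover have "open {x :: real^'n. x $ i < 1}" by (intro open_Collect_less continuous_intros)
    ultimately have b: "U \<inter> ({x. 0 \<le> x $ i} \<inter> {x. x $ i < 1}) \<in> sets borel" using U by (intro sets.Int) auto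
    have eq: "U \<inter> {x. 0 \<le> x $ i \<and> x $ i < 1} = U \<inter> ({x. 0 \<le> x $ i} \<inter> {x. x $ i < 1})" by auto
    show "U \<inter> {x. 0 \<le> x $ i \<and> x $ i < 1} \<in> sets lborel" unfolding eq sets_lborel by (rule b)
  qed
  finally show ?thesis .
qed

lemma bij_image_vimage_inv: "bij f \<Longrightarrow> f ` T = inv f -` T"
  by (metis bij_imp_bij_inv bij_vimage_eq_inv_image inv_inv_eq)

text \<open>Up to a null set, an open superset is a countable disjoint union of balls, and an
  orthogonal map sends balls to balls of the same radius.\<close>

lemma emeasure_orthogonal_image_le:
  fixes f :: "real^'n::finite \<Rightarrow> real^'n"
  assumes f: "orthogonal_transformation f" and S: "S \<in> sets borel"
  shows "emeasure lborel (f ` S) \<le> emeasure lborel S"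
proof -
  have lin: "linear f" and inj: "inj f" using f orthogonal_transformation_linear orthogonal_transformation_inj by auto
  have bij: "bij f" using f orthogonal_transformation_bij by blast
  have finv: "orthogonal_transformation (inv f)" using f by (rule orthogonal_transformation_inv)
  have "linear (inv f)" using finv orthogonal_transformation_linear by blast
  then have "continuous_on UNIV (inv f)" by (rule linear_continuous_on[OF linear_conv_bounded_linear[THEN iffD1]])
  then have im: "inv f \<in> borel_measurable borel" by (rule borel_measurable_continuous_onI)
  have img: "f ` T = inv f -` T" for T using bij by (rule bij_image_vimage_inv)
  have fm: "f ` T \<in> sets borel" if "T \<in> sets borel" for T unfolding img using measurable_sets[OF im that] by simp
  have op: "emeasure lborel (f ` S) \<le> emeasure lborel U" if U: "open U" "S \<subseteq> U" for U
  proof -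
    define K where "K = {(x, r). 0 < r \<and> cball x r \<subseteq> U}"
    obtain C where C: "countable C" "C \<subseteq> K" "pairwise (\<lambda>i j. disjnt (cball (fst i) (snd i)) (cball (fst j) (snd j))) C"
      "negligible (U - (\<Union>i\<in>C. cball (fst i) (snd i)))"
    proof (rule Vitali_covering_theorem_cballs[of K snd U fst])
      show "\<And>i. i \<in> K \<Longrightarrow> 0 < snd i" by (auto simp: K_def)
      fix x :: "real^'n" and d :: real assume x: "x \<in> U" and d: "0 < d"
      obtain e where e: "e > 0" "cball x e \<subseteq> U" using U x by (meson open_contains_cball)
      have "cball x (min e (d/2)) \<subseteq> cball x e" by auto
      then show "\<exists>i. i \<in> K \<and> x \<in> cball (fst i) (snd i) \<and> snd i < d"
        using e d by (intro exI[of _ "(x, min e (d/2))"]) (auto simp: K_def)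
    qed blast
    let ?B = "\<lambda>i. cball (fst i) (snd i)"
    have disj: "disjoint_family_on ?B C"
      using C(3) by (auto simp: disjoint_family_on_def pairwise_def disjnt_def)
    have fB: "f ` ?B i = cball (f (fst i)) (snd i)" for i using image_orthogonal_transformation_cball[OF f] by blast
    have disjf: "disjoint_family_on (\<lambda>i. f ` ?B i) C"
      unfolding disjoint_family_on_def
    proof (intro ballI impI)
      fix i j assume ij: "i \<in> C" "j \<in> C" "i \<noteq> j"
      have "f ` ?B i \<inter> f ` ?B j = f ` (?B i \<inter> ?B j)" by (rule image_Int[OF inj, symmetric])
      also have "?B i \<inter> ?B j = {}" using disj ij unfolding disjoint_family_on_def by blast
      finally show "f ` ?B i \<inter> f ` ?B j = {}" by simp
    qed
    let ?N = "U - (\<Union>i\<in>C. ?B i)"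
    have "negligible (f ` ?N)" using C(4) lin
      by (intro negligible_differentiable_image_negligible[OF order_refl C(4)] differentiable_at_imp_differentiable_on linear_imp_differentiable)
    then have nul: "f ` ?N \<in> null_sets lebesgue" by (simp add: negligible_iff_null_sets)
    have "?N \<in> sets borel" using C(1) U by (intro sets.Diff sets.countable_UN' borel_open) auto
    then have "f ` ?N \<in> sets lborel" using fm by simp
    with nul have nul': "f ` ?N \<in> null_sets lborel" by (simp add: null_sets_def)
    have UNm: "(\<Union>i\<in>C. f ` ?B i) \<in> sets lborel" unfolding fB using C(1) by (intro sets.countable_UN') auto
    have "emeasure lborel (f ` S) \<le> emeasure lborel ((\<Union>i\<in>C. f ` ?B i) \<union> f ` ?N)"
    proof (intro emeasure_mono sets.Un UNm null_setsD2[OF nul'])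
      show "f ` S \<subseteq> (\<Union>i\<in>C. f ` ?B i) \<union> f ` ?N"
      proof
        fix y assume "y \<in> f ` S"
        then obtain x where x: "x \<in> S" "y = f x" by blast
        show "y \<in> (\<Union>i\<in>C. f ` ?B i) \<union> f ` ?N"
        proof (cases "x \<in> (\<Union>i\<in>C. ?B i)")
          case False
          then have "x \<in> ?N" using x(1) U(2) by blast
          then show ?thesis using x(2) by blast
        qed (use x(2) in blast)
      qed
    qed
    also have "\<dots> = emeasure lborel (\<Union>i\<in>C. f ` ?B i)" using UNm nul' by (rule emeasure_Un_null_set)
    also have "\<dots> = (\<integral>\<^sup>+i. emeasure lborel (f ` ?B i) \<partial>count_space C)"
      using disjf unfolding fB by (intro emeasure_UN_countable C(1)) auto
    also have "\<dots> = (\<integral>\<^sup>+i. emeasure lborel (?B i) \<partial>count_space C)"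
    proof (rule nn_integral_cong)
      fix i assume "i \<in> space (count_space C)"
      then have "0 < snd i" using C(2) by (auto simp: K_def)
      then show "emeasure lborel (f ` ?B i) = emeasure lborel (?B i)" unfolding fB by (simp add: emeasure_cball)
    qed
    also have "\<dots> = emeasure lborel (\<Union>i\<in>C. ?B i)" using C(1) disj by (intro emeasure_UN_countable[symmetric]) auto
    also have "\<dots> \<le> emeasure lborel U"
    proof (intro emeasure_mono UN_least)
      fix i assume "i \<in> C"
      then have "i \<in> K" using C(2) by blast
      then show "?B i \<subseteq> U" by (auto simp: K_def simp del: mem_cball)
    qed (use U(1) in auto)
    finally show ?thesis .
  qed
  show ?thesis
  proof (rule ennreal_le_epsilon)
    fix e :: real assume e: "e > 0"
    obtain U where U: "open U" "S \<subseteq> U" "emeasure lborel (U - S) < ennreal e" using outer_regular_lborel[OF S e] by blast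
    have "emeasure lborel (f ` S) \<le> emeasure lborel U" by (rule op[OF U(1,2)])
    also have "U = S \<union> (U - S)" using U(2) by blast
    also have "emeasure lborel (S \<union> (U - S)) \<le> emeasure lborel S + emeasure lborel (U - S)"
      using S U(1) by (intro emeasure_subadditive) auto
    also have "\<dots> \<le> emeasure lborel S + ennreal e" using U(3) by (intro add_left_mono less_imp_le)
    finally show "emeasure lborel (f ` S) \<le> emeasure lborel S + ennreal e" .
  qed
qed

lemma hcont_le_hausdorff: "\<delta> > 0 \<Longrightarrow> hcont s \<delta> A \<le> hausdorff_measure s A"
  unfolding hausdorff_measure_hcont by (rule SUP_upper) simp

text \<open>Openness is gained by thickening: an open \<open>U\<close> around the unit cylinder over
  the section exceeds it by at most \<open>e\<close> in volume. The slice of \<open>U\<close> at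
  each height \<open>t\<close> in \<open>[0, 1)\<close> contains a copy of the section and spans an
  open cylinder, to which \<open>hcont_open_cylinder\<close> applies; averaging over
  \<open>t\<close> recovers the volume of \<open>U\<close>.\<close>

lemma hausdorff_section_axis:
  fixes A :: "(real^'n::finite) set"
  assumes A: "A \<in> sets borel"
  shows "hausdorff_measure (CARD('n) - 1) (A \<inter> {x. x $ i = 0}) \<le> emeasure lborel (seccyl (axis i 1) 0 A)"
  unfolding hausdorff_measure_hcont
proof (rule SUP_least)
  fix \<delta> :: real assume "\<delta> \<in> {0<..}"
  then have d: "\<delta> > 0" by simp
  let ?e = "axis i 1 :: real^'n"
  let ?s = "CARD('n) - 1"
  have ex: "?e \<bullet> x = x $ i" for x by (simp add: inner_axis inner_commute)
  let ?S = "seccyl ?e 0 A"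
  have Sm: "?S \<in> sets borel" by (rule sets_seccyl[OF A])
  show "hcont ?s \<delta> (A \<inter> {x. x $ i = 0}) \<le> emeasure lborel ?S"
  proof (rule ennreal_le_epsilon)
    fix e :: real assume e: "e > 0"
    obtain U where U: "open U" "?S \<subseteq> U" "emeasure lborel (U - ?S) < ennreal e" using outer_regular_lborel[OF Sm e] by blast
    have ineq: "hcont ?s \<delta> (A \<inter> {x. x $ i = 0}) \<le> emeasure lborel (seccyl ?e t U)" if t: "t \<in> {0..<1}" for t
    proof -
      define W where "W = {x. x + (t - x $ i) *\<^sub>R ?e \<in> U}"
      have "open ((\<lambda>x. x + (t - x $ i) *\<^sub>R ?e) -` U)"
        by (intro open_vimage[OF U(1)] continuous_intros)
      then have Wo: "open W" by (simp add: W_def vimage_def)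
      have Wc: "x + r *\<^sub>R ?e \<in> W" if "x \<in> W" for x r
      proof -
        have "x + r *\<^sub>R ?e + (t - (x + r *\<^sub>R ?e) $ i) *\<^sub>R ?e = x + (t - x $ i) *\<^sub>R ?e"
          by (simp add: axis_def algebra_simps)
        then show ?thesis using that by (simp only: W_def mem_Collect_eq)
      qed
      have "A \<inter> {x. x $ i = 0} \<subseteq> W \<inter> {x. x $ i = 0}"
      proof
        fix x assume x: "x \<in> A \<inter> {x. x $ i = 0}"
        have c: "?e \<bullet> (x + t *\<^sub>R ?e) = t" unfolding ex using x by simp
        have "x + t *\<^sub>R ?e \<in> ?S" unfolding seccyl_def mem_Collect_eq c using x t by simp
        then show "x \<in> W \<inter> {x. x $ i = 0}" using U(2) x by (auto simp: W_def)
      qed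
      then have "hcont ?s \<delta> (A \<inter> {x. x $ i = 0}) \<le> hcont ?s \<delta> (W \<inter> {x. x $ i = 0})" by (rule hcont_mono)
      also have "\<dots> \<le> emeasure lborel (W \<inter> {x. 0 \<le> x $ i \<and> x $ i < 1})" by (rule hcont_open_cylinder[OF Wo Wc d])
      also have "W \<inter> {x. 0 \<le> x $ i \<and> x $ i < 1} = seccyl ?e t U" by (auto simp: W_def seccyl_def ex)
      finally show ?thesis .
    qed
    have "hcont ?s \<delta> (A \<inter> {x. x $ i = 0}) = (\<integral>\<^sup>+t. hcont ?s \<delta> (A \<inter> {x. x $ i = 0}) * indicator {0..<1::real} t \<partial>lborel)"
      by (simp add: nn_integral_cmult)
    also have "\<dots> \<le> (\<integral>\<^sup>+t. emeasure lborel (seccyl ?e t U) \<partial>lborel)"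
      using ineq by (intro nn_integral_mono) (auto simp: indicator_def)
    also have "\<dots> = emeasure lborel U" using U(1) by (intro nn_integral_seccyl) (auto simp: norm_axis_1)
    also have "U = ?S \<union> (U - ?S)" using U(2) by blast
    also have "emeasure lborel (?S \<union> (U - ?S)) \<le> emeasure lborel ?S + emeasure lborel (U - ?S)"
      using Sm U(1) by (intro emeasure_subadditive) auto
    also have "\<dots> \<le> emeasure lborel ?S + ennreal e" using U(3) by (intro add_left_mono less_imp_le)
    finally show "hcont ?s \<delta> (A \<inter> {x. x $ i = 0}) \<le> emeasure lborel ?S + ennreal e" .
  qed
qed

lemma hausdorff_isometry:
  fixes A :: "(real^'n::finite) set" and f :: "real^'n \<Rightarrow> real^'n"
  assumes "\<And>x y. dist (f x) (f y) \<le> dist x y"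
  shows "hausdorff_measure s (f ` A) \<le> hausdorff_measure s A"
  unfolding hausdorff_measure_hcont by (intro SUP_mono) (use hcont_isometry[OF assms] in blast)

text \<open>Reduction to a coordinate hyperplane by a translation along \<open>n\<close> and a
  rotation that takes \<open>n\<close> to an axis.\<close>

lemma hausdorff_section:
  fixes A :: "(real^'n::finite) set"
  assumes A: "A \<in> sets borel" and n: "norm n = 1"
  shows "hausdorff_measure (CARD('n) - 1) (A \<inter> {x. n \<bullet> x = s}) \<le> emeasure lborel (seccyl n s A)"
proof -
  define i :: 'n where "i = undefined"
  let ?e = "axis i 1 :: real^'n"
  let ?d = "CARD('n) - 1"
  have ex: "?e \<bullet> x = x $ i" for x by (simp add: inner_axis inner_commute)
  have nn: "n \<bullet> n = 1" using n by (simp add: dot_square_norm)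
  obtain f where f: "orthogonal_transformation f" "f n = ?e"
    using orthogonal_transformation_exists_1[OF n, of ?e] by (auto simp: norm_axis_1)
  have lin: "linear f" using f orthogonal_transformation_linear by blast
  have bij: "bij f" using f orthogonal_transformation_bij by blast
  have finv: "orthogonal_transformation (inv f)" using f(1) by (rule orthogonal_transformation_inv)
  have ifx: "inv f (f x) = x" for x using bij by (simp add: bij_is_inj)
  have "linear (inv f)" using finv orthogonal_transformation_linear by blast
  then have ci: "continuous_on UNIV (inv f)" by (rule linear_continuous_on[OF linear_conv_bounded_linear[THEN iffD1]])
  have comp: "f x $ i = n \<bullet> x" for x
    using f unfolding orthogonal_transformation_def by (metis ex)
  define T where "T x = f (x - s *\<^sub>R n)" for x
  define T' where "T' y = inv f y + s *\<^sub>R n" for y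
  have TT: "T' (T x) = x" "T (T' y) = y" for x y
    using bij by (simp_all add: T_def T'_def ifx bij_is_surj surj_f_inv_f)
  have iso: "dist (T' x) (T' y) \<le> dist x y" for x y
    using finv orthogonal_transformation_linear[OF finv]
    by (simp add: T'_def dist_norm linear_diff[symmetric] orthogonal_transformation_norm)
  have TA: "T ` A = T' -` A" using TT by (auto intro: rev_image_eqI)
  have "continuous_on UNIV T'" unfolding T'_def by (intro continuous_intros ci)
  then have "T' \<in> borel_measurable borel" by (rule borel_measurable_continuous_onI)
  from measurable_sets[OF this A] have TAm: "T ` A \<in> sets borel" unfolding TA by simp
  have Ti: "T x $ i = n \<bullet> x - s" for x by (simp add: T_def comp inner_diff_right nn)
  have eq: "A \<inter> {x. n \<bullet> x = s} = T' ` (T ` A \<inter> {x. x $ i = 0})"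
  proof (intro equalityI subsetI)
    fix x assume x: "x \<in> A \<inter> {x. n \<bullet> x = s}"
    then have "T x \<in> T ` A \<inter> {x. x $ i = 0}" by (simp add: Ti)
    then show "x \<in> T' ` (T ` A \<inter> {x. x $ i = 0})" by (intro image_eqI[of _ _ "T x"]) (simp_all add: TT)
  next
    fix x assume "x \<in> T' ` (T ` A \<inter> {x. x $ i = 0})"
    then obtain a where a: "a \<in> A" "x = T' (T a)" "T a $ i = 0" by blast
    then show "x \<in> A \<inter> {x. n \<bullet> x = s}" by (simp add: TT Ti)
  qed
  have "hausdorff_measure ?d (A \<inter> {x. n \<bullet> x = s}) \<le> hausdorff_measure ?d (T ` A \<inter> {x. x $ i = 0})"
    unfolding eq by (rule hausdorff_isometry[OF iso])
  also have "\<dots> \<le> emeasure lborel (seccyl ?e 0 (T ` A))" by (rule hausdorff_section_axis[OF TAm])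
  also have "seccyl ?e 0 (T ` A) \<subseteq> f ` seccyl n s A"
  proof
    fix y assume y: "y \<in> seccyl ?e 0 (T ` A)"
    define x where "x = inv f y"
    have yx: "y = f x" using bij by (simp add: x_def bij_is_surj surj_f_inv_f)
    from y obtain a where a: "a \<in> A" "y + (0 - y $ i) *\<^sub>R ?e = T a" and y01: "0 \<le> y $ i" "y $ i < 1" by (auto simp: seccyl_def ex)
    have "T a = f (x - (n \<bullet> x) *\<^sub>R n)"
      using a(2) lin by (simp add: yx comp linear_diff linear_scale f(2))
    then have "f (a - s *\<^sub>R n) = f (x - (n \<bullet> x) *\<^sub>R n)" by (simp add: T_def)
    then have "a - s *\<^sub>R n = x - (n \<bullet> x) *\<^sub>R n" using bij by (metis ifx)
    then have "a = (x - (n \<bullet> x) *\<^sub>R n) + s *\<^sub>R n" by (metis diff_add_cancel)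
    then have "a = x + (s - n \<bullet> x) *\<^sub>R n" by (simp add: scaleR_left_diff_distrib)
    then have "x \<in> seccyl n s A" using a(1) y01 by (simp add: seccyl_def yx comp)
    then show "y \<in> f ` seccyl n s A" using yx by blast
  qed
  then have "emeasure lborel (seccyl ?e 0 (T ` A)) \<le> emeasure lborel (f ` seccyl n s A)"
  proof (rule emeasure_mono)
    have "f ` seccyl n s A = inv f -` seccyl n s A" using bij by (rule bij_image_vimage_inv)
    then show "f ` seccyl n s A \<in> sets lborel"
      using measurable_sets[OF borel_measurable_continuous_onI[OF ci] sets_seccyl[OF A]] by simp
  qed
  also have "\<dots> \<le> emeasure lborel (seccyl n s A)" by (rule emeasure_orthogonal_image_le[OF f(1) sets_seccyl[OF A]])
  finally show ?thesis .
qed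

lemma hausdorff_UN:
  fixes A :: "nat \<Rightarrow> (real^'n::finite) set"
  shows "hausdorff_measure s (\<Union>j. A j) \<le> (\<Sum>j. hausdorff_measure s (A j))"
  unfolding hausdorff_measure_hcont[of s "\<Union>j. A j"]
proof (rule SUP_least)
  fix \<delta> :: real assume "\<delta> \<in> {0<..}"
  then have d: "\<delta> > 0" by simp
  have "hcont s \<delta> (\<Union>j. A j) \<le> (\<integral>\<^sup>+j. hcont s \<delta> (A j) \<partial>count_space UNIV)" using d by (intro hcont_UN_UNIV) simp
  also have "\<dots> \<le> (\<integral>\<^sup>+j. hausdorff_measure s (A j) \<partial>count_space UNIV)"
    by (intro nn_integral_mono hcont_le_hausdorff d)
  also have "\<dots> = (\<Sum>j. hausdorff_measure s (A j))" by (rule nn_integral_count_space_nat)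
  finally show "hcont s \<delta> (\<Union>j. A j) \<le> (\<Sum>j. hausdorff_measure s (A j))" .
qed

text \<open>On each affine piece with unit gradient the coarea formula is Fubini, so the level sets have total
  surface at most \<open>m\<close>, and countably many bad levels do not matter.\<close>
lemma coarea_select:
  fixes G :: "real^'n::finite \<Rightarrow> real" and n :: "nat \<Rightarrow> real^'n" and b :: "nat \<Rightarrow> real"
  assumes Gm: "G \<in> borel_measurable borel" and X: "X \<in> sets borel" and nn: "\<And>j. norm (n j) = 1"
    and pw: "\<And>x. \<exists>j. G x = n j \<bullet> x - b j"
    and lu: "l < u" and m: "emeasure lborel (X \<inter> {x. l < G x \<and> G x < u}) \<le> ennreal m" "m \<ge> 0" and e: "e > 0" and bad: "countable bad"
  shows "\<exists>\<sigma>. l < \<sigma> \<and> \<sigma> < u \<and> \<sigma> \<notin> bad \<and> hausdorff_measure (CARD('n) - 1) (X \<inter> {x. G x = \<sigma>}) \<le> ennreal (m / (u - l) + e)"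
proof (rule ccontr)
  let ?d = "CARD('n) - 1"
  assume neg: "\<not> ?thesis"
  note Gm[measurable]
  let ?X = "X \<inter> {x. l < G x \<and> G x < u}"
  have Xm: "?X \<in> sets borel"
  proof -
    have "{x \<in> space borel. l < G x \<and> G x < u} \<in> sets borel" by measurable
    then show ?thesis using X by auto
  qed
  define Z where "Z j = ?X \<inter> {x. G x = n j \<bullet> x - b j}" for j
  have Zm: "Z j \<in> sets borel" for j
  proof -
    have "{x \<in> space borel. G x = n j \<bullet> x - b j} \<in> sets borel" by measurable
    then show ?thesis using Xm unfolding Z_def by auto
  qed
  \<comment> \<open>Disjoint parts, on each of which \<open>G\<close> is one fixed affine function
    with unit gradient.\<close>
  define Y where "Y = disjointed Z"
  have Ym: "Y j \<in> sets borel" for j using Zm sets.range_disjointed_sets[of Z borel] unfolding Y_def by blast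
  have YZ: "Y j \<subseteq> Z j" for j unfolding Y_def by (rule disjointed_subset)
  have UY: "(\<Union>j. Y j) = ?X" unfolding Y_def UN_disjointed_eq using pw by (auto simp: Z_def)
  have dY: "disjoint_family Y" unfolding Y_def by (rule disjoint_family_disjointed)
  have H: "hausdorff_measure ?d (X \<inter> {x. G x = \<sigma>}) \<le> (\<Sum>j. emeasure lborel (seccyl (n j) (\<sigma> + b j) (Y j)))"
    if s: "l < \<sigma>" "\<sigma> < u" for \<sigma>
  proof -
    have "X \<inter> {x. G x = \<sigma>} = (\<Union>j. Y j \<inter> {x. n j \<bullet> x = \<sigma> + b j})"
    proof (intro equalityI subsetI)
      fix x assume x: "x \<in> X \<inter> {x. G x = \<sigma>}"
      then have "x \<in> (\<Union>j. Y j)" unfolding UY using s by auto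
      then obtain j where j: "x \<in> Y j" by blast
      then have "G x = n j \<bullet> x - b j" using YZ by (auto simp: Z_def)
      then show "x \<in> (\<Union>j. Y j \<inter> {x. n j \<bullet> x = \<sigma> + b j})" using j x by auto
    next
      fix x assume "x \<in> (\<Union>j. Y j \<inter> {x. n j \<bullet> x = \<sigma> + b j})"
      then obtain j where "x \<in> Z j" "n j \<bullet> x = \<sigma> + b j" using YZ by blast
      then show "x \<in> X \<inter> {x. G x = \<sigma>}" by (auto simp: Z_def)
    qed
    then have "hausdorff_measure ?d (X \<inter> {x. G x = \<sigma>}) \<le> (\<Sum>j. hausdorff_measure ?d (Y j \<inter> {x. n j \<bullet> x = \<sigma> + b j}))"
      by (simp only: hausdorff_UN)
    also have "\<dots> \<le> (\<Sum>j. emeasure lborel (seccyl (n j) (\<sigma> + b j) (Y j)))"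
      by (intro suminf_le hausdorff_section[OF Ym nn]) auto
    finally show ?thesis .
  qed
  have sm: "(\<lambda>\<sigma>. emeasure lborel (seccyl (n j) (\<sigma> + b j) (Y j))) \<in> borel_measurable borel" for j
    by (rule measurable_compose[OF _ seccyl_measurable[OF Ym]]) measurable
  have "ennreal (m / (u - l) + e) * ennreal (u - l) = (\<integral>\<^sup>+\<sigma>. ennreal (m / (u - l) + e) * indicator {l<..<u} \<sigma> \<partial>lborel)"
    using lu by (simp add: nn_integral_cmult)
  also have "\<dots> \<le> (\<integral>\<^sup>+\<sigma>. (\<Sum>j. emeasure lborel (seccyl (n j) (\<sigma> + b j) (Y j))) \<partial>lborel)"
  proof (rule nn_integral_mono_AE)
    have "AE \<sigma> in lborel. \<sigma> \<notin> bad" using bad by (intro AE_not_in countable_imp_null_set_lborel)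
    then show "AE \<sigma> in lborel. ennreal (m / (u - l) + e) * indicator {l<..<u} \<sigma> \<le> (\<Sum>j. emeasure lborel (seccyl (n j) (\<sigma> + b j) (Y j)))"
    proof eventually_elim
      case (elim \<sigma>)
      show ?case
      proof (cases "\<sigma> \<in> {l<..<u}")
        case True
        then have "\<not> hausdorff_measure ?d (X \<inter> {x. G x = \<sigma>}) \<le> ennreal (m / (u - l) + e)" using neg elim by auto
        then have "ennreal (m / (u - l) + e) \<le> hausdorff_measure ?d (X \<inter> {x. G x = \<sigma>})" by simp
        also have "\<dots> \<le> (\<Sum>j. emeasure lborel (seccyl (n j) (\<sigma> + b j) (Y j)))" using True by (intro H) auto
        finally show ?thesis using True by simp
      qed simp
    qed
  qed
  also have "\<dots> = (\<Sum>j. \<integral>\<^sup>+\<sigma>. emeasure lborel (seccyl (n j) (\<sigma> + b j) (Y j)) \<partial>lborel)"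
    using sm by (intro nn_integral_suminf) simp
  also have "\<dots> = (\<Sum>j. emeasure lborel (Y j))"
  proof (rule suminf_cong)
    fix j
    have "(\<integral>\<^sup>+\<sigma>. emeasure lborel (seccyl (n j) \<sigma> (Y j)) \<partial>lborel) = (\<integral>\<^sup>+\<sigma>. emeasure lborel (seccyl (n j) \<sigma> (Y j)) \<partial>distr lborel borel ((+) (b j)))"
      by (simp add: lborel_distr_plus)
    also have "\<dots> = (\<integral>\<^sup>+\<sigma>. emeasure lborel (seccyl (n j) (b j + \<sigma>) (Y j)) \<partial>lborel)"
      using seccyl_measurable[OF Ym] by (intro nn_integral_distr) auto
    finally show "(\<integral>\<^sup>+\<sigma>. emeasure lborel (seccyl (n j) (\<sigma> + b j) (Y j)) \<partial>lborel) = emeasure lborel (Y j)"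
      using nn_integral_seccyl[OF Ym nn] by (simp add: add.commute)
  qed
  also have "\<dots> = emeasure lborel (\<Union>j. Y j)" using Ym dY by (intro suminf_emeasure) auto
  also have "\<dots> \<le> ennreal m" using m(1) unfolding UY .
  finally have "ennreal (m / (u - l) + e) * ennreal (u - l) \<le> ennreal m" .
  moreover have "m / (u - l) + e \<ge> 0" using m lu e by simp
  ultimately have "(m / (u - l) + e) * (u - l) \<le> m" using lu m by (simp add: ennreal_mult[symmetric])
  moreover have "(m / (u - l) + e) * (u - l) = m + e * (u - l)" using lu by (simp add: distrib_right)
  moreover have "e * (u - l) > 0" using e lu by simp
  ultimately show False by linarith
qed

section \<open>Polyhedral neighbourhoods with Lipschitz boundary\<close>

text \<open>\<open>F\<close> grows at unit speed in direction \<open>v\<close>, so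
  \<open>F w < 0\<close> says that the height \<open>w \<bullet> v\<close> lies below minus the
  value of \<open>F\<close> at the projection of \<open>w\<close> orthogonal to \<open>v\<close>.
  This is a Lipschitz subgraph once \<open>v\<close> is rotated to a coordinate axis.\<close>

lemma lipschitz_boundaryI:
  fixes E :: "(real^'n::finite) set"
  assumes *: "\<And>x. x \<in> frontier E \<Longrightarrow> \<exists>r>0. \<exists>v F c. norm v = 1 \<and> c-lipschitz_on UNIV F \<and>
     (\<forall>w t. F (w + t *\<^sub>R v) = F w + t) \<and> E \<inter> ball x r = {y \<in> ball x r. F (y - x) < (0::real)}"
  shows "lipschitz_boundary E"
  unfolding lipschitz_boundary_def
proof
  fix x assume "x \<in> frontier E"
  then obtain r v F c where r: "r > 0" and v: "norm v = 1" and F: "c-lipschitz_on UNIV F"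
    and Ft: "\<And>w t. F (w + t *\<^sub>R v) = F w + t" and E: "E \<inter> ball x r = {y \<in> ball x r. F (y - x) < 0}"
    using * by meson
  define i :: 'n where "i = undefined"
  let ?e = "axis i 1 :: real^'n"
  obtain R where R: "orthogonal_transformation R" "R v = ?e"
    using orthogonal_transformation_exists_1[OF v, of ?e] by (auto simp: norm_axis_1)
  have bij: "bij R" using R orthogonal_transformation_bij by blast
  have iR: "orthogonal_transformation (inv R)" using R(1) by (rule orthogonal_transformation_inv)
  have lin: "linear R" "linear (inv R)" using R(1) iR orthogonal_transformation_linear by auto
  have ifx: "inv R (R w) = w" for w using bij by (simp add: bij_is_inj)
  have comp: "R w $ i = w \<bullet> v" for w
  proof -
    have "R w \<bullet> R v = w \<bullet> v" using R(1) by (simp add: orthogonal_transformation_def)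
    then show ?thesis by (simp add: R(2) inner_axis)
  qed
  define pr where "pr z = z - z $ i *\<^sub>R ?e" for z
  define g where "g z = - F (inv R (pr z))" for z
  have prn: "norm (pr z - pr w) \<le> norm (z - w)" for z w
  proof -
    have "pr z - pr w = (\<chi> j. if j = i then 0 else (z - w) $ j)" by (simp add: pr_def vec_eq_iff axis_def)
    then show ?thesis by (auto simp: norm_vec_def intro!: L2_set_mono)
  qed
  have gl: "c-lipschitz_on UNIV g"
  proof (rule lipschitz_onI)
    fix z w
    have "dist (g z) (g w) = dist (F (inv R (pr z))) (F (inv R (pr w)))" by (simp add: g_def dist_norm norm_minus_commute)
    also have "\<dots> \<le> c * dist (inv R (pr z)) (inv R (pr w))" using F by (rule lipschitz_onD) auto
    also have "dist (inv R (pr z)) (inv R (pr w)) = norm (pr z - pr w)"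
      using iR lin by (simp add: dist_norm linear_diff[symmetric] orthogonal_transformation_norm)
    also have "c * \<dots> \<le> c * dist z w" using prn lipschitz_on_nonneg[OF F] by (intro mult_left_mono) (auto simp: dist_norm)
    finally show "dist (g z) (g w) \<le> c * dist z w" .
  qed (rule lipschitz_on_nonneg[OF F])
  have ginv: "g y = g w" if "\<forall>j. j \<noteq> i \<longrightarrow> y $ j = w $ j" for y w
  proof -
    have "pr y = pr w" using that by (auto simp: pr_def vec_eq_iff axis_def)
    then show ?thesis by (simp add: g_def)
  qed
  have iff: "R w $ i < g (R w) \<longleftrightarrow> F w < 0" for w
  proof -
    have "pr (R w) = R (w + (- (w \<bullet> v)) *\<^sub>R v)"
      using lin(1) by (simp add: pr_def comp linear_diff linear_scale R(2))
    then have "g (R w) = - F (w + (- (w \<bullet> v)) *\<^sub>R v)" by (simp add: g_def ifx)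
    then have "g (R w) = - (F w - w \<bullet> v)" unfolding Ft by simp
    then show ?thesis by (simp add: comp)
  qed
  have "E \<inter> ball x r = {y \<in> ball x r. R (y - x) $ i < g (R (y - x))}" unfolding E iff ..
  then show "\<exists>r>0. \<exists>(R :: real^'n \<Rightarrow> real^'n) (i :: 'n) (g :: real^'n \<Rightarrow> real) (L :: real).
       orthogonal_transformation R \<and> L-lipschitz_on UNIV g \<and>
       (\<forall>y w. (\<forall>j. j \<noteq> i \<longrightarrow> y $ j = w $ j) \<longrightarrow> g y = g w) \<and>
       E \<inter> ball x r = {y \<in> ball x r. (R (y - x)) $ i < g (R (y - x))}"
    using r R(1) gl ginv by (intro exI[of _ r] exI[of _ R] exI[of _ i] exI[of _ g] exI[of _ c] conjI) auto
qed

text \<open>The half-spaces with these normals cut out a polyhedron close to the Euclidean unit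
  ball; compactness of the sphere makes finitely many of them suffice.\<close>

lemma unit_net:
  assumes "\<epsilon> > 0"
  obtains \<Lambda> :: "(real^'n::finite) set" where "finite \<Lambda>" "\<Lambda> \<noteq> {}" "\<And>n. n \<in> \<Lambda> \<Longrightarrow> norm n = 1"
    "\<And>y. \<exists>n\<in>\<Lambda>. (1 - \<epsilon>) * norm y \<le> n \<bullet> y"
proof -
  have cs: "compact (sphere (0::real^'n) 1)" by simp
  have cov: "sphere (0::real^'n) 1 \<subseteq> (\<Union>n\<in>sphere 0 1. ball n \<epsilon>)"
  proof
    fix y :: "real^'n" assume "y \<in> sphere 0 1"
    then show "y \<in> (\<Union>n\<in>sphere 0 1. ball n \<epsilon>)" using assms by (intro UN_I[of y]) auto
  qed
  obtain \<Lambda> where L: "\<Lambda> \<subseteq> sphere (0::real^'n) 1" "finite \<Lambda>" "sphere 0 1 \<subseteq> (\<Union>n\<in>\<Lambda>. ball n \<epsilon>)"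
    by (rule compactE_image[OF cs _ cov]) auto
  have L1: "norm n = 1" if "n \<in> \<Lambda>" for n using L(1) that by auto
  have s: "axis undefined 1 \<in> sphere (0::real^'n) 1" by (simp add: norm_axis_1)
  then have ne: "\<Lambda> \<noteq> {}" using L(3) by blast
  have "\<exists>n\<in>\<Lambda>. (1 - \<epsilon>) * norm y \<le> n \<bullet> y" for y
  proof (cases "y = 0")
    case False
    define u where "u = y /\<^sub>R norm y"
    have u: "norm u = 1" "y = norm y *\<^sub>R u" using False by (simp_all add: u_def)
    then obtain n where n: "n \<in> \<Lambda>" "dist n u < \<epsilon>" using L(3) by fastforce
    have "- ((n - u) \<bullet> u) \<le> norm (n - u) * norm u" using Cauchy_Schwarz_ineq2[of "n - u" u] by linarith
    then have "1 - \<epsilon> \<le> n \<bullet> u" using n(2) u(1) by (simp add: inner_diff_left dot_square_norm dist_norm)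
    then have "norm y * (1 - \<epsilon>) \<le> norm y * (n \<bullet> u)" by (intro mult_left_mono) auto
    also have "\<dots> = n \<bullet> y" by (subst (2) u(2)) simp
    finally show ?thesis using n(1) by (auto simp: mult.commute)
  qed (use ne in auto)
  then show thesis using that[of \<Lambda>] L(2) L1 ne by blast
qed

lemma finite_lattice_cball: "finite {z. norm (p + lattice_vec z) \<le> R}" for p :: "real^'n::finite"
proof -
  have "z i \<in> {\<lfloor>- R - \<bar>p $ i\<bar>\<rfloor>..\<lceil>R + \<bar>p $ i\<bar>\<rceil>}" if "norm (p + lattice_vec z) \<le> R" for z i
  proof -
    have "\<bar>p $ i + real_of_int (z i)\<bar> \<le> R"
      using component_le_norm_cart[of "p + lattice_vec z" i] that by (simp add: lattice_vec_def)
    then have "- R - \<bar>p $ i\<bar> \<le> real_of_int (z i)" "real_of_int (z i) \<le> R + \<bar>p $ i\<bar>" by linarith+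
    from floor_mono[OF this(1)] ceiling_mono[OF this(2)] show ?thesis by simp
  qed
  then have "{z. norm (p + lattice_vec z) \<le> R} \<subseteq> PiE UNIV (\<lambda>i. {\<lfloor>- R - \<bar>p $ i\<bar>\<rfloor>..\<lceil>R + \<bar>p $ i\<bar>\<rceil>})"
    by (auto simp: PiE_def extensional_def)
  then show ?thesis by (rule finite_subset) (auto intro: finite_PiE)
qed

lemma Max_image_le_add:
  fixes f g :: "'a \<Rightarrow> real"
  assumes "finite A" "A \<noteq> {}" "\<And>a. a \<in> A \<Longrightarrow> f a \<le> g a + d"
  shows "Max (f ` A) \<le> Max (g ` A) + d"
proof -
  have "f a \<le> Max (g ` A) + d" if "a \<in> A" for a
    using assms(3)[OF that] Max_ge[OF finite_imageI[OF assms(1)] imageI[OF that], of g] by linarith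
  then show ?thesis using assms by simp
qed

lemma Min_image_le_add:
  fixes f g :: "'a \<Rightarrow> real"
  assumes "finite A" "A \<noteq> {}" "\<And>a. a \<in> A \<Longrightarrow> f a \<le> g a + d"
  shows "Min (f ` A) \<le> Min (g ` A) + d"
proof -
  have "Min (g ` A) \<in> g ` A" using assms by (intro Min_in) auto
  then obtain a where a: "a \<in> A" "g a = Min (g ` A)" by (metis imageE)
  have "Min (f ` A) \<le> f a" using assms a by simp
  then show ?thesis using assms(3)[OF a(1)] a(2) by simp
qed

lemma Max_image_add:
  fixes f :: "'a \<Rightarrow> real"
  assumes "finite A" "A \<noteq> {}" shows "Max ((\<lambda>a. f a + d) ` A) = Max (f ` A) + d"
  using Max_image_le_add[OF assms, of "\<lambda>a. f a + d" f d] Max_image_le_add[OF assms, of f "\<lambda>a. f a + d" "- d"] by simp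

lemma Min_image_add:
  fixes f :: "'a \<Rightarrow> real"
  assumes "finite A" "A \<noteq> {}" shows "Min ((\<lambda>a. f a + d) ` A) = Min (f ` A) + d"
  using Min_image_le_add[OF assms, of "\<lambda>a. f a + d" f d] Min_image_le_add[OF assms, of f "\<lambda>a. f a + d" "- d"] by simp

section \<open>Polyhedral distance functions\<close>

text \<open>The normals in \<open>\<Lambda>\<close> give a polyhedral gauge between
  \<open>(1 - \<epsilon>)\<close> times the norm and the norm; \<open>K0\<close> generates, by
  lattice translations, the centres from which the gauge is measured.\<close>

locale polyhedral =
  fixes \<Lambda> :: "(real^'n::finite) set" and \<epsilon> :: real and K0 :: "(real^'n) set"
  assumes fin: "finite \<Lambda>" "\<Lambda> \<noteq> {}" and unit: "\<And>n. n \<in> \<Lambda> \<Longrightarrow> norm n = 1"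
    and eps: "0 < \<epsilon>" "\<epsilon> < 1" and net: "\<And>y. \<exists>n\<in>\<Lambda>. (1 - \<epsilon>) * norm y \<le> n \<bullet> y"
    and K0: "finite K0" "K0 \<noteq> {}"
begin

definition pgauge where "pgauge y = Max ((\<lambda>n. n \<bullet> y) ` \<Lambda>)"

lemma pgauge_less_iff: "pgauge y < c \<longleftrightarrow> (\<forall>n\<in>\<Lambda>. n \<bullet> y < c)"
  unfolding pgauge_def using fin by (subst Max_less_iff) auto

lemma pgauge_ge_comp: "n \<in> \<Lambda> \<Longrightarrow> n \<bullet> y \<le> pgauge y"
  unfolding pgauge_def using fin by (intro Max_ge) auto

lemma pgauge_attained: "\<exists>n\<in>\<Lambda>. pgauge y = n \<bullet> y"
  using Max_in[of "(\<lambda>n. n \<bullet> y) ` \<Lambda>"] fin unfolding pgauge_def by fastforce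

lemma pgauge_ge: "(1 - \<epsilon>) * norm y \<le> pgauge y"
  using net[of y] pgauge_ge_comp order_trans by blast

lemma pgauge_le_add: "pgauge y \<le> pgauge z + norm (y - z)"
  unfolding pgauge_def
proof (rule Max_image_le_add[OF fin])
  fix n assume "n \<in> \<Lambda>"
  then show "n \<bullet> y \<le> n \<bullet> z + norm (y - z)" using norm_cauchy_schwarz[of n "y - z"] unit by (simp add: inner_diff_right)
qed

lemma pgauge_le: "pgauge y \<le> norm y"
proof -
  obtain n where "n \<in> \<Lambda>" "pgauge y = n \<bullet> y" using pgauge_attained by blast
  then show ?thesis using norm_cauchy_schwarz[of n y] unit by simp
qed

definition K where "K = {k + lattice_vec z | k z. k \<in> K0}"

lemma K_lattice: "k \<in> K \<Longrightarrow> k + lattice_vec z \<in> K"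
proof -
  assume "k \<in> K"
  then obtain k0 w where "k0 \<in> K0" "k = k0 + lattice_vec w" by (auto simp: K_def)
  then have "k + lattice_vec z = k0 + lattice_vec (\<lambda>i. w i + z i)" by (simp add: lattice_vec_add)
  then show ?thesis using \<open>k0 \<in> K0\<close> unfolding K_def by blast
qed

lemma K_finite: "finite {k \<in> K. norm (x - k) \<le> R}"
proof -
  have "{k \<in> K. norm (x - k) \<le> R} \<subseteq> (\<Union>k0\<in>K0. (\<lambda>z. k0 + lattice_vec z) ` {z. norm ((k0 - x) + lattice_vec z) \<le> R})"
  proof
    fix k assume k: "k \<in> {k \<in> K. norm (x - k) \<le> R}"
    then obtain k0 z where kz: "k0 \<in> K0" "k = k0 + lattice_vec z" by (auto simp: K_def)
    have "norm ((k0 - x) + lattice_vec z) \<le> R" using k by (simp add: kz(2) norm_minus_commute[of x] algebra_simps)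
    then show "k \<in> (\<Union>k0\<in>K0. (\<lambda>z. k0 + lattice_vec z) ` {z. norm ((k0 - x) + lattice_vec z) \<le> R})" using kz by blast
  qed
  then show ?thesis by (rule finite_subset) (intro finite_UN_I K0 finite_imageI finite_lattice_cball)
qed

lemma K_nonempty: "K \<noteq> {}" using K0 by (auto simp: K_def)

lemma K_countable: "countable K"
proof -
  have "K = (\<Union>k0\<in>K0. range (\<lambda>z. k0 + lattice_vec z))" by (auto simp: K_def)
  moreover have "countable (\<Union>k0\<in>K0. range (\<lambda>z. k0 + lattice_vec z))"
    by (rule countable_UN[OF countable_finite[OF K0(1)]]) simp
  ultimately show ?thesis by simp
qed

text \<open>Polyhedral distance to the periodic set \<open>K\<close>: a locally finite minimum of
  finite maxima of affine functions with unit gradients. It lies between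
  \<open>(1 - \<epsilon>)\<close> times the Euclidean distance to \<open>K\<close> and that
  distance.\<close>

definition G where "G x = Inf ((\<lambda>k. pgauge (x - k)) ` K)"

lemma G_le: "k \<in> K \<Longrightarrow> G x \<le> pgauge (x - k)"
  unfolding G_def
proof (rule cInf_lower)
  have "0 \<le> pgauge (x - k)" for k
  proof -
    have "0 \<le> (1 - \<epsilon>) * norm (x - k)" using eps by simp
    then show ?thesis using pgauge_ge[of "x - k"] by linarith
  qed
  then show "bdd_below ((\<lambda>k. pgauge (x - k)) ` K)" by (auto simp: bdd_below_def)
qed auto

lemma G_attained: "\<exists>k\<in>K. G x = pgauge (x - k)"
proof -
  obtain k1 where k1: "k1 \<in> K" using K_nonempty by blast
  \<comment> \<open>Centres farther than \<open>R\<close> from \<open>x\<close> have a larger gauge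
    than \<open>k1\<close>, which leaves finitely many to compare.\<close>
  define R where "R = (pgauge (x - k1)) / (1 - \<epsilon>)"
  define F where "F = {k \<in> K. norm (x - k) \<le> R}"
  have e1: "1 - \<epsilon> > 0" using eps by simp
  have out: "pgauge (x - k1) < pgauge (x - k)" if "k \<in> K" "k \<notin> F" for k
  proof -
    have "R < norm (x - k)" using that by (simp add: F_def)
    then have "pgauge (x - k1) < (1 - \<epsilon>) * norm (x - k)" using e1 by (simp add: R_def pos_divide_less_eq mult.commute)
    then show ?thesis using pgauge_ge[of "x - k"] by linarith
  qed
  have k1F: "k1 \<in> F" using out[OF k1] by blast
  have finF: "finite F" unfolding F_def by (rule K_finite)
  obtain k where k: "k \<in> F" "pgauge (x - k) = Min ((\<lambda>k. pgauge (x - k)) ` F)"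
    using Min_in[of "(\<lambda>k. pgauge (x - k)) ` F"] finF k1F by fastforce
  have "pgauge (x - k) \<le> pgauge (x - j)" if j: "j \<in> K" for j
  proof (cases "j \<in> F")
    case True
    then show ?thesis unfolding k(2) using finF by (intro Min_le) auto
  next
    case False
    have "pgauge (x - k) \<le> pgauge (x - k1)" unfolding k(2) using finF k1F by (intro Min_le) auto
    then show ?thesis using out[OF j False] by linarith
  qed
  then have "pgauge (x - k) \<le> G x" unfolding G_def using K_nonempty by (intro cInf_greatest) auto
  moreover have kK: "k \<in> K" using k by (simp add: F_def)
  ultimately show ?thesis using G_le[OF kK, of x] by (intro bexI[of _ k]) auto
qed

lemma G_less_iff: "G x < c \<longleftrightarrow> (\<exists>k\<in>K. pgauge (x - k) < c)"
proof
  assume "G x < c"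
  then show "\<exists>k\<in>K. pgauge (x - k) < c" using G_attained[of x] by auto
next
  assume "\<exists>k\<in>K. pgauge (x - k) < c"
  then show "G x < c" using G_le[of _ x] by (meson le_less_trans)
qed

lemma G_le_add: "G x \<le> G y + norm (x - y)"
proof -
  obtain k where k: "k \<in> K" "G y = pgauge (y - k)" using G_attained by blast
  have "G x \<le> pgauge (x - k)" by (rule G_le[OF k(1)])
  also have "\<dots> \<le> pgauge (y - k) + norm ((x - k) - (y - k))" by (rule pgauge_le_add)
  finally show ?thesis using k by simp
qed

lemma G_cont: "continuous_on UNIV G"
proof (rule lipschitz_on_continuous_on[of 1])
  show "1-lipschitz_on UNIV G"
  proof (rule lipschitz_onI)
    fix x y show "dist (G x) (G y) \<le> 1 * dist x y"
      using G_le_add[of x y] G_le_add[of y x] by (simp add: dist_norm abs_le_iff norm_minus_commute)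
  qed simp
qed

lemma G_periodic: "G (x + lattice_vec z) = G x"
proof (rule antisym)
  have le: "G (x + lattice_vec z) \<le> G x" for x z
  proof -
    obtain k where k: "k \<in> K" "G x = pgauge (x - k)" using G_attained by blast
    have "G (x + lattice_vec z) \<le> pgauge (x + lattice_vec z - (k + lattice_vec z))" by (rule G_le[OF K_lattice[OF k(1)]])
    then show ?thesis using k by simp
  qed
  show "G (x + lattice_vec z) \<le> G x" by (rule le)
  show "G x \<le> G (x + lattice_vec z)" using le[of "x + lattice_vec z" "\<lambda>i. - z i"] by (simp add: lattice_vec_minus)
qed

lemma G_near: "G x < c \<Longrightarrow> \<exists>k\<in>K. norm (x - k) < c / (1 - \<epsilon>)"
proof -
  assume "G x < c"
  then obtain k where k: "k \<in> K" "pgauge (x - k) < c" using G_less_iff by blast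
  have "(1 - \<epsilon>) * norm (x - k) < c" using pgauge_ge[of "x - k"] k(2) by linarith
  then show ?thesis using k(1) eps by (auto simp: pos_less_divide_eq mult.commute)
qed

lemma G_less_if_near: "k \<in> K \<Longrightarrow> norm (x - k) < c \<Longrightarrow> G x < c"
  using G_le[of k x] pgauge_le[of "x - k"] by linarith

lemma G_pieces:
  obtains n b where "\<And>j::nat. norm (n j) = 1" "\<And>x. \<exists>j. G x = n j \<bullet> x - b j"
proof -
  let ?S = "\<Lambda> \<times> K"
  have c: "countable ?S" "?S \<noteq> {}" using fin K_countable K_nonempty by (auto intro: countable_finite)
  define f where "f = from_nat_into ?S"
  have f: "f j \<in> ?S" for j unfolding f_def using c by (intro from_nat_into)
  have f2: "\<exists>j. f j = p" if "p \<in> ?S" for p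
    using from_nat_into_to_nat_on[OF c(1) that] unfolding f_def by blast
  show thesis
  proof (rule that[of "\<lambda>j. fst (f j)" "\<lambda>j. fst (f j) \<bullet> snd (f j)"])
    show "norm (fst (f j)) = 1" for j using f[of j] unit by (auto simp: mem_Times_iff)
    fix x
    obtain k where k: "k \<in> K" "G x = pgauge (x - k)" using G_attained by blast
    obtain n where n: "n \<in> \<Lambda>" "pgauge (x - k) = n \<bullet> (x - k)" using pgauge_attained by blast
    obtain j where "f j = (n, k)" using f2[of "(n, k)"] n k by auto
    then show "\<exists>j. G x = fst (f j) \<bullet> x - fst (f j) \<bullet> snd (f j)" using n k by (intro exI[of _ j]) (simp add: inner_diff_right)
  qed
qed

text \<open>The critical levels: those at which the active unit normals at some point have \<open>0\<close> in their convex hull.\<close>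
definition critical where
  "critical = {\<sigma>. \<exists>A x. finite A \<and> A \<subseteq> K \<times> \<Lambda> \<and> (\<forall>(k, n)\<in>A. n \<bullet> (x - k) = \<sigma>) \<and> 0 \<in> convex hull (snd ` A)}"

text \<open>There are countably many finite sets of pairs, and each belongs to at most one level:
  the vanishing convex combination of its normals eliminates \<open>x\<close> from the equations
  \<open>n \<bullet> (x - k) = \<sigma>\<close>.\<close>

lemma countable_critical: "countable critical"
proof -
  let ?b = "\<lambda>A. {\<sigma>. \<exists>x. (\<forall>(k, n)\<in>A. n \<bullet> (x - k) = \<sigma>) \<and> 0 \<in> convex hull (snd ` A)}"
  have eq: "critical = (\<Union>A\<in>{A. finite A \<and> A \<subseteq> K \<times> \<Lambda>}. ?b A)" unfolding critical_def by blast
  have cA: "countable {A. finite A \<and> A \<subseteq> K \<times> \<Lambda>}"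
    by (intro countable_Collect_finite_subset countable_SIGMA K_countable countable_finite[OF fin(1)])
  have "countable (?b A)" if A: "finite A" for A
  proof (cases "0 \<in> convex hull (snd ` A)")
    case True
    then obtain u where u: "\<forall>n\<in>snd ` A. 0 \<le> u n" "sum u (snd ` A) = 1" "(\<Sum>n\<in>snd ` A. u n *\<^sub>R n) = 0"
      using convex_hull_finite[of "snd ` A"] A by auto
    define kk where "kk n = (SOME k. (k, n) \<in> A)" for n
    have kk: "(kk n, n) \<in> A" if "n \<in> snd ` A" for n
      using that unfolding kk_def by (auto intro: someI)
    have "\<sigma> = - (\<Sum>n\<in>snd ` A. u n * (n \<bullet> kk n))" if s: "\<forall>(k, n)\<in>A. n \<bullet> (x - k) = \<sigma>" for \<sigma> x
    proof -
      have "\<sigma> = (\<Sum>n\<in>snd ` A. u n * \<sigma>)" using u(2) by (simp add: sum_distrib_right[symmetric])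
      also have "\<dots> = (\<Sum>n\<in>snd ` A. u n * (n \<bullet> (x - kk n)))"
      proof (rule sum.cong[OF refl])
        fix n assume n: "n \<in> snd ` A"
        show "u n * \<sigma> = u n * (n \<bullet> (x - kk n))" using bspec[OF s kk[OF n]] by simp
      qed
      also have "\<dots> = (\<Sum>n\<in>snd ` A. u n *\<^sub>R n) \<bullet> x - (\<Sum>n\<in>snd ` A. u n * (n \<bullet> kk n))"
        by (simp add: inner_diff_right right_diff_distrib sum_subtractf inner_sum_left)
      finally show ?thesis by (simp add: u(3))
    qed
    then have "?b A \<subseteq> {- (\<Sum>n\<in>snd ` A. u n * (n \<bullet> kk n))}" by blast
    then show ?thesis by (rule countable_subset) simp
  qed simp
  then show ?thesis unfolding eq using cA by (intro countable_UN) auto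
qed

lemma frontier_sublevel: "frontier {x. G x < \<sigma>} \<subseteq> {x. G x = \<sigma>}"
proof -
  have op: "open {x. G x < \<sigma>}" by (intro open_Collect_less G_cont continuous_on_const)
  have cl: "closed {x. G x \<le> \<sigma>}" by (intro closed_Collect_le G_cont continuous_on_const)
  have "closure {x. G x < \<sigma>} \<subseteq> {x. G x \<le> \<sigma>}" by (rule closure_minimal[OF _ cl]) auto
  then show ?thesis unfolding frontier_def interior_open[OF op] by auto
qed

text \<open>Near a frontier point only active centres and normals matter, and the sublevel set is a
  finite union of open polyhedral cones with apex \<open>x\<close>. At a noncritical level a
  separating hyperplane gives a direction \<open>v\<close> along which all active pieces increase at
  speed at least \<open>c\<close>; each cone is then a subgraph with Lipschitz constant
  \<open>1 / c\<close>, and so is their union.\<close>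

lemma lipschitz_boundary_sublevel:
  assumes s: "\<sigma> \<notin> critical"
  shows "lipschitz_boundary {x. G x < \<sigma>}"
proof (rule lipschitz_boundaryI)
  fix x assume "x \<in> frontier {x. G x < \<sigma>}"
  then have Gx: "G x = \<sigma>" using frontier_sublevel by blast
  have e1: "1 - \<epsilon> > 0" using eps by simp
  define KA where "KA = {k \<in> K. pgauge (x - k) = \<sigma>}"
  \<comment> \<open>Centres beyond \<open>R\<close> have gauge more than 1 above the level and
    cannot interfere within a ball of radius at most 1.\<close>
  define R where "R = (\<sigma> + 1) / (1 - \<epsilon>)"
  define KR where "KR = {k \<in> K. norm (x - k) \<le> R}"
  have KRf: "finite KR" unfolding KR_def by (rule K_finite)
  have outR: "\<sigma> + 1 < pgauge (x - k)" if "k \<in> K" "k \<notin> KR" for k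
  proof -
    have "R < norm (x - k)" using that by (simp add: KR_def)
    then have "\<sigma> + 1 < (1 - \<epsilon>) * norm (x - k)" using e1 by (simp add: R_def pos_divide_less_eq mult.commute)
    then show ?thesis using pgauge_ge[of "x - k"] by linarith
  qed
  have KAR: "KA \<subseteq> KR" using outR by (force simp: KA_def)
  then have KAf: "finite KA" using KRf finite_subset by blast
  have KAne: "KA \<noteq> {}" using G_attained[of x] Gx by (auto simp: KA_def)
  have ge: "\<sigma> \<le> pgauge (x - k)" if "k \<in> K" for k using G_le[OF that, of x] Gx by simp
  define La where "La k = {n \<in> \<Lambda>. n \<bullet> (x - k) = \<sigma>}" for k
  have Laf: "finite (La k)" for k using fin by (simp add: La_def)
  have Lane: "La k \<noteq> {}" if "k \<in> KA" for k using that pgauge_attained[of "x - k"] by (auto simp: La_def KA_def)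
  \<comment> \<open>The amounts by which the finitely many inactive centres and normals miss the
    level. All functions involved are 1-Lipschitz, so within the smallest gap they stay
    inactive.\<close>
  define gaps where "gaps = (\<lambda>k. pgauge (x - k) - \<sigma>) ` (KR - KA) \<union> (\<lambda>(k, n). \<sigma> - n \<bullet> (x - k)) ` {(k, n). k \<in> KA \<and> n \<in> \<Lambda> - La k}"
  have gf: "finite gaps"
  proof -
    have "{(k, n). k \<in> KA \<and> n \<in> \<Lambda> - La k} \<subseteq> KA \<times> \<Lambda>" by auto
    then have "finite {(k, n). k \<in> KA \<and> n \<in> \<Lambda> - La k}" using KAf fin by (meson finite_SigmaI finite_subset)
    then show ?thesis unfolding gaps_def using KRf by simp
  qed
  have gpos: "g > 0" if "g \<in> gaps" for g
    using that unfolding gaps_def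
  proof
    assume "g \<in> (\<lambda>k. pgauge (x - k) - \<sigma>) ` (KR - KA)"
    then obtain k where k: "k \<in> KR" "k \<notin> KA" "g = pgauge (x - k) - \<sigma>" by blast
    have kK: "k \<in> K" using k(1) by (simp add: KR_def)
    then have "pgauge (x - k) \<noteq> \<sigma>" using k(2) by (simp add: KA_def)
    then show ?thesis using ge[OF kK] k(3) by linarith
  next
    assume "g \<in> (\<lambda>(k, n). \<sigma> - n \<bullet> (x - k)) ` {(k, n). k \<in> KA \<and> n \<in> \<Lambda> - La k}"
    then obtain k n where kn: "k \<in> KA" "n \<in> \<Lambda>" "n \<notin> La k" "g = \<sigma> - n \<bullet> (x - k)" by auto
    have "n \<bullet> (x - k) \<noteq> \<sigma>" using kn by (simp add: La_def)
    moreover have "n \<bullet> (x - k) \<le> \<sigma>" using pgauge_ge_comp[OF kn(2), of "x - k"] kn(1) by (simp add: KA_def)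
    ultimately show ?thesis using kn(4) by linarith
  qed
  define r where "r = Min (insert 1 gaps)"
  have r: "r > 0" "r \<le> 1" "\<And>g. g \<in> gaps \<Longrightarrow> r \<le> g" using gf gpos by (auto simp: r_def)
  have loc: "G y < \<sigma> \<longleftrightarrow> (\<exists>k\<in>KA. \<forall>n\<in>La k. n \<bullet> (y - x) < 0)" if y: "y \<in> ball x r" for y
  proof -
    have nyx: "norm (y - x) < r" using y by (simp add: dist_norm norm_minus_commute)
    have 1: "\<sigma> < pgauge (y - k)" if k: "k \<in> K" "k \<notin> KA" for k
    proof -
      have "r \<le> pgauge (x - k) - \<sigma>"
      proof (cases "k \<in> KR")
        case True
        then show ?thesis using k by (intro r(3)) (auto simp: gaps_def)
      next
        case False
        then show ?thesis using outR[OF k(1)] r(2) by fastforce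
      qed
      then show ?thesis using pgauge_le_add[of "x - k" "y - k"] nyx by (simp add: norm_minus_commute)
    qed
    have 2: "pgauge (y - k) < \<sigma> \<longleftrightarrow> (\<forall>n\<in>La k. n \<bullet> (y - x) < 0)" if k: "k \<in> KA" for k
    proof
      assume "pgauge (y - k) < \<sigma>"
      then show "\<forall>n\<in>La k. n \<bullet> (y - x) < 0" unfolding pgauge_less_iff by (force simp: La_def inner_diff_right)
    next
      assume a: "\<forall>n\<in>La k. n \<bullet> (y - x) < 0"
      show "pgauge (y - k) < \<sigma>" unfolding pgauge_less_iff
      proof
        fix n assume n: "n \<in> \<Lambda>"
        have eq: "n \<bullet> (y - k) = n \<bullet> (y - x) + n \<bullet> (x - k)" by (simp add: inner_diff_right)
        show "n \<bullet> (y - k) < \<sigma>"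
        proof (cases "n \<in> La k")
          case True
          then show ?thesis using a eq by (auto simp: La_def)
        next
          case False
          have "\<sigma> - n \<bullet> (x - k) \<in> gaps" unfolding gaps_def using k n False by (intro UnI2 image_eqI[of _ _ "(k, n)"]) auto
          then have "r \<le> \<sigma> - n \<bullet> (x - k)" by (rule r(3))
          moreover have "n \<bullet> (y - x) \<le> norm (y - x)" using norm_cauchy_schwarz[of n "y - x"] unit[OF n] by simp
          ultimately show ?thesis using nyx eq by linarith
        qed
      qed
    qed
    have "G y < \<sigma> \<longleftrightarrow> (\<exists>k\<in>K. pgauge (y - k) < \<sigma>)" by (rule G_less_iff)
    also have "\<dots> \<longleftrightarrow> (\<exists>k\<in>KA. pgauge (y - k) < \<sigma>)" using 1 by (auto simp: KA_def) (meson less_asym)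
    finally show ?thesis using 2 by auto
  qed
  let ?A = "{(k, n). k \<in> KA \<and> n \<in> La k}"
  have Af: "finite ?A" "?A \<subseteq> K \<times> \<Lambda>"
  proof -
    show sub: "?A \<subseteq> K \<times> \<Lambda>" by (auto simp: KA_def La_def)
    have "?A \<subseteq> KA \<times> \<Lambda>" by (auto simp: La_def)
    then show "finite ?A" using KAf fin by (meson finite_SigmaI finite_subset)
  qed
  have "0 \<notin> convex hull (snd ` ?A)"
  proof
    assume 0: "0 \<in> convex hull (snd ` ?A)"
    have "\<forall>(k, n)\<in>?A. n \<bullet> (x - k) = \<sigma>" by (auto simp: La_def)
    then have "\<sigma> \<in> critical" unfolding critical_def using 0 Af by blast
    with s show False ..
  qed
  moreover have "closed (convex hull (snd ` ?A))" using Af(1) by (intro compact_imp_closed compact_convex_hull finite_imp_compact) simp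
  ultimately obtain a b where ab: "a \<noteq> 0" "0 < b" "\<And>n. n \<in> convex hull (snd ` ?A) \<Longrightarrow> b < a \<bullet> n"
    using separating_hyperplane_closed_0[of "convex hull (snd ` ?A)"] convex_convex_hull by blast
  define v where "v = a /\<^sub>R norm a"
  define c where "c = b / norm a"
  have v: "norm v = 1" using ab by (simp add: v_def)
  have c: "c > 0" using ab by (simp add: c_def)
  have nv: "c \<le> n \<bullet> v" if "k \<in> KA" "n \<in> La k" for k n
  proof -
    have "n \<in> snd ` ?A" using that by force
    then have "b < a \<bullet> n" using hull_inc[of n "snd ` ?A" convex] by (intro ab(3)) auto
    then show ?thesis using ab(1) by (simp add: c_def v_def inner_commute divide_inverse mult.commute)
  qed
  \<comment> \<open>Division by \<open>n \<bullet> v > 0\<close> keeps signs and makes every piece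
    grow at unit speed along \<open>v\<close>; the minimum over centres, taken in \<open>F\<close>,
    corresponds to the union of the cones.\<close>
  define Fk where "Fk k w = Max ((\<lambda>n. (n \<bullet> w) / (n \<bullet> v)) ` La k)" for k w
  define F where "F w = Min ((\<lambda>k. Fk k w) ` KA)" for w
  have F0: "F w < 0 \<longleftrightarrow> (\<exists>k\<in>KA. \<forall>n\<in>La k. n \<bullet> w < 0)" for w
  proof -
    have "F w < 0 \<longleftrightarrow> (\<exists>k\<in>KA. Fk k w < 0)" unfolding F_def using KAf KAne by (subst Min_less_iff) auto
    also have "\<dots> \<longleftrightarrow> (\<exists>k\<in>KA. \<forall>n\<in>La k. n \<bullet> w < 0)"
    proof (rule bex_cong[OF refl])
      fix k assume k: "k \<in> KA"
      have "Fk k w < 0 \<longleftrightarrow> (\<forall>n\<in>La k. (n \<bullet> w) / (n \<bullet> v) < 0)" unfolding Fk_def using Laf Lane[OF k] by (subst Max_less_iff) auto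
      also have "\<dots> \<longleftrightarrow> (\<forall>n\<in>La k. n \<bullet> w < 0)"
      proof (rule ball_cong[OF refl])
        fix n assume "n \<in> La k"
        then have "n \<bullet> v > 0" using nv[OF k] c by force
        then show "((n \<bullet> w) / (n \<bullet> v) < 0) = (n \<bullet> w < 0)" by (simp add: divide_less_0_iff)
      qed
      finally show "(Fk k w < 0) = (\<forall>n\<in>La k. n \<bullet> w < 0)" .
    qed
    finally show ?thesis .
  qed
  have Ft: "F (w + t *\<^sub>R v) = F w + t" for w t
  proof -
    have "Fk k (w + t *\<^sub>R v) = Fk k w + t" if k: "k \<in> KA" for k
    proof -
      have "(n \<bullet> (w + t *\<^sub>R v)) / (n \<bullet> v) = (n \<bullet> w) / (n \<bullet> v) + t" if "n \<in> La k" for n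
        using nv[OF k that] c by (simp add: inner_add_right add_divide_distrib)
      then have "Fk k (w + t *\<^sub>R v) = Max ((\<lambda>n. (n \<bullet> w) / (n \<bullet> v) + t) ` La k)" unfolding Fk_def by (intro arg_cong[where f=Max] image_cong) auto
      also have "\<dots> = Fk k w + t" unfolding Fk_def by (rule Max_image_add[OF Laf Lane[OF k]])
      finally show ?thesis .
    qed
    then have "F (w + t *\<^sub>R v) = Min ((\<lambda>k. Fk k w + t) ` KA)" unfolding F_def by (intro arg_cong[where f=Min] image_cong) auto
    also have "\<dots> = F w + t" unfolding F_def by (rule Min_image_add[OF KAf KAne])
    finally show ?thesis .
  qed
  have Fle: "F w \<le> F w' + (1/c) * norm (w - w')" for w w'
    unfolding F_def
  proof (rule Min_image_le_add[OF KAf KAne])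
    fix k assume k: "k \<in> KA"
    show "Fk k w \<le> Fk k w' + (1/c) * norm (w - w')" unfolding Fk_def
    proof (rule Max_image_le_add[OF Laf Lane[OF k]])
      fix n assume n: "n \<in> La k"
      have nc: "c \<le> n \<bullet> v" by (rule nv[OF k n])
      have "norm n = 1" using n unit by (simp add: La_def)
      then have "n \<bullet> (w - w') \<le> norm (w - w')" using norm_cauchy_schwarz[of n "w - w'"] by simp
      then have "(n \<bullet> (w - w')) / (n \<bullet> v) \<le> norm (w - w') / (n \<bullet> v)" using nc c by (intro divide_right_mono) auto
      also have "\<dots> \<le> norm (w - w') / c" using nc c by (intro divide_left_mono) auto
      finally show "(n \<bullet> w) / (n \<bullet> v) \<le> (n \<bullet> w') / (n \<bullet> v) + (1/c) * norm (w - w')"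
        by (simp add: inner_diff_right diff_divide_distrib)
    qed
  qed
  have Fl: "(1/c)-lipschitz_on UNIV F"
  proof (rule lipschitz_onI)
    fix w w' show "dist (F w) (F w') \<le> 1 / c * dist w w'"
      using Fle[of w w'] Fle[of w' w] by (simp add: dist_norm abs_le_iff norm_minus_commute)
  qed (use c in simp)
  have "{x. G x < \<sigma>} \<inter> ball x r = {y \<in> ball x r. F (y - x) < 0}" unfolding F0 using loc by auto
  then show "\<exists>r>0. \<exists>v F c. norm v = 1 \<and> c-lipschitz_on UNIV F \<and> (\<forall>w t. F (w + t *\<^sub>R v) = F w + t) \<and>
     {x. G x < \<sigma>} \<inter> ball x r = {y \<in> ball x r. F (y - x) < (0::real)}"
    using r(1) v Fl Ft by blast
qed

end

section \<open>The divergence and trapping regions\<close>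

text \<open>Limit of difference quotients along \<open>1 / (n + 1)\<close>, hence a Borel function; the junk values at
  points of nondifferentiability are irrelevant by Rademacher.\<close>
definition pd :: "'n \<Rightarrow> (real^'n::finite \<Rightarrow> real) \<Rightarrow> real^'n \<Rightarrow> real" where
  "pd i f x = lim (\<lambda>n. (f (x + (1 / real (Suc n)) *\<^sub>R axis i 1) - f x) * real (Suc n))"

section \<open>Partial derivatives of periodic Lipschitz functions\<close>

lemma pd_limit:
  assumes "(f has_derivative f') (at x)"
  shows "(\<lambda>n. (f (x + (1 / real (Suc n)) *\<^sub>R axis i 1) - f x) * real (Suc n)) \<longlonglongrightarrow> f' (axis i 1)"
proof -
  have "((\<lambda>t. x + t *\<^sub>R axis i 1) has_derivative (\<lambda>t. t *\<^sub>R axis i 1)) (at 0)" by (auto intro!: derivative_eq_intros)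
  moreover have "(f has_derivative f') (at (x + 0 *\<^sub>R axis i 1))" using assms by simp
  ultimately have "((\<lambda>t. f (x + t *\<^sub>R axis i 1)) has_derivative (\<lambda>t. f' (t *\<^sub>R axis i 1))) (at 0)"
    by (rule has_derivative_compose)
  moreover have "f' (t *\<^sub>R axis i 1) = f' (axis i 1) * t" for t
    using linear_scale[OF has_derivative_linear[OF assms]] by simp
  ultimately have "((\<lambda>t. f (x + t *\<^sub>R axis i 1)) has_field_derivative f' (axis i 1)) (at 0)"
    by (simp add: has_field_derivative_def mult_commute_abs)
  then have "((\<lambda>h. (f (x + (0 + h) *\<^sub>R axis i 1) - f (x + 0 *\<^sub>R axis i 1)) / h) \<longlongrightarrow> f' (axis i 1)) (at 0)"
    unfolding DERIV_def .
  moreover have "filterlim (\<lambda>n. 1 / real (Suc n)) (at 0) sequentially"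
    unfolding filterlim_at using LIMSEQ_Suc[OF lim_1_over_n[where 'a=real]] by (auto intro!: always_eventually)
  ultimately have "(\<lambda>n. (f (x + (0 + 1 / real (Suc n)) *\<^sub>R axis i 1) - f (x + 0 *\<^sub>R axis i 1)) / (1 / real (Suc n))) \<longlonglongrightarrow> f' (axis i 1)"
    by (rule filterlim_compose)
  then show ?thesis by simp
qed

lemma pd_eq: "(f has_derivative f') (at x) \<Longrightarrow> pd i f x = f' (axis i 1)"
  unfolding pd_def by (rule limI[OF pd_limit])

lemma pd_measurable:
  assumes "continuous_on UNIV f" shows "pd i f \<in> borel_measurable borel"
proof -
  have [measurable]: "f \<in> borel_measurable borel" using assms by (rule borel_measurable_continuous_onI)
  show ?thesis unfolding pd_def[abs_def] by measurable
qed

lemma AE_differentiable: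
  fixes f :: "real^'n::finite \<Rightarrow> real^'m::finite"
  assumes "L-lipschitz_on UNIV f" shows "AE x in lborel. f differentiable (at x)"
proof -
  have "{x. \<not> f differentiable (at x)} \<in> null_sets lebesgue" using rademacher[OF assms] by (simp add: negligible_iff_null_sets)
  then have "AE x in lebesgue. f differentiable (at x)" by (auto intro: AE_I')
  then show ?thesis by (simp add: AE_completion_iff)
qed

lemma AE_differentiable_real:
  fixes f :: "real^'n::finite \<Rightarrow> real"
  assumes "L-lipschitz_on UNIV f" shows "AE x in lborel. f differentiable (at x)"
proof -
  have "{x. \<not> f differentiable (at x)} \<in> null_sets lebesgue" using rademacher_real[OF assms] by (simp add: negligible_iff_null_sets)
  then have "AE x in lebesgue. f differentiable (at x)" by (auto intro: AE_I')
  then show ?thesis by (simp add: AE_completion_iff)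
qed

lemma integrable_unit_cell_bounded:
  fixes g :: "real^'n::finite \<Rightarrow> real"
  assumes "g \<in> borel_measurable borel" "AE x in lborel. \<bar>g x\<bar> \<le> C"
  shows "integrable lborel (\<lambda>x. indicator unit_cell x * g x)"
proof (rule Bochner_Integration.integrable_bound[of _ "\<lambda>x. C * indicat_real unit_cell x"])
  show "integrable lborel (\<lambda>x :: real^'n. C * indicat_real unit_cell x)"
    using emeasure_unit_cell[where 'n='n] by (intro integrable_mult_right integrable_real_indicator) (auto intro: sets_unit_cell)
  show "(\<lambda>x. indicator unit_cell x * g x) \<in> borel_measurable lborel"
    using assms(1) sets_unit_cell by simp
  show "AE x in lborel. norm (indicator unit_cell x * g x) \<le> norm (C * indicat_real unit_cell x)"
    using assms(2) by (rule AE_mp) (auto simp: indicator_def)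
qed

lemma lborel_integral_translate:
  fixes f :: "'a::euclidean_space \<Rightarrow> real"
  assumes "f \<in> borel_measurable borel"
  shows "(\<integral>x. f (x + v) \<partial>lborel) = (\<integral>x. f x \<partial>lborel)"
proof -
  have "(\<integral>x. f x \<partial>lborel) = (\<integral>x. f x \<partial>distr lborel borel ((+) v))" by (simp add: lborel_distr_plus)
  also have "\<dots> = (\<integral>x. f (v + x) \<partial>lborel)" using assms by (intro integral_distr) auto
  finally show ?thesis by (simp add: add.commute)
qed

text \<open>Shifting the cell along the axis trades the slab \<open>A\<close> at one face for its
  translate at the opposite face, and periodicity equates their contributions.\<close>

lemma integral_unit_cell_axis_shift:
  fixes f :: "real^'n::finite \<Rightarrow> real"
  assumes f: "continuous_on UNIV f" "zn_periodic f" "\<And>x. \<bar>f x\<bar> \<le> C" and h: "0 < h" "h \<le> 1"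
  shows "(\<integral>x. indicator unit_cell x * f (x + h *\<^sub>R axis i 1) \<partial>lborel) = (\<integral>x. indicator unit_cell x * f x \<partial>lborel)"
proof -
  let ?e = "axis i 1 :: real^'n"
  note sets_unit_cell[measurable]
  have fm[measurable]: "f \<in> borel_measurable borel" using f(1) by (rule borel_measurable_continuous_onI)
  have cp: "(x + a *\<^sub>R ?e) $ j = (if j = i then x $ j + a else x $ j)" for x a j by (simp add: axis_def)
  have cm: "(x - a *\<^sub>R ?e) $ j = (if j = i then x $ j - a else x $ j)" for x a j by (simp add: axis_def)
  have ax: "?e $ j = 0" if "j \<noteq> i" for j using that by (simp add: axis_def)
  define A where "A = unit_cell \<inter> {x. x $ i < h}"
  have [measurable]: "A \<in> sets borel"
    unfolding A_def by (intro sets.Int sets_unit_cell borel_open open_Collect_less continuous_intros)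
  have memc: "x \<in> unit_cell \<longleftrightarrow> (0 \<le> x $ i \<and> x $ i < 1) \<and> (\<forall>j. j \<noteq> i \<longrightarrow> 0 \<le> x $ j \<and> x $ j < 1)" for x :: "real^'n"
    by (auto simp: unit_cell_def)
  have ind: "indicator unit_cell (y - h *\<^sub>R ?e) = indicator unit_cell y - indicator A y + (indicator A (y - ?e) :: real)" for y
  proof (cases "\<forall>j. j \<noteq> i \<longrightarrow> 0 \<le> y $ j \<and> y $ j < 1")
    case True
    have 1: "y - h *\<^sub>R ?e \<in> unit_cell \<longleftrightarrow> 0 \<le> y $ i - h \<and> y $ i - h < 1" using True by (auto simp: memc ax)
    have 2: "y \<in> unit_cell \<longleftrightarrow> 0 \<le> y $ i \<and> y $ i < 1" using True by (auto simp: memc)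
    have 3: "y - ?e \<in> A \<longleftrightarrow> 0 \<le> y $ i - 1 \<and> y $ i - 1 < h" using True h cm[of y 1] by (auto simp: memc A_def)
    show ?thesis unfolding indicator_def A_def Int_iff mem_Collect_eq 1 2 3[unfolded A_def Int_iff mem_Collect_eq] using h by auto
  next
    case False
    then obtain j where j: "j \<noteq> i" "\<not> (0 \<le> y $ j \<and> y $ j < 1)" by blast
    have "x \<notin> unit_cell" if "x $ j = y $ j" for x
    proof
      assume "x \<in> unit_cell"
      then have "0 \<le> x $ j \<and> x $ j < 1" by (simp add: unit_cell_def)
      then show False using j(2) that by simp
    qed
    then have "y - h *\<^sub>R ?e \<notin> unit_cell" "y \<notin> unit_cell" "y - ?e \<notin> unit_cell" using ax[OF j(1)] by auto
    then show ?thesis by (simp add: A_def)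
  qed
  have int1: "integrable lborel (\<lambda>y. indicator unit_cell y * f y)" by (rule integrable_unit_cell_bounded[of _ C]) (use f(3) in auto)
  have int2: "integrable lborel (\<lambda>y. indicator A y * f y)"
    by (rule Bochner_Integration.integrable_bound[OF int1]) (auto simp: A_def indicator_def)
  have fe: "f (x + ?e) = f x" for x
  proof -
    have "?e = lattice_vec (\<lambda>j. if j = i then 1 else 0)" by (auto simp: lattice_vec_def vec_eq_iff axis_def)
    then show ?thesis using zn_periodicD[OF f(2)] by simp
  qed
  have int3: "integrable lborel (\<lambda>y. indicator A (y - ?e) * f y)"
  proof -
    have "integrable (distr lborel borel ((+) (- ?e))) (\<lambda>y. indicator A y * f y)" using int2 by (simp add: lborel_distr_plus)
    then have "integrable lborel (\<lambda>y. indicator A (- ?e + y) * f (- ?e + y))" by (subst (asm) integrable_distr_eq) auto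
    moreover have "f (- ?e + y) = f y" for y using fe[of "- ?e + y"] by simp
    ultimately show ?thesis by (simp add: add.commute)
  qed
  have "(\<integral>x. indicator unit_cell x * f (x + h *\<^sub>R ?e) \<partial>lborel) = (\<integral>x. indicator unit_cell (x + h *\<^sub>R ?e - h *\<^sub>R ?e) * f (x + h *\<^sub>R ?e) \<partial>lborel)" by simp
  also have "\<dots> = (\<integral>y. indicator unit_cell (y - h *\<^sub>R ?e) * f y \<partial>lborel)"
    by (rule lborel_integral_translate[of "\<lambda>y. indicator unit_cell (y - h *\<^sub>R ?e) * f y"]) measurable
  also have "\<dots> = (\<integral>y. indicator unit_cell y * f y - indicator A y * f y + indicator A (y - ?e) * f y \<partial>lborel)"
    unfolding ind by (intro Bochner_Integration.integral_cong) (auto simp: algebra_simps)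
  also have "\<dots> = (\<integral>y. indicator unit_cell y * f y \<partial>lborel) - (\<integral>y. indicator A y * f y \<partial>lborel) + (\<integral>y. indicator A (y - ?e) * f y \<partial>lborel)"
    using int1 int2 int3 by simp
  also have "(\<integral>y. indicator A (y - ?e) * f y \<partial>lborel) = (\<integral>x. indicator A (x + ?e - ?e) * f (x + ?e) \<partial>lborel)"
    by (rule lborel_integral_translate[symmetric]) measurable
  also have "\<dots> = (\<integral>y. indicator A y * f y \<partial>lborel)" by (simp add: fe)
  finally show ?thesis by simp
qed

lemma periodic_continuous_bounded:
  fixes f :: "real^'n::finite \<Rightarrow> real"
  assumes "continuous_on UNIV f" "zn_periodic f"
  obtains C where "\<And>x. \<bar>f x\<bar> \<le> C"
proof -
  have "compact (f ` cbox 0 1)" by (intro compact_continuous_image compact_cbox continuous_on_subset[OF assms(1)]) auto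
  then have "bounded (f ` cbox 0 1)" by (rule compact_imp_bounded)
  then obtain C where C: "\<forall>x\<in>cbox 0 1. \<bar>f x\<bar> \<le> C" by (auto simp: bounded_iff)
  have "\<bar>f x\<bar> \<le> C" for x
  proof -
    obtain z where "x + lattice_vec z \<in> unit_cell" using ex_lattice_translate_in_unit_cell by blast
    then show ?thesis using C[rule_format, of "x + lattice_vec z"] unit_cell_subset_cbox zn_periodicD[OF assms(2), of x z] by auto
  qed
  then show thesis by (rule that)
qed

text \<open>The difference quotients are bounded by the Lipschitz constant and have mean zero by
  periodicity; both pass to the limit, the second by dominated convergence.\<close>

lemma pd_integral_zero:
  fixes f :: "real^'n::finite \<Rightarrow> real"
  assumes lip: "M-lipschitz_on UNIV f" and per: "zn_periodic f"
  shows "integrable lborel (\<lambda>x. indicator unit_cell x * pd i f x)" (is ?A)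
    and "(\<integral>x. indicator unit_cell x * pd i f x \<partial>lborel) = 0" (is ?B)
    and "AE x in lborel. \<bar>pd i f x\<bar> \<le> M" (is ?C)
proof -
  let ?e = "axis i 1 :: real^'n"
  note sets_unit_cell[measurable]
  have cont: "continuous_on UNIV f" using lip by (rule lipschitz_on_continuous_on)
  have fm[measurable]: "f \<in> borel_measurable borel" using cont by (rule borel_measurable_continuous_onI)
  have pm[measurable]: "pd i f \<in> borel_measurable borel" using cont by (rule pd_measurable)
  obtain C where C: "\<And>x. \<bar>f x\<bar> \<le> C" using periodic_continuous_bounded[OF cont per] by blast
  define q where "q n x = (f (x + (1 / real (Suc n)) *\<^sub>R ?e) - f x) * real (Suc n)" for n x
  have [measurable]: "q n \<in> borel_measurable borel" for n unfolding q_def by measurable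
  have qb: "\<bar>q n x\<bar> \<le> M" for n x
  proof -
    have "\<bar>f (x + (1 / real (Suc n)) *\<^sub>R ?e) - f x\<bar> \<le> M * dist (x + (1 / real (Suc n)) *\<^sub>R ?e) x"
      using lipschitz_onD[OF lip, of "x + (1 / real (Suc n)) *\<^sub>R ?e" x] by (simp add: dist_real_def)
    also have "\<dots> = M / real (Suc n)" by (simp add: dist_norm norm_axis_1)
    finally show ?thesis by (simp add: q_def abs_mult pos_le_divide_eq del: of_nat_Suc)
  qed
  have lim: "AE x in lborel. (\<lambda>n. q n x) \<longlonglongrightarrow> pd i f x"
    using AE_differentiable_real[OF lip]
  proof (rule AE_mp, intro AE_I2 impI)
    fix x assume "f differentiable (at x)"
    then obtain f' where f': "(f has_derivative f') (at x)" by (auto simp: differentiable_def)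
    show "(\<lambda>n. q n x) \<longlonglongrightarrow> pd i f x" unfolding pd_eq[OF f'] q_def by (rule pd_limit[OF f'])
  qed
  show ?C using lim
  proof (rule AE_mp, intro AE_I2 impI)
    fix x assume l: "(\<lambda>n. q n x) \<longlonglongrightarrow> pd i f x"
    show "\<bar>pd i f x\<bar> \<le> M" by (rule LIMSEQ_le_const2[OF tendsto_rabs[OF l]]) (use qb in auto)
  qed
  then show ?A by (rule integrable_unit_cell_bounded[OF pm])
  have "(\<lambda>n. \<integral>x. indicator unit_cell x * q n x \<partial>lborel) \<longlonglongrightarrow> (\<integral>x. indicator unit_cell x * pd i f x \<partial>lborel)"
  proof (rule integral_dominated_convergence[where w="\<lambda>x. indicator unit_cell x * M"])
    show "integrable lborel (\<lambda>x :: real^'n. indicator unit_cell x * M)" by (rule integrable_unit_cell_bounded[of _ "\<bar>M\<bar>"]) auto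
    show "AE x in lborel. (\<lambda>n. indicator unit_cell x * q n x) \<longlonglongrightarrow> indicator unit_cell x * pd i f x"
      using lim by (rule AE_mp) (auto intro!: tendsto_mult)
    show "AE x in lborel. norm (indicator unit_cell x * q n x) \<le> indicator unit_cell x * M" for n
      using qb by (intro AE_I2) (auto simp: indicator_def)
  qed measurable
  moreover have "(\<integral>x. indicator unit_cell x * q n x \<partial>lborel) = 0" for n
  proof -
    have i1: "integrable lborel (\<lambda>x. indicator unit_cell x * f (x + (1 / real (Suc n)) *\<^sub>R ?e))"
      by (rule integrable_unit_cell_bounded[of _ C]) (use C in auto)
    have i2: "integrable lborel (\<lambda>x. indicator unit_cell x * f x)"
      by (rule integrable_unit_cell_bounded[of _ C]) (use C in auto)
    have "(\<integral>x. indicator unit_cell x * q n x \<partial>lborel) = (\<integral>x. (indicator unit_cell x * f (x + (1 / real (Suc n)) *\<^sub>R ?e) - indicator unit_cell x * f x) * real (Suc n) \<partial>lborel)"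
      by (intro Bochner_Integration.integral_cong) (auto simp: q_def algebra_simps simp del: of_nat_Suc)
    also have "\<dots> = ((\<integral>x. indicator unit_cell x * f (x + (1 / real (Suc n)) *\<^sub>R ?e) \<partial>lborel) - (\<integral>x. indicator unit_cell x * f x \<partial>lborel)) * real (Suc n)"
      using i1 i2 by (simp del: of_nat_Suc)
    also have "\<dots> = 0" using integral_unit_cell_axis_shift[OF cont per C, of "1 / real (Suc n)" i] by simp
    finally show ?thesis .
  qed
  ultimately have "(\<lambda>n. 0 :: real) \<longlonglongrightarrow> (\<integral>x. indicator unit_cell x * pd i f x \<partial>lborel)" by simp
  then show ?B by (simp add: LIMSEQ_const_iff)
qed

lemma emeasure_open_periodic_pos:
  fixes U :: "(real^'n::finite) set"
  assumes U: "open U" "U \<noteq> {}" "zn_periodic_set U"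
  shows "0 < measure lborel (U \<inter> unit_cell)"
proof -
  have "emeasure lborel (U \<inter> unit_cell) \<noteq> 0"
  proof
    assume 0: "emeasure lborel (U \<inter> unit_cell) = 0"
    have "emeasure lborel U = (\<integral>\<^sup>+z. emeasure lborel ({x. x + lattice_vec z \<in> U} \<inter> unit_cell) \<partial>count_space UNIV)"
      using U by (intro emeasure_lattice_decompose) auto
    also have "\<dots> = 0" using 0 zn_periodic_setD[OF U(3)] by simp
    finally have "U \<in> null_sets lborel" using U(1) by (auto simp: null_sets_def)
    then have "negligible U" by (auto simp: negligible_iff_null_sets null_sets_completionI)
    then show False using open_not_negligible[OF U(1,2)] by blast
  qed
  moreover have "emeasure lborel (U \<inter> unit_cell) \<le> 1"
    using emeasure_mono[where M=lborel, of "U \<inter> unit_cell" "unit_cell :: (real^'n) set"] sets_unit_cell emeasure_unit_cell[where 'n='n] by auto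
  ultimately show ?thesis
    by (simp add: measure_def enn2real_positive_iff zero_less_iff_neq_zero ennreal_one_less_top le_less_trans[of _ 1])
qed

section \<open>Trapping regions\<close>

context flow
begin

text \<open>\<open>adm_small\<close> made uniform in the starting point: a radius \<open>r\<close>
  halfway between the actual deviation and 1 leaves room for a perturbation of size
  \<open>(1 - r) / (L + 1)\<close>.\<close>

lemma adm_near:
  assumes "norm (q - V y) < 1"
  obtains e t0 where "e > 0" "t0 > 0" "\<And>y' t. y' \<in> ball y e \<Longrightarrow> 0 < t \<Longrightarrow> t \<le> t0 \<Longrightarrow> adm V 1 y' q t"
proof -
  define r where "r = (1 + norm (q - V y)) / 2"
  have r: "norm (q - V y) < r" "r < 1" using assms by (auto simp: r_def)
  obtain t0 where t0: "t0 > 0" "\<And>t s. 0 < t \<Longrightarrow> t \<le> t0 \<Longrightarrow> 0 \<le> s \<Longrightarrow> s \<le> t \<Longrightarrow> adm V r (y - s *\<^sub>R q) q t"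
    using adm_small[OF r(1)] by blast
  define e where "e = (1 - r) / (L + 1)"
  have L1: "L + 1 > 0" using L_nonneg by simp
  have e: "e > 0" using r(2) L1 by (simp add: e_def)
  show thesis
  proof (rule that[OF e t0(1)])
    fix y' t assume y': "y' \<in> ball y e" and t: "0 < t" "t \<le> t0"
    have a: "adm V r y q t" using t0(2)[OF t, of 0] t by simp
    have "norm (q - V (y' + s *\<^sub>R q)) < 1" if "s \<in> {0..t}" for s
    proof -
      have 1: "norm (q - V (y + s *\<^sub>R q)) < r" using a that by (simp add: adm_def)
      have "norm (V (y + s *\<^sub>R q) - V (y' + s *\<^sub>R q)) \<le> L * norm (y - y')" using V_lip[of "y + s *\<^sub>R q" "y' + s *\<^sub>R q"] by simp
      also have "\<dots> \<le> (L + 1) * e" using y' L_nonneg by (intro mult_mono) (auto simp: dist_norm)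
      also have "\<dots> = 1 - r" using L1 by (simp add: e_def)
      finally have 2: "norm (V (y + s *\<^sub>R q) - V (y' + s *\<^sub>R q)) \<le> 1 - r" .
      have "norm (q - V (y' + s *\<^sub>R q)) = norm ((q - V (y + s *\<^sub>R q)) + (V (y + s *\<^sub>R q) - V (y' + s *\<^sub>R q)))" by simp
      also have "\<dots> \<le> norm (q - V (y + s *\<^sub>R q)) + norm (V (y + s *\<^sub>R q) - V (y' + s *\<^sub>R q))" by (rule norm_triangle_ineq)
      finally show ?thesis using 1 2 by linarith
    qed
    then show "adm V 1 y' q t" using t(1) by (simp add: adm_def)
  qed
qed

text \<open>If the flow is not controllable, the closure of the set reachable from some point is a
  nontrivial trapping region: on its boundary \<open>V\<close> points inwards with unit speed.\<close>
lemma not_controllable_trap: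
  assumes "\<not> controllable"
  obtains A where "closed A" "zn_periodic_set A" "0 < measure lborel (A \<inter> unit_cell)" "measure lborel (A \<inter> unit_cell) < 1"
    "\<And>x y. x \<notin> A \<Longrightarrow> y \<in> A \<Longrightarrow> dist x y = infdist x A \<Longrightarrow> (x - y) \<bullet> V y \<le> - norm (x - y)"
proof -
  obtain x y where xy: "\<And>T z. \<not> reach V 1 x (y + lattice_vec z) T" using assms unfolding controllable_def by blast
  define R where "R = {w. \<exists>T z. reach V 1 x (w + lattice_vec z) T}"
  have Rop: "open R" unfolding open_contains_ball
  proof
    fix w assume "w \<in> R"
    then obtain T z where "reach V 1 x (w + lattice_vec z) T" by (auto simp: R_def)
    then obtain e where e: "e > 0" "\<And>y'. y' \<in> ball (w + lattice_vec z) e \<Longrightarrow> reach V 1 x y' T" using reach_end_open by blast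
    have "ball w e \<subseteq> R"
    proof
      fix w' assume "w' \<in> ball w e"
      then have "w' + lattice_vec z \<in> ball (w + lattice_vec z) e" by simp
      then show "w' \<in> R" using e(2) unfolding R_def by blast
    qed
    then show "\<exists>e>0. ball w e \<subseteq> R" using e(1) by blast
  qed
  have Rper1: "w + lattice_vec z0 \<in> R" if w: "w \<in> R" for w z0
  proof -
    obtain T z where "reach V 1 x (w + lattice_vec z) T" using w by (auto simp: R_def)
    then have "reach V 1 x (w + lattice_vec z0 + lattice_vec (\<lambda>i. z i - z0 i)) T" by (simp add: lattice_vec_diff)
    then show ?thesis unfolding R_def by blast
  qed
  have Rfwd: "w + t *\<^sub>R q \<in> R" if w: "w \<in> R" and a: "adm V 1 w q t" for w t q
  proof -
    obtain T z where T: "reach V 1 x (w + lattice_vec z) T" using w by (auto simp: R_def)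
    have "reach V 1 x (w + lattice_vec z + t *\<^sub>R q) (T + t)" by (rule reach_step[OF T adm_lattice[OF a]])
    then have "reach V 1 x (w + t *\<^sub>R q + lattice_vec z) (T + t)" by (simp add: add.assoc add.commute[of "t *\<^sub>R q"])
    then show ?thesis unfolding R_def by blast
  qed
  have Rne: "R \<noteq> {}"
  proof -
    obtain t0 where t0: "t0 > 0" "\<And>t s. 0 < t \<Longrightarrow> t \<le> t0 \<Longrightarrow> 0 \<le> s \<Longrightarrow> s \<le> t \<Longrightarrow> adm V 1 (x - s *\<^sub>R V x) (V x) t"
      using adm_small[of "V x" x 1] by auto
    have "adm V 1 x (V x) t0" using t0(2)[of t0 0] t0(1) by simp
    from reach_one[OF this] have "reach V 1 x (x + t0 *\<^sub>R V x + lattice_vec (\<lambda>i. 0)) t0" by simp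
    then have "x + t0 *\<^sub>R V x \<in> R" unfolding R_def by blast
    then show ?thesis by blast
  qed
  define A where "A = closure R"
  have Acl: "closed A" by (simp add: A_def)
  have Aper1: "w + lattice_vec z0 \<in> A" if w: "w \<in> A" for w z0
    unfolding A_def closure_approachable
  proof (intro allI impI)
    fix e :: real assume "e > 0"
    then obtain r where "r \<in> R" "dist r w < e" using w unfolding A_def closure_approachable by blast
    then show "\<exists>r\<in>R. dist r (w + lattice_vec z0) < e" by (intro bexI[of _ "r + lattice_vec z0"] Rper1) auto
  qed
  have Aper: "zn_periodic_set A" unfolding zn_periodic_set_def
  proof (intro allI iffI)
    fix w z assume "w + lattice_vec z \<in> A"
    from Aper1[OF this, of "\<lambda>i. - z i"] show "w \<in> A" by (simp add: lattice_vec_minus)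
  qed (rule Aper1)
  have Rper: "zn_periodic_set R" unfolding zn_periodic_set_def
  proof (intro allI iffI)
    fix w z assume "w + lattice_vec z \<in> R"
    from Rper1[OF this, of "\<lambda>i. - z i"] show "w \<in> R" by (simp add: lattice_vec_minus)
  qed (rule Rper1)
  have RA: "R \<subseteq> A" unfolding A_def by (rule closure_subset)
  \<comment> \<open>Points of the closure inherit forward invariance for a short time, by
    approximation with points of \<open>R\<close> that follow the same velocity.\<close>
  have Afwd: "\<exists>t0>0. \<forall>t. 0 < t \<and> t \<le> t0 \<longrightarrow> w + t *\<^sub>R q \<in> A" if w: "w \<in> A" and q: "norm (q - V w) < 1" for w q
  proof -
    obtain e t0 where e: "e > 0" "t0 > 0" "\<And>y' t. y' \<in> ball w e \<Longrightarrow> 0 < t \<Longrightarrow> t \<le> t0 \<Longrightarrow> adm V 1 y' q t"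
      using adm_near[OF q] by blast
    have "w + t *\<^sub>R q \<in> A" if t: "0 < t" "t \<le> t0" for t
      unfolding A_def closure_approachable
    proof (intro allI impI)
      fix d :: real assume "d > 0"
      then have "min d e > 0" using e by simp
      then obtain r where r: "r \<in> R" "dist r w < min d e" using w unfolding A_def closure_approachable by blast
      have "adm V 1 r q t" using r(2) t by (intro e(3)) (auto simp: dist_commute)
      from Rfwd[OF r(1) this] show "\<exists>r\<in>R. dist r (w + t *\<^sub>R q) < d" using r(2) by (intro bexI[of _ "r + t *\<^sub>R q"]) auto
    qed
    then show ?thesis using e(2) by blast
  qed
  \<comment> \<open>A whole ball of points reaches \<open>y\<close>. None of them is in
    \<open>R\<close>, for otherwise \<open>x\<close> would reach \<open>y\<close> modulo the
    lattice; being open, the ball misses the closure as well.\<close>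
  have Cne: "- A \<noteq> {}"
  proof -
    obtain t0 where t0: "t0 > 0" "\<And>t s. 0 < t \<Longrightarrow> t \<le> t0 \<Longrightarrow> 0 \<le> s \<Longrightarrow> s \<le> t \<Longrightarrow> adm V 1 (y - s *\<^sub>R V y) (V y) t"
      using adm_small[of "V y" y 1] by auto
    have "adm V 1 (y - t0 *\<^sub>R V y) (V y) t0" using t0(2)[of t0 t0] t0(1) by simp
    from reach_one[OF this] have "reach V 1 (y - t0 *\<^sub>R V y) y t0" by simp
    from reach_start_open[OF this] obtain e where e: "e > 0" "\<And>x'. x' \<in> ball (y - t0 *\<^sub>R V y) e \<Longrightarrow> reach V 1 x' y t0" by blast
    have "ball (y - t0 *\<^sub>R V y) e \<inter> R = {}"
    proof (rule ccontr)
      assume "ball (y - t0 *\<^sub>R V y) e \<inter> R \<noteq> {}"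
      then obtain x' where x': "x' \<in> ball (y - t0 *\<^sub>R V y) e" "x' \<in> R" by blast
      obtain T z where T: "reach V 1 x (x' + lattice_vec z) T" using x'(2) by (auto simp: R_def)
      from reach_trans[OF reach_lattice[OF e(2)[OF x'(1)]] T] xy show False by blast
    qed
    then have "ball (y - t0 *\<^sub>R V y) e \<inter> A = {}" unfolding A_def by (simp add: open_Int_closure_eq_empty)
    then have "y - t0 *\<^sub>R V y \<notin> A" using centre_in_ball[THEN iffD2, OF e(1)] by blast
    then show ?thesis by blast
  qed
  have cellfin: "emeasure lborel (unit_cell :: (real^'n) set) \<noteq> \<infinity>" using emeasure_unit_cell[where 'n='n] by simp
  have Am: "A \<in> sets lborel" using Acl by simp
  have m0: "0 < measure lborel (A \<inter> unit_cell)"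
  proof -
    have "0 < measure lborel (R \<inter> unit_cell)" by (rule emeasure_open_periodic_pos[OF Rop Rne Rper])
    also have "\<dots> \<le> measure lborel (A \<inter> unit_cell)"
    proof (rule measure_mono_fmeasurable)
      show "A \<inter> unit_cell \<in> fmeasurable lborel"
        using Am sets_unit_cell[where 'n='n] cellfin by (intro fmeasurable_Int_fmeasurable[of unit_cell, unfolded Int_commute[of unit_cell]]) (auto simp: fmeasurable_def top.not_eq_extremum)
      show "R \<inter> unit_cell \<in> sets lborel" using Rop sets_unit_cell by auto
    qed (use RA in blast)
    finally show ?thesis .
  qed
  have "0 < measure lborel (- A \<inter> unit_cell)"
    using Aper by (intro emeasure_open_periodic_pos Cne) (auto simp: Acl zn_periodic_set_def)
  moreover have "measure lborel (unit_cell - A) = measure lborel (unit_cell :: (real^'n) set) - measure lborel (A \<inter> unit_cell)"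
    using measure_Diff[of lborel unit_cell "A \<inter> unit_cell"] cellfin Am sets_unit_cell[where 'n='n] by (simp add: Diff_Int2 Diff_Int)
  moreover have "measure lborel (unit_cell :: (real^'n) set) = 1" by (simp add: measure_def emeasure_unit_cell)
  moreover have "- A \<inter> unit_cell = unit_cell - A" by blast
  ultimately have m1: "measure lborel (A \<inter> unit_cell) < 1" by simp
  have inward: "(x - y) \<bullet> V y \<le> - norm (x - y)" if x: "x \<notin> A" and y: "y \<in> A" and d: "dist x y = infdist x A" for x y
  proof -
    define n where "n = x - y"
    have n0: "norm n > 0" using x y by (auto simp: n_def)
    \<comment> \<open>If the velocity \<open>V y\<close> plus \<open>c\<close> times the unit vector
      towards \<open>x\<close> had a positive component towards \<open>x\<close>, a short step
      inside \<open>A\<close> would come closer to \<open>x\<close> than its nearest point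
      \<open>y\<close>. Values of \<open>c\<close> close to 1 give the full inward speed.\<close>
    have c: "n \<bullet> V y + c * norm n \<le> 0" if c: "0 \<le> c" "c < 1" for c
    proof -
      define q where "q = V y + (c / norm n) *\<^sub>R n"
      have "norm (q - V y) < 1" using c n0 by (simp add: q_def)
      from Afwd[OF y this] obtain t0 where t0: "t0 > 0" "\<And>t. 0 < t \<Longrightarrow> t \<le> t0 \<Longrightarrow> y + t *\<^sub>R q \<in> A" by blast
      have nq: "n \<bullet> q = n \<bullet> V y + c * norm n" using n0 by (simp add: q_def inner_add_right dot_square_norm power2_eq_square)
      have b: "2 * (n \<bullet> q) \<le> t * (q \<bullet> q)" if t: "0 < t" "t \<le> t0" for t
      proof -
        have "infdist x A \<le> dist x (y + t *\<^sub>R q)" by (rule infdist_le[OF t0(2)[OF t]])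
        then have "norm n \<le> norm (n - t *\<^sub>R q)" by (simp add: d[symmetric] dist_norm n_def algebra_simps)
        then have "n \<bullet> n \<le> (n - t *\<^sub>R q) \<bullet> (n - t *\<^sub>R q)" by (simp add: norm_le)
        then have "0 \<le> t * (t * (q \<bullet> q) - 2 * (n \<bullet> q))" by (simp add: inner_diff_left inner_diff_right inner_commute algebra_simps)
        then show ?thesis using t(1) by (simp add: zero_le_mult_iff)
      qed
      have "n \<bullet> q \<le> 0"
      proof (rule ccontr)
        assume neg: "\<not> n \<bullet> q \<le> 0"
        define t where "t = min t0 ((n \<bullet> q) / (q \<bullet> q + 1))"
        have qq: "q \<bullet> q + 1 > 0" by (simp add: add_nonneg_pos)
        have t: "0 < t" "t \<le> t0" "t \<le> (n \<bullet> q) / (q \<bullet> q + 1)" using neg t0(1) qq by (auto simp: t_def)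
        have "t * (q \<bullet> q) \<le> t * (q \<bullet> q + 1)" using t by (intro mult_left_mono) auto
        also have "\<dots> \<le> n \<bullet> q" using t(3) qq by (simp add: pos_le_divide_eq)
        finally show False using b[OF t(1,2)] neg by linarith
      qed
      then show ?thesis by (simp add: nq)
    qed
    have "n \<bullet> V y \<le> - norm n"
    proof (rule ccontr)
      assume neg: "\<not> n \<bullet> V y \<le> - norm n"
      define a where "a = (n \<bullet> V y) / norm n"
      have g: "- 1 < a" and a: "n \<bullet> V y = a * norm n" using neg n0 by (simp_all add: a_def pos_less_divide_eq)
      define b where "b = max 0 ((1 - a) / 2)"
      have b: "0 \<le> b" "b < 1" "0 < a + b" using g by (auto simp: b_def max_def field_simps)
      have "(a + b) * norm n \<le> 0" using c[OF b(1,2)] a by (simp add: algebra_simps)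
      then show False using b(3) n0 by (simp add: mult_le_0_iff)
    qed
    then show ?thesis by (simp add: n_def)
  qed
  show thesis by (rule that[OF Acl Aper m0 m1 inward])
qed

end

section \<open>Divergence and integration by parts\<close>

context flow
begin

lemma component_lipschitz: "L-lipschitz_on UNIV (\<lambda>x. V x $ i)"
proof (rule lipschitz_onI[OF _ L_nonneg])
  fix x y
  have "\<bar>(V x - V y) $ i\<bar> \<le> norm (V x - V y)" by (rule component_le_norm_cart)
  also have "\<dots> \<le> L * norm (x - y)" by (rule V_lip)
  finally show "dist (V x $ i) (V y $ i) \<le> L * dist x y" by (simp add: dist_norm)
qed

lemma component_periodic: "zn_periodic (\<lambda>x. V x $ i)"
  using per by (simp add: zn_periodic_def)

lemma component_measurable: "(\<lambda>x. V x $ i) \<in> borel_measurable borel"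
  by (intro borel_measurable_continuous_onI lipschitz_on_continuous_on[OF component_lipschitz])

text \<open>A Borel representative of the divergence; by Rademacher's theorem it agrees almost
  everywhere with \<open>divergence V\<close>.\<close>

definition dv where "dv x = (\<Sum>i\<in>UNIV. pd i (\<lambda>x. V x $ i) x)"

lemma dv_measurable: "dv \<in> borel_measurable borel"
  unfolding dv_def[abs_def]
  by (intro borel_measurable_sum pd_measurable lipschitz_on_continuous_on[OF component_lipschitz])

lemma AE_dv_bound: "AE x in lborel. \<bar>dv x\<bar> \<le> real CARD('n) * L"
proof -
  have "AE x in lborel. \<forall>i. \<bar>pd i (\<lambda>x. V x $ i) x\<bar> \<le> L"
    using pd_integral_zero(3)[OF component_lipschitz component_periodic] by (subst AE_all_countable) auto
  then show ?thesis
  proof (rule AE_mp, intro AE_I2 impI)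
    fix x assume *: "\<forall>i. \<bar>pd i (\<lambda>x. V x $ i) x\<bar> \<le> L"
    have "\<bar>dv x\<bar> \<le> (\<Sum>i\<in>UNIV. \<bar>pd i (\<lambda>x. V x $ i) x\<bar>)" unfolding dv_def by (rule sum_abs)
    also have "\<dots> \<le> (\<Sum>i\<in>(UNIV :: 'n set). L)" using * by (intro sum_mono) auto
    finally show "\<bar>dv x\<bar> \<le> real CARD('n) * L" by simp
  qed
qed

lemma AE_dv_eq_divergence: "AE x in lborel. dv x = divergence V x"
  using AE_differentiable[OF lip]
proof (rule AE_mp, intro AE_I2 impI)
  fix x assume "V differentiable (at x)"
  then have D: "(V has_derivative frechet_derivative V (at x)) (at x)" by (simp add: frechet_derivative_works)
  have "((\<lambda>x. V x $ i) has_derivative (\<lambda>h. frechet_derivative V (at x) h $ i)) (at x)" for i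
    by (rule bounded_linear.has_derivative[OF bounded_linear_vec_nth D])
  from pd_eq[OF this] show "dv x = divergence V x" unfolding dv_def divergence_def by simp
qed

lemma dv_integrable: "integrable lborel (\<lambda>x. indicator unit_cell x * dv x)"
  by (rule integrable_unit_cell_bounded[OF dv_measurable AE_dv_bound])

lemma dv_integral: "(\<integral>x. indicator unit_cell x * dv x \<partial>lborel) = 0"
proof -
  have "(\<integral>x. indicator unit_cell x * dv x \<partial>lborel) = (\<integral>x. (\<Sum>i\<in>UNIV. indicator unit_cell x * pd i (\<lambda>x. V x $ i) x) \<partial>lborel)"
    by (simp add: dv_def sum_distrib_left)
  also have "\<dots> = (\<Sum>i\<in>UNIV. \<integral>x. indicator unit_cell x * pd i (\<lambda>x. V x $ i) x \<partial>lborel)"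
    by (intro Bochner_Integration.integral_sum pd_integral_zero(1)[OF component_lipschitz component_periodic])
  also have "\<dots> = 0" by (intro sum.neutral ballI pd_integral_zero(2)[OF component_lipschitz component_periodic])
  finally show ?thesis .
qed

text \<open>The products \<open>u x * V x $ i\<close> are periodic and Lipschitz, so their partial
  derivatives have mean zero; almost everywhere the product rule expands these.\<close>

lemma integration_by_parts:
  fixes u :: "real^'n \<Rightarrow> real"
  assumes ul: "M-lipschitz_on UNIV u" and up: "zn_periodic u" and ub: "\<And>x. \<bar>u x\<bar> \<le> 1"
  shows "integrable lborel (\<lambda>x. indicator unit_cell x * (\<Sum>i\<in>UNIV. pd i u x * V x $ i))" (is ?A)
    and "(\<integral>x. indicator unit_cell x * (\<Sum>i\<in>UNIV. pd i u x * V x $ i) \<partial>lborel)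
      = - (\<integral>x. indicator unit_cell x * (u x * dv x) \<partial>lborel)" (is ?B)
proof -
  note sets_unit_cell[measurable] dv_measurable[measurable] component_measurable[measurable]
  have M0: "M \<ge> 0" using ul by (rule lipschitz_on_nonneg)
  have ucont: "continuous_on UNIV u" using ul by (rule lipschitz_on_continuous_on)
  have um[measurable]: "u \<in> borel_measurable borel" using ucont by (rule borel_measurable_continuous_onI)
  have pum[measurable]: "pd i u \<in> borel_measurable borel" for i using ucont by (rule pd_measurable)
  have Vb: "\<bar>V x $ i\<bar> \<le> B" for x i using component_le_norm_cart[of "V x" i] V_le_B[of x] by linarith
  let ?g = "\<lambda>x. \<Sum>i\<in>UNIV. pd i u x * V x $ i"
  have "AE x in lborel. \<forall>i. \<bar>pd i u x\<bar> \<le> M"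
    using pd_integral_zero(3)[OF ul up] by (subst AE_all_countable) auto
  then have "AE x in lborel. \<bar>?g x\<bar> \<le> real CARD('n) * (M * B)"
  proof (rule AE_mp, intro AE_I2 impI)
    fix x assume *: "\<forall>i. \<bar>pd i u x\<bar> \<le> M"
    have "\<bar>?g x\<bar> \<le> (\<Sum>i\<in>UNIV. \<bar>pd i u x * V x $ i\<bar>)" by (rule sum_abs)
    also have "\<dots> \<le> (\<Sum>i\<in>(UNIV :: 'n set). M * B)"
      using * Vb M0 by (intro sum_mono) (auto simp: abs_mult intro!: mult_mono)
    finally show "\<bar>?g x\<bar> \<le> real CARD('n) * (M * B)" by simp
  qed
  then show gi: ?A by (intro integrable_unit_cell_bounded) auto
  have "AE x in lborel. \<bar>u x * dv x\<bar> \<le> real CARD('n) * L"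
    using AE_dv_bound
  proof (rule AE_mp, intro AE_I2 impI)
    fix x assume *: "\<bar>dv x\<bar> \<le> real CARD('n) * L"
    have "\<bar>u x * dv x\<bar> \<le> 1 * \<bar>dv x\<bar>" unfolding abs_mult by (rule mult_right_mono[OF ub abs_ge_zero])
    then show "\<bar>u x * dv x\<bar> \<le> real CARD('n) * L" using * by simp
  qed
  then have hi: "integrable lborel (\<lambda>x. indicator unit_cell x * (u x * dv x))" by (intro integrable_unit_cell_bounded) auto
  define f where "f i x = u x * V x $ i" for i x
  have fl: "(L + B * M)-lipschitz_on UNIV (f i)" for i
  proof (rule lipschitz_onI)
    fix x y
    have 1: "\<bar>V x $ i - V y $ i\<bar> \<le> L * dist x y" using lipschitz_onD[OF component_lipschitz, of x y i] by (simp add: dist_real_def)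
    have 2: "\<bar>u x - u y\<bar> \<le> M * dist x y" using lipschitz_onD[OF ul, of x y] by (simp add: dist_real_def)
    have "f i x - f i y = u x * (V x $ i - V y $ i) + V y $ i * (u x - u y)" by (simp add: f_def algebra_simps)
    then have "\<bar>f i x - f i y\<bar> \<le> \<bar>u x\<bar> * \<bar>V x $ i - V y $ i\<bar> + \<bar>V y $ i\<bar> * \<bar>u x - u y\<bar>"
      by (metis abs_triangle_ineq abs_mult)
    also have "\<dots> \<le> 1 * (L * dist x y) + B * (M * dist x y)"
      using 1 2 ub Vb B_nonneg by (intro add_mono mult_mono) auto
    finally show "dist (f i x) (f i y) \<le> (L + B * M) * dist x y" by (simp add: dist_real_def algebra_simps)
  qed (use L_nonneg B_nonneg M0 in simp)
  have fp: "zn_periodic (f i)" for i using up component_periodic[of i] by (simp add: f_def zn_periodic_def)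
  have "AE x in lborel. \<forall>i. (\<lambda>x. V x $ i) differentiable (at x)"
    using AE_differentiable_real[OF component_lipschitz] by (subst AE_all_countable) auto
  then have eq: "AE x in lborel. (\<Sum>i\<in>UNIV. indicator unit_cell x * pd i (f i) x) = indicator unit_cell x * ?g x + indicator unit_cell x * (u x * dv x)"
    using AE_differentiable_real[OF ul]
  proof eventually_elim
    fix x assume "\<forall>i. (\<lambda>x. V x $ i) differentiable (at x)" and "u differentiable (at x)"
    then obtain u' v' where d: "(u has_derivative u') (at x)" "\<And>i. ((\<lambda>x. V x $ i) has_derivative v' i) (at x)"
      unfolding differentiable_def by metis
    have fd: "(f i has_derivative (\<lambda>h. u x * v' i h + u' h * V x $ i)) (at x)" for i
      unfolding f_def by (rule has_derivative_mult[OF d])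
    have "pd i (f i) x = pd i u x * V x $ i + u x * pd i (\<lambda>x. V x $ i) x" for i
      using pd_eq[OF d(1), of i] pd_eq[OF d(2), of i i] pd_eq[OF fd, of i i] by simp
    then show "(\<Sum>i\<in>UNIV. indicator unit_cell x * pd i (f i) x) = indicator unit_cell x * ?g x + indicator unit_cell x * (u x * dv x)"
      by (simp add: dv_def sum_distrib_left sum.distrib distrib_left)
  qed
  have fm: "pd i (f i) \<in> borel_measurable borel" for i by (intro pd_measurable lipschitz_on_continuous_on[OF fl])
  note fm[measurable]
  have "0 = (\<Sum>i\<in>UNIV. \<integral>x. indicator unit_cell x * pd i (f i) x \<partial>lborel)"
    using pd_integral_zero(2)[OF fl fp] by simp
  also have "\<dots> = (\<integral>x. (\<Sum>i\<in>UNIV. indicator unit_cell x * pd i (f i) x) \<partial>lborel)"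
    by (intro Bochner_Integration.integral_sum[symmetric] pd_integral_zero(1)[OF fl fp])
  also have "\<dots> = (\<integral>x. indicator unit_cell x * ?g x + indicator unit_cell x * (u x * dv x) \<partial>lborel)"
    by (rule integral_cong_AE[OF _ _ eq]) measurable
  also have "\<dots> = (\<integral>x. indicator unit_cell x * ?g x \<partial>lborel) + (\<integral>x. indicator unit_cell x * (u x * dv x) \<partial>lborel)"
    by (rule Bochner_Integration.integral_add[OF gi hi])
  finally show ?B by simp
qed

end

section \<open>Flux through thin shells\<close>

locale trap = flow +
  fixes A
  assumes A_closed: "closed A" and A_per: "zn_periodic_set A"
    and A_pos: "0 < measure lborel (A \<inter> unit_cell)" and A_less: "measure lborel (A \<inter> unit_cell) < 1"
    and inward: "\<And>x y. x \<notin> A \<Longrightarrow> y \<in> A \<Longrightarrow> dist x y = infdist x A \<Longrightarrow> (x - y) \<bullet> V y \<le> - norm (x - y)"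
begin

lemma A_nonempty: "A \<noteq> {}" using A_pos by auto

lemma infdist_periodic: "infdist (x + lattice_vec z) A = infdist x A"
proof -
  have le: "infdist (x + lattice_vec z) A \<le> infdist x A" for x z
  proof -
    obtain y where y: "y \<in> A" "infdist x A = dist x y" using infdist_attains_inf[OF A_closed A_nonempty] by blast
    have "y + lattice_vec z \<in> A" using zn_periodic_setD[OF A_per] y(1) by blast
    from infdist_le[OF this, of "x + lattice_vec z"] show ?thesis using y(2) by simp
  qed
  show ?thesis using le[of x z] le[of "x + lattice_vec z" "\<lambda>i. - z i"] by (simp add: lattice_vec_minus)
qed

lemma infdist_zero_iff: "infdist x A = 0 \<longleftrightarrow> x \<in> A"
  using in_closed_iff_infdist_zero[OF A_closed A_nonempty] by blast

lemma infdist_lip: "\<bar>infdist x A - infdist y A\<bar> \<le> dist x y"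
  by (rule infdist_triangle_abs)

lemma infdist_measurable: "(\<lambda>x. infdist x A) \<in> borel_measurable borel"
  by (intro borel_measurable_continuous_onI continuous_intros)

definition cut where "cut s x = max 0 (1 - infdist x A / s)"

definition shell where "shell s = {x. 0 < infdist x A \<and> infdist x A < s}"

lemma shell_sets: "shell s \<in> sets borel"
proof -
  note infdist_measurable[measurable]
  show ?thesis unfolding shell_def by measurable
qed

lemma cut_lipschitz: assumes "s > 0" shows "(1 / s)-lipschitz_on UNIV (cut s)"
proof (rule lipschitz_onI)
  fix x y
  have "\<bar>cut s x - cut s y\<bar> \<le> \<bar>infdist x A / s - infdist y A / s\<bar>" by (simp add: cut_def)
  also have "\<dots> = \<bar>infdist x A - infdist y A\<bar> / s" using assms by (simp add: diff_divide_distrib[symmetric] abs_divide)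
  also have "\<dots> \<le> dist x y / s" using assms infdist_lip by (intro divide_right_mono) auto
  finally show "dist (cut s x) (cut s y) \<le> 1 / s * dist x y" by (simp add: dist_real_def)
qed (use assms in simp)

lemma cut_periodic: "zn_periodic (cut s)"
  by (simp add: zn_periodic_def cut_def infdist_periodic)

lemma cut_range: assumes "s > 0" shows "0 \<le> cut s x" "cut s x \<le> 1"
  using assms infdist_nonneg[of x A] by (auto simp: cut_def)

text \<open>At a point of the shell, \<open>cut s\<close> touches \<open>1 - dist y x / s\<close> from above, where \<open>y\<close> is the nearest
  point of \<open>A\<close>; elsewhere the gradient vanishes because \<open>cut s\<close> is extremal.\<close>
lemma cut_gradient:
  assumes s: "s > 0" and D: "(cut s has_derivative D) (at x)"
  shows "(1 - L * s) / s * indicator (shell s) x \<le> D (V x)"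
proof (cases "x \<in> shell s")
  case False
  then have "x \<in> A \<or> s \<le> infdist x A" using infdist_nonneg[of x A] infdist_zero_iff[of x] by (auto simp: shell_def)
  then have "(\<forall>y\<in>UNIV. cut s y \<le> cut s x) \<or> (\<forall>y\<in>UNIV. cut s x \<le> cut s y)"
  proof
    assume "x \<in> A" then have "cut s x = 1" using infdist_zero_iff[of x] by (simp add: cut_def)
    then show ?thesis using cut_range[OF s] by simp
  next
    assume "s \<le> infdist x A" then have "cut s x = 0" using s by (simp add: cut_def)
    then show ?thesis using cut_range[OF s] by simp
  qed
  from differential_zero_maxmin[OF UNIV_I open_UNIV D this] show ?thesis using False by simp
next
  case True
  then have d: "0 < infdist x A" "infdist x A < s" by (auto simp: shell_def)
  obtain y where y: "y \<in> A" "infdist x A = dist x y" using infdist_attains_inf[OF A_closed A_nonempty] by blast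
  define n where "n = x - y"
  have n: "0 < norm n" "norm n < s" using d y(2) by (auto simp: n_def dist_norm)
  have xA: "x \<notin> A" using d(1) infdist_zero_iff[of x] by auto
  define f where "f z = cut s z + norm (z - y) / s" for z
  have fmin: "f x \<le> f z" for z
  proof -
    have "infdist x A / s < 1" using d s by simp
    then have "f x = 1" using y(2) by (simp add: f_def cut_def dist_norm)
    have "infdist z A / s \<le> norm (z - y) / s" using infdist_le[OF y(1), of z] s by (intro divide_right_mono) (auto simp: dist_norm)
    then have "1 \<le> f z" by (simp add: f_def cut_def)
    with \<open>f x = 1\<close> show ?thesis by simp
  qed
  have nd: "(norm has_derivative (\<lambda>h. h \<bullet> sgn n)) (at n)"
    using GDERIV_norm[of n] n(1) unfolding gderiv_def by auto
  have nd': "((\<lambda>z. norm (z - y)) has_derivative (\<lambda>h. h \<bullet> sgn n)) (at x)"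
  proof (rule has_derivative_compose[of "\<lambda>z. z - y" "\<lambda>h. h" x UNIV norm])
    show "((\<lambda>z. z - y) has_derivative (\<lambda>h. h)) (at x)" by (auto intro!: derivative_eq_intros)
    show "(norm has_derivative (\<lambda>h. h \<bullet> sgn n)) (at (x - y))" using nd by (simp add: n_def)
  qed
  have "(f has_derivative (\<lambda>h. D h + (h \<bullet> sgn n) / s)) (at x)"
    unfolding f_def by (intro has_derivative_add D bounded_linear.has_derivative[OF bounded_linear_divide nd'])
  from differential_zero_maxmin[OF UNIV_I open_UNIV this] fmin have "(\<lambda>h. D h + (h \<bullet> sgn n) / s) = (\<lambda>h. 0)" by blast
  then have "D (V x) + (V x \<bullet> sgn n) / s = 0" by meson
  then have DV: "D (V x) = - (V x \<bullet> sgn n) / s" by simp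
  \<comment> \<open>The inward speed at \<open>y\<close> is at least 1, and going from
    \<open>y\<close> to \<open>x\<close>, a distance below \<open>s\<close>, costs at most
    \<open>L * s\<close> of it.\<close>
  have "n \<bullet> V x = n \<bullet> V y + n \<bullet> (V x - V y)" by (simp add: inner_diff_right)
  also have "n \<bullet> V y \<le> - norm n" using inward[OF xA y(1)] y(2) by (simp add: n_def)
  also have "n \<bullet> (V x - V y) \<le> norm n * norm (V x - V y)" by (rule norm_cauchy_schwarz)
  also have "norm (V x - V y) \<le> L * norm n" using V_lip[of x y] by (simp add: n_def)
  also have "L * norm n \<le> L * s" using n L_nonneg by (intro mult_left_mono) auto
  finally have "n \<bullet> V x \<le> - norm n + norm n * (L * s)" using n(1) by (simp add: mult_left_mono)
  then have "n \<bullet> V x \<le> norm n * (L * s - 1)" by (simp add: algebra_simps)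
  then have "(n \<bullet> V x) / norm n \<le> L * s - 1" using n(1) by (simp add: pos_divide_le_eq mult.commute)
  moreover have "V x \<bullet> sgn n = (n \<bullet> V x) / norm n" by (simp add: sgn_div_norm inner_commute divide_inverse mult.commute)
  ultimately have "1 - L * s \<le> - (V x \<bullet> sgn n)" by simp
  then have "(1 - L * s) / s \<le> - (V x \<bullet> sgn n) / s" using s by (intro divide_right_mono) auto
  then show ?thesis using True DV by simp
qed

text \<open>By parts, this is the integral of the derivative of \<open>cut s\<close> along
  \<open>V\<close>; as \<open>s\<close> tends to 0 it converges to minus the integral of
  \<open>dv\<close> over the part of \<open>A\<close> in the cell.\<close>

definition flux where "flux s = - (\<integral>x. indicator unit_cell x * (cut s x * dv x) \<partial>lborel)"

text \<open>Almost everywhere the derivative of \<open>cut s\<close> along \<open>V\<close> is at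
  least \<open>(1 - L * s) / s\<close> on the shell and nonnegative elsewhere; integration by parts
  turns its integral into the flux.\<close>

lemma shell_measure_le:
  assumes s: "s > 0"
  shows "(1 - L * s) / s * measure lborel (unit_cell \<inter> shell s) \<le> flux s"
proof -
  note sets_unit_cell[measurable] shell_sets[measurable]
  have ub: "\<bar>cut s x\<bar> \<le> 1" for x using cut_range[OF s, of x] by simp
  note ip = integration_by_parts[OF cut_lipschitz[OF s] cut_periodic ub]
  have Vm: "unit_cell \<inter> shell s \<in> sets lborel" by simp
  have "emeasure lborel (unit_cell \<inter> shell s) \<le> emeasure lborel (unit_cell :: (real^'a) set)"
    by (intro emeasure_mono) auto
  then have fin: "emeasure lborel (unit_cell \<inter> shell s) < \<infinity>" using emeasure_unit_cell[where 'n='a] by (auto simp: top.not_eq_extremum intro: le_less_trans)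
  have "(1 - L * s) / s * measure lborel (unit_cell \<inter> shell s) = (\<integral>x. (1 - L * s) / s * indicator (unit_cell \<inter> shell s) x \<partial>lborel)"
    using fin Vm by simp
  also have "\<dots> \<le> (\<integral>x. indicator unit_cell x * (\<Sum>i\<in>UNIV. pd i (cut s) x * V x $ i) \<partial>lborel)"
  proof (rule integral_mono_AE)
    show "integrable lborel (\<lambda>x. (1 - L * s) / s * indicator (unit_cell \<inter> shell s) x)"
      using fin Vm by (intro integrable_mult_right integrable_real_indicator) auto
    show "integrable lborel (\<lambda>x. indicator unit_cell x * (\<Sum>i\<in>UNIV. pd i (cut s) x * V x $ i))" by (rule ip(1))
    show "AE x in lborel. (1 - L * s) / s * indicator (unit_cell \<inter> shell s) x \<le> indicator unit_cell x * (\<Sum>i\<in>UNIV. pd i (cut s) x * V x $ i)"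
      using AE_differentiable_real[OF cut_lipschitz[OF s]]
    proof (rule AE_mp, intro AE_I2 impI)
      fix x assume "cut s differentiable (at x)"
      then obtain D where D: "(cut s has_derivative D) (at x)" by (auto simp: differentiable_def)
      have lin: "linear D" using D has_derivative_linear by blast
      have "D (V x) = D (\<Sum>i\<in>UNIV. V x $ i *\<^sub>R axis i 1)" using basis_expansion[of "V x"] by (simp add: scalar_mult_eq_scaleR)
      also have "\<dots> = (\<Sum>i\<in>UNIV. V x $ i * D (axis i 1))" using lin by (simp add: linear_sum linear_scale)
      also have "\<dots> = (\<Sum>i\<in>UNIV. pd i (cut s) x * V x $ i)" using pd_eq[OF D] by (simp add: mult.commute)
      finally have "(1 - L * s) / s * indicator (shell s) x \<le> (\<Sum>i\<in>UNIV. pd i (cut s) x * V x $ i)"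
        using cut_gradient[OF s D] by simp
      then show "(1 - L * s) / s * indicator (unit_cell \<inter> shell s) x \<le> indicator unit_cell x * (\<Sum>i\<in>UNIV. pd i (cut s) x * V x $ i)"
        by (simp add: indicator_def)
    qed
  qed
  also have "\<dots> = flux s" unfolding flux_def by (rule ip(2))
  finally show ?thesis .
qed

end

section \<open>Using the isoperimetric constant; Hoelder's inequality\<close>

lemma torus_isoperimetric_constant_nonneg: "0 \<le> torus_isoperimetric_constant TYPE('n::finite)"
  unfolding torus_isoperimetric_constant_def
  by (rule cInf_greatest) (use torus_isoperimetric_inequality[where 'n='n] in blast)+

text \<open>The infimum inherits the inequality from the admissible constants: dividing by a finite
  positive bound \<open>h\<close> of the perimeter turns it into a lower bound for all of
  them.\<close>

lemma torus_isoperimetric_constantD: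
  fixes E :: "(real^'n::finite) set"
  assumes E: "zn_periodic_set E" "lipschitz_boundary E"
    and h: "hausdorff_measure (CARD('n) - 1) (frontier E \<inter> unit_cell) \<le> ennreal h" "0 < h"
  shows "(min (measure lborel (E \<inter> unit_cell)) (1 - measure lborel (E \<inter> unit_cell))) powr (1 - 1 / real CARD('n))
    \<le> torus_isoperimetric_constant TYPE('n) * h" (is "?p \<le> _")
proof -
  have "?p / h \<le> torus_isoperimetric_constant TYPE('n)"
    unfolding torus_isoperimetric_constant_def
  proof (rule cInf_greatest)
    show "{c. 0 \<le> c \<and> (\<forall>E :: (real ^ 'n) set. zn_periodic_set E \<and> lipschitz_boundary E \<longrightarrow>
          ennreal ((min (measure lborel (E \<inter> unit_cell)) (1 - measure lborel (E \<inter> unit_cell))) powr (1 - 1 / real CARD('n)))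
          \<le> ennreal c * hausdorff_measure (CARD('n) - 1) (frontier E \<inter> unit_cell))} \<noteq> {}"
      using torus_isoperimetric_inequality[where 'n='n] by blast
    fix c assume "c \<in> {c. 0 \<le> c \<and> (\<forall>E :: (real ^ 'n) set. zn_periodic_set E \<and> lipschitz_boundary E \<longrightarrow>
          ennreal ((min (measure lborel (E \<inter> unit_cell)) (1 - measure lborel (E \<inter> unit_cell))) powr (1 - 1 / real CARD('n)))
          \<le> ennreal c * hausdorff_measure (CARD('n) - 1) (frontier E \<inter> unit_cell))}"
    then have c: "0 \<le> c" "ennreal ?p \<le> ennreal c * hausdorff_measure (CARD('n) - 1) (frontier E \<inter> unit_cell)" using E by auto
    note c(2)
    also have "\<dots> \<le> ennreal c * ennreal h" by (rule mult_left_mono[OF h(1)]) simp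
    also have "\<dots> = ennreal (c * h)" using c h by (simp add: ennreal_mult)
    finally have "?p \<le> c * h" using c h by (simp add: ennreal_le_iff)
    then show "?p / h \<le> c" using h by (simp add: pos_divide_le_eq)
  qed
  then show ?thesis using h by (simp add: pos_divide_le_eq)
qed

lemma hausdorff_measure_mono: "A \<subseteq> B \<Longrightarrow> hausdorff_measure s A \<le> hausdorff_measure s B"
  unfolding hausdorff_measure_def by (intro SUP_mono' INF_superset_mono) auto

lemma fmeasurable_cell: "X \<in> sets borel \<Longrightarrow> X \<inter> unit_cell \<in> fmeasurable (lborel :: (real^'n::finite) measure)"
proof (rule fmeasurableI)
  assume X: "X \<in> sets borel"
  then show "X \<inter> unit_cell \<in> sets lborel" using sets_unit_cell by simp
  have "emeasure lborel (X \<inter> unit_cell) \<le> emeasure lborel (unit_cell :: (real^'n) set)"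
    using sets_unit_cell by (intro emeasure_mono) auto
  then show "emeasure lborel (X \<inter> unit_cell) < \<infinity>" unfolding emeasure_unit_cell by (rule le_less_trans) simp
qed

lemma finite_net:
  fixes X :: "(real^'n::finite) set"
  assumes "bounded X" "r > 0"
  obtains K0 where "finite K0" "K0 \<subseteq> X" "\<And>x. x \<in> X \<Longrightarrow> \<exists>k\<in>K0. dist x k < r"
proof -
  have "compact (closure X)" using assms(1) by simp
  moreover have "closure X \<subseteq> (\<Union>k\<in>X. ball k r)"
    using assms(2) by (auto simp: closure_approachable)
  ultimately obtain K0 where "K0 \<subseteq> X" "finite K0" "closure X \<subseteq> (\<Union>k\<in>K0. ball k r)"
    by (rule compactE_image[OF _ open_ball])
  moreover have "\<exists>k\<in>K0. dist x k < r" if "x \<in> X" for x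
  proof -
    have "x \<in> closure X" using closure_subset[of X] that by blast
    then have "x \<in> (\<Union>k\<in>K0. ball k r)" using \<open>closure X \<subseteq> (\<Union>k\<in>K0. ball k r)\<close> by blast
    then show ?thesis by (auto simp: dist_commute)
  qed
  ultimately show thesis using that by blast
qed

text \<open>Hoelder's inequality in the form of Jensen: the tangent of \<open>y ^ N\<close> at the
  mean \<open>c = I / \<mu>\<close> stays below the power by Bernoulli's inequality, and is
  integrated over \<open>S\<close>.\<close>

lemma integral_power_le:
  fixes g :: "'a \<Rightarrow> real"
  assumes S: "S \<in> sets M" "emeasure M S \<noteq> \<infinity>" "0 < measure M S" and g: "\<And>x. 0 \<le> g x"
    and i1: "integrable M (\<lambda>x. indicator S x * g x)" and iN: "integrable M (\<lambda>x. indicator S x * g x ^ N)" and N: "N > 0"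
  shows "(\<integral>x. indicator S x * g x \<partial>M) ^ N \<le> (\<integral>x. indicator S x * g x ^ N \<partial>M) * measure M S ^ (N - 1)"
proof -
  define \<mu> where "\<mu> = measure M S"
  define I where "I = (\<integral>x. indicator S x * g x \<partial>M)"
  define J where "J = (\<integral>x. indicator S x * g x ^ N \<partial>M)"
  have mu: "\<mu> > 0" using S(3) by (simp add: \<mu>_def)
  have I0: "I \<ge> 0" unfolding I_def using g by (intro integral_nonneg_AE AE_I2) simp
  have J0: "J \<ge> 0" unfolding J_def using g by (intro integral_nonneg_AE AE_I2) simp
  obtain k where k: "N = Suc k" using N by (cases N) auto
  show ?thesis
  proof (cases "I = 0")
    case True
    have "0 \<le> J * \<mu> ^ (N - 1)" using J0 mu by (intro mult_nonneg_nonneg) auto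
    moreover have "I ^ N = 0" unfolding True by (rule zero_power[OF N])
    ultimately show ?thesis unfolding I_def[symmetric] J_def[symmetric] \<mu>_def[symmetric] by linarith
  next
    case False
    define c where "c = I / \<mu>"
    have c: "c > 0" using False I0 mu by (simp add: c_def)
    have bern: "c ^ N + real N * c ^ k * (y - c) \<le> y ^ N" if y: "y \<ge> 0" for y
    proof -
      have "1 + real N * (y / c - 1) \<le> (1 + (y / c - 1)) ^ N" using y c by (intro Bernoulli_inequality) simp
      then have "c ^ N * (1 + real N * (y / c - 1)) \<le> c ^ N * (y / c) ^ N" using c by (intro mult_left_mono) auto
      also have "c ^ N * (y / c) ^ N = y ^ N" using c by (simp add: power_divide)
      also have "c ^ N * (1 + real N * (y / c - 1)) = c ^ N + real N * c ^ k * (y - c)" using c by (simp add: k field_simps)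
      finally show ?thesis .
    qed
    have iS: "integrable M (\<lambda>x. indicator S x :: real)" using S by (simp add: top.not_eq_extremum)
    have "(\<integral>x. (c ^ N - real N * c ^ k * c) * indicator S x + real N * c ^ k * (indicator S x * g x) \<partial>M) \<le> J"
      unfolding J_def
    proof (rule integral_mono[OF _ iN])
      show "integrable M (\<lambda>x. (c ^ N - real N * c ^ k * c) * indicator S x + real N * c ^ k * (indicator S x * g x))"
        using iS i1 by (intro Bochner_Integration.integrable_add integrable_mult_right)
      show "(c ^ N - real N * c ^ k * c) * indicator S x + real N * c ^ k * (indicator S x * g x) \<le> indicator S x * g x ^ N" for x
        using bern[OF g[of x]] by (cases "x \<in> S") (simp_all add: algebra_simps)
    qed
    also have "(\<integral>x. (c ^ N - real N * c ^ k * c) * indicator S x + real N * c ^ k * (indicator S x * g x) \<partial>M)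
       = (c ^ N - real N * c ^ k * c) * \<mu> + real N * c ^ k * I"
    proof (subst Bochner_Integration.integral_add)
      show "integrable M (\<lambda>x. (c ^ N - real N * c ^ k * c) * indicator S x)" using iS by (rule integrable_mult_right)
      show "integrable M (\<lambda>x. real N * c ^ k * (indicator S x * g x))" using i1 by (rule integrable_mult_right)
      have "(\<integral>x. indicator S x \<partial>M) = \<mu>" using S by (simp add: \<mu>_def)
      then show "(\<integral>x. (c ^ N - real N * c ^ k * c) * indicator S x \<partial>M) + (\<integral>x. real N * c ^ k * (indicator S x * g x) \<partial>M)
        = (c ^ N - real N * c ^ k * c) * \<mu> + real N * c ^ k * I" by (simp add: I_def)
    qed
    also have "I = c * \<mu>" using mu by (simp add: c_def)
    also have "(c ^ N - real N * c ^ k * c) * \<mu> + real N * c ^ k * (c * \<mu>) = c ^ N * \<mu>" by (simp add: algebra_simps)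
    finally have J: "c ^ N * \<mu> \<le> J" .
    have "I ^ N = (c ^ N * \<mu>) * \<mu> ^ k" using mu by (simp add: c_def k power_divide)
    also have "\<dots> \<le> J * \<mu> ^ k" using J mu by (intro mult_right_mono) auto
    finally show ?thesis by (simp add: I_def J_def \<mu>_def k)
  qed
qed

section \<open>Isoperimetry of the shell and the contradiction\<close>

context trap
begin

text \<open>With an \<open>\<epsilon> * s\<close>-net of \<open>A\<close> as centres, the sublevel
  sets of \<open>G\<close> for levels between \<open>\<epsilon> * s\<close> and
  \<open>(1 - \<epsilon>) * s\<close> contain \<open>A\<close> and stay within \<open>A\<close> and
  its shell. This range of levels has length \<open>(1 - 2 * \<epsilon>) * s\<close>, and
  \<open>coarea_select\<close> finds a noncritical level of small perimeter in it.\<close>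

lemma shell_isoperimetry_eps:
  fixes s \<epsilon> :: real
  assumes s: "s > 0" and e: "0 < \<epsilon>" "\<epsilon> < 1/2"
  defines "m \<equiv> measure lborel (A \<inter> unit_cell)" and "\<mu> \<equiv> measure lborel (unit_cell \<inter> shell s)"
  shows "0 \<le> 1 - m - \<mu>"
    and "(min m (1 - m - \<mu>)) powr (1 - 1 / real CARD('a)) \<le> torus_isoperimetric_constant TYPE('a) * (\<mu> / ((1 - 2 * \<epsilon>) * s) + \<epsilon>)"
proof -
  have Ab: "A \<in> sets borel" using A_closed by simp
  have sh: "unit_cell \<inter> shell s = shell s \<inter> unit_cell" by (rule Int_commute)
  have disj: "A \<inter> shell s = {}" using infdist_zero_iff by (auto simp: shell_def)
  have un: "measure lborel ((A \<union> shell s) \<inter> unit_cell) = m + \<mu>"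
  proof -
    have "measure lborel ((A \<inter> unit_cell) \<union> (shell s \<inter> unit_cell)) = m + \<mu>"
      unfolding m_def \<mu>_def sh using fmeasurable_cell[OF Ab] fmeasurable_cell[OF shell_sets[of s]] disj
      by (intro measure_Union) (auto simp: fmeasurable_def)
    then show ?thesis by (simp add: Int_Un_distrib2)
  qed
  have mono: "measure lborel (X \<inter> unit_cell) \<le> measure lborel (Y \<inter> unit_cell)" if "X \<subseteq> Y" "X \<in> sets borel" "Y \<in> sets borel" for X Y :: "(real^'a) set"
    using that fmeasurable_cell[of X] by (intro measure_mono_fmeasurable fmeasurable_cell) auto
  have "measure lborel ((A \<union> shell s) \<inter> unit_cell) \<le> measure lborel (UNIV \<inter> (unit_cell :: (real^'a) set))"
    using Ab shell_sets by (intro mono) auto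
  also have "\<dots> = 1" by (simp add: measure_def emeasure_unit_cell)
  finally show le1: "0 \<le> 1 - m - \<mu>" using un by simp
  have Xb: "bounded (A \<inter> unit_cell)"
    using bounded_subset[OF bounded_cbox, of "A \<inter> unit_cell" 0 1] unit_cell_subset_cbox by blast
  have Xne: "A \<inter> unit_cell \<noteq> {}" using A_pos by auto
  have es: "\<epsilon> * s > 0" using e s by simp
  obtain K0 where KA0: "finite K0" "K0 \<subseteq> A \<inter> unit_cell" "\<And>x. x \<in> A \<inter> unit_cell \<Longrightarrow> \<exists>k\<in>K0. dist x k < \<epsilon> * s"
    using finite_net[OF Xb es] by blast
  have K0ne: "K0 \<noteq> {}" using KA0(3) Xne by blast
  obtain \<Lambda> :: "(real^'a) set" where La: "finite \<Lambda>" "\<Lambda> \<noteq> {}" "\<And>n. n \<in> \<Lambda> \<Longrightarrow> norm n = 1" "\<And>y. \<exists>n\<in>\<Lambda>. (1 - \<epsilon>) * norm y \<le> n \<bullet> y"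
    using unit_net[OF e(1)] by blast
  interpret polyhedral \<Lambda> \<epsilon> K0 using La KA0(1) K0ne e by unfold_locales auto
  have K0K: "K0 \<subseteq> K"
  proof
    fix k assume "k \<in> K0"
    then have "k + lattice_vec (\<lambda>i. 0) \<in> K" unfolding K_def by blast
    then show "k \<in> K" by simp
  qed
  have KA: "K \<subseteq> A"
  proof
    fix k assume "k \<in> K"
    then obtain k0 z where k0: "k0 \<in> K0" "k = k0 + lattice_vec z" unfolding K_def by blast
    then have "k0 \<in> A" using KA0(2) by auto
    then show "k \<in> A" unfolding k0(2) by (rule zn_periodic_setD[OF A_per, THEN iffD2])
  qed
  have AG: "G x < \<epsilon> * s" if x: "x \<in> A" for x
  proof -
    obtain z where z: "x + lattice_vec z \<in> unit_cell" using ex_lattice_translate_in_unit_cell by blast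
    have "x + lattice_vec z \<in> A" using x by (rule zn_periodic_setD[OF A_per, THEN iffD2])
    then obtain k where k: "k \<in> K0" "dist (x + lattice_vec z) k < \<epsilon> * s" using KA0(3)[of "x + lattice_vec z"] z by blast
    then have "G (x + lattice_vec z) < \<epsilon> * s" using K0K by (intro G_less_if_near[of k]) (auto simp: dist_norm)
    then show ?thesis by (simp add: G_periodic)
  qed
  have Gd: "infdist x A < s" if x: "G x < (1 - \<epsilon>) * s" for x
  proof -
    obtain k where k: "k \<in> K" "norm (x - k) < (1 - \<epsilon>) * s / (1 - \<epsilon>)" using G_near[OF x] by blast
    then have "norm (x - k) < s" using e by simp
    moreover have "infdist x A \<le> dist x k" using k KA by (intro infdist_le) auto
    ultimately show ?thesis by (simp add: dist_norm)
  qed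
  have Gm: "G \<in> borel_measurable borel" using G_cont by (rule borel_measurable_continuous_onI)
  obtain n b where nb: "\<And>j::nat. norm (n j) = 1" "\<And>x. \<exists>j. G x = n j \<bullet> x - b j" using G_pieces by metis
  have lu: "\<epsilon> * s < (1 - \<epsilon>) * s" using e s by (intro mult_strict_right_mono) auto
  have mu0: "0 \<le> \<mu>" by (simp add: \<mu>_def)
  have le: "emeasure lborel (unit_cell \<inter> {x. \<epsilon> * s < G x \<and> G x < (1 - \<epsilon>) * s}) \<le> ennreal \<mu>"
  proof -
    have sub: "unit_cell \<inter> {x. \<epsilon> * s < G x \<and> G x < (1 - \<epsilon>) * s} \<subseteq> shell s \<inter> unit_cell"
    proof
      fix x assume x: "x \<in> unit_cell \<inter> {x. \<epsilon> * s < G x \<and> G x < (1 - \<epsilon>) * s}"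
      then have "x \<notin> A" using AG[of x] by auto
      then have "infdist x A > 0" using infdist_zero_iff[of x] infdist_nonneg[of x A] by linarith
      then show "x \<in> shell s \<inter> unit_cell" using x Gd[of x] by (auto simp: shell_def)
    qed
    have "emeasure lborel (unit_cell \<inter> {x. \<epsilon> * s < G x \<and> G x < (1 - \<epsilon>) * s}) \<le> emeasure lborel (shell s \<inter> unit_cell)"
      using sub shell_sets sets_unit_cell by (intro emeasure_mono) auto
    also have "\<dots> = ennreal \<mu>" unfolding \<mu>_def sh
      using fmeasurable_cell[OF shell_sets[of s]] by (intro emeasure_eq_measure2) (auto simp: fmeasurable_def)
    finally show ?thesis .
  qed
  from coarea_select[OF Gm sets_unit_cell nb lu le mu0 e(1) countable_critical]
  obtain \<sigma> where sg: "\<epsilon> * s < \<sigma>" "\<sigma> < (1 - \<epsilon>) * s" "\<sigma> \<notin> critical"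
    "hausdorff_measure (CARD('a) - 1) (unit_cell \<inter> {x. G x = \<sigma>}) \<le> ennreal (\<mu> / ((1 - \<epsilon>) * s - \<epsilon> * s) + \<epsilon>)" by blast
  define E where "E = {x. G x < \<sigma>}"
  have Eper: "zn_periodic_set E" by (simp add: zn_periodic_set_def E_def G_periodic)
  have Elip: "lipschitz_boundary E" unfolding E_def by (rule lipschitz_boundary_sublevel[OF sg(3)])
  have Eb: "E \<in> sets borel" unfolding E_def using Gm by measurable
  have AE: "A \<subseteq> E" using AG sg(1) by (fastforce simp: E_def)
  have EA: "E \<subseteq> A \<union> shell s"
  proof
    fix x assume "x \<in> E"
    then have "infdist x A < s" using sg(2) by (intro Gd) (simp add: E_def)
    then show "x \<in> A \<union> shell s" using infdist_zero_iff[of x] infdist_nonneg[of x A] by (auto simp: shell_def)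
  qed
  let ?mE = "measure lborel (E \<inter> unit_cell)"
  \<comment> \<open>The chosen set lies between \<open>A\<close> and \<open>A\<close> with its
    shell, so its smaller side has measure at least \<open>min m (1 - m - \<mu>)\<close>.\<close>
  have mE: "m \<le> ?mE" "?mE \<le> m + \<mu>"
    using mono[OF AE Ab Eb] mono[OF EA Eb] un Ab shell_sets by (auto simp: m_def)
  have "hausdorff_measure (CARD('a) - 1) (frontier E \<inter> unit_cell) \<le> hausdorff_measure (CARD('a) - 1) (unit_cell \<inter> {x. G x = \<sigma>})"
    using frontier_sublevel[of \<sigma>] by (intro hausdorff_measure_mono) (auto simp: E_def)
  also note sg(4)
  also have "(1 - \<epsilon>) * s - \<epsilon> * s = (1 - 2 * \<epsilon>) * s" by (simp add: algebra_simps)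
  finally have H: "hausdorff_measure (CARD('a) - 1) (frontier E \<inter> unit_cell) \<le> ennreal (\<mu> / ((1 - 2 * \<epsilon>) * s) + \<epsilon>)" .
  have "0 \<le> \<mu> / ((1 - 2 * \<epsilon>) * s)" using mu0 e s by simp
  then have hp: "0 < \<mu> / ((1 - 2 * \<epsilon>) * s) + \<epsilon>" using e by linarith
  have "(min m (1 - m - \<mu>)) powr (1 - 1 / real CARD('a)) \<le> (min ?mE (1 - ?mE)) powr (1 - 1 / real CARD('a))"
    using mE le1 A_pos by (intro powr_mono2) (auto simp: m_def Suc_le_eq)
  also have "\<dots> \<le> torus_isoperimetric_constant TYPE('a) * (\<mu> / ((1 - 2 * \<epsilon>) * s) + \<epsilon>)"
    by (rule torus_isoperimetric_constantD[OF Eper Elip H hp])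
  finally show "(min m (1 - m - \<mu>)) powr (1 - 1 / real CARD('a)) \<le> torus_isoperimetric_constant TYPE('a) * (\<mu> / ((1 - 2 * \<epsilon>) * s) + \<epsilon>)" .
qed

lemma shell_isoperimetry:
  fixes s :: real
  assumes s: "s > 0"
  defines "m \<equiv> measure lborel (A \<inter> unit_cell)" and "\<mu> \<equiv> measure lborel (unit_cell \<inter> shell s)"
  shows "(min m (1 - m - \<mu>)) powr (1 - 1 / real CARD('a)) \<le> torus_isoperimetric_constant TYPE('a) * (\<mu> / s)"
proof (rule tendsto_lowerbound)
  show "((\<lambda>\<epsilon>. torus_isoperimetric_constant TYPE('a) * (\<mu> / ((1 - 2 * \<epsilon>) * s) + \<epsilon>)) \<longlongrightarrow> torus_isoperimetric_constant TYPE('a) * (\<mu> / s)) (at_right 0)"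
    using s by (auto intro!: tendsto_eq_intros)
  have "eventually (\<lambda>\<epsilon>. \<epsilon> \<in> {0<..<(1/2::real)}) (at_right 0)" by (rule eventually_at_right_real) simp
  then show "\<forall>\<^sub>F \<epsilon> in at_right 0. (min m (1 - m - \<mu>)) powr (1 - 1 / real CARD('a)) \<le> torus_isoperimetric_constant TYPE('a) * (\<mu> / ((1 - 2 * \<epsilon>) * s) + \<epsilon>)"
    by eventually_elim (use shell_isoperimetry_eps(2)[OF s] in \<open>auto simp: m_def \<mu>_def\<close>)
qed simp

text \<open>Since \<open>A\<close> is closed, the cut-offs tend pointwise to its indicator
  function.\<close>

lemma flux_limit:
  "(\<lambda>n. flux (1 / real (Suc n))) \<longlonglongrightarrow> - (\<integral>x. indicator (A \<inter> unit_cell) x * dv x \<partial>lborel)"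
  unfolding flux_def
proof (intro tendsto_minus integral_dominated_convergence[where w="\<lambda>x. indicator unit_cell x * \<bar>dv x\<bar>"])
  note sets_unit_cell[measurable] dv_measurable[measurable]
  have Ab[measurable]: "A \<in> sets borel" using A_closed by simp
  show "integrable lborel (\<lambda>x. indicator unit_cell x * \<bar>dv x\<bar>)"
    using AE_dv_bound by (intro integrable_unit_cell_bounded[of _ "real CARD('a) * L"]) auto
  show "(\<lambda>x. indicator (A \<inter> unit_cell) x * dv x) \<in> borel_measurable lborel" by measurable
  have cm[measurable]: "cut (1 / real (Suc n)) \<in> borel_measurable borel" for n
    by (intro borel_measurable_continuous_onI lipschitz_on_continuous_on[OF cut_lipschitz]) simp
  show "(\<lambda>x. indicator unit_cell x * (cut (1 / real (Suc n)) x * dv x)) \<in> borel_measurable lborel" for n by measurable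
  show "AE x in lborel. norm (indicator unit_cell x * (cut (1 / real (Suc n)) x * dv x)) \<le> indicator unit_cell x * \<bar>dv x\<bar>" for n
  proof (rule AE_I2)
    fix x
    have c: "0 \<le> cut (1 / real (Suc n)) x" "cut (1 / real (Suc n)) x \<le> 1" by (rule cut_range; simp)+
    then have "\<bar>cut (1 / real (Suc n)) x * dv x\<bar> \<le> 1 * \<bar>dv x\<bar>" unfolding abs_mult by (intro mult_right_mono) auto
    then show "norm (indicator unit_cell x * (cut (1 / real (Suc n)) x * dv x)) \<le> indicator unit_cell x * \<bar>dv x\<bar>"
      by (simp add: indicator_def)
  qed
  show "AE x in lborel. (\<lambda>n. indicator unit_cell x * (cut (1 / real (Suc n)) x * dv x)) \<longlonglongrightarrow> indicator (A \<inter> unit_cell) x * dv x"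
  proof (rule AE_I2)
    fix x
    have "(\<lambda>n. cut (1 / real (Suc n)) x) \<longlonglongrightarrow> indicator A x"
    proof (cases "x \<in> A")
      case True
      then have "cut (1 / real (Suc n)) x = 1" for n using infdist_zero_iff[of x] by (simp add: cut_def)
      then show ?thesis using True by simp
    next
      case False
      then have d: "infdist x A > 0" using infdist_zero_iff[of x] infdist_nonneg[of x A] by linarith
      obtain n0 where n0: "1 / infdist x A < real n0" using reals_Archimedean2 by blast
      have "\<forall>\<^sub>F n in sequentially. cut (1 / real (Suc n)) x = 0"
        using eventually_ge_at_top[of n0]
      proof eventually_elim
        fix n assume "n0 \<le> n"
        then have "1 / infdist x A \<le> real (Suc n)" using n0 by simp
        then have "1 \<le> infdist x A * real (Suc n)" using d by (simp add: pos_divide_le_eq mult.commute)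
        then show "cut (1 / real (Suc n)) x = 0" by (simp add: cut_def)
      qed
      then show ?thesis using False by (simp add: tendsto_eventually)
    qed
    then have "(\<lambda>n. indicator unit_cell x * (cut (1 / real (Suc n)) x * dv x)) \<longlonglongrightarrow> indicator unit_cell x * (indicator A x * dv x)"
      by (intro tendsto_intros)
    then show "(\<lambda>n. indicator unit_cell x * (cut (1 / real (Suc n)) x * dv x)) \<longlonglongrightarrow> indicator (A \<inter> unit_cell) x * dv x"
      by (simp add: indicator_inter_arith mult_ac)
  qed
qed

text \<open>The quotient \<open>\<mu> / s\<close> is at most \<open>flux s / (1 - L * s)\<close>,
  which converges to the flux through the boundary of \<open>A\<close>; in particular
  \<open>\<mu>\<close> tends to 0 and disappears from the minimum.\<close>

lemma isoperimetric_flux: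
  defines "m \<equiv> measure lborel (A \<inter> unit_cell)"
  shows "(min m (1 - m)) powr (1 - 1 / real CARD('a))
    \<le> torus_isoperimetric_constant TYPE('a) * - (\<integral>x. indicator (A \<inter> unit_cell) x * dv x \<partial>lborel)"
proof -
  let ?c = "torus_isoperimetric_constant TYPE('a)"
  let ?F = "- (\<integral>x. indicator (A \<inter> unit_cell) x * dv x \<partial>lborel)"
  define s where "s n = 1 / real (Suc n)" for n
  have s0: "s n > 0" for n by (simp add: s_def)
  have slim: "s \<longlonglongrightarrow> 0" unfolding s_def[abs_def] using LIMSEQ_Suc[OF lim_1_over_n[where 'a=real]] by simp
  define \<mu> where "\<mu> n = measure lborel (unit_cell \<inter> shell (s n))" for n
  have mu0: "0 \<le> \<mu> n" for n by (simp add: \<mu>_def)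
  define \<phi> where "\<phi> n = flux (s n) / (1 - L * s n)" for n
  have one: "(\<lambda>n. 1 - L * s n) \<longlonglongrightarrow> 1" using slim by (auto intro!: tendsto_eq_intros)
  have fl: "(\<lambda>n. flux (s n)) \<longlonglongrightarrow> ?F" unfolding s_def by (rule flux_limit)
  have philim: "\<phi> \<longlonglongrightarrow> ?F" unfolding \<phi>_def[abs_def] using tendsto_divide[OF fl one] by simp
  have ev: "\<forall>\<^sub>F n in sequentially. \<mu> n / s n \<le> \<phi> n"
    using order_tendstoD(1)[OF one, of 0, simplified]
  proof eventually_elim
    fix n assume p: "L * s n < 1"
    have "(1 - L * s n) * (\<mu> n / s n) \<le> flux (s n)" using shell_measure_le[OF s0[of n]] by (simp add: \<mu>_def)
    then show "\<mu> n / s n \<le> \<phi> n" using p by (simp add: \<phi>_def pos_le_divide_eq mult.commute)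
  qed
  have mulim: "\<mu> \<longlonglongrightarrow> 0"
  proof (rule real_tendsto_sandwich[where f="\<lambda>_. 0" and h="\<lambda>n. \<phi> n * s n"])
    show "\<forall>\<^sub>F n in sequentially. \<mu> n \<le> \<phi> n * s n"
      using ev by eventually_elim (use s0 in \<open>auto simp: pos_divide_le_eq\<close>)
    show "(\<lambda>n. \<phi> n * s n) \<longlonglongrightarrow> 0" using tendsto_mult[OF philim slim] by simp
  qed (use mu0 in auto)
  have m: "0 < m" "m < 1" using A_pos A_less by (auto simp: m_def)
  have "(\<lambda>n. min m (1 - m - \<mu> n)) \<longlonglongrightarrow> min m (1 - m - 0)" by (intro tendsto_intros mulim)
  then have l1: "(\<lambda>n. (min m (1 - m - \<mu> n)) powr (1 - 1 / real CARD('a))) \<longlonglongrightarrow> (min m (1 - m)) powr (1 - 1 / real CARD('a))"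
    using m by (intro tendsto_powr tendsto_const) auto
  have l2: "(\<lambda>n. ?c * \<phi> n) \<longlonglongrightarrow> ?c * ?F" by (intro tendsto_intros philim)
  show ?thesis
  proof (rule tendsto_le[OF sequentially_bot l2 l1])
    show "\<forall>\<^sub>F n in sequentially. (min m (1 - m - \<mu> n)) powr (1 - 1 / real CARD('a)) \<le> ?c * \<phi> n"
      using ev
    proof eventually_elim
      fix n assume "\<mu> n / s n \<le> \<phi> n"
      then have "?c * (\<mu> n / s n) \<le> ?c * \<phi> n" by (rule mult_left_mono[OF _ torus_isoperimetric_constant_nonneg])
      then show "(min m (1 - m - \<mu> n)) powr (1 - 1 / real CARD('a)) \<le> ?c * \<phi> n"
        using shell_isoperimetry[OF s0[of n]] unfolding \<mu>_def m_def by linarith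
    qed
  qed
qed

text \<open>Since \<open>dv\<close> has mean zero, the flux is bounded by the integral of \<open>\<bar>dv\<bar>\<close> over either side of
  \<open>\<partial>A\<close>; by Hoelder the isoperimetric inequality forces all of the \<open>L\<^sup>N\<close> norm to sit on one side,
  which leaves no flux.\<close>
lemma divergence_not_small:
  assumes "(\<integral>\<^sup>+ x \<in> unit_cell. ennreal (\<bar>divergence V x\<bar> ^ CARD('a)) \<partial>lborel)
           \<le> ennreal ((1 / torus_isoperimetric_constant TYPE('a)) ^ CARD('a))"
  shows False
proof -
  note sets_unit_cell[measurable] dv_measurable[measurable]
  have Ab[measurable]: "A \<in> sets borel" using A_closed by simp
  let ?N = "CARD('a)" and ?\<chi> = "torus_isoperimetric_constant TYPE('a)"
  define m where "m = measure lborel (A \<inter> unit_cell)"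
  have m: "0 < m" "m < 1" using A_pos A_less by (auto simp: m_def)
  define F where "F = - (\<integral>x. indicator (A \<inter> unit_cell) x * dv x \<partial>lborel)"
  define a where "a = (\<integral>x. indicator (A \<inter> unit_cell) x * \<bar>dv x\<bar> ^ ?N \<partial>lborel)"
  define b where "b = (\<integral>x. indicator (- A \<inter> unit_cell) x * \<bar>dv x\<bar> ^ ?N \<partial>lborel)"
  have chi0: "0 \<le> ?\<chi>" by (rule torus_isoperimetric_constant_nonneg)
  have q: "(min m (1 - m)) powr (1 - 1 / real ?N) \<le> ?\<chi> * F"
    using isoperimetric_flux by (simp add: m_def F_def)
  \<comment> \<open>Positivity of the left side forces both the constant and the flux to be
    positive; so \<open>1 / ?\<chi>\<close> in the assumption is a genuine quotient and not the
    default value for division by 0.\<close>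
  have q0: "0 < (min m (1 - m)) powr (1 - 1 / real ?N)" using m by simp
  with q have "0 < ?\<chi> * F" by linarith
  with chi0 have chi: "0 < ?\<chi>" and F: "0 < F" by (auto simp: zero_less_mult_iff)
  have Nb: "AE x in lborel. \<bar>\<bar>dv x\<bar> ^ ?N\<bar> \<le> (real ?N * L) ^ ?N"
    using AE_dv_bound by eventually_elim (auto intro: power_mono)
  have iN: "integrable lborel (\<lambda>x. indicator unit_cell x * \<bar>dv x\<bar> ^ ?N)"
    by (rule integrable_unit_cell_bounded[OF _ Nb]) measurable
  have i1: "integrable lborel (\<lambda>x. indicator unit_cell x * \<bar>dv x\<bar>)"
    using AE_dv_bound by (intro integrable_unit_cell_bounded[of _ "real CARD('a) * L"]) auto
  have sub: "integrable lborel (\<lambda>x. indicator (X \<inter> unit_cell) x * f x)"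
    if "integrable lborel (\<lambda>x. indicator unit_cell x * f x)" "X \<in> sets borel" "f \<in> borel_measurable borel" for X and f :: "real^'a \<Rightarrow> real"
    using that by (intro Bochner_Integration.integrable_bound[OF that(1)]) (auto simp: indicator_def)
  have nA: "- A \<in> sets borel" using Ab by simp
  have split: "(\<integral>x. indicator (A \<inter> unit_cell) x * f x \<partial>lborel) + (\<integral>x. indicator (- A \<inter> unit_cell) x * f x \<partial>lborel)
      = (\<integral>x. indicator unit_cell x * f x \<partial>lborel)"
    if "integrable lborel (\<lambda>x. indicator unit_cell x * f x)" "f \<in> borel_measurable borel" for f :: "real^'a \<Rightarrow> real"
  proof -
    have "(\<integral>x. indicator (A \<inter> unit_cell) x * f x \<partial>lborel) + (\<integral>x. indicator (- A \<inter> unit_cell) x * f x \<partial>lborel)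
      = (\<integral>x. indicator (A \<inter> unit_cell) x * f x + indicator (- A \<inter> unit_cell) x * f x \<partial>lborel)"
      by (rule Bochner_Integration.integral_add[OF sub[OF that(1) Ab that(2)] sub[OF that(1) nA that(2)], symmetric])
    also have "\<dots> = (\<integral>x. indicator unit_cell x * f x \<partial>lborel)" by (intro Bochner_Integration.integral_cong) (auto simp: indicator_def)
    finally show ?thesis .
  qed
  have dvm: "(\<lambda>x. \<bar>dv x\<bar>) \<in> borel_measurable borel" "(\<lambda>x. \<bar>dv x\<bar> ^ ?N) \<in> borel_measurable borel" by measurable
  have b_meas: "measure lborel (- A \<inter> unit_cell) = 1 - m"
  proof -
    have "measure lborel ((A \<inter> unit_cell) \<union> (- A \<inter> unit_cell)) = m + measure lborel (- A \<inter> unit_cell)"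
      unfolding m_def using fmeasurable_cell[OF Ab] fmeasurable_cell[OF nA] by (intro measure_Union) (auto simp: fmeasurable_def)
    moreover have "(A \<inter> unit_cell) \<union> (- A \<inter> unit_cell) = unit_cell" by blast
    ultimately show ?thesis by (simp add: measure_def emeasure_unit_cell)
  qed
  have Fa: "F \<le> (\<integral>x. indicator (A \<inter> unit_cell) x * \<bar>dv x\<bar> \<partial>lborel)"
  proof -
    have "F = (\<integral>x. - (indicator (A \<inter> unit_cell) x * dv x) \<partial>lborel)" by (simp add: F_def)
    also have "\<dots> \<le> (\<integral>x. indicator (A \<inter> unit_cell) x * \<bar>dv x\<bar> \<partial>lborel)"
      using sub[OF dv_integrable Ab dv_measurable] sub[OF i1 Ab dvm(1)]
      by (intro integral_mono Bochner_Integration.integrable_minus) (auto simp: indicator_def)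
    finally show ?thesis .
  qed
  have Fb: "F \<le> (\<integral>x. indicator (- A \<inter> unit_cell) x * \<bar>dv x\<bar> \<partial>lborel)"
  proof -
    have "F = (\<integral>x. indicator (- A \<inter> unit_cell) x * dv x \<partial>lborel)"
      using split[OF dv_integrable dv_measurable] dv_integral by (simp add: F_def)
    also have "\<dots> \<le> (\<integral>x. indicator (- A \<inter> unit_cell) x * \<bar>dv x\<bar> \<partial>lborel)"
      using sub[OF dv_integrable nA dv_measurable] sub[OF i1 nA dvm(1)]
      by (intro integral_mono) (auto simp: indicator_def)
    finally show ?thesis .
  qed
  have hol: "F ^ ?N \<le> (\<integral>x. indicator (X \<inter> unit_cell) x * \<bar>dv x\<bar> ^ ?N \<partial>lborel) * measure lborel (X \<inter> unit_cell) ^ (?N - 1)"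
    if X: "X \<in> sets borel" "0 < measure lborel (X \<inter> unit_cell)" "F \<le> (\<integral>x. indicator (X \<inter> unit_cell) x * \<bar>dv x\<bar> \<partial>lborel)" for X
  proof -
    have "F ^ ?N \<le> (\<integral>x. indicator (X \<inter> unit_cell) x * \<bar>dv x\<bar> \<partial>lborel) ^ ?N" using X(3) F by (intro power_mono) auto
    also have "\<dots> \<le> (\<integral>x. indicator (X \<inter> unit_cell) x * \<bar>dv x\<bar> ^ ?N \<partial>lborel) * measure lborel (X \<inter> unit_cell) ^ (?N - 1)"
      using fmeasurable_cell[OF X(1)] X(2) sub[OF i1 X(1) dvm(1)] sub[OF iN X(1) dvm(2)]
      by (intro integral_power_le) (auto simp: fmeasurable_def)
    finally show ?thesis .
  qed
  have Ha: "F ^ ?N \<le> a * m ^ (?N - 1)" using hol[OF Ab A_pos Fa] by (simp add: a_def m_def)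
  have Hb: "F ^ ?N \<le> b * (1 - m) ^ (?N - 1)" using hol[OF nA _ Fb] m by (simp add: b_def b_meas)
  have FN: "0 < F ^ ?N" using F by simp
  have ab: "a + b \<le> (1 / ?\<chi>) ^ ?N"
  proof -
    have J: "a + b = (\<integral>x. indicator unit_cell x * \<bar>dv x\<bar> ^ ?N \<partial>lborel)" unfolding a_def b_def by (rule split[OF iN dvm(2)])
    have "ennreal (a + b) = (\<integral>\<^sup>+x. ennreal (indicator unit_cell x * \<bar>dv x\<bar> ^ ?N) \<partial>lborel)"
      unfolding J by (rule nn_integral_eq_integral[OF iN, symmetric]) simp
    also have "\<dots> = (\<integral>\<^sup>+ x \<in> unit_cell. ennreal (\<bar>divergence V x\<bar> ^ ?N) \<partial>lborel)"
      using AE_dv_eq_divergence by (intro nn_integral_cong_AE) (auto simp: indicator_def elim!: eventually_mono)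
    also note assms
    finally show ?thesis using chi by (simp add: ennreal_le_iff)
  qed
  then have chab: "?\<chi> ^ ?N * (a + b) \<le> 1" using chi by (simp add: power_one_over pos_le_divide_eq mult.commute)
  have qN: "(min m (1 - m)) ^ (?N - 1) \<le> ?\<chi> ^ ?N * F ^ ?N"
  proof -
    have qp: "0 < min m (1 - m)" using m by simp
    have "(min m (1 - m)) ^ (?N - 1) = (min m (1 - m)) powr real (?N - 1)" by (rule powr_realpow[OF qp, symmetric])
    also have "real (?N - 1) = (1 - 1 / real ?N) * real ?N" by (simp add: field_simps of_nat_diff Suc_le_eq)
    also have "(min m (1 - m)) powr \<dots> = ((min m (1 - m)) powr (1 - 1 / real ?N)) ^ ?N" unfolding powr_powr[symmetric] by (rule powr_realpow[OF q0])
    also have "\<dots> \<le> (?\<chi> * F) ^ ?N" using q by (intro power_mono) auto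
    finally show ?thesis by (simp add: power_mult_distrib)
  qed
  \<comment> \<open>Here \<open>r\<close> is the measure of the smaller side and \<open>a'\<close>
    its share of the integral. The isoperimetric and Hoelder bounds give
    \<open>1 \<le> ?\<chi> ^ ?N * a'\<close>, which exhausts the total; so
    \<open>b' \<le> 0\<close>, against the positive flux that the other side has to carry. Equality
    in the assumption is thus excluded too.\<close>
  have fin: False if H: "F ^ ?N \<le> a' * r ^ (?N - 1)" "F ^ ?N \<le> b' * (1 - r) ^ (?N - 1)" and r: "r = min m (1 - m)" "r \<le> 1 - r"
    and s: "a' + b' = a + b" for a' b' r
  proof -
    have r0: "0 < r" "r < 1" using r m by auto
    have "r ^ (?N - 1) \<le> ?\<chi> ^ ?N * F ^ ?N" using qN r by simp
    also have "\<dots> \<le> ?\<chi> ^ ?N * (a' * r ^ (?N - 1))" using H(1) chi by (intro mult_left_mono) auto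
    finally have "1 * r ^ (?N - 1) \<le> (?\<chi> ^ ?N * a') * r ^ (?N - 1)" by (simp add: mult.assoc)
    then have "1 \<le> ?\<chi> ^ ?N * a'" using r0 by (subst (asm) mult_le_cancel_right_pos) auto
    then have "?\<chi> ^ ?N * b' \<le> 0" using chab unfolding s[symmetric] by (simp add: distrib_left)
    moreover have "0 < ?\<chi> ^ ?N" using chi by simp
    ultimately have "b' \<le> 0" by (simp add: mult_le_0_iff)
    then have "b' * (1 - r) ^ (?N - 1) \<le> 0" using r0 by (simp add: mult_le_0_iff)
    then show False using H(2) FN by linarith
  qed
  show False
  proof (cases "m \<le> 1 - m")
    case True
    then show False using fin[OF Ha Hb] by simp
  next
    case False
    have Ha': "F ^ ?N \<le> a * (1 - (1 - m)) ^ (?N - 1)" using Ha by simp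
    show False using False fin[OF Hb Ha'] by simp
  qed
qed

end

section \<open>Conclusion\<close>

lemma (in flow) controllable_if_divergence_small:
  assumes "(\<integral>\<^sup>+ x \<in> unit_cell. ennreal (\<bar>divergence V x\<bar> ^ CARD('n)) \<partial>lborel)
           \<le> ennreal ((1 / torus_isoperimetric_constant TYPE('n)) ^ CARD('n))"
  shows controllable
proof (rule ccontr)
  assume "\<not> controllable"
  then obtain A where "closed A" "zn_periodic_set A" "0 < measure lborel (A \<inter> unit_cell)" "measure lborel (A \<inter> unit_cell) < 1"
    "\<And>x y. x \<notin> A \<Longrightarrow> y \<in> A \<Longrightarrow> dist x y = infdist x A \<Longrightarrow> (x - y) \<bullet> V y \<le> - norm (x - y)"
    using not_controllable_trap by blast
  then interpret trap V L A by unfold_locales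
  show False by (rule divergence_not_small[OF assms])
qed

theorem theorem6p5:
  fixes V :: "real ^ 'n::finite \<Rightarrow> real ^ 'n" and P :: "real ^ 'n"
  assumes "zn_periodic V"
    and "\<exists>L. L-lipschitz_on UNIV V"
    and "(\<integral>\<^sup>+ x \<in> unit_cell. ennreal (\<bar>divergence V x\<bar> ^ CARD('n)) \<partial>lborel)
           \<le> ennreal ((1 / torus_isoperimetric_constant TYPE('n)) ^ CARD('n))"
  shows "((\<lambda>k::nat. eff_ham (ham_k (real k) V) P) \<longlonglongrightarrow> eff_ham (ham V) P) \<and>
         (\<exists>c. eff_ham (ham V) P = ereal c \<and>
           (\<exists>u. upper_semicont u \<and> bounded (range u) \<and> zn_periodic u \<and> visc_subsol (ham V) P c u) \<and>
           (\<exists>v. lower_semicont v \<and> bounded (range v) \<and> zn_periodic v \<and> visc_supersol (ham V) P c v))"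
proof -
  obtain L where L: "L-lipschitz_on UNIV V" using assms(2) by blast
  interpret flow V L by unfold_locales (rule assms(1), rule L)
  have ctrl: controllable by (rule controllable_if_divergence_small[OF assms(3)])
  interpret ctrl_flow V L P by unfold_locales (rule ctrl)
  show ?thesis by (rule ergodic_problem)
qed

end
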